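(* Let $d\in\{1,2\}$. There exists a universal constant $C_M$ such that the following holds. Suppose that $\mathscr T_h^{\rm a}\cup\mathscr T_h^{\rm i}\subset\mathscr T_\varepsilon$ and that $y\in\mathscr Y$. Then, for all $p\in[1,\infty)$, $$\big\|\delta\mathscr E_{\rm ac}(y)-\delta\mathscr E_{\rm a}(y)\big\|_{W^{-1,p}_h}\le M^{\rm a}C_M\,\varepsilon\Big(\sum_{T\in\mathscr T_\varepsilon^{\rm c}}|T|\,{\rm osc}(\nabla y;\omega_T^{\rm c})^p\Big)^{1/p}+\big\|\delta\mathscr E_{\rm ac}(y)-\delta\mathscr E_{\rm a}(y)\big\|_{W^{-1,p}_\varepsilon},$$ and, for $p=\infty$, the same estimate holds with the first term on the right-hand side replaced by $M^{\rm a}C_M\,\varepsilon\max_{T\in\mathscr T_\varepsilon^{\rm c}}{\rm osc}(\nabla y;\omega_T^{\rm c})$.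
   Context: **Atomistic model.** Let $N\in\mathbb N$, $\varepsilon=1/N$, $\Omega=(-1,1]^d$, $\mathscr L=\varepsilon\{-N+1,\dots,N\}^d$, $\mathscr L^\#=\varepsilon\mathbb Z^d$. For $A\subset\mathbb R^d$ let $A^\#=\bigcup_{\xi\in2\mathbb Z^d}(\xi+A)$. $\mathscr U$ is the space of $2\mathbb Z^d$-periodic $u:\mathscr L^\#\to\mathbb R^d$; for $\mathsf A\in\mathbb R^{d\times d}$, $y_{\mathsf A}(x)=\mathsf Ax$; $\mathscr Y=\{y:\mathscr L^\#\to\mathbb R^d: y-y_{\mathsf A}\in\mathscr U\text{ for some }\mathsf A\}$. $D_rv(x)=\varepsilon^{-1}(v(x+\varepsilon r)-v(x))$; $\mathscr R\subset\mathbb Z^d\setminus\{0\}$ is finite; $D_{\mathscr R}y(x)=(D_ry(x))_{r\in\mathscr R}$. $V\in C^2((\mathbb R^d)^{\mathscr R})$ satisfies $\sup_{\bf g}\|\partial^2V({\bf g})/\partial g_r\partial g_s\|\le M^{\rm a}_{r,s}$ ($\ell^2$-operator norm), and $M^{\rm a}=\sum_{r,s\in\mathscr R}|r||s|M^{\rm a}_{r,s}$. $\mathscr E_{\rm a}(y)=\varepsilon^d\sum_{x\in\mathscr L}V(D_{\mathscr R}y(x))$, $W(\mathsf F)=V((\mathsf Fr)_{r\in\mathscr R})$. First variations: $\langle\delta\mathscr E(y),z\rangle=\frac{d}{dt}\mathscr E(y+tz)|_{t=0}$. **Meshes.** $\mathscr T_\varepsilon^\#$ is the triangulation of $\mathbb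 R^d$ with vertex set $\mathscr L^\#$ obtained by $\varepsilon\mathbb Z^d$-translation of a subdivision of $\varepsilon(0,1)^d$ ($d=1$: the interval itself; $d=2$: two triangles separated by a diagonal); elements are closed; $\mathscr T_\varepsilon$ is its restriction to $\Omega$ (elements contained in $\overline\Omega$). Each $v:\mathscr L^\#\to\mathbb R^k$ is identified with its continuous piecewise affine interpolant on $\mathscr T_\varepsilon^\#$. $\mathscr T_h$ is a regular triangulation of $\overline\Omega$ (closed elements, vertices in $\mathscr L^\#$) that extends $2\mathbb Z^d$-periodically to a regular triangulation $\mathscr T_h^\#$ of $\mathbb R^d$. $\mathscr U_h$ is the space of $u_h\in\mathscr U$ that are restrictions to $\mathscr L^\#$ of continuous functions piecewise affine with respect to $\mathscr T_h^\#$; $u_h\in\mathscr U_h$ is identified with that function (interpolant on $\mathscr T_h^\#$, not on $\mathscr T_\varepsilon^\#$). **a/c energy.** $\mathscr T_h$ is the disjoint union of $\mathscr T_h^{\rm a},\mathscr T_h^{\rm i},\mathscr T_h^{\rm c}$, with (closed) unions of elements $\Omega_{\rm a},\Omega_{\rm i},\Omega_{\rm c}$; $\mathscr T_\varepsilon^{\rm c}=\{T\in\mathscr T_\varepsilon:T\subset\Omega_{\rm c}\}$. A bond $(x,x')\in\mathscr L^\#\times\mathscr L^\#$ is identified with the closed segment from $x$ to $x'$. $\mathscr L_{\rm a}=\{x\in\mathscr L:(x,x+\varepsilon r)\cap\Omega_{\rm a}^\#\ne\emptyset\text{ for some }r\in\mathscr R\}$, and it is assumed that $\{x+t\varepsilon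 r: x\in\mathscr L_{\rm a},t\in[0,1],r\in\mathscr R\}\subset\Omega_{\rm a}\cup\Omega_{\rm i}$. $\mathscr B_{\rm i}=\{(x,x+\varepsilon r):x\in\mathscr L,r\in\mathscr R,(x,x+\varepsilon r)\subset\Omega_{\rm i}^\#\}$; $\mathscr E_{\rm i}(y)=\varepsilon^dE_{\rm i}((D_ry(x))_{(x,x+\varepsilon r)\in\mathscr B_{\rm i}})$ with $E_{\rm i}\in C^2$. For $\tilde y\in\mathscr Y+\mathscr U_h$ (elements of $\mathscr Y$ interpolated on $\mathscr T_\varepsilon^\#$, elements of $\mathscr U_h$ on $\mathscr T_h^\#$), $\mathscr E_{\rm ac}(\tilde y)=\int_{\Omega_{\rm c}}W(\nabla\tilde y)\,dx+\varepsilon^d\sum_{x\in\mathscr L_{\rm a}}V(D_{\mathscr R}\tilde y(x))+\mathscr E_{\rm i}(\tilde y)$. **Norms.** $\|\nabla v\|_{L^q}=\|\,|\nabla v|_q\|_{L^q}$ with $|\cdot|_q$ the entrywise $\ell^q$-norm; $1/p+1/p'=1$. $\|\Phi\|_{W^{-1,p}_h}=\sup\{\langle\Phi,v_h\rangle:v_h\in\mathscr U_h,\|\nabla v_h\|_{L^{p'}(\Omega)}=1\}$, and $\|\Phi\|_{W^{-1,p}_\varepsilon}=\sup\{\langle\Phi,v\rangle:v\in\mathscr U,\|\nabla v\|_{L^{p'}(\Omega)}=1\}$ (interpolants on $\mathscr T_\varepsilon^\#$). For measurable $\omega$, ${\rm osc}(\nabla y;\omega)=\varepsilon^{-1}\operatorname{ess\,sup}_{x,x'\in\omega}|\nabla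 y(x)-\nabla y(x')|$, with $|\cdot|$ the Frobenius norm. For $T\in\mathscr T_\varepsilon$, $\omega_T^{\rm c}=\Omega_{\rm c}^\#\cap\bigcup\{T'\in\mathscr T_\varepsilon^\#:T\cap T'\ne\emptyset\}$. *)

theory Defs
  imports "HOL-Analysis.Analysis" "HOL-Probability.Essential_Supremum"
begin

text \<open>
  The space dimension is \<open>d = CARD('n)\<close>. Lattice functions are total functions on \<^typ>\<open>real^'n\<close>
  of which only the values on the lattice \<open>per_lattice N\<close> are relevant.
\<close>

section \<open>Lattices and periodicity\<close>

abbreviation eps :: "nat \<Rightarrow> real" where
  "eps N \<equiv> 1 / real N"

definition Zd :: "(real^'n) set" where
  "Zd = {z. \<forall>i. z $ i \<in> \<int>}"

definition Omega :: "(real^'n) set" where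
  "Omega = {x. \<forall>i. -1 < x $ i \<and> x $ i \<le> 1}"

definition lattice :: "nat \<Rightarrow> (real^'n) set" where
  "lattice N = {eps N *\<^sub>R z |z. z \<in> Zd \<and> (\<forall>i. - real N + 1 \<le> z $ i \<and> z $ i \<le> real N)}"

definition per_lattice :: "nat \<Rightarrow> (real^'n) set" where
  "per_lattice N = {eps N *\<^sub>R z |z. z \<in> Zd}"

definition twoZd :: "(real^'n) set" where
  "twoZd = {2 *\<^sub>R z |z. z \<in> Zd}"

definition periodize :: "(real^'n) set \<Rightarrow> (real^'n) set" where
  "periodize A = (\<Union>\<xi>\<in>twoZd. (\<lambda>x. \<xi> + x) ` A)"

definition periodic_displacements :: "nat \<Rightarrow> (real^'n \<Rightarrow> real^'n) set" where
  "periodic_displacements N =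
     {u. \<forall>x\<in>per_lattice N. \<forall>\<xi>\<in>twoZd. u (x + \<xi>) = u x}"

definition deformations :: "nat \<Rightarrow> (real^'n \<Rightarrow> real^'n) set" where
  "deformations N = {y. \<exists>A :: real^'n^'n. (\<lambda>x. y x - A *v x) \<in> periodic_displacements N}"

definition Dq :: "nat \<Rightarrow> real^'n \<Rightarrow> (real^'n \<Rightarrow> real^'n) \<Rightarrow> real^'n \<Rightarrow> real^'n" where
  "Dq N r v x = (1 / eps N) *\<^sub>R (v (x + eps N *\<^sub>R r) - v x)"

section \<open>Twice continuously differentiable functions of finite families of vectors\<close>

text \<open>
  \<open>(\<real>\<^sup>d)\<^sup>A\<close> is the set \<open>A \<rightarrow>\<^sub>E UNIV\<close> of extensional functions, with the product topology.
  \<open>pgrad F r g\<close> is the gradient of \<open>F\<close> in the vector variable \<open>g\<^sub>r\<close>, and \<open>phess F r s g\<close>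
  the \<open>d \<times> d\<close> block of second derivatives in \<open>g\<^sub>r\<close> and \<open>g\<^sub>s\<close>.
\<close>

definition pgrad :: "(('a \<Rightarrow> real^'n) \<Rightarrow> real) \<Rightarrow> 'a \<Rightarrow> ('a \<Rightarrow> real^'n) \<Rightarrow> real^'n" where
  "pgrad F r g = (\<chi> i. frechet_derivative (\<lambda>h. F (g(r := h))) (at (g r)) (axis i 1))"

definition phess :: "(('a \<Rightarrow> real^'n) \<Rightarrow> real) \<Rightarrow> 'a \<Rightarrow> 'a \<Rightarrow> ('a \<Rightarrow> real^'n) \<Rightarrow> real^'n^'n" where
  "phess F r s g = jacobian (\<lambda>h. pgrad F r (g(s := h))) (at (g s))"

definition C2_family :: "'a set \<Rightarrow> (('a \<Rightarrow> real^'n) \<Rightarrow> real) \<Rightarrow> bool" where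
  "C2_family A F \<longleftrightarrow>
     continuous_on (A \<rightarrow>\<^sub>E UNIV) F \<and>
     (\<forall>r\<in>A. (\<forall>g\<in>A \<rightarrow>\<^sub>E UNIV. (\<lambda>h. F (g(r := h))) differentiable (at (g r))) \<and>
       continuous_on (A \<rightarrow>\<^sub>E UNIV) (pgrad F r)) \<and>
     (\<forall>r\<in>A. \<forall>s\<in>A.
       (\<forall>g\<in>A \<rightarrow>\<^sub>E UNIV. (\<lambda>h. pgrad F r (g(s := h))) differentiable (at (g s))) \<and>
       continuous_on (A \<rightarrow>\<^sub>E UNIV) (phess F r s))"

section \<open>Meshes\<close>

definition unit_corners :: "(real^'n) set" where
  "unit_corners = {c. \<forall>i. c $ i \<in> {0, 1}}"

text \<open>
  Only meant for \<open>d \<in> {1, 2}\<close>. For \<open>d = 2\<close> the diagonal joins a corner \<open>a\<close> of the unit square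
  to the opposite corner \<open>1 - a\<close> (where \<open>1\<close> is the vector of ones).
\<close>
definition cell_subdivision :: "(real^'n) set set \<Rightarrow> bool" where
  "cell_subdivision K \<longleftrightarrow>
     (if CARD('n) = 1 then K = {cbox 0 1}
      else \<exists>a\<in>unit_corners. K = {convex hull {a, 1 - a, c} |c. c \<in> unit_corners - {a, 1 - a}})"

definition per_fine_mesh :: "nat \<Rightarrow> (real^'n) set set \<Rightarrow> (real^'n) set set" where
  "per_fine_mesh N K = {(\<lambda>x. \<xi> + eps N *\<^sub>R x) ` T |\<xi> T. \<xi> \<in> per_lattice N \<and> T \<in> K}"

definition fine_mesh :: "nat \<Rightarrow> (real^'n) set set \<Rightarrow> (real^'n) set set" where
  "fine_mesh N K = {T \<in> per_fine_mesh N K. T \<subseteq> closure Omega}"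

text \<open>
  ``Regular'' means conforming (no hanging nodes). The library's \<^const>\<open>triangulation\<close> is
  restricted to finite collections, which excludes triangulations of the whole space.
\<close>
definition regular_triangulation :: "(real^'n) set set \<Rightarrow> (real^'n) set \<Rightarrow> bool" where
  "regular_triangulation \<T> S \<longleftrightarrow>
     (\<forall>T\<in>\<T>. int CARD('n) simplex T) \<and>
     (\<forall>T\<in>\<T>. \<forall>T'\<in>\<T>. (T \<inter> T') face_of T \<and> (T \<inter> T') face_of T') \<and>
     \<Union>\<T> = S"

definition periodize_mesh :: "(real^'n) set set \<Rightarrow> (real^'n) set set" where
  "periodize_mesh \<T> = {(\<lambda>x. \<xi> + x) ` T |\<xi> T. \<xi> \<in> twoZd \<and> T \<in> \<T>}"

definition P1 :: "(real^'n) set set \<Rightarrow> (real^'n \<Rightarrow> real^'n) \<Rightarrow> bool" where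
  "P1 \<T> w \<longleftrightarrow> continuous_on UNIV w \<and>
     (\<forall>T\<in>\<T>. \<exists>(A :: real^'n^'n) b. \<forall>x\<in>T. w x = A *v x + b)"

definition interpolant ::
    "nat \<Rightarrow> (real^'n) set set \<Rightarrow> (real^'n \<Rightarrow> real^'n) \<Rightarrow> real^'n \<Rightarrow> real^'n" where
  "interpolant N \<T> v = (THE w. P1 \<T> w \<and> (\<forall>x\<in>per_lattice N. w x = v x))"

definition coarse_displacements ::
    "nat \<Rightarrow> (real^'n) set set \<Rightarrow> (real^'n \<Rightarrow> real^'n) set" where
  "coarse_displacements N \<T> =
     {u \<in> periodic_displacements N. \<exists>w. P1 (periodize_mesh \<T>) w \<and> (\<forall>x\<in>per_lattice N. w x = u x)}"

section \<open>Energies\<close>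

text \<open>
  Energies are functions of maps on all of \<^typ>\<open>real^'n\<close>, so that the energy of the coupled model
  applies to sums of functions that are piecewise affine on different meshes.
\<close>

definition E_a :: "nat \<Rightarrow> (real^'n) set \<Rightarrow> ((real^'n \<Rightarrow> real^'n) \<Rightarrow> real)
    \<Rightarrow> (real^'n \<Rightarrow> real^'n) \<Rightarrow> real" where
  "E_a N R V y = eps N ^ CARD('n) * (\<Sum>x\<in>lattice N. V (\<lambda>r\<in>R. Dq N r y x))"

definition Wcb :: "(real^'n) set \<Rightarrow> ((real^'n \<Rightarrow> real^'n) \<Rightarrow> real) \<Rightarrow> real^'n^'n \<Rightarrow> real" where
  "Wcb R V F = V (\<lambda>r\<in>R. F *v r)"

abbreviation grad :: "(real^'n \<Rightarrow> real^'n) \<Rightarrow> real^'n \<Rightarrow> real^'n^'n" where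
  "grad v x \<equiv> jacobian v (at x)"

definition atomistic_sites ::
    "nat \<Rightarrow> (real^'n) set \<Rightarrow> (real^'n) set set \<Rightarrow> (real^'n) set" where
  "atomistic_sites N R Ta =
     {x \<in> lattice N. \<exists>r\<in>R. closed_segment x (x + eps N *\<^sub>R r) \<inter> periodize (\<Union>Ta) \<noteq> {}}"

definition interface_bonds ::
    "nat \<Rightarrow> (real^'n) set \<Rightarrow> (real^'n) set set \<Rightarrow> ((real^'n) \<times> (real^'n)) set" where
  "interface_bonds N R Ti =
     {(x, x + eps N *\<^sub>R r) |x r. x \<in> lattice N \<and> r \<in> R \<and>
        closed_segment x (x + eps N *\<^sub>R r) \<subseteq> periodize (\<Union>Ti)}"

text \<open>For a bond \<open>(x, x') = (x, x + \<epsilon>r)\<close> the direction is recovered as \<open>r = (x' - x) / \<epsilon>\<close>.\<close>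
definition E_int :: "nat \<Rightarrow> (real^'n) set \<Rightarrow> (real^'n) set set
    \<Rightarrow> (((real^'n) \<times> (real^'n) \<Rightarrow> real^'n) \<Rightarrow> real) \<Rightarrow> (real^'n \<Rightarrow> real^'n) \<Rightarrow> real" where
  "E_int N R Ti Ei y = eps N ^ CARD('n) *
     Ei (restrict (\<lambda>(x, x'). Dq N ((1 / eps N) *\<^sub>R (x' - x)) y x) (interface_bonds N R Ti))"

definition E_ac :: "nat \<Rightarrow> (real^'n) set \<Rightarrow> ((real^'n \<Rightarrow> real^'n) \<Rightarrow> real)
    \<Rightarrow> (real^'n) set set \<Rightarrow> (real^'n) set set \<Rightarrow> (real^'n) set set
    \<Rightarrow> (((real^'n) \<times> (real^'n) \<Rightarrow> real^'n) \<Rightarrow> real) \<Rightarrow> (real^'n \<Rightarrow> real^'n) \<Rightarrow> real" where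
  "E_ac N R V Ta Ti Tc Ei y =
     (LINT x : \<Union>Tc | lebesgue. Wcb R V (grad y x)) +
     eps N ^ CARD('n) * (\<Sum>x\<in>atomistic_sites N R Ta. V (\<lambda>r\<in>R. Dq N r y x)) +
     E_int N R Ti Ei y"

definition first_variation :: "((real^'n \<Rightarrow> real^'n) \<Rightarrow> real) \<Rightarrow> (real^'n \<Rightarrow> real^'n)
    \<Rightarrow> (real^'n \<Rightarrow> real^'n) \<Rightarrow> real" where
  "first_variation E y z = deriv (\<lambda>t. E (\<lambda>x. y x + t *\<^sub>R z x)) 0"

section \<open>Norms and oscillation\<close>

definition entry_norm :: "ennreal \<Rightarrow> real^'n^'n \<Rightarrow> real" where
  "entry_norm q A =
     (if q = \<infinity> then Max {\<bar>A $ i $ j\<bar> |i j. True}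
      else (\<Sum>i\<in>UNIV. \<Sum>j\<in>UNIV. \<bar>A $ i $ j\<bar> powr enn2real q) powr (1 / enn2real q))"

definition grad_norm :: "ennreal \<Rightarrow> (real^'n \<Rightarrow> real^'n) \<Rightarrow> real" where
  "grad_norm q v =
     (if q = \<infinity> then real_of_ereal (esssup (lebesgue_on Omega) (\<lambda>x. ereal (entry_norm q (grad v x))))
      else (LINT x : Omega | lebesgue. entry_norm q (grad v x) powr enn2real q)
             powr (1 / enn2real q))"

definition conj_exponent :: "ennreal \<Rightarrow> ennreal" where
  "conj_exponent p = inverse (1 - inverse p)"

lemma conj_exponent:
  assumes "1 \<le> p"
  shows "1 / p + 1 / conj_exponent p = 1"
proof -
  have inv2: "inverse (inverse x) = x" for x :: ennreal
    by (cases x rule: ennreal_cases)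
      (metis ennreal_0 ennreal_inverse_top ennreal_inverse_zero inverse_ennreal inverse_inverse_eq
        order_le_less positive_imp_inverse_positive, simp)
  have "inverse p \<le> 1"
  proof (cases p rule: ennreal_cases)
    case (real r)
    with assms have "1 \<le> r"
      by (metis ennreal_1 ennreal_le_iff)
    then have "inverse (ennreal r) = ennreal (inverse r)"
      by (intro inverse_ennreal) simp
    also have "\<dots> \<le> ennreal 1"
      using \<open>1 \<le> r\<close> by (intro ennreal_leI) (simp add: inverse_le_1_iff)
    finally show ?thesis
      using real by simp
  qed simp
  then show ?thesis
    by (simp add: divide_ennreal_def conj_exponent_def inv2 add_diff_inverse_ennreal)
qed

text \<open>The supremum is taken in the extended reals.\<close>
definition dual_norm :: "(real^'n \<Rightarrow> real^'n) set \<Rightarrow> ennreal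
    \<Rightarrow> ((real^'n \<Rightarrow> real^'n) \<Rightarrow> real) \<Rightarrow> ereal" where
  "dual_norm U p \<Phi> = (SUP v \<in> {v \<in> U. grad_norm (conj_exponent p) v = 1}. ereal (\<Phi> v))"

text \<open>The norm of \<^typ>\<open>real^'n^'n\<close> is the Frobenius norm.\<close>
definition osc :: "nat \<Rightarrow> (real^'n \<Rightarrow> real^'n) \<Rightarrow> (real^'n) set \<Rightarrow> real" where
  "osc N y \<omega> = (1 / eps N) *
     real_of_ereal (esssup (lebesgue_on \<omega> \<Otimes>\<^sub>M lebesgue_on \<omega>)
       (\<lambda>(x, x'). ereal (norm (grad y x - grad y x'))))"

definition continuum_fine_mesh ::
    "nat \<Rightarrow> (real^'n) set set \<Rightarrow> (real^'n) set set \<Rightarrow> (real^'n) set set" where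
  "continuum_fine_mesh N K Tc = {T \<in> fine_mesh N K. T \<subseteq> \<Union>Tc}"

definition patch :: "nat \<Rightarrow> (real^'n) set set \<Rightarrow> (real^'n) set set \<Rightarrow> (real^'n) set
    \<Rightarrow> (real^'n) set" where
  "patch N K Tc T = periodize (\<Union>Tc) \<inter> \<Union>{T' \<in> per_fine_mesh N K. T \<inter> T' \<noteq> {}}"

section \<open>Standing assumptions\<close>

definition M_total :: "(real^'n) set \<Rightarrow> (real^'n \<Rightarrow> real^'n \<Rightarrow> real) \<Rightarrow> real" where
  "M_total R M = (\<Sum>r\<in>R. \<Sum>s\<in>R. norm r * norm s * M r s)"

locale ac_setting =
  fixes N :: nat
    and K :: "(real^'n) set set"
    and R :: "(real^'n) set"
    and V :: "(real^'n \<Rightarrow> real^'n) \<Rightarrow> real"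
    and M :: "real^'n \<Rightarrow> real^'n \<Rightarrow> real"
    and Ta Ti Tc :: "(real^'n) set set"
    and Ei :: "((real^'n) \<times> (real^'n) \<Rightarrow> real^'n) \<Rightarrow> real"
  assumes N_pos: "1 \<le> N"
    and cell: "cell_subdivision K"
    and R_finite: "finite R"
    and R_lattice: "R \<subseteq> Zd - {0}"
    and V_C2: "C2_family R V"
    and V_bound: "\<And>r s g. \<lbrakk>r \<in> R; s \<in> R; g \<in> R \<rightarrow>\<^sub>E UNIV\<rbrakk> \<Longrightarrow>
                    onorm (\<lambda>h. phess V r s g *v h) \<le> M r s"
    and Th_triangulation: "regular_triangulation (Ta \<union> Ti \<union> Tc) (closure Omega)"
    and Th_vertices: "\<And>T x. \<lbrakk>T \<in> Ta \<union> Ti \<union> Tc; x extreme_point_of T\<rbrakk> \<Longrightarrow> x \<in> per_lattice N"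
    and Th_periodic: "regular_triangulation (periodize_mesh (Ta \<union> Ti \<union> Tc)) UNIV"
    and Th_disjoint: "Ta \<inter> Ti = {}" "Ta \<inter> Tc = {}" "Ti \<inter> Tc = {}"
    and sites_enclosed: "\<And>x r t. \<lbrakk>x \<in> atomistic_sites N R Ta; r \<in> R; 0 \<le> t; t \<le> 1\<rbrakk> \<Longrightarrow>
                    x + (t * eps N) *\<^sub>R r \<in> \<Union>Ta \<union> \<Union>Ti"
    and Ei_C2: "C2_family (interface_bonds N R Ti) Ei"

end

theory Submission
  imports Defs
begin

text \<open>On the line every fine interval lies in a single coarse interval, because the coarse nodes are lattice
  points. The coarse test functions are therefore among the fine ones, and the estimate is the
  monotonicity of a supremum (\<open>line_dual_norm_le\<close>).

  In the plane, let \<open>w\<close> be a coarse test function and \<open>v\<close> the interpolant of its lattice values on the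
  fine mesh. The sums over lattice points and bonds in both energies see lattice values only, so the
  first variations at \<open>w\<close> and at \<open>v\<close> differ only through the Cauchy--Born integral over the continuum
  region. The deformation is affine on each fine tile \<open>\<tau>\<close>, so this difference is the sum over the
  tiles of \<open>S\<^sub>\<tau> : \<integral>\<^sub>\<tau> (\<nabla>w - \<nabla>v)\<close> with a constant stress \<open>S\<^sub>\<tau>\<close>. Tiles of the atomistic and of the
  interface region contribute nothing, since they are elements of both meshes and \<open>w = v\<close> on them
  (\<open>coarse_vs_fine\<close>).

  The sum is estimated in two steps (\<open>consistency_error_bound\<close>). The stresses on the two tiles of a
  lattice cell are replaced by one of them; since the stress is Lipschitz with constant \<open>M_total R M\<close>,
  this costs the oscillation of the gradient of the deformation (\<open>tile_part_bound\<close>). What remains on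
  each cell is the integral of a partial derivative of \<open>w - v\<close>, that is, a difference of integrals of
  \<open>w - v\<close> over two opposite faces (\<open>cell_gradient_defect\<close>). A periodic summation by parts shifts the
  difference to the stresses of neighbouring cells, which again differ by an oscillation
  (\<open>face_part_bound\<close>). The remaining factor, the integral of \<open>w - v\<close> over a face, is the error of the
  trapezoidal rule for \<open>w\<close> and thus bounded by the oscillation of \<open>w\<close> along one lattice edge. All
  terms belong to tiles on which \<open>w\<close> and \<open>v\<close> differ. These lie in the continuum region, so oscillations
  over the patches suffice.

  Finally \<open>\<parallel>\<nabla>v\<parallel> \<le> \<parallel>\<nabla>w\<parallel>\<close>, so that \<open>v\<close> is, up to normalization, an admissible test function in the
  fine dual norm (\<open>fine_error_le_dual_norm\<close>). This and the bound on the faces need the same fact: the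
  \<open>q\<close>-norm of the difference quotients, or oscillations, of \<open>w\<close> along the lattice edges is at most that
  of the partial derivative of \<open>w\<close>, although edges are null sets and coarse elements may be
  arbitrarily thin. This is \<open>mesh_edge_bound\<close>: it holds by Jensen's inequality on almost every row
  parallel to the edges, and since the elements have lattice vertices, the lengths of the slices of an
  element are concave between consecutive lattice rows, so that the mean over the rows of a strip
  dominates the mean of their limits at the two lattice rows that bound it. To treat \<open>q = \<infinity>\<close> alike, the norm is
  compared with one through the convex functions \<open>growth q\<close>.\<close>

section \<open>Derivatives along lines of functions of finite families\<close>

text \<open>The chain rule for continuous partial gradients: changing the coordinates one after the other,
  each single change is a mean value of the corresponding partial derivative, at a point that
  converges to \<open>g\<close>.\<close>

lemma has_real_derivative_family_at_0:
  fixes F :: "('a \<Rightarrow> real^'n) \<Rightarrow> real" and D :: "'a \<Rightarrow> ('a \<Rightarrow> real^'n) \<Rightarrow> real^'n"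
  assumes "finite A" "B \<subseteq> A"
    and der: "\<And>r g. r \<in> A \<Longrightarrow> g \<in> A \<rightarrow>\<^sub>E UNIV \<Longrightarrow>
        ((\<lambda>h. F (g(r := h))) has_derivative (\<lambda>k. D r g \<bullet> k)) (at (g r))"
    and cont: "\<And>r. r \<in> A \<Longrightarrow> continuous_on (A \<rightarrow>\<^sub>E UNIV) (D r)"
    and g: "g \<in> A \<rightarrow>\<^sub>E UNIV"
  shows "((\<lambda>t. F (\<lambda>r\<in>A. if r \<in> B then g r + t *\<^sub>R h r else g r)) has_real_derivative
           (\<Sum>r\<in>B. D r g \<bullet> h r)) (at 0)"
  using finite_subset[OF assms(2,1)] assms(2)
proof (induction B rule: finite_induct)
  case empty
  then show ?case by simp
next
  case (insert b B)
  define G where "G \<xi> t = (\<lambda>r\<in>A. if r = b then g b + \<xi> *\<^sub>R h b else if r \<in> B then g r + t *\<^sub>R h r else g r)"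
    for \<xi> t :: real
  have GA: "G \<xi> t \<in> A \<rightarrow>\<^sub>E UNIV" for \<xi> t by (simp add: G_def)
  have bA: "b \<in> A" using insert by auto
  have G00: "G 0 0 = g" using g by (auto simp: G_def fun_eq_iff PiE_def extensional_def)
  have Gsplit: "F (\<lambda>r\<in>A. if r \<in> insert b B then g r + t *\<^sub>R h r else g r) = F (G t t)"
    "F (\<lambda>r\<in>A. if r \<in> B then g r + t *\<^sub>R h r else g r) = F (G 0 t)" for t
    by (intro arg_cong[where f=F] ext; use insert(2) in \<open>auto simp: G_def\<close>)+
  have dG: "((\<lambda>\<xi>. F (G \<xi> t)) has_real_derivative D b (G \<xi> t) \<bullet> h b) (at \<xi>)" for \<xi> t
  proof -
    have upd: "(\<lambda>x. F ((G \<xi> t)(b := g b + x *\<^sub>R h b))) = (\<lambda>\<xi>. F (G \<xi> t))"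
      by (intro ext arg_cong[where f=F]) (use bA in \<open>auto simp: G_def\<close>)
    have at: "G \<xi> t b = g b + \<xi> *\<^sub>R h b" using bA by (simp add: G_def)
    have "((\<lambda>h. F ((G \<xi> t)(b := h))) has_derivative (\<lambda>k. D b (G \<xi> t) \<bullet> k)) (at (g b + \<xi> *\<^sub>R h b))"
      using der[OF bA GA, of \<xi> t] unfolding at .
    then have "((\<lambda>x. F ((G \<xi> t)(b := g b + x *\<^sub>R h b))) has_derivative
        (\<lambda>x. D b (G \<xi> t) \<bullet> (x *\<^sub>R h b))) (at \<xi>)"
      by (rule has_derivative_compose[rotated]) (auto intro!: derivative_eq_intros)
    then show ?thesis unfolding upd has_field_derivative_def
      by (rule has_derivative_eq_rhs) (auto simp: fun_eq_iff)
  qed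
  have contc: "continuous_on UNIV (\<lambda>(\<xi>, t). D b (G \<xi> t) \<bullet> h b)"
  proof -
    have "continuous_on UNIV (\<lambda>p. G (fst p) (snd p))"
      unfolding G_def
    proof (rule continuous_on_coordinatewise_then_product)
      fix i
      show "continuous_on UNIV (\<lambda>p. (\<lambda>r\<in>A. if r = b then g b + fst p *\<^sub>R h b
              else if r \<in> B then g r + snd p *\<^sub>R h r else g r) i)"
        by (cases "i \<in> A"; cases "i = b"; cases "i \<in> B") (auto intro!: continuous_intros)
    qed
    then have "continuous_on UNIV (\<lambda>p. D b (G (fst p) (snd p)))"
      by (rule continuous_on_compose2[OF cont[OF bA]]) (use GA in auto)
    then show ?thesis by (auto simp: case_prod_unfold intro!: continuous_intros)
  qed
  have step: "((\<lambda>t. F (G t t) - F (G 0 t)) has_real_derivative D b g \<bullet> h b) (at 0)"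
    unfolding has_field_derivative_iff LIM_eq
  proof (intro allI impI)
    fix e :: real assume "0 < e"
    from contc have "isCont (\<lambda>(\<xi>, t). D b (G \<xi> t) \<bullet> h b) (0, 0)"
      by (simp add: continuous_on_eq_continuous_at)
    then obtain d where d: "d > 0" "\<And>p. dist p (0,0) < d \<Longrightarrow>
        dist ((\<lambda>(\<xi>, t). D b (G \<xi> t) \<bullet> h b) p) (D b (G 0 0) \<bullet> h b) < e"
      using \<open>0 < e\<close> unfolding continuous_at_eps_delta by fastforce
    show "\<exists>s>0. \<forall>x. x \<noteq> 0 \<and> norm (x - 0) < s \<longrightarrow>
       norm ((F (G x x) - F (G 0 x) - (F (G 0 0) - F (G 0 0))) / (x - 0) - D b g \<bullet> h b) < e"
    proof (intro exI[of _ "d/2"] conjI allI impI)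
      show "d/2 > 0" using d by simp
      fix x :: real assume x: "x \<noteq> 0 \<and> norm (x - 0) < d/2"
      have "\<exists>\<xi>. \<bar>\<xi>\<bar> \<le> \<bar>x\<bar> \<and> F (G x x) - F (G 0 x) = x * (D b (G \<xi> x) \<bullet> h b)"
      proof (cases "x > 0")
        case True
        from MVT2[OF True dG[of x]] obtain z where "0 < z" "z < x"
          "F (G x x) - F (G 0 x) = (x - 0) * (D b (G z x) \<bullet> h b)" by blast
        then show ?thesis by (intro exI[of _ z]) auto
      next
        case False
        then have "x < 0" using x by simp
        from MVT2[OF this dG[of x]] obtain z where "x < z" "z < 0"
          "F (G 0 x) - F (G x x) = (0 - x) * (D b (G z x) \<bullet> h b)" by blast
        then show ?thesis by (intro exI[of _ z]) (auto simp: algebra_simps)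
      qed
      then obtain \<xi> where \<xi>: "\<bar>\<xi>\<bar> \<le> \<bar>x\<bar>" "F (G x x) - F (G 0 x) = x * (D b (G \<xi> x) \<bullet> h b)" by blast
      have "dist (\<xi>, x) (0, 0::real) \<le> \<bar>\<xi>\<bar> + \<bar>x\<bar>"
        by (simp add: dist_prod_def dist_real_def sqrt_sum_squares_le_sum_abs)
      also have "\<dots> < d" using \<xi> x by auto
      finally show "norm ((F (G x x) - F (G 0 x) - (F (G 0 0) - F (G 0 0))) / (x - 0) - D b g \<bullet> h b) < e"
        using d(2)[of "(\<xi>, x)"] x \<xi> by (simp add: G00 dist_real_def)
    qed
  qed
  from insert have "((\<lambda>t. F (G 0 t)) has_real_derivative (\<Sum>r\<in>B. D r g \<bullet> h r)) (at 0)"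
    unfolding Gsplit by auto
  from DERIV_add[OF step this] show ?case
    unfolding Gsplit using insert by simp
qed

lemma has_real_derivative_family_line:
  fixes F :: "('a \<Rightarrow> real^'n) \<Rightarrow> real" and D :: "'a \<Rightarrow> ('a \<Rightarrow> real^'n) \<Rightarrow> real^'n"
  assumes "finite A"
    and der: "\<And>r g. r \<in> A \<Longrightarrow> g \<in> A \<rightarrow>\<^sub>E UNIV \<Longrightarrow>
        ((\<lambda>h. F (g(r := h))) has_derivative (\<lambda>k. D r g \<bullet> k)) (at (g r))"
    and cont: "\<And>r. r \<in> A \<Longrightarrow> continuous_on (A \<rightarrow>\<^sub>E UNIV) (D r)"
  shows "((\<lambda>t. F (\<lambda>r\<in>A. g r + t *\<^sub>R h r)) has_real_derivative
           (\<Sum>r\<in>A. D r (\<lambda>r\<in>A. g r + t *\<^sub>R h r) \<bullet> h r)) (at t)"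
proof -
  let ?g = "\<lambda>r\<in>A. g r + t *\<^sub>R h r"
  have "((\<lambda>s. F (\<lambda>r\<in>A. if r \<in> A then ?g r + s *\<^sub>R h r else ?g r)) has_real_derivative
           (\<Sum>r\<in>A. D r ?g \<bullet> h r)) (at 0)"
    by (rule has_real_derivative_family_at_0[OF assms(1) subset_refl der cont]) auto
  also have "(\<lambda>s. F (\<lambda>r\<in>A. if r \<in> A then ?g r + s *\<^sub>R h r else ?g r)) =
      (\<lambda>s. F (\<lambda>r\<in>A. g r + (t + s) *\<^sub>R h r))"
    by (intro ext arg_cong[where f=F]) (auto simp: algebra_simps)
  finally show ?thesis
    using DERIV_at_within_shift[of "\<lambda>t. F (\<lambda>r\<in>A. g r + t *\<^sub>R h r)" _ t 0 UNIV]
    by (simp add: restrict_def)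
qed

lemma C2_family_pgrad:
  fixes F :: "('a \<Rightarrow> real^'n) \<Rightarrow> real"
  assumes "C2_family A F" "r \<in> A" "g \<in> A \<rightarrow>\<^sub>E UNIV"
  shows "((\<lambda>h. F (g(r := h))) has_derivative (\<lambda>k. pgrad F r g \<bullet> k)) (at (g r))"
proof -
  have "(\<lambda>h. F (g(r := h))) differentiable (at (g r))"
    using assms by (auto simp: C2_family_def)
  then have fd: "((\<lambda>h. F (g(r := h))) has_derivative
      frechet_derivative (\<lambda>h. F (g(r := h))) (at (g r))) (at (g r))" (is "(_ has_derivative ?f) _")
    by (simp add: frechet_derivative_works)
  interpret f: linear ?f using fd by (rule has_derivative_linear)
  have "?f k = pgrad F r g \<bullet> k" for k
  proof -
    have "?f k = ?f (\<Sum>i\<in>UNIV. k $ i *\<^sub>R axis i 1)"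
      using basis_expansion[of k] by (simp add: scalar_mult_eq_scaleR)
    also have "\<dots> = (\<Sum>i\<in>UNIV. k $ i * ?f (axis i 1))" by (simp add: f.sum f.scale)
    finally show ?thesis by (simp add: pgrad_def inner_vec_def mult.commute)
  qed
  then have "?f = (\<lambda>k. pgrad F r g \<bullet> k)" by auto
  with fd show ?thesis by simp
qed

lemma C2_family_derivative_line:
  fixes F :: "('a \<Rightarrow> real^'n) \<Rightarrow> real"
  assumes "C2_family A F" "finite A"
  shows "((\<lambda>t. F (\<lambda>r\<in>A. g r + t *\<^sub>R h r)) has_real_derivative
           (\<Sum>r\<in>A. pgrad F r (\<lambda>r\<in>A. g r + t *\<^sub>R h r) \<bullet> h r)) (at t)"
  by (rule has_real_derivative_family_line[OF assms(2) C2_family_pgrad[OF assms(1)]])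
     (use assms in \<open>auto simp: C2_family_def\<close>)

lemma C2_family_pgrad_derivative_line:
  fixes F :: "('a \<Rightarrow> real^'n) \<Rightarrow> real"
  assumes F: "C2_family A F" "finite A" and r: "r \<in> A"
  shows "((\<lambda>t. pgrad F r (\<lambda>s\<in>A. g s + t *\<^sub>R h s) \<bullet> u) has_real_derivative
           (\<Sum>s\<in>A. (phess F r s (\<lambda>s\<in>A. g s + t *\<^sub>R h s) *v h s) \<bullet> u)) (at t)"
proof -
  have der: "((\<lambda>t. pgrad F r (\<lambda>s\<in>A. g s + t *\<^sub>R h s) \<bullet> u) has_real_derivative
     (\<Sum>s\<in>A. (transpose (phess F r s (\<lambda>s\<in>A. g s + t *\<^sub>R h s)) *v u) \<bullet> h s)) (at t)"
  proof (rule has_real_derivative_family_line[OF F(2), where D = "\<lambda>s g. transpose (phess F r s g) *v u"])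
    fix s and g :: "'a \<Rightarrow> real^'n" assume s: "s \<in> A" and g: "g \<in> A \<rightarrow>\<^sub>E UNIV"
    have "(\<lambda>h. pgrad F r (g(s := h))) differentiable (at (g s))"
      using F r s g by (auto simp: C2_family_def)
    then have "((\<lambda>h. pgrad F r (g(s := h))) has_derivative (\<lambda>k. phess F r s g *v k)) (at (g s))"
      unfolding phess_def jacobian_works .
    then have "((\<lambda>h. pgrad F r (g(s := h)) \<bullet> u) has_derivative (\<lambda>k. (phess F r s g *v k) \<bullet> u)) (at (g s))"
      by (auto intro!: derivative_eq_intros)
    then show "((\<lambda>h. pgrad F r (g(s := h)) \<bullet> u) has_derivative
        (\<lambda>k. (transpose (phess F r s g) *v u) \<bullet> k)) (at (g s))"
      using dot_lmul_matrix[of u "phess F r s g"] by (simp add: inner_commute)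
  next
    fix s assume s: "s \<in> A"
    have "continuous_on (A \<rightarrow>\<^sub>E UNIV) (phess F r s)" using F r s by (auto simp: C2_family_def)
    then show "continuous_on (A \<rightarrow>\<^sub>E UNIV) (\<lambda>g. transpose (phess F r s g) *v u)"
      unfolding matrix_vector_mult_def transpose_def
      by (auto intro!: continuous_intros continuous_on_vec_lambda)
  qed
  have e: "(transpose P *v u) \<bullet> k = (P *v k) \<bullet> u" for P :: "real^'n^'n" and k
    using dot_lmul_matrix[of u P k] by (simp add: inner_commute)
  from der show ?thesis unfolding e .
qed

section \<open>The Cauchy--Born stress\<close>

definition stress :: "(real^'n) set \<Rightarrow> ((real^'n \<Rightarrow> real^'n) \<Rightarrow> real) \<Rightarrow> real^'n^'n \<Rightarrow> real^'n^'n \<Rightarrow> real"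
  where "stress R V F G = (\<Sum>r\<in>R. pgrad V r (\<lambda>r\<in>R. F *v r) \<bullet> (G *v r))"

lemma linear_stress: "linear (stress R V F)"
  unfolding stress_def
  by (intro linearI)
     (simp_all add: matrix_vector_mult_add_rdistrib inner_add_right sum.distrib
       scaleR_matrix_vector_assoc[symmetric] sum_distrib_left)

lemma Wcb_derivative:
  assumes "C2_family R V" "finite R"
  shows "((\<lambda>t. Wcb R V (F + t *\<^sub>R G)) has_real_derivative stress R V F G) (at 0)"
proof -
  have "(\<lambda>r\<in>R. (F + t *\<^sub>R G) *v r) = (\<lambda>r\<in>R. F *v r + t *\<^sub>R (G *v r))" for t
    by (simp add: fun_eq_iff restrict_def matrix_vector_mult_add_rdistrib scaleR_matrix_vector_assoc[symmetric])
  then show ?thesis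
    using C2_family_derivative_line[OF assms, of "\<lambda>r. F *v r" "\<lambda>r. G *v r" 0]
    unfolding Wcb_def stress_def by simp
qed

lemma norm_matrix_vector_mult_le:
  fixes A :: "real^'n^'m"
  shows "norm (A *v x) \<le> norm A * norm x"
proof -
  have "(norm (A *v x))\<^sup>2 = (\<Sum>i\<in>UNIV. (A $ i \<bullet> x)\<^sup>2)"
    by (simp add: norm_vec_def L2_set_def sum_nonneg matrix_vector_mul_component row_def)
  also have "\<dots> \<le> (\<Sum>i\<in>UNIV. (norm (A $ i))\<^sup>2 * (norm x)\<^sup>2)"
    by (intro sum_mono) (metis Cauchy_Schwarz_ineq2 abs_ge_zero power2_abs power_mono power_mult_distrib)
  also have "\<dots> = (norm A * norm x)\<^sup>2"
    by (simp add: norm_vec_def[of A] L2_set_def sum_nonneg power_mult_distrib sum_distrib_right)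
  finally show ?thesis by (rule power2_le_imp_le) simp
qed

text \<open>The derivative of the stress along the segment from \<open>F'\<close> to \<open>F\<close> is a sum of second
  derivatives of \<open>V\<close>, each applied to \<open>(F - F') s\<close> and \<open>G r\<close>.\<close>

lemma stress_lipschitz:
  fixes F F' G :: "real^'n^'n"
  assumes V: "C2_family R V" "finite R"
    and bd: "\<And>r s g. \<lbrakk>r \<in> R; s \<in> R; g \<in> R \<rightarrow>\<^sub>E UNIV\<rbrakk> \<Longrightarrow> onorm (\<lambda>h. phess V r s g *v h) \<le> M r s"
    and G: "\<And>r. r \<in> R \<Longrightarrow> norm (G *v r) \<le> norm r * \<gamma>"
  shows "\<bar>stress R V F G - stress R V F' G\<bar> \<le> M_total R M * norm (F - F') * \<gamma>"
proof (cases "R = {}")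
  case True
  then show ?thesis by (simp add: stress_def M_total_def)
next
  case False
  let ?g = "\<lambda>t::real. \<lambda>r\<in>R. F' *v r + t *\<^sub>R ((F - F') *v r)"
  let ?q = "\<lambda>t. \<Sum>r\<in>R. pgrad V r (?g t) \<bullet> (G *v r)"
  let ?q' = "\<lambda>t. \<Sum>r\<in>R. \<Sum>s\<in>R. (phess V r s (?g t) *v ((F - F') *v s)) \<bullet> (G *v r)"
  have der: "(?q has_real_derivative ?q' t) (at t)" for t
    by (intro DERIV_sum C2_family_pgrad_derivative_line[OF V])
  obtain z where z: "?q 1 - ?q 0 = (1 - 0) * ?q' z"
    using MVT2[of 0 1 ?q ?q', OF _ der] by auto
  have q: "?q 1 = stress R V F G" "?q 0 = stress R V F' G"
    by (simp_all add: stress_def matrix_vector_mult_diff_rdistrib)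
  have term_le: "\<bar>(phess V r s (?g z) *v ((F - F') *v s)) \<bullet> (G *v r)\<bar> \<le> (norm r * norm s * M r s) * (norm (F - F') * \<gamma>)"
    if rs: "r \<in> R" "s \<in> R" for r s
  proof -
    have M0: "onorm (\<lambda>h. phess V r s (?g z) *v h) \<le> M r s" by (rule bd) (use rs in auto)
    have Mnn: "0 \<le> M r s" using M0 onorm_pos_le[OF matrix_vector_mul_bounded_linear, of "phess V r s (?g z)"] by linarith
    have "\<bar>(phess V r s (?g z) *v ((F - F') *v s)) \<bullet> (G *v r)\<bar> \<le>
        norm (phess V r s (?g z) *v ((F - F') *v s)) * norm (G *v r)"
      by (rule Cauchy_Schwarz_ineq2)
    also have "\<dots> \<le> (M r s * norm ((F - F') *v s)) * norm (G *v r)"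
    proof (rule mult_right_mono)
      have "norm (phess V r s (?g z) *v ((F - F') *v s)) \<le>
          onorm (\<lambda>h. phess V r s (?g z) *v h) * norm ((F - F') *v s)"
        by (rule onorm[OF matrix_vector_mul_bounded_linear])
      also have "\<dots> \<le> M r s * norm ((F - F') *v s)" by (rule mult_right_mono[OF M0]) simp
      finally show "norm (phess V r s (?g z) *v ((F - F') *v s)) \<le> M r s * norm ((F - F') *v s)" .
    qed simp
    also have "\<dots> \<le> (M r s * (norm (F - F') * norm s)) * (norm r * \<gamma>)"
      by (intro mult_mono mult_left_mono norm_matrix_vector_mult_le G rs mult_nonneg_nonneg Mnn) auto
    finally show ?thesis by (simp add: mult_ac)
  qed
  have "\<bar>?q' z\<bar> \<le> (\<Sum>r\<in>R. \<Sum>s\<in>R. (norm r * norm s * M r s) * (norm (F - F') * \<gamma>))"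
    by (intro order_trans[OF sum_abs] sum_mono term_le)
  also have "\<dots> = M_total R M * norm (F - F') * \<gamma>"
    by (simp add: M_total_def sum_distrib_right mult.assoc)
  finally show ?thesis using z q by simp
qed

section \<open>Piecewise affine functions on an interval\<close>

lemma compact_convex_interval:
  fixes S :: "real set"
  assumes "compact S" "convex S"
  obtains l u where "S = {l..u}"
proof -
  have "connected S" using assms by (rule_tac convex_connected)
  from connected_compact_interval_1[of S] this assms(1) show ?thesis
    using that by auto
qed

text \<open>Away from the finitely many endpoints a point belongs to exactly one of the intervals, so the
  fundamental theorem of calculus with finitely many exceptional points applies.\<close>

lemma increment_piecewise_affine:
  fixes f :: "real \<Rightarrow> real"
  assumes "finite P" and ab: "a \<le> b" and cont: "continuous_on {a..b} f"
    and cov: "{a..b} \<subseteq> (\<Union>p\<in>P. I p)"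
    and conv: "\<And>p. p \<in> P \<Longrightarrow> convex (I p)" and comp: "\<And>p. p \<in> P \<Longrightarrow> compact (I p)"
    and null: "\<And>p q. p \<in> P \<Longrightarrow> q \<in> P \<Longrightarrow> p \<noteq> q \<Longrightarrow> negligible (I p \<inter> I q)"
    and aff: "\<And>p x. p \<in> P \<Longrightarrow> x \<in> I p \<Longrightarrow> x \<in> {a..b} \<Longrightarrow> f x = c p * x + d p"
  shows "f b - f a = (\<Sum>p\<in>P. c p * measure lebesgue (I p \<inter> {a..b}))"
proof -
  have "\<exists>l u. I p \<inter> {a..b} = {l..u}" if "p \<in> P" for p
    using compact_convex_interval[of "I p \<inter> {a..b}"] conv[OF that] comp[OF that]
    by (metis compact_Int compact_Icc convex_Int convex_real_interval(5))
  then obtain l u where lu: "\<And>p. p \<in> P \<Longrightarrow> I p \<inter> {a..b} = {l p..u p}" by metis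
  define f' where "f' x = (\<Sum>p\<in>P. if x \<in> I p \<inter> {a..b} then c p else 0)" for x
  have int: "(f' has_integral (\<Sum>p\<in>P. c p * measure lebesgue (I p \<inter> {a..b}))) {a..b}"
    unfolding f'_def
  proof (rule has_integral_sum[OF assms(1)])
    fix p assume p: "p \<in> P"
    have sub: "{l p..u p} \<subseteq> {a..b}" using lu[OF p] by auto
    have "((\<lambda>x. c p) has_integral c p * measure lebesgue {l p..u p}) {l p..u p}"
      using has_integral_const_real[of "c p" "l p" "u p"]
      by (simp add: mult.commute)
    then have "((\<lambda>x. if x \<in> {l p..u p} then c p else 0) has_integral
        c p * measure lebesgue {l p..u p}) {a..b}"
      by (simp only: has_integral_restrict[OF sub, where f = "\<lambda>x. c p"])
    then show "((\<lambda>x. if x \<in> I p \<inter> {a..b} then c p else 0) has_integral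
        c p * measure lebesgue (I p \<inter> {a..b})) {a..b}"
      using lu[OF p] by simp
  qed
  have "(f' has_integral (f b - f a)) {a..b}"
  proof (rule fundamental_theorem_of_calculus_interior_strong[where S = "l ` P \<union> u ` P"])
    show "finite (l ` P \<union> u ` P)" using assms(1) by simp
    fix x assume x: "x \<in> {a<..<b} - (l ` P \<union> u ` P)"
    then have xab: "x \<in> {a..b}" by auto
    then obtain p where p: "p \<in> P" "x \<in> I p" using cov by blast
    have inner: "x \<in> {l q<..<u q}" if q: "q \<in> P" "x \<in> I q" for q
    proof -
      have "x \<in> {l q..u q}" using q xab lu[OF q(1)] by blast
      moreover have "x \<noteq> l q" "x \<noteq> u q" using x q by blast+
      ultimately show ?thesis by auto
    qed
    note xp = inner[OF p]
    have other: "x \<notin> I q" if q: "q \<in> P" "q \<noteq> p" for q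
    proof
      assume "x \<in> I q"
      then have xq: "x \<in> {l q<..<u q}" by (rule inner[OF q(1)])
      define m n where "m = max (l p) (l q)" and "n = min (u p) (u q)"
      have "{m..n} \<subseteq> {l p..u p} \<inter> {l q..u q}" by (auto simp: m_def n_def)
      then have "{m..n} \<subseteq> I p \<inter> I q" using lu[OF p(1)] lu[OF q(1)] by blast
      then have "negligible {m..n}" using null[OF p(1) q(1)] q negligible_subset by blast
      moreover have "m < n" using xp xq by (auto simp: m_def n_def)
      ultimately show False
        using negligible_interval(1)[of m n] by simp
    qed
    have "f' x = (\<Sum>q\<in>P. if q = p then c p else 0)"
      unfolding f'_def by (intro sum.cong) (use other p x in auto)
    then have f': "f' x = c p" using p assms(1) by simp
    have "((\<lambda>x. c p * x + d p) has_vector_derivative c p) (at x)"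
      by (auto intro!: derivative_eq_intros)
    then have "(f has_vector_derivative c p) (at x)"
    proof (rule has_vector_derivative_transform_within_open)
      fix y assume "y \<in> {l p<..<u p}"
      then have "y \<in> {l p..u p}" by auto
      then have "y \<in> I p \<inter> {a..b}" using lu[OF p(1)] by blast
      then show "c p * y + d p = f y" using aff p by auto
    qed (use xp in auto)
    then show "(f has_vector_derivative f' x) (at x)" using f' by simp
  qed (use ab cont in auto)
  with int show ?thesis using has_integral_unique by blast
qed

section \<open>Slices of plane sets\<close>

text \<open>In the plane this is the point with coordinates \<open>s\<close> in direction \<open>j\<close> and \<open>t\<close> in the other direction.\<close>

definition pt :: "'n \<Rightarrow> real \<Rightarrow> real \<Rightarrow> real^'n" where
  "pt j s t = (\<chi> l. if l = j then s else t)"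

definition slice :: "'n \<Rightarrow> (real^'n) set \<Rightarrow> real \<Rightarrow> real set" where
  "slice j T t = {s. pt j s t \<in> T}"

lemma slice_Int: "slice j (S \<inter> T) t = slice j S t \<inter> slice j T t"
  by (auto simp: slice_def)

lemma pt_convex_comb:
  "u + v = 1 \<Longrightarrow> u *\<^sub>R pt j s t + v *\<^sub>R pt j s' t' = pt j (u * s + v * s') (u * t + v * t')"
  by (simp add: pt_def vec_eq_iff)

lemma convex_slice: "convex T \<Longrightarrow> convex (slice j T t)"
  unfolding convex_alt slice_def
proof (intro ballI allI impI, clarify)
  fix x y u :: real
  assume T: "\<forall>x\<in>T. \<forall>y\<in>T. \<forall>u. 0 \<le> u \<and> u \<le> 1 \<longrightarrow> (1 - u) *\<^sub>R x + u *\<^sub>R y \<in> T"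
    and "pt j x t \<in> T" "pt j y t \<in> T" "0 \<le> u" "u \<le> 1"
  then have "(1 - u) *\<^sub>R pt j x t + u *\<^sub>R pt j y t \<in> T" by blast
  then show "pt j ((1 - u) *\<^sub>R x + u *\<^sub>R y) t \<in> T"
    by (subst (asm) pt_convex_comb) (auto simp: algebra_simps)
qed

lemma continuous_on_pt [continuous_intros]:
  assumes "continuous_on S f" "continuous_on S g"
  shows "continuous_on S (\<lambda>x. pt j (f x) (g x))"
  unfolding pt_def
proof (rule continuous_on_vec_lambda)
  fix l
  show "continuous_on S (\<lambda>x. if l = j then f x else g x)"
    using assms by (cases "l = j") auto
qed

lemma closed_slice: "closed T \<Longrightarrow> closed (slice j T t)"
  using continuous_on_closed_vimage[of UNIV "\<lambda>s. pt j s t"] continuous_on_pt[of UNIV "\<lambda>s. s" "\<lambda>s. t" j]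
  by (auto simp: slice_def vimage_def)

lemma compact_slice:
  fixes T :: "(real^'n) set"
  assumes "compact T"
  shows "compact (slice j T t)"
proof -
  obtain B where "\<And>x. x \<in> T \<Longrightarrow> norm x \<le> B"
    using compact_imp_bounded[OF assms] by (auto simp: bounded_iff)
  moreover have "\<bar>s\<bar> \<le> norm (pt j s t)" for s
    using component_le_norm_cart[of "pt j s t" j] by (simp add: pt_def)
  ultimately have "bounded (slice j T t)"
    unfolding bounded_iff slice_def by (metis mem_Collect_eq order_trans real_norm_def)
  then show ?thesis using closed_slice[OF compact_imp_closed[OF assms]] compact_eq_bounded_closed by blast
qed

text \<open>Coordinates of the plane: \<open>j\<close> is the direction of the slices, \<open>i\<close> numbers them.\<close>

locale plane =
  fixes i j :: "'n::finite"
  assumes ij: "i \<noteq> j" and all_ij: "UNIV = {i, j}"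
begin

lemma sum_ij: "(\<Sum>l\<in>UNIV. f l) = f i + (f j :: 'b::comm_monoid_add)"
  using ij by (simp add: all_ij)

lemma ex_ij: "(\<forall>l. Q l) \<longleftrightarrow> Q i \<and> Q j"
  using all_ij by (metis UNIV_I insert_iff singletonD)

lemma pt_nth [simp]: "pt j s t $ j = s" "pt j s t $ i = t"
  using ij by (simp_all add: pt_def)

lemma pt_eta [simp]: "pt j (x $ j) (x $ i) = x"
  using ex_ij[of "\<lambda>l. pt j (x $ j) (x $ i) $ l = x $ l"] by (simp add: vec_eq_iff)

lemma borel_measurable_pt: "(\<lambda>(t, s). pt j s t) \<in> borel_measurable (lborel \<Otimes>\<^sub>M lborel)"
proof -
  have "continuous_on UNIV (\<lambda>p. pt j (snd p) (fst p))" by (intro continuous_intros)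
  then show ?thesis
    by (simp add: lborel_prod case_prod_unfold borel_measurable_continuous_onI)
qed

lemma lborel_eq_distr_pt:
  "(lborel :: (real^'n) measure) = distr (lborel \<Otimes>\<^sub>M lborel) borel (\<lambda>(t, s). pt j s t)"
proof (rule lborel_eqI)
  fix l u :: "real^'n" assume lu: "\<And>b. b \<in> Basis \<Longrightarrow> l \<bullet> b \<le> u \<bullet> b"
  have le: "l $ k \<le> u $ k" for k
    using lu[of "axis k 1"] by (simp add: inner_axis)
  have pre: "(\<lambda>(t, s). pt j s t) -` box l u \<inter> space (lborel \<Otimes>\<^sub>M lborel) =
      {l $ i<..<u $ i} \<times> {l $ j<..<u $ j}"
    using ex_ij[of "\<lambda>k. l $ k < pt j s t $ k \<and> pt j s t $ k < u $ k" for s t]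
    by (auto simp: mem_box_cart space_pair_measure)
  have "emeasure (distr (lborel \<Otimes>\<^sub>M lborel) borel (\<lambda>(t, s). pt j s t)) (box l u) =
      emeasure (lborel \<Otimes>\<^sub>M lborel) ({l $ i<..<u $ i} \<times> {l $ j<..<u $ j})"
    by (subst emeasure_distr) (use borel_measurable_pt pre in auto)
  also have "\<dots> = emeasure lborel {l $ i<..<u $ i} * emeasure lborel {l $ j<..<u $ j}"
    by (intro lborel.emeasure_pair_measure_Times) auto
  also have "\<dots> = ennreal ((u $ i - l $ i) * (u $ j - l $ j))"
    using le by (simp add: ennreal_mult)
  also have "(u $ i - l $ i) * (u $ j - l $ j) = (\<Prod>b\<in>Basis. (u - l) \<bullet> b)"
  proof -
    have B: "(Basis :: (real^'n) set) = {axis i 1, axis j 1}"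
      by (auto simp: Basis_vec_def all_ij)
    show ?thesis unfolding B using ij by (simp add: axis_eq_axis inner_axis)
  qed
  finally show "emeasure (distr (lborel \<Otimes>\<^sub>M lborel) borel (\<lambda>(t, s). pt j s t)) (box l u) =
      (\<Prod>b\<in>Basis. (u - l) \<bullet> b)" .
qed simp

lemma pt_vimage_sets:
  assumes "closed (T :: (real^'n) set)"
  shows "(\<lambda>(t, s). pt j s t) -` T \<inter> space (lborel \<Otimes>\<^sub>M lborel) \<in> sets (lborel \<Otimes>\<^sub>M lborel)"
  by (rule measurable_sets[OF borel_measurable_pt]) (use assms in auto)

lemma Pair_vimage_slice:
  "Pair t -` ((\<lambda>(t, s). pt j s t) -` T \<inter> space (lborel \<Otimes>\<^sub>M lborel)) = slice j T t"
  by (auto simp: slice_def space_pair_measure)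

lemma emeasure_slices:
  assumes "closed (T :: (real^'n) set)"
  shows "emeasure lborel T = (\<integral>\<^sup>+ t. emeasure lborel (slice j T t) \<partial>lborel)"
proof -
  let ?P = "(\<lambda>(t, s). pt j s t) -` T \<inter> space (lborel \<Otimes>\<^sub>M lborel)"
  have "emeasure lborel T = emeasure (lborel \<Otimes>\<^sub>M lborel) ?P"
    by (subst lborel_eq_distr_pt, subst emeasure_distr)
       (use borel_measurable_pt assms in auto)
  also have "\<dots> = (\<integral>\<^sup>+ t. emeasure lborel (Pair t -` ?P) \<partial>lborel)"
    by (rule lborel.emeasure_pair_measure_alt[OF pt_vimage_sets[OF assms]])
  finally show ?thesis unfolding Pair_vimage_slice .
qed

lemma slice_length_measurable:
  assumes "closed (T :: (real^'n) set)"
  shows "(\<lambda>t. emeasure lborel (slice j T t)) \<in> borel_measurable lborel"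
  using lborel.measurable_emeasure_Pair[OF pt_vimage_sets[OF assms]]
  unfolding Pair_vimage_slice .

lemma emeasure_slice:
  assumes "compact T"
  shows "emeasure lborel (slice j T t) = ennreal (measure lebesgue (slice j T t))"
  using compact_slice[OF assms, of j t] emeasure_compact_finite[of "slice j T t"]
  by (simp add: emeasure_eq_ennreal_measure less_top measure_completion borel_compact)

lemma has_integral_slice_length:
  assumes "compact (T :: (real^'n) set)"
  shows "((\<lambda>t. measure lebesgue (slice j T t)) has_integral measure lebesgue T) UNIV"
proof -
  have cl: "closed T" using assms by (rule compact_imp_closed)
  have fin: "emeasure lborel T < \<infinity>" by (rule emeasure_compact_finite[OF assms])
  have "has_bochner_integral lborel (\<lambda>t. measure lebesgue (slice j T t)) (measure lborel T)"
  proof (rule has_bochner_integral_nn_integral)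
    show "(\<lambda>t. measure lebesgue (slice j T t)) \<in> borel_measurable lborel"
    proof -
      have "(\<lambda>t. enn2real (emeasure lborel (slice j T t))) \<in> borel_measurable lborel"
        using slice_length_measurable[OF cl] by measurable
      then show ?thesis by (simp add: emeasure_slice[OF assms])
    qed
    show "(\<integral>\<^sup>+ x. ennreal (measure lebesgue (slice j T x)) \<partial>lborel) = ennreal (measure lborel T)"
    proof -
      have "emeasure lborel T = ennreal (measure lborel T)"
        using fin by (intro emeasure_eq_ennreal_measure) auto
      then show ?thesis using emeasure_slices[OF cl] by (simp add: emeasure_slice[OF assms])
    qed
  qed auto
  moreover have "measure lborel T = measure lebesgue T"
    using cl by (simp add: measure_completion)
  ultimately show ?thesis
    using has_integral_integral_lborel[of "\<lambda>t. measure lebesgue (slice j T t)"]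
    by (simp add: has_bochner_integral_iff)
qed

lemma negligible_slices:
  assumes "compact (T :: (real^'n) set)" "negligible T"
  shows "negligible {t. \<not> negligible (slice j T t)}"
proof -
  have cl: "closed T" using assms by (simp add: compact_imp_closed)
  have "emeasure lborel T = 0"
    using assms(2) cl by (simp add: negligible_iff_emeasure0 emeasure_completion)
  then have "AE t in lborel. emeasure lborel (slice j T t) = 0"
    using emeasure_slices[OF cl] slice_length_measurable[OF cl] by (simp add: nn_integral_0_iff_AE)
  then obtain Z where Z: "Z \<in> null_sets lborel" "{t. emeasure lborel (slice j T t) \<noteq> 0} \<subseteq> Z"
    by (auto elim!: AE_E simp: null_sets_def)
  have "{t. \<not> negligible (slice j T t)} \<subseteq> Z"
    using Z(2) closed_slice[OF cl] by (auto simp: negligible_iff_emeasure0 emeasure_completion)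
  moreover have "negligible Z"
    using Z(1) by (simp add: negligible_iff_null_sets null_sets_completionI)
  ultimately show ?thesis using negligible_subset by blast
qed

end

section \<open>Bounding edge quantities by a mesh with lattice vertices\<close>

text \<open>The elements of a mesh may overlap in null sets. They are indexed, so that the intersections of the
  elements of two meshes form a tiling as well, even if several of these intersections are empty.\<close>

definition tiling :: "'p set \<Rightarrow> ('p \<Rightarrow> 'a::euclidean_space set) \<Rightarrow> bool" where
  "tiling P T \<longleftrightarrow> finite P \<and> (\<forall>p\<in>P. compact (T p) \<and> convex (T p)) \<and>
     (\<forall>p\<in>P. \<forall>q\<in>P. p \<noteq> q \<longrightarrow> negligible (T p \<inter> T q))"

lemma tilingD:
  assumes "tiling P T"
  shows "finite P" "p \<in> P \<Longrightarrow> compact (T p)" "p \<in> P \<Longrightarrow> convex (T p)"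
    "p \<in> P \<Longrightarrow> q \<in> P \<Longrightarrow> p \<noteq> q \<Longrightarrow> negligible (T p \<inter> T q)"
  using assms by (auto simp: tiling_def)

lemma tiling_Int:
  assumes "tiling P T" "compact S" "convex S"
  shows "tiling P (\<lambda>p. T p \<inter> S)"
  using assms unfolding tiling_def
  by (auto intro: compact_Int convex_Int negligible_subset[of "T p \<inter> T q" for p q])

lemma measure_tiling:
  assumes "tiling P T" "compact S" "convex S" "S \<subseteq> (\<Union>p\<in>P. T p)"
  shows "measure lebesgue S = (\<Sum>p\<in>P. measure lebesgue (T p \<inter> S))"
proof -
  note t = tiling_Int[OF assms(1-3)]
  have "measure lebesgue (\<Union>p\<in>P. T p \<inter> S) = (\<Sum>p\<in>P. measure lebesgue (T p \<inter> S))"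
    using t by (intro measure_negligible_finite_Union_image)
      (auto simp: pairwise_def tiling_def lmeasurable_compact)
  moreover have "(\<Union>p\<in>P. T p \<inter> S) = S" using assms(4) by auto
  ultimately show ?thesis by simp
qed

text \<open>The functions to which Jensen's inequality is applied: \<open>\<bar>x\<bar>\<^sup>q\<close> for a finite exponent, and
  \<open>max 0 (\<bar>x\<bar> - 1)\<close> in place of the exponent \<open>\<infinity>\<close>.\<close>

locale even_convex =
  fixes \<phi> :: "real \<Rightarrow> real"
  assumes \<phi>_convex: "convex_on UNIV \<phi>" and \<phi>_0: "\<phi> 0 = 0" and \<phi>_nonneg: "0 \<le> \<phi> x" and \<phi>_minus: "\<phi> (- x) = \<phi> x"
begin

lemma \<phi>_abs: "\<phi> \<bar>x\<bar> = \<phi> x"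
  using \<phi>_minus[of x] by (auto simp: abs_if)

lemma \<phi>_scale_le:
  assumes "0 \<le> u" "u \<le> 1" shows "\<phi> (u * x) \<le> u * \<phi> x"
  using convex_onD[OF \<phi>_convex assms, of 0 x] \<phi>_0 by simp

lemma \<phi>_mono:
  assumes "\<bar>x\<bar> \<le> y" shows "\<phi> x \<le> \<phi> y"
proof (cases "y = 0")
  case False
  then have y: "y > 0" using assms by linarith
  have "\<phi> \<bar>x\<bar> = \<phi> ((\<bar>x\<bar> / y) * y)" using y by simp
  also have "\<dots> \<le> (\<bar>x\<bar> / y) * \<phi> y" by (rule \<phi>_scale_le) (use assms y in auto)
  also have "\<dots> \<le> 1 * \<phi> y" by (intro mult_right_mono \<phi>_nonneg) (use assms y in auto)
  finally show ?thesis by (simp add: \<phi>_abs)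
qed (use assms in auto)

lemma continuous_on_\<phi>: "continuous_on UNIV \<phi>"
  by (rule convex_on_continuous[OF open_UNIV \<phi>_convex])

lemma \<phi>_jensen:
  assumes "finite P" "\<And>p. p \<in> P \<Longrightarrow> 0 \<le> w p" "sum w P = 1"
  shows "\<phi> (\<Sum>p\<in>P. w p * x p) \<le> (\<Sum>p\<in>P. w p * \<phi> (x p))"
proof -
  have "P \<noteq> {}" using assms(3) by auto
  then show ?thesis using convex_on_sum[OF assms(1) _ \<phi>_convex assms(3), of x] assms(2) by simp
qed

end

context plane
begin

text \<open>The one-dimensional Brunn--Minkowski inequality: the convex combinations of the points of two slices
  lie in the slice between them.\<close>

lemma slice_length_concave:
  assumes T: "compact T" "convex T" and ne: "slice j T t1 \<noteq> {}" "slice j T t2 \<noteq> {}"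
    and u: "0 \<le> u" "u \<le> 1"
  shows "(1 - u) * measure lebesgue (slice j T t1) + u * measure lebesgue (slice j T t2)
    \<le> measure lebesgue (slice j T ((1 - u) * t1 + u * t2))"
proof -
  obtain l1 u1 where 1: "slice j T t1 = {l1..u1}"
    using compact_convex_interval[OF compact_slice convex_slice] T by metis
  obtain l2 u2 where 2: "slice j T t2 = {l2..u2}"
    using compact_convex_interval[OF compact_slice convex_slice] T by metis
  have le: "l1 \<le> u1" "l2 \<le> u2" using ne 1 2 by auto
  let ?t = "(1 - u) * t1 + u * t2"
  obtain l3 u3 where 3: "slice j T ?t = {l3..u3}"
    using compact_convex_interval[OF compact_slice convex_slice] T by metis
  have mem: "(1 - u) * s1 + u * s2 \<in> slice j T ?t" if "s1 \<in> slice j T t1" "s2 \<in> slice j T t2" for s1 s2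
  proof -
    have "(1 - u) *\<^sub>R pt j s1 t1 + u *\<^sub>R pt j s2 t2 \<in> T"
      using T(2) that u unfolding convex_alt slice_def by blast
    then show ?thesis by (simp add: slice_def pt_convex_comb)
  qed
  have "(1 - u) * l1 + u * l2 \<in> {l3..u3}" "(1 - u) * u1 + u * u2 \<in> {l3..u3}"
    unfolding 3[symmetric] by (intro mem; use 1 2 le in auto)+
  then have "(1 - u) * (u1 - l1) + u * (u2 - l2) \<le> u3 - l3" "l3 \<le> u3"
    by (auto simp: algebra_simps)
  then show ?thesis unfolding 1 2 3 using le by simp
qed

text \<open>On a strip between two lattice rows the slice lengths are concave, so their mean over the
  strip dominates the mean of their one-sided limits at the two rows. The slices on the rows
  themselves are avoided: there two tiles may share a whole edge.\<close>

lemma strip_bound: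
  assumes ab: "a < b" and "finite P" and T: "\<And>p. p \<in> P \<Longrightarrow> compact (T p)" "\<And>p. p \<in> P \<Longrightarrow> convex (T p)"
    and w: "\<And>p. p \<in> P \<Longrightarrow> 0 \<le> w p"
    and rows: "\<And>p t t'. p \<in> P \<Longrightarrow> t \<in> {a<..<b} \<Longrightarrow> t' \<in> {a<..<b} \<Longrightarrow> slice j (T p) t \<noteq> {} \<Longrightarrow> slice j (T p) t' \<noteq> {}"
    and g: "continuous_on {a..b} g" and Z: "negligible Z"
    and le: "\<And>t. t \<in> {a<..<b} \<Longrightarrow> t \<notin> Z \<Longrightarrow> g t \<le> (\<Sum>p\<in>P. w p * measure lebesgue (slice j (T p) t))"
  shows "(b - a) / 2 * (g a + g b) \<le>
    (\<Sum>p\<in>P. w p * integral {a..b} (\<lambda>t. measure lebesgue (slice j (T p) t)))"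
proof -
  define f where "f t = (\<Sum>p\<in>P. w p * measure lebesgue (slice j (T p) t))" for t
  define R where "R = (\<Sum>p\<in>P. w p * integral {a..b} (\<lambda>t. measure lebesgue (slice j (T p) t)))"
  have intR: "(f has_integral R) {a..b}"
    unfolding f_def R_def
  proof (intro has_integral_sum has_integral_mult_right assms(2) integrable_integral)
    fix p assume "p \<in> P"
    then show "(\<lambda>t. measure lebesgue (slice j (T p) t)) integrable_on {a..b}"
      using integrable_on_subinterval[of _ UNIV a b] has_integral_slice_length[OF T(1)] by blast
  qed
  have refl: "(\<lambda>x. a + b - x) ` {a..b} = {a..b}"
    by (auto simp: image_iff intro!: bexI[of _ "a + b - x" for x])
  have "((\<lambda>t. f (a + b - t)) has_integral R) {a..b}"
    using has_integral_affinity[of f R a b "-1" "a + b"] intR refl by simp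
  with intR have int2: "((\<lambda>t. f t + f (a + b - t)) has_integral (R + R)) {a..b}"
    by (rule has_integral_add)
  \<comment> \<open>The total length of two slices symmetric about the middle of the strip does not decrease as they move inwards.\<close>
  have sym: "f (a + \<tau>) + f (b - \<tau>) \<le> f t + f (a + b - t)"
    if \<tau>: "0 < \<tau>" "a + \<tau> \<le> t" "t \<le> b - \<tau>" for t \<tau>
    unfolding f_def sum.distrib[symmetric] distrib_left[symmetric]
  proof (intro sum_mono mult_left_mono w)
    fix p assume p: "p \<in> P"
    let ?L = "\<lambda>t. measure lebesgue (slice j (T p) t)"
    show "?L (a + \<tau>) + ?L (b - \<tau>) \<le> ?L t + ?L (a + b - t)"
    proof (cases "slice j (T p) (a + \<tau>) = {}")
      case True
      then have "slice j (T p) (b - \<tau>) = {}" using rows[OF p, of "b - \<tau>" "a + \<tau>"] \<tau> by auto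
      with True show ?thesis by simp
    next
      case ne1: False
      then have ne2: "slice j (T p) (b - \<tau>) \<noteq> {}"
        using rows[OF p, of "a + \<tau>" "b - \<tau>"] \<tau> by auto
      show ?thesis
      proof (cases "a + \<tau> = b - \<tau>")
        case True
        then have e: "t = b - \<tau>" "a + b - t = a + \<tau>" using \<tau> by auto
        show ?thesis unfolding e(2) by (subst e(1)) simp
      next
        case False
        define u where "u = (t - (a + \<tau>)) / (b - \<tau> - (a + \<tau>))"
        have u: "0 \<le> u" "u \<le> 1" using False \<tau> by (auto simp: u_def divide_simps)
        have "u * (b - \<tau> - (a + \<tau>)) = t - (a + \<tau>)" using False by (simp add: u_def)
        then have t: "t = (1 - u) * (a + \<tau>) + u * (b - \<tau>)"
          and t': "a + b - t = (1 - (1 - u)) * (a + \<tau>) + (1 - u) * (b - \<tau>)"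
          by (simp_all add: algebra_simps)
        have "(1 - u) * ?L (a + \<tau>) + u * ?L (b - \<tau>) \<le> ?L t"
          unfolding t by (rule slice_length_concave[OF T(1)[OF p] T(2)[OF p] ne1 ne2 u])
        moreover have "(1 - (1 - u)) * ?L (a + \<tau>) + (1 - u) * ?L (b - \<tau>) \<le> ?L (a + b - t)"
          unfolding t' by (rule slice_length_concave[OF T(1)[OF p] T(2)[OF p] ne1 ne2]) (use u in auto)
        ultimately show ?thesis by (simp add: algebra_simps)
      qed
    qed
  qed
  \<comment> \<open>The pair of slices moves to the rows \<open>a\<close> and \<open>b\<close>, along values of \<open>\<tau>\<close> that avoid \<open>Z\<close>.\<close>
  have key: "g a + g b \<le> f t + f (a + b - t)" if t: "t \<in> {a<..<b}" for t
  proof (rule ccontr)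
    assume no: "\<not> ?thesis"
    define e where "e = (g a + g b - (f t + f (a + b - t))) / 2"
    have e: "e > 0" using no by (simp add: e_def)
    from g have "\<exists>d>0. \<forall>x\<in>{a..b}. dist x a < d \<longrightarrow> dist (g x) (g a) < e"
      using e ab by (auto simp: continuous_on_iff)
    then obtain d1 where d1: "d1 > 0" "\<And>x. x \<in> {a..b} \<Longrightarrow> dist x a < d1 \<Longrightarrow> dist (g x) (g a) < e" by blast
    from g have "\<exists>d>0. \<forall>x\<in>{a..b}. dist x b < d \<longrightarrow> dist (g x) (g b) < e"
      using e ab by (auto simp: continuous_on_iff)
    then obtain d2 where d2: "d2 > 0" "\<And>x. x \<in> {a..b} \<Longrightarrow> dist x b < d2 \<Longrightarrow> dist (g x) (g b) < e" by blast
    define d where "d = Min {d1, d2, t - a, b - t}"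
    have d: "d > 0" "d \<le> d1" "d \<le> d2" "d \<le> t - a" "d \<le> b - t" using d1 d2 t by (auto simp: d_def)
    have "negligible ((+) (- a) ` Z \<union> (+) b ` (uminus ` Z))"
      by (intro negligible_Un negligible_translation negligible_differentiable_image_negligible Z) auto
    moreover have "\<not> negligible {0<..<d}"
      using open_not_negligible[of "{0<..<d}"] d(1) by auto
    ultimately obtain \<tau> where \<tau>: "\<tau> \<in> {0<..<d}" "\<tau> \<notin> (+) (- a) ` Z \<union> (+) b ` (uminus ` Z)"
      using negligible_subset by blast
    have nZ: "a + \<tau> \<notin> Z" "b - \<tau> \<notin> Z"
    proof -
      show "a + \<tau> \<notin> Z" using \<tau>(2) by (auto simp: image_iff)
      show "b - \<tau> \<notin> Z" using \<tau>(2) by (auto simp: image_iff)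
    qed
    have "g (a + \<tau>) + g (b - \<tau>) \<le> f (a + \<tau>) + f (b - \<tau>)"
      unfolding f_def by (intro add_mono le nZ) (use \<tau>(1) d in auto)
    also have "\<dots> \<le> f t + f (a + b - t)" by (rule sym) (use \<tau>(1) d in auto)
    finally have "g (a + \<tau>) + g (b - \<tau>) \<le> f t + f (a + b - t)" .
    moreover have "dist (g (a + \<tau>)) (g a) < e" "dist (g (b - \<tau>)) (g b) < e"
      by (intro d1 d2; use \<tau>(1) d in \<open>auto simp: dist_real_def\<close>)+
    ultimately show False unfolding dist_real_def e_def by argo
  qed
  have "((\<lambda>t. g a + g b) has_integral (b - a) * (g a + g b)) {a..b}"
    using has_integral_const_real[of "g a + g b" a b] ab by simp
  then have "(b - a) * (g a + g b) \<le> R + R"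
    using int2 key unfolding has_integral_Icc_iff_Ioo by (rule has_integral_le)
  then show ?thesis by (simp add: R_def)
qed


lemma negligible_bad_rows:
  fixes T :: "'p \<Rightarrow> (real^'n) set"
  assumes "tiling P T"
  shows "negligible {t. \<not> (\<forall>p\<in>P. \<forall>q\<in>P. p \<noteq> q \<longrightarrow> negligible (slice j (T p) t \<inter> slice j (T q) t))}"
proof -
  let ?B = "\<Union>p\<in>P. \<Union>q\<in>P - {p}. {t. \<not> negligible (slice j (T p \<inter> T q) t)}"
  have "negligible ?B"
    using tilingD[OF assms]
    by (intro negligible_Union finite_imageI) (auto intro!: negligible_slices compact_Int)
  then show ?thesis
    by (rule negligible_subset) (auto simp: slice_Int)
qed

lemma row_increment:
  fixes T :: "'p \<Rightarrow> (real^'n) set" and f :: "real^'n \<Rightarrow> real"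
  assumes tl: "tiling P T" and f: "continuous_on UNIV f"
    and good: "\<And>p q. p \<in> P \<Longrightarrow> q \<in> P \<Longrightarrow> p \<noteq> q \<Longrightarrow> negligible (slice j (T p) t \<inter> slice j (T q) t)"
    and aff: "\<And>p x. p \<in> P \<Longrightarrow> x \<in> T p \<Longrightarrow> f x = c p \<bullet> x + d p"
    and cov: "\<And>s. s \<in> {a..b} \<Longrightarrow> pt j s t \<in> (\<Union>p\<in>P. T p)" and ab: "a \<le> b"
  shows "f (pt j b t) - f (pt j a t) = (\<Sum>p\<in>P. c p $ j * measure lebesgue (slice j (T p) t \<inter> {a..b}))"
proof (rule increment_piecewise_affine[where f = "\<lambda>s. f (pt j s t)" and d = "\<lambda>p. c p $ i * t + d p"])
  show "continuous_on {a..b} (\<lambda>s. f (pt j s t))"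
    by (rule continuous_on_compose2[OF f]) (auto intro!: continuous_intros)
  show "{a..b} \<subseteq> (\<Union>p\<in>P. slice j (T p) t)" using cov by (auto simp: slice_def)
  show "f (pt j s t) = c p $ j * s + (c p $ i * t + d p)" if "p \<in> P" "s \<in> slice j (T p) t" for p s
    using aff[OF that(1)] that(2) by (auto simp: slice_def inner_vec_def sum_ij)
qed (use tilingD[OF tl] ab good in \<open>auto intro!: convex_slice compact_slice\<close>)

text \<open>\<open>\<Lambda> s t\<close> stands for a quantity of the edge from \<open>(s, t)\<close> to \<open>(s + \<epsilon>, t)\<close> that is bounded by the
  oscillation of \<open>f\<close> on this edge. Almost every horizontal row is cut by the tiles into intervals
  with negligible overlaps, so there Jensen's inequality bounds the mean of \<open>\<phi> (\<Lambda> / \<epsilon>)\<close> by the mean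
  of \<open>\<phi> (\<partial>\<^sub>j f)\<close>; concavity of the slice lengths between lattice rows carries this over to the
  lattice rows, each of which receives half of the two strips beside it.\<close>

lemma mesh_edge_bound:
  fixes T :: "'p \<Rightarrow> (real^'n) set" and f :: "real^'n \<Rightarrow> real" and \<Lambda> :: "real \<Rightarrow> real \<Rightarrow> real"
  assumes \<phi>: "even_convex \<phi>" and N: "1 \<le> N"
    and tl: "tiling P T" and cov: "cbox (-1) 1 \<subseteq> (\<Union>p\<in>P. T p)" and sub: "\<And>p. p \<in> P \<Longrightarrow> T p \<subseteq> cbox (-1) 1"
    and f: "continuous_on UNIV f"
    and aff: "\<And>p x. p \<in> P \<Longrightarrow> x \<in> T p \<Longrightarrow> f x = c p \<bullet> x + d p"
    and rows: "\<And>p k t t'. p \<in> P \<Longrightarrow> t \<in> {real k / N - 1<..<real (Suc k) / N - 1} \<Longrightarrow>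
        t' \<in> {real k / N - 1<..<real (Suc k) / N - 1} \<Longrightarrow> slice j (T p) t \<noteq> {} \<Longrightarrow> slice j (T p) t' \<noteq> {}"
    and \<Lambda>_cont: "\<And>s. continuous_on UNIV (\<Lambda> s)"
    and \<Lambda>_bound: "\<And>s t v. (\<And>x y. x \<in> {s..s + 1 / N} \<Longrightarrow> y \<in> {s..s + 1 / N} \<Longrightarrow>
        \<bar>f (pt j x t) - f (pt j y t)\<bar> \<le> v) \<Longrightarrow> \<bar>\<Lambda> s t\<bar> \<le> v"
    and \<Lambda>_per: "\<And>s. \<Lambda> s 1 = \<Lambda> s (-1)"
  shows "(\<Sum>m<2*N. \<Sum>k<2*N. (1 / N)\<^sup>2 * \<phi> (real N * \<Lambda> (real m / N - 1) (real k / N - 1)))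
    \<le> (\<Sum>p\<in>P. measure lebesgue (T p) * \<phi> (c p $ j))"
proof -
  interpret even_convex \<phi> by fact
  define \<epsilon> where "\<epsilon> = 1 / real N"
  have \<epsilon>: "\<epsilon> > 0" "real N * \<epsilon> = 1" using N by (simp_all add: \<epsilon>_def)
  define \<sigma> where "\<sigma> m = real m / N - 1" for m :: nat
  have \<sigma>: "\<sigma> 0 = -1" "\<sigma> (2 * N) = 1" "\<sigma> (Suc m) = \<sigma> m + \<epsilon>" for m
    using N by (simp_all add: \<sigma>_def \<epsilon>_def add_divide_distrib)
  have \<sigma>_range: "-1 \<le> \<sigma> m" "\<sigma> m + \<epsilon> \<le> 1" if "m < 2 * N" for m
  proof -
    show "-1 \<le> \<sigma> m" by (simp add: \<sigma>_def)
    have "real (Suc m) \<le> 2 * real N" using that by linarith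
    then show "\<sigma> m + \<epsilon> \<le> 1" unfolding \<sigma>(3)[symmetric] using N by (simp add: \<sigma>_def divide_simps)
  qed
  define L where "L p t = measure lebesgue (slice j (T p) t)" for p t
  define Z where "Z = {t. \<not> (\<forall>p\<in>P. \<forall>q\<in>P. p \<noteq> q \<longrightarrow> negligible (slice j (T p) t \<inter> slice j (T q) t))}"
  have Z: "negligible Z" unfolding Z_def by (rule negligible_bad_rows[OF tl])
  have finP: "finite P" by (rule tilingD[OF tl])
  define g where "g t = (\<Sum>m<2*N. \<epsilon> * \<phi> (real N * \<Lambda> (\<sigma> m) t))" for t
  have g_cont: "continuous_on S g" for S
    unfolding g_def
    by (intro continuous_intros continuous_on_compose2[OF continuous_on_\<phi>]
      continuous_on_subset[OF \<Lambda>_cont]) auto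
  have in_box: "pt j s t \<in> cbox (-1) 1 \<longleftrightarrow> s \<in> {-1..1} \<and> t \<in> {-1..1}" for s t
    using ex_ij[of "\<lambda>k. -1 \<le> pt j s t $ k \<and> pt j s t $ k \<le> 1"] by (auto simp: mem_box_cart)
  have row: "g t \<le> (\<Sum>p\<in>P. \<phi> (c p $ j) * L p t)" if t: "t \<in> {-1..1}" "t \<notin> Z" for t
  proof -
    have good: "\<And>p q. p \<in> P \<Longrightarrow> q \<in> P \<Longrightarrow> p \<noteq> q \<Longrightarrow> negligible (slice j (T p) t \<inter> slice j (T q) t)"
      using t(2) by (auto simp: Z_def)
    define e where "e m p = measure lebesgue (slice j (T p) t \<inter> {\<sigma> m..\<sigma> m + \<epsilon>})" for m p
    have e0: "0 \<le> e m p" for m p by (simp add: e_def)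
    have edge: "\<epsilon> * \<phi> (real N * \<Lambda> (\<sigma> m) t) \<le> (\<Sum>p\<in>P. \<phi> (c p $ j) * e m p)" if m: "m < 2 * N" for m
    proof -
      have cov': "pt j s t \<in> (\<Union>p\<in>P. T p)" if "s \<in> {\<sigma> m..\<sigma> m + \<epsilon>}" for s
        by (rule subsetD[OF cov]) (use that t \<sigma>_range[OF m] in_box in auto)
      have sl_meas: "slice j (T p) t \<inter> {a..b} \<in> lmeasurable" if "p \<in> P" for p a b
        using tilingD(2)[OF tl that] by (intro lmeasurable_compact compact_Int compact_slice) auto
      define v where "v = (\<Sum>p\<in>P. \<bar>c p $ j\<bar> * e m p)"
      have inc: "\<bar>f (pt j y t) - f (pt j x t)\<bar> \<le> v"
        if xy: "x \<le> y" "x \<in> {\<sigma> m..\<sigma> m + \<epsilon>}" "y \<in> {\<sigma> m..\<sigma> m + \<epsilon>}" for x y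
      proof -
        have "f (pt j y t) - f (pt j x t) = (\<Sum>p\<in>P. c p $ j * measure lebesgue (slice j (T p) t \<inter> {x..y}))"
          by (rule row_increment[OF tl f good aff]) (use xy cov' in auto)
        also have "\<bar>\<dots>\<bar> \<le> v"
          unfolding v_def e_def
          by (intro order_trans[OF sum_abs] sum_mono)
             (use xy sl_meas in \<open>auto simp: abs_mult intro!: mult_left_mono measure_mono_fmeasurable\<close>)
        finally show ?thesis .
      qed
      have "\<bar>\<Lambda> (\<sigma> m) t\<bar> \<le> v"
      proof (rule \<Lambda>_bound)
        fix x y assume "x \<in> {\<sigma> m..\<sigma> m + 1 / N}" "y \<in> {\<sigma> m..\<sigma> m + 1 / N}"
        then show "\<bar>f (pt j x t) - f (pt j y t)\<bar> \<le> v"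
          using inc[of x y] inc[of y x] by (cases "x \<le> y") (auto simp: \<epsilon>_def abs_minus_commute)
      qed
      then have "\<bar>real N * \<Lambda> (\<sigma> m) t\<bar> \<le> real N * v" by (simp add: abs_mult mult_left_mono)
      then have "\<phi> (real N * \<Lambda> (\<sigma> m) t) \<le> \<phi> (real N * v)" by (rule \<phi>_mono)
      also have "real N * v = (\<Sum>p\<in>P. (real N * e m p) * \<bar>c p $ j\<bar>)"
        by (simp add: v_def sum_distrib_left mult_ac)
      also have "\<phi> \<dots> \<le> (\<Sum>p\<in>P. (real N * e m p) * \<phi> \<bar>c p $ j\<bar>)"
      proof (rule \<phi>_jensen[OF finP])
        have "measure lebesgue {\<sigma> m..\<sigma> m + \<epsilon>} = (\<Sum>p\<in>P. e m p)"
        proof -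
          have "tiling P (\<lambda>p. slice j (T p) t)"
            using tilingD[OF tl] good by (auto simp: tiling_def compact_slice convex_slice)
          moreover have "{\<sigma> m..\<sigma> m + \<epsilon>} \<subseteq> (\<Union>p\<in>P. slice j (T p) t)"
            using cov' by (auto simp: slice_def)
          ultimately show ?thesis
            unfolding e_def by (intro measure_tiling) auto
        qed
        then have "(\<Sum>p\<in>P. e m p) = \<epsilon>" using \<epsilon> by simp
        then show "(\<Sum>p\<in>P. real N * e m p) = 1" using \<epsilon> by (simp add: sum_distrib_left[symmetric])
      qed (use e0 in auto)
      finally have "\<epsilon> * \<phi> (real N * \<Lambda> (\<sigma> m) t) \<le> \<epsilon> * (\<Sum>p\<in>P. (real N * e m p) * \<phi> \<bar>c p $ j\<bar>)"
        using \<epsilon> by (intro mult_left_mono) auto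
      also have "\<dots> = (\<Sum>p\<in>P. (real N * \<epsilon>) * (\<phi> (c p $ j) * e m p))"
        by (simp add: sum_distrib_left \<phi>_abs mult_ac)
      finally show ?thesis using \<epsilon> by simp
    qed
    have tl_edges: "tiling {..<2*N} (\<lambda>m. {\<sigma> m..\<sigma> m + \<epsilon>})"
    proof -
      have "negligible ({\<sigma> m..\<sigma> m + \<epsilon>} \<inter> {\<sigma> k..\<sigma> k + \<epsilon>})" if "m < k" for m k
      proof -
        have "\<sigma> m + \<epsilon> \<le> \<sigma> k"
        proof -
          have "real (Suc m) \<le> real k" using that by linarith
          then show ?thesis unfolding \<sigma>(3)[symmetric] by (simp add: \<sigma>_def divide_right_mono)
        qed
        then have "{\<sigma> m..\<sigma> m + \<epsilon>} \<inter> {\<sigma> k..\<sigma> k + \<epsilon>} \<subseteq> {\<sigma> k}" by auto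
        then show ?thesis using negligible_sing negligible_subset by blast
      qed
      then have "negligible ({\<sigma> m..\<sigma> m + \<epsilon>} \<inter> {\<sigma> k..\<sigma> k + \<epsilon>})" if "m \<noteq> k" for m k
        using that by (metis inf_commute linorder_neqE_nat)
      then show ?thesis unfolding tiling_def by simp
    qed
    have cov_edges: "{-1..1} \<subseteq> (\<Union>m<2*N. {\<sigma> m..\<sigma> m + \<epsilon>})"
    proof
      fix s :: real assume s: "s \<in> {-1..1}"
      show "s \<in> (\<Union>m<2*N. {\<sigma> m..\<sigma> m + \<epsilon>})"
      proof (cases "s = 1")
        case True
        then have "s \<in> {\<sigma> (2*N-1)..\<sigma> (2*N-1) + \<epsilon>}"
          using \<sigma>(2) \<sigma>(3)[of "2*N-1"] N \<epsilon> by (simp add: Suc_diff_le)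
        then show ?thesis using N by (intro UN_I[of "2*N-1"]) auto
      next
        case False
        define m where "m = nat \<lfloor>(s + 1) * N\<rfloor>"
        have 1: "0 \<le> (s + 1) * N" using s by simp
        have "(s + 1) * N < 2 * N" using s False N by simp
        then have "\<lfloor>(s + 1) * N\<rfloor> < 2 * int N" by (simp add: floor_less_iff)
        then have "m < 2 * N" using 1 by (simp add: m_def nat_less_iff)
        moreover have "real m = of_int \<lfloor>(s + 1) * N\<rfloor>" using 1 by (simp add: m_def)
        then have "real m \<le> (s + 1) * N" "(s + 1) * N \<le> real m + 1" by linarith+
        then have "\<sigma> m \<le> s" "s \<le> \<sigma> m + \<epsilon>" using N by (simp_all add: \<sigma>_def \<epsilon>_def field_simps)
        ultimately show ?thesis by auto
      qed
    qed
    have sum_e: "(\<Sum>m<2*N. e m p) = L p t" if p: "p \<in> P" for p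
    proof -
      have "slice j (T p) t \<subseteq> {-1..1}"
        using sub[OF p] in_box by (auto simp: slice_def)
      then have "measure lebesgue (slice j (T p) t) = (\<Sum>m<2*N. measure lebesgue ({\<sigma> m..\<sigma> m + \<epsilon>} \<inter> slice j (T p) t))"
        using cov_edges tilingD(2,3)[OF tl p]
        by (intro measure_tiling[OF tl_edges] compact_slice convex_slice) auto
      then show ?thesis by (simp add: e_def L_def Int_commute)
    qed
    have "g t \<le> (\<Sum>m<2*N. \<Sum>p\<in>P. \<phi> (c p $ j) * e m p)"
      unfolding g_def by (intro sum_mono edge) auto
    also have "\<dots> = (\<Sum>p\<in>P. \<phi> (c p $ j) * (\<Sum>m<2*N. e m p))"
      by (subst sum.swap) (simp add: sum_distrib_left)
    also have "\<dots> = (\<Sum>p\<in>P. \<phi> (c p $ j) * L p t)" by (intro sum.cong) (auto simp: sum_e)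
    finally show ?thesis .
  qed
  have Lint: "L p integrable_on {a..b}" if "p \<in> P" for p a b
    using integrable_on_subinterval[of _ UNIV a b] has_integral_slice_length[OF tilingD(2)[OF tl that]]
    unfolding L_def by blast
  have strip: "\<epsilon> / 2 * (g (\<sigma> k) + g (\<sigma> (Suc k))) \<le> (\<Sum>p\<in>P. \<phi> (c p $ j) * integral {\<sigma> k..\<sigma> (Suc k)} (L p))"
    if k: "k < 2 * N" for k
  proof -
    have "(\<sigma> (Suc k) - \<sigma> k) / 2 * (g (\<sigma> k) + g (\<sigma> (Suc k))) \<le>
      (\<Sum>p\<in>P. \<phi> (c p $ j) * integral {\<sigma> k..\<sigma> (Suc k)} (\<lambda>t. measure lebesgue (slice j (T p) t)))"
    proof (rule strip_bound[where Z = Z])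
      fix t assume "t \<in> {\<sigma> k<..<\<sigma> (Suc k)}" "t \<notin> Z"
      then show "g t \<le> (\<Sum>p\<in>P. \<phi> (c p $ j) * measure lebesgue (slice j (T p) t))"
        using row[of t] \<sigma>_range[OF k] by (simp add: \<sigma>(3) L_def)
    next
      fix p t t' assume "p \<in> P" "t \<in> {\<sigma> k<..<\<sigma> (Suc k)}" "t' \<in> {\<sigma> k<..<\<sigma> (Suc k)}" "slice j (T p) t \<noteq> {}"
      then show "slice j (T p) t' \<noteq> {}" using rows[of p t k t'] by (auto simp: \<sigma>_def)
    qed (use tilingD[OF tl] \<phi>_nonneg g_cont Z \<epsilon> \<sigma>(3) in auto)
    then show ?thesis by (simp add: \<sigma>(3) L_def[abs_def])
  qed
  have tele: "(\<Sum>k<n. integral {\<sigma> k..\<sigma> (Suc k)} (L p)) = integral {-1..\<sigma> n} (L p)" if "p \<in> P" for p n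
  proof (induction n)
    case 0 then show ?case by (simp add: \<sigma>(1))
  next
    case (Suc n)
    have "- 1 \<le> \<sigma> n" by (simp add: \<sigma>_def)
    then show ?case
      using Suc Henstock_Kurzweil_Integration.integral_combine[of "-1" "\<sigma> n" "\<sigma> (Suc n)" "L p"] Lint[OF that] \<epsilon> by (simp add: \<sigma>(3))
  qed
  have total: "integral {-1..1} (L p) \<le> measure lebesgue (T p)" if p: "p \<in> P" for p
  proof -
    have hi: "(L p has_integral measure lebesgue (T p)) UNIV"
      unfolding L_def by (rule has_integral_slice_length[OF tilingD(2)[OF tl p]])
    then have "integral {-1..1} (L p) \<le> integral UNIV (L p)"
      by (intro integral_subset_le Lint[OF p]) (auto simp: L_def)
    then show ?thesis using hi by (simp add: integral_unique)
  qed
  have g_per: "g 1 = g (-1)" by (simp add: g_def \<Lambda>_per)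
  have trap: "(\<Sum>k<n. \<epsilon> / 2 * (g (\<sigma> k) + g (\<sigma> (Suc k)))) = (\<Sum>k<n. \<epsilon> * g (\<sigma> k)) + \<epsilon> / 2 * (g (\<sigma> n) - g (\<sigma> 0))" for n
    by (induction n) (simp_all add: algebra_simps)
  have "(\<Sum>m<2*N. \<Sum>k<2*N. (1 / N)\<^sup>2 * \<phi> (real N * \<Lambda> (\<sigma> m) (\<sigma> k))) = (\<Sum>k<2*N. \<epsilon> * g (\<sigma> k))"
    unfolding g_def sum_distrib_left
    by (subst sum.swap) (simp add: \<epsilon>_def power2_eq_square)
  also have "\<dots> = (\<Sum>k<2*N. \<epsilon> / 2 * (g (\<sigma> k) + g (\<sigma> (Suc k))))"
    unfolding trap \<sigma>(1,2) g_per by simp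
  also have "\<dots> \<le> (\<Sum>k<2*N. \<Sum>p\<in>P. \<phi> (c p $ j) * integral {\<sigma> k..\<sigma> (Suc k)} (L p))"
    by (intro sum_mono strip) auto
  also have "\<dots> = (\<Sum>p\<in>P. \<phi> (c p $ j) * integral {-1..1} (L p))"
    by (subst sum.swap) (simp add: sum_distrib_left[symmetric] tele \<sigma>(2) del: of_nat_Suc)
  also have "\<dots> \<le> (\<Sum>p\<in>P. \<phi> (c p $ j) * measure lebesgue (T p))"
    by (intro sum_mono mult_left_mono total \<phi>_nonneg)
  finally show ?thesis by (simp add: \<sigma>_def mult.commute)
qed

text \<open>Fubini's theorem, and on almost every row the fundamental theorem of calculus.\<close>

lemma integral_partial_over_box:
  fixes T :: "'p \<Rightarrow> (real^'n) set" and f :: "real^'n \<Rightarrow> real"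
  assumes tl: "tiling P T" and f: "continuous_on UNIV f"
    and aff: "\<And>p x. p \<in> P \<Longrightarrow> x \<in> T p \<Longrightarrow> f x = c p \<bullet> x + d p"
    and cov: "cbox l u \<subseteq> (\<Union>p\<in>P. T p)" and lu: "\<And>k. l $ k \<le> u $ k"
  shows "(\<Sum>p\<in>P. c p $ j * measure lebesgue (T p \<inter> cbox l u)) =
    integral {l $ i..u $ i} (\<lambda>t. f (pt j (u $ j) t) - f (pt j (l $ j) t))"
proof -
  define T' where "T' p = T p \<inter> cbox l u" for p
  have tl': "tiling P T'" unfolding T'_def by (rule tiling_Int[OF tl]) auto
  define h where "h t = (\<Sum>p\<in>P. c p $ j * measure lebesgue (slice j (T' p) t))" for t
  have "(h has_integral (\<Sum>p\<in>P. c p $ j * measure lebesgue (T' p))) UNIV"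
    unfolding h_def
    by (intro has_integral_sum has_integral_mult_right has_integral_slice_length tilingD[OF tl'])
  moreover have box: "pt j s t \<in> cbox l u \<longleftrightarrow> s \<in> {l $ j..u $ j} \<and> t \<in> {l $ i..u $ i}" for s t
    using ex_ij[of "\<lambda>k. l $ k \<le> pt j s t $ k \<and> pt j s t $ k \<le> u $ k"] by (auto simp: mem_box_cart)
  have "slice j (T' p) t = {}" if "t \<notin> {l $ i..u $ i}" for p t
    using that box by (auto simp: slice_def T'_def)
  then have "h = (\<lambda>t. if t \<in> {l $ i..u $ i} then h t else 0)" by (auto simp: h_def)
  ultimately have "(h has_integral (\<Sum>p\<in>P. c p $ j * measure lebesgue (T' p))) {l $ i..u $ i}"
    using has_integral_restrict_UNIV[of "{l $ i..u $ i}" h] by simp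
  then have "((\<lambda>t. f (pt j (u $ j) t) - f (pt j (l $ j) t)) has_integral
      (\<Sum>p\<in>P. c p $ j * measure lebesgue (T' p))) {l $ i..u $ i}"
  proof (rule has_integral_spike[OF negligible_bad_rows[OF tl'], rotated])
    fix t assume t: "t \<in> {l $ i..u $ i} -
      {t. \<not> (\<forall>p\<in>P. \<forall>q\<in>P. p \<noteq> q \<longrightarrow> negligible (slice j (T' p) t \<inter> slice j (T' q) t))}"
    have "f (pt j (u $ j) t) - f (pt j (l $ j) t) =
      (\<Sum>p\<in>P. c p $ j * measure lebesgue (slice j (T' p) t \<inter> {l $ j..u $ j}))"
    proof (rule row_increment[OF tl' f])
      fix s assume "s \<in> {l $ j..u $ j}"
      then have "pt j s t \<in> cbox l u" using t box by auto
      then show "pt j s t \<in> (\<Union>p\<in>P. T' p)" using cov by (auto simp: T'_def)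
    qed (use t lu aff in \<open>auto simp: T'_def\<close>)
    also have "\<dots> = h t"
    proof -
      have "slice j (T' p) t \<inter> {l $ j..u $ j} = slice j (T' p) t" for p
        using box by (auto simp: slice_def T'_def)
      then show ?thesis by (simp add: h_def)
    qed
    finally show "f (pt j (u $ j) t) - f (pt j (l $ j) t) = h t" .
  qed
  then show ?thesis by (simp add: integral_unique T'_def)
qed

end

section \<open>The fine mesh\<close>

definition upd :: "real^'n \<Rightarrow> 'n \<Rightarrow> real \<Rightarrow> real^'n" where
  "upd c l b = (\<chi> k. if k = l then b else c $ k)"

text \<open>The corner triangle of the unit square with its right angle at \<open>c\<close>: both triangles of a
  subdivision are of this form, for the two opposite corners \<open>c\<close> off the diagonal.\<close>

definition corner_tile :: "real^'n \<Rightarrow> (real^'n) set" where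
  "corner_tile c = {x \<in> cbox 0 1. (\<Sum>l\<in>UNIV. \<bar>x $ l - c $ l\<bar>) \<le> 1}"

definition lattice_tile :: "nat \<Rightarrow> real^'n \<Rightarrow> real^'n \<Rightarrow> (real^'n) set" where
  "lattice_tile N z c = {x. real N *\<^sub>R x - z \<in> corner_tile c}"

lemma lattice_tile_eq_image:
  assumes "1 \<le> N"
  shows "lattice_tile N z c = (\<lambda>x. eps N *\<^sub>R x + eps N *\<^sub>R z) ` corner_tile c"
    (is "_ = ?f ` _")
proof (intro equalityI subsetI)
  fix x assume "x \<in> lattice_tile N z c"
  then have "real N *\<^sub>R x - z \<in> corner_tile c" by (simp add: lattice_tile_def)
  moreover have "x = ?f (real N *\<^sub>R x - z)" using assms by (simp add: algebra_simps)
  ultimately show "x \<in> ?f ` corner_tile c" by blast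
next
  fix x assume "x \<in> ?f ` corner_tile c"
  then show "x \<in> lattice_tile N z c" using assms by (auto simp: lattice_tile_def algebra_simps)
qed

lemma unit_corners_nth: "c \<in> unit_corners \<Longrightarrow> c $ l = 0 \<or> c $ l = 1"
  by (auto simp: unit_corners_def)

lemma mem_unit_box: "x \<in> cbox 0 (1::real^'n) \<longleftrightarrow> (\<forall>l. 0 \<le> x $ l \<and> x $ l \<le> 1)"
  by (simp add: mem_box_cart)

lemma corner_abs:
  assumes "c \<in> unit_corners" "x \<in> cbox 0 1"
  shows "\<bar>x $ l - c $ l\<bar> = c $ l + (1 - 2 * c $ l) * x $ l"
  using unit_corners_nth[OF assms(1), of l] assms(2) by (auto simp: mem_unit_box)

lemma corner_tile_halfspace:
  assumes "c \<in> unit_corners"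
  shows "corner_tile c = cbox 0 1 \<inter> {x. (\<chi> l. 1 - 2 * c $ l) \<bullet> x \<le> 1 - (\<Sum>l\<in>UNIV. c $ l)}"
  using corner_abs[OF assms] by (auto simp: corner_tile_def inner_vec_def sum.distrib)

lemma compact_corner_tile: "c \<in> unit_corners \<Longrightarrow> compact (corner_tile c)"
  and convex_corner_tile: "c \<in> unit_corners \<Longrightarrow> convex (corner_tile c)"
  by (auto simp: corner_tile_halfspace intro!: compact_Int_closed closed_halfspace_le convex_Int convex_halfspace_le)

lemma compact_lattice_tile: "1 \<le> N \<Longrightarrow> c \<in> unit_corners \<Longrightarrow> compact (lattice_tile N z c)"
  unfolding lattice_tile_eq_image
  by (intro compact_continuous_image continuous_intros compact_corner_tile)

lemma convex_lattice_tile: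
  assumes "1 \<le> N" "c \<in> unit_corners" shows "convex (lattice_tile N z c)"
proof -
  have "lattice_tile N z c = (\<lambda>x. eps N *\<^sub>R z + x) ` (\<lambda>x. eps N *\<^sub>R x) ` corner_tile c"
    unfolding lattice_tile_eq_image[OF assms(1)] image_image by (simp add: add.commute)
  then show ?thesis using convex_translation[OF convex_scaling[OF convex_corner_tile[OF assms(2)]]] by metis
qed

lemma upd_nth [simp]: "upd c l b $ k = (if k = l then b else c $ k)"
  by (simp add: upd_def)

lemma edge_in_corner_tile:
  assumes "c \<in> unit_corners" "0 \<le> b" "b \<le> 1"
  shows "upd c l b \<in> corner_tile c"
proof -
  have "(\<Sum>k\<in>UNIV. \<bar>upd c l b $ k - c $ k\<bar>) = (\<Sum>k\<in>UNIV. if k = l then \<bar>b - c $ l\<bar> else 0)"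
    by (intro sum.cong) auto
  also have "\<dots> \<le> 1" using unit_corners_nth[OF assms(1), of l] assms by auto
  finally have "(\<Sum>k\<in>UNIV. \<bar>upd c l b $ k - c $ k\<bar>) \<le> 1" .
  moreover have "0 \<le> upd c l b $ k \<and> upd c l b $ k \<le> 1" for k
    using assms unit_corners_nth[OF assms(1), of k] by auto
  ultimately show ?thesis by (simp add: corner_tile_def mem_unit_box)
qed

lemma upd_same: "upd c l (c $ l) = c"
  by (simp add: vec_eq_iff)

lemma edge_in_lattice_tile:
  assumes "1 \<le> N" "c \<in> unit_corners" "0 \<le> b" "b \<le> 1"
  shows "eps N *\<^sub>R (z + upd c l b) \<in> lattice_tile N z c"
  using edge_in_corner_tile[OF assms(2-4)] assms(1) by (simp add: lattice_tile_def)

definition cells :: "nat \<Rightarrow> (real^'n) set" where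
  "cells N = {z \<in> Zd. \<forall>l. - real N \<le> z $ l \<and> z $ l \<le> real N - 1}"

definition tile_corners :: "real^'n \<Rightarrow> (real^'n) set" where
  "tile_corners a = unit_corners - {a, 1 - a}"

context plane
begin

lemma unit_corners_pt: "unit_corners = {pt j 0 0, pt j 0 1, pt j 1 0, pt j 1 1}"
proof -
  have "x \<in> unit_corners \<longleftrightarrow> x $ j \<in> {0,1} \<and> x $ i \<in> {0,1}" for x :: "real^'n"
    using ex_ij[of "\<lambda>k. x $ k \<in> {0, 1}"] by (auto simp: unit_corners_def)
  moreover have "x = pt j s t \<longleftrightarrow> x $ j = s \<and> x $ i = t" for x :: "real^'n" and s t
    using pt_eta[of x] pt_nth[of s t] by metis
  ultimately show ?thesis by (intro set_eqI) auto
qed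

lemma vec_eq_ij: "x = y \<longleftrightarrow> x $ j = y $ j \<and> x $ i = (y $ i :: 'b)" for x y :: "'b^'n"
  using ex_ij[of "\<lambda>k. x $ k = y $ k"] by (auto simp: vec_eq_iff)

lemma pt_eq_iff [simp]: "pt j s t = pt j s' t' \<longleftrightarrow> s = s' \<and> t = t'"
  by (auto simp: vec_eq_ij)

text \<open>The right angles of the two tiles are opposite corners. Calling \<open>c\<close> the one with \<open>c $ i = 0\<close> singles
  out the tile that contains the face of the cell on which coordinate \<open>i\<close> is smallest.\<close>

lemma tile_corners_obtain:
  assumes "a \<in> unit_corners"
  obtains c where "c \<in> unit_corners" "tile_corners a = {c, 1 - c}" "c $ i = 0"
    "a = upd c i (1 - c $ i) \<or> a = upd c j (1 - c $ j)"
proof -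
  have m: "1 - pt j s t = pt j (1 - s) (1 - t)" for s t :: real by (simp add: vec_eq_ij)
  from assms consider "a = pt j 0 0" | "a = pt j 0 1" | "a = pt j 1 0" | "a = pt j 1 1"
    unfolding unit_corners_pt by auto
  then show thesis
  proof cases
    case 1
    then show ?thesis by (intro that[of "pt j 1 0"])
      (auto simp: tile_corners_def unit_corners_pt m vec_eq_ij ij ij[symmetric])
  next
    case 2
    then show ?thesis by (intro that[of "pt j 0 0"])
      (auto simp: tile_corners_def unit_corners_pt m vec_eq_ij ij ij[symmetric])
  next
    case 3
    then show ?thesis by (intro that[of "pt j 0 0"])
      (auto simp: tile_corners_def unit_corners_pt m vec_eq_ij ij ij[symmetric])
  next
    case 4
    then show ?thesis by (intro that[of "pt j 1 0"])
      (auto simp: tile_corners_def unit_corners_pt m vec_eq_ij ij ij[symmetric])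
  qed
qed

lemma corner_ne_opposite: "c \<in> unit_corners \<Longrightarrow> (c::real^'n) \<noteq> 1 - c"
  using unit_corners_nth[of c j] by (auto simp: vec_eq_iff intro!: exI[of _ j])

lemma tile_corners_subset: "tile_corners a \<subseteq> unit_corners"
  by (auto simp: tile_corners_def)

lemma convex_hull_corner_tile:
  assumes a: "(a::real^'n) \<in> unit_corners" and c: "c \<in> tile_corners a"
  shows "convex hull {a, 1 - a, c} = corner_tile c"
proof -
  have corner: "c \<in> unit_corners" using c by (simp add: tile_corners_def)
  define A where "A = upd c j (1 - c $ j)"
  define B where "B = upd c i (1 - c $ i)"
  have AB: "{a, 1 - a} = {A, B}"
  proof -
    obtain s t where st: "c = pt j s t" "s \<in> {0,1}" "t \<in> {0,1}" using corner unfolding unit_corners_pt by auto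
    obtain s' t' where st': "a = pt j s' t'" "s' \<in> {0,1}" "t' \<in> {0,1}" using a unfolding unit_corners_pt by auto
    have "c \<noteq> a" "c \<noteq> 1 - a" using c by (auto simp: tile_corners_def)
    then have "s' = s \<and> t' = 1 - t \<or> s' = 1 - s \<and> t' = t"
      using st st' by (auto simp: vec_eq_ij)
    then show ?thesis using st st' by (auto simp: A_def B_def doubleton_eq_iff vec_eq_ij ij ij[symmetric])
  qed
  have "convex hull {A, B, c} = corner_tile c"
  proof
    have ABc: "A \<in> corner_tile c" "B \<in> corner_tile c" "c \<in> corner_tile c"
      using edge_in_corner_tile[OF corner, of "1 - c $ j" j] edge_in_corner_tile[OF corner, of "1 - c $ i" i]
        edge_in_corner_tile[OF corner, of "c $ i" i] unit_corners_nth[OF corner, of j] unit_corners_nth[OF corner, of i]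
      by (auto simp: A_def B_def upd_same)
    then show "convex hull {A, B, c} \<subseteq> corner_tile c"
      by (intro hull_minimal convex_corner_tile[OF corner]) auto
    show "corner_tile c \<subseteq> convex hull {A, B, c}"
    proof
      fix x assume x: "x \<in> corner_tile c"
      then have xb: "x \<in> cbox 0 1" and s: "\<bar>x $ i - c $ i\<bar> + \<bar>x $ j - c $ j\<bar> \<le> 1"
        by (auto simp: corner_tile_def sum_ij)
      have "x = \<bar>x $ j - c $ j\<bar> *\<^sub>R A + \<bar>x $ i - c $ i\<bar> *\<^sub>R B + (1 - \<bar>x $ i - c $ i\<bar> - \<bar>x $ j - c $ j\<bar>) *\<^sub>R c"
        using unit_corners_nth[OF corner, of j] unit_corners_nth[OF corner, of i] xb
        by (auto simp: vec_eq_ij A_def B_def ij ij[symmetric] mem_unit_box)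
      then show "x \<in> convex hull {A, B, c}"
        unfolding convex_hull_3 using s by (intro CollectI exI conjI) (assumption | auto)+
    qed
  qed
  then show ?thesis using AB by (metis insert_commute insert_is_Un)
qed

lemma opposite_corner_tile:
  assumes "c \<in> unit_corners"
  shows "corner_tile (1 - c) = {x \<in> cbox 0 (1::real^'n). (\<Sum>l\<in>UNIV. \<bar>x $ l - c $ l\<bar>) \<ge> 1}"
proof -
  have "\<bar>x $ l - (1 - c) $ l\<bar> = 1 - \<bar>x $ l - c $ l\<bar>" if "x \<in> cbox 0 1" for x l
    using unit_corners_nth[OF assms, of l] that by (auto simp: mem_unit_box)
  then show ?thesis by (auto simp: corner_tile_def sum_ij)
qed

lemma opposite_tiles_overlap:
  assumes corner: "(c::real^'n) \<in> unit_corners"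
  shows "negligible (corner_tile c \<inter> corner_tile (1 - c))"
proof -
  have "corner_tile c \<inter> corner_tile (1 - c) \<subseteq> {x. (\<chi> l. 1 - 2 * c $ l) \<bullet> x = 1 - (\<Sum>l\<in>UNIV. c $ l)}"
    unfolding opposite_corner_tile[OF corner] unfolding corner_tile_def using corner_abs[OF corner]
    by (auto simp: inner_vec_def sum.distrib)
  moreover have "(\<chi> l. 1 - 2 * c $ l) \<noteq> (0 :: real^'n)"
    using unit_corners_nth[OF corner, of j] by (auto simp: vec_eq_iff intro!: exI[of _ j])
  ultimately show ?thesis using negligible_hyperplane negligible_subset by blast
qed

lemma opposite_tiles_cover:
  assumes "c \<in> unit_corners"
  shows "cbox 0 (1::real^'n) = corner_tile c \<union> corner_tile (1 - c)"
  unfolding opposite_corner_tile[OF assms] by (auto simp: corner_tile_def)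

lemma measure_corner_tile: "(c::real^'n) \<in> unit_corners \<Longrightarrow> measure lebesgue (corner_tile c) = 1 / 2"
proof -
  assume corner: "(c::real^'n) \<in> unit_corners"
  then have cu': "1 - c \<in> unit_corners" by (auto simp: unit_corners_def)
  have "corner_tile (1 - c) = (\<lambda>x. (- 1) *\<^sub>R x + 1) ` corner_tile c"
  proof (intro equalityI subsetI)
    have *: "1 - x \<in> corner_tile (1 - c)" if "x \<in> corner_tile c" for x c :: "real^'n"
      using that by (auto simp: corner_tile_def mem_unit_box abs_minus_commute)
    fix x :: "real^'n"
    show "x \<in> (\<lambda>x. (- 1) *\<^sub>R x + 1) ` corner_tile c" if "x \<in> corner_tile (1 - c)"
      using *[OF that] by (intro image_eqI[of _ _ "1 - x"]) auto
    show "x \<in> corner_tile (1 - c)" if "x \<in> (\<lambda>x. (- 1) *\<^sub>R x + 1) ` corner_tile c"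
      using that * by auto
  qed
  then have eq: "measure lebesgue (corner_tile (1 - c)) = measure lebesgue (corner_tile c)"
    using measure_lebesgue_affine[of "-1" 1 "corner_tile c"] by simp
  have "measure lebesgue (cbox 0 (1::real^'n)) = 1"
    using content_cbox_cart[of 0 "1::real^'n"] by (simp add: interval_ne_empty_cart)
  moreover have "measure lebesgue (corner_tile c \<union> corner_tile (1 - c)) =
      measure lebesgue (corner_tile c) + measure lebesgue (corner_tile (1 - c))"
    using measure_negligible_finite_Union_image[of "{True, False}" "\<lambda>b. corner_tile (if b then c else 1 - c)"]
      opposite_tiles_overlap[OF corner] compact_corner_tile[OF corner] compact_corner_tile[OF cu']
    by (auto simp: pairwise_def lmeasurable_compact Int_commute)
  ultimately show ?thesis using eq opposite_tiles_cover[OF corner] by simp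
qed

end

definition lattice_cell :: "nat \<Rightarrow> real^'n \<Rightarrow> (real^'n) set" where
  "lattice_cell N z = cbox (eps N *\<^sub>R z) (eps N *\<^sub>R (z + 1))"

lemma mem_lattice_cell:
  assumes "1 \<le> N"
  shows "x \<in> lattice_cell N z \<longleftrightarrow> real N *\<^sub>R x - z \<in> cbox 0 1"
  using assms by (simp add: lattice_cell_def mem_box_cart field_simps)

lemma lattice_tile_subset_cell: "1 \<le> N \<Longrightarrow> lattice_tile N z c \<subseteq> lattice_cell N z"
  by (auto simp: mem_lattice_cell lattice_tile_def corner_tile_def)

lemma lattice_cells_overlap:
  fixes z z' :: "real^'n"
  assumes N: "1 \<le> N" and z: "z \<in> Zd" "z' \<in> Zd" "z \<noteq> z'"
  shows "negligible (lattice_cell N z \<inter> lattice_cell N z')"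
proof -
  have *: "negligible (lattice_cell N z \<inter> lattice_cell N z')"
    if z: "z \<in> Zd" "z' \<in> Zd" "z $ l < z' $ l" for z z' :: "real^'n" and l
  proof -
    obtain m m' :: int where m: "z $ l = of_int m" "z' $ l = of_int m'"
      using z(1,2) by (auto simp: Zd_def Ints_def) (metis rangeE)
    then have "m + 1 \<le> m'" using z(3) by simp
    then have "real_of_int (m + 1) \<le> of_int m'" by (simp only: of_int_le_iff)
    then have "z $ l + 1 \<le> z' $ l" using m by simp
    then have "lattice_cell N z \<inter> lattice_cell N z' \<subseteq> {x. axis l 1 \<bullet> x = eps N * z' $ l}"
    proof (intro subsetI CollectI)
      fix x assume "x \<in> lattice_cell N z \<inter> lattice_cell N z'"
      then have "real N * x $ l - z $ l \<le> 1" "0 \<le> real N * x $ l - z' $ l"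
        using N by (simp_all add: mem_lattice_cell mem_unit_box)
      then have "real N * x $ l = z' $ l" using \<open>z $ l + 1 \<le> z' $ l\<close> by linarith
      then show "axis l 1 \<bullet> x = eps N * z' $ l" using N by (simp add: inner_axis' field_simps)
    qed
    moreover have "axis l 1 \<noteq> (0 :: real^'n)" by (simp add: axis_eq_0_iff)
    ultimately show ?thesis using negligible_hyperplane negligible_subset by blast
  qed
  from z obtain l where "z $ l \<noteq> z' $ l" by (auto simp: vec_eq_iff)
  then show ?thesis using *[of z z' l] *[of z' z l] z by (metis inf_commute linorder_neqE)
qed

lemma nearest_cell:
  fixes x :: "real^'n"
  assumes N: "1 \<le> N" and x: "x \<in> cbox (-1) 1"
  obtains z where "z \<in> cells N" "x \<in> lattice_cell N z"
proof
  let ?z = "\<chi> l. (of_int (min \<lfloor>real N * x $ l\<rfloor> (int N - 1)) :: real)"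
  have b: "- real N \<le> real N * x $ l" "real N * x $ l \<le> real N" for l
    using x N mult_left_mono[of "-1" "x $ l" "real N"] mult_left_mono[of "x $ l" 1 "real N"]
    by (auto simp: mem_box_cart)
  have "- int N \<le> \<lfloor>real N * x $ l\<rfloor>" for l using b[of l] by (simp add: le_floor_iff)
  then have "- int N \<le> min \<lfloor>real N * x $ l\<rfloor> (int N - 1)" for l using N by simp
  then have "of_int (- int N) \<le> (of_int (min \<lfloor>real N * x $ l\<rfloor> (int N - 1)) :: real)" for l
    by (simp only: of_int_le_iff)
  moreover have "(of_int (min \<lfloor>real N * x $ l\<rfloor> (int N - 1)) :: real) \<le> of_int (int N - 1)" for l
    by (simp only: of_int_le_iff)
  ultimately show "?z \<in> cells N" by (simp add: cells_def Zd_def)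
  have "0 \<le> real N * x $ l - ?z $ l \<and> real N * x $ l - ?z $ l \<le> 1" for l
    using b[of l] by (auto simp: min_def; linarith)
  then show "x \<in> lattice_cell N ?z" by (simp add: mem_lattice_cell[OF N] mem_unit_box)
qed

lemma floor_cell:
  assumes "1 \<le> N"
  shows "x \<in> lattice_cell N (\<chi> l. of_int \<lfloor>real N * x $ l\<rfloor>)"
  unfolding mem_lattice_cell[OF assms] mem_unit_box by (auto; linarith)

lemma closure_Omega: "closure Omega = cbox (-1) (1 :: real^'n)"
proof
  show "closure Omega \<subseteq> cbox (-1) (1 :: real^'n)"
  proof (rule closure_minimal)
    show "Omega \<subseteq> cbox (-1) (1 :: real^'n)"
      unfolding Omega_def mem_box_cart subset_eq by (simp add: less_imp_le)
  qed (rule closed_cbox)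
  have "box (-1) 1 \<subseteq> (Omega :: (real^'n) set)"
  proof
    fix x :: "real^'n" assume "x \<in> box (-1) 1"
    then have "-1 < x $ l \<and> x $ l < 1" for l by (simp add: mem_box_cart)
    then show "x \<in> Omega" unfolding Omega_def by (simp add: less_imp_le)
  qed
  moreover have "box (-1) (1::real^'n) \<noteq> {}" by (simp add: interval_ne_empty_cart)
  then have "closure (box (-1) 1) = cbox (-1) (1 :: real^'n)" by (rule closure_box)
  ultimately show "cbox (-1) (1 :: real^'n) \<subseteq> closure Omega" using closure_mono by metis
qed

lemma lattice_cell_subset_iff:
  assumes N: "1 \<le> N" and z: "z \<in> Zd"
  shows "z \<in> cells N \<longleftrightarrow> lattice_cell N z \<subseteq> cbox (-1) (1 :: real^'n)"
proof -
  have "lattice_cell N z \<subseteq> cbox (-1) 1 \<longleftrightarrow> (\<forall>l. -1 \<le> eps N * z $ l \<and> eps N * (z $ l + 1) \<le> 1)"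
    unfolding lattice_cell_def using N
    by (subst subset_interval_cart) (auto simp: field_simps)
  then show ?thesis using N z by (auto simp: cells_def field_simps)
qed

text \<open>The gradient of the interpolant on a tile consists of difference quotients along the two
  legs of the tile.\<close>

definition tile_grad :: "nat \<Rightarrow> (real^'n \<Rightarrow> real^'n) \<Rightarrow> real^'n \<Rightarrow> real^'n \<Rightarrow> real^'n^'n" where
  "tile_grad N v z c = (\<chi> l k. real N * (v (eps N *\<^sub>R (z + upd c k 1)) $ l - v (eps N *\<^sub>R (z + upd c k 0)) $ l))"

lemma upd_unit_corners: "c \<in> unit_corners \<Longrightarrow> b \<in> {0, 1} \<Longrightarrow> upd c k b \<in> unit_corners"
  by (auto simp: unit_corners_def)

lemma unit_corners_Zd: "unit_corners \<subseteq> (Zd :: (real^'n) set)"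
proof
  fix c :: "real^'n" assume "c \<in> unit_corners"
  then have "c $ l \<in> \<int>" for l using unit_corners_nth[of c l] by auto
  then show "c \<in> Zd" by (simp add: Zd_def)
qed

lemma Zd_add: "x \<in> Zd \<Longrightarrow> y \<in> Zd \<Longrightarrow> x + y \<in> Zd"
  and Zd_diff: "x \<in> Zd \<Longrightarrow> y \<in> Zd \<Longrightarrow> x - y \<in> Zd"
  by (auto simp: Zd_def)

lemma affine_on_lattice_tile:
  fixes A :: "real^'n^'n"
  assumes N: "1 \<le> N" and c: "c \<in> unit_corners"
    and w: "\<And>x. x \<in> lattice_tile N z c \<Longrightarrow> w x = A *v x + b"
  shows "A = tile_grad N w z c"
proof -
  have "tile_grad N w z c $ l $ k = A $ l $ k" for l k
  proof -
    have "w (eps N *\<^sub>R (z + upd c k 1)) - w (eps N *\<^sub>R (z + upd c k 0)) =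
        A *v (eps N *\<^sub>R (z + upd c k 1) - eps N *\<^sub>R (z + upd c k 0))"
      using w edge_in_lattice_tile[OF N c, of 1 z k] edge_in_lattice_tile[OF N c, of 0 z k]
      by (simp add: matrix_vector_mult_diff_distrib)
    also have "eps N *\<^sub>R (z + upd c k 1) - eps N *\<^sub>R (z + upd c k 0) = eps N *\<^sub>R axis k 1"
      by (simp add: vec_eq_iff axis_def algebra_simps)
    also have "A *v (eps N *\<^sub>R axis k 1) = eps N *\<^sub>R column k A"
      by (simp add: matrix_vector_mult_scaleR matrix_vector_mult_basis)
    finally have "(w (eps N *\<^sub>R (z + upd c k 1)) - w (eps N *\<^sub>R (z + upd c k 0))) $ l = eps N * A $ l $ k"
      by (simp add: column_def)
    then show ?thesis using N by (simp add: tile_grad_def)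
  qed
  then show ?thesis by (simp add: vec_eq_iff)
qed

context plane
begin

lemma cells_bij: "bij_betw (\<lambda>(m, k). pt j (real m - real N) (real k - real N)) ({..<2*N} \<times> {..<2*N})
    (cells N :: (real^'n) set)"
proof (rule bij_betwI')
  fix x y assume "x \<in> {..<2*N} \<times> {..<2*N}" "y \<in> {..<2*N} \<times> {..<2*N}"
  then show "((\<lambda>(m, k). pt j (real m - real N) (real k - real N)) x =
      (\<lambda>(m, k). pt j (real m - real N) (real k - real N)) y) = (x = y)"
    by (auto simp: pt_eq_iff split: prod.splits)
next
  fix x assume x: "x \<in> {..<2*N} \<times> {..<2*N}"
  have 1: "- real N \<le> real m - real N \<and> real m - real N \<le> real N - 1" if "m < 2 * N" for m
  proof -
    have "real (Suc m) \<le> real (2 * N)" using that by (simp only: of_nat_le_iff)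
    then show ?thesis by simp
  qed
  have "(\<forall>l. pt j s t $ l \<in> \<int> \<and> - real N \<le> pt j s t $ l \<and> pt j s t $ l \<le> real N - 1)"
    if "s \<in> \<int>" "t \<in> \<int>" "- real N \<le> s \<and> s \<le> real N - 1" "- real N \<le> t \<and> t \<le> real N - 1" for s t
    by (subst ex_ij) (use that in auto)
  then show "(\<lambda>(m, k). pt j (real m - real N) (real k - real N)) x \<in> cells N"
    using x 1 by (auto simp: cells_def Zd_def)
next
  fix z :: "real^'n" assume z: "z \<in> cells N"
  have "\<exists>m<2*N. z $ l = real m - real N" for l
  proof -
    obtain k :: int where k: "z $ l = of_int k" using z by (auto simp: cells_def Zd_def Ints_def)
    have "- real N \<le> z $ l" "z $ l \<le> real N - 1" using z by (auto simp: cells_def)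
    then have "- int N \<le> k" "k \<le> int N - 1" unfolding k by linarith+
    then show ?thesis using k by (intro exI[of _ "nat (k + int N)"]) auto
  qed
  then obtain m k where "m < 2*N" "k < 2*N" "z $ j = real m - real N" "z $ i = real k - real N" by metis
  moreover from this have "z = pt j (real m - real N) (real k - real N)" by (simp add: vec_eq_ij)
  ultimately show "\<exists>x\<in>{..<2*N} \<times> {..<2*N}. z = (\<lambda>(m, k). pt j (real m - real N) (real k - real N)) x"
    by (intro bexI[of _ "(m, k)"]) auto
qed

lemma finite_cells: "finite (cells N :: (real^'n) set)"
  using bij_betw_finite[OF cells_bij] by simp

lemma sum_cells:
  fixes h :: "real^'n \<Rightarrow> 'b::comm_monoid_add"
  shows "(\<Sum>z\<in>cells N. h z) = (\<Sum>m<2*N. \<Sum>k<2*N. h (pt j (real m - real N) (real k - real N)))"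
  using sum.reindex_bij_betw[OF cells_bij, of h N] by (simp add: sum.cartesian_product case_prod_unfold)

lemma finite_near_Zd: "finite {z \<in> Zd. \<forall>l. \<bar>z $ l - (y::real^'n) $ l\<bar> \<le> r}"
proof -
  obtain M :: nat where M: "\<bar>y $ i\<bar> + r + 1 \<le> real M" "\<bar>y $ j\<bar> + r + 1 \<le> real M"
    by (metis max.bounded_iff real_arch_simple)
  then have M': "\<bar>y $ l\<bar> + r + 1 \<le> real M" for l using ex_ij[of "\<lambda>l. \<bar>y $ l\<bar> + r + 1 \<le> real M"] by blast
  have "{z \<in> Zd. \<forall>l. \<bar>z $ l - y $ l\<bar> \<le> r} \<subseteq> cells M"
  proof
    fix z assume z: "z \<in> {z \<in> Zd. \<forall>l. \<bar>z $ l - y $ l\<bar> \<le> r}"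
    have "- real M \<le> z $ l \<and> z $ l \<le> real M - 1" for l
    proof -
      have "\<bar>z $ l - y $ l\<bar> \<le> r" using z by simp
      then show ?thesis using M'[of l] by linarith
    qed
    then show "z \<in> cells M" using z by (simp add: cells_def)
  qed
  then show ?thesis using finite_cells finite_subset by blast
qed

lemma DIM_plane: "DIM(real^'n) = 2" 
proof -
  have "CARD('n) = 2" using ij unfolding all_ij by simp
  then show ?thesis by simp
qed

lemma measure_lattice_tile:
  fixes z c :: "real^'n"
  assumes "1 \<le> N" "c \<in> unit_corners"
  shows "measure lebesgue (lattice_tile N z c) = (1 / real N)\<^sup>2 / 2"
  unfolding lattice_tile_eq_image[OF assms(1)]
  using measure_lebesgue_affine[of "eps N" "eps N *\<^sub>R z" "corner_tile c"] measure_corner_tile[OF assms(2)]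
  by (simp add: DIM_plane power_divide del: DIM_cart)

lemma tiling_lattice_tiles:
  assumes N: "1 \<le> N" and a: "(a::real^'n) \<in> unit_corners" and Z: "finite Z" "Z \<subseteq> Zd"
  shows "tiling (Z \<times> tile_corners a) (\<lambda>(z, c). lattice_tile N z c)"
proof -
  obtain c0 where c0: "c0 \<in> unit_corners" "tile_corners a = {c0, 1 - c0}"
    using tile_corners_obtain[OF a] by metis
  have sub: "c \<in> unit_corners" if "c \<in> tile_corners a" for c using that tile_corners_subset by blast
  have "negligible (lattice_tile N z c \<inter> lattice_tile N z' c')"
    if "z \<in> Z" "z' \<in> Z" "c \<in> tile_corners a" "c' \<in> tile_corners a" "(z, c) \<noteq> (z', c')" for z z' c c'
  proof (cases "z = z'")
    case True
    then have "{c, c'} = {c0, 1 - c0}" using that c0 by auto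
    then have "negligible (corner_tile c \<inter> corner_tile c')"
      using opposite_tiles_overlap[OF c0(1)] by (auto simp: doubleton_eq_iff Int_commute)
    then have "negligible ((\<lambda>x. eps N *\<^sub>R x + eps N *\<^sub>R z) ` (corner_tile c \<inter> corner_tile c'))"
      by (intro negligible_differentiable_image_negligible) auto
    moreover have "inj (\<lambda>x. eps N *\<^sub>R x + eps N *\<^sub>R z)" using N by (auto simp: inj_on_def)
    ultimately show ?thesis
      unfolding True lattice_tile_eq_image[OF N] by (simp add: image_Int)
  next
    case False
    then have "negligible (lattice_cell N z \<inter> lattice_cell N z')"
      using that Z by (intro lattice_cells_overlap N) auto
    then show ?thesis by (rule negligible_subset) (use lattice_tile_subset_cell[OF N] in blast)
  qed
  moreover have "finite (Z \<times> tile_corners a)"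
    using c0 Z by (intro finite_cartesian_product) simp_all
  ultimately show ?thesis
    unfolding tiling_def by (auto intro: compact_lattice_tile[OF N] convex_lattice_tile[OF N] sub)
qed

lemma tiling_cells:
  assumes N: "1 \<le> N" and a: "(a::real^'n) \<in> unit_corners"
  shows "tiling (cells N \<times> tile_corners a) (\<lambda>(z, c). lattice_tile N z c)"
  by (rule tiling_lattice_tiles[OF N a finite_cells]) (auto simp: cells_def)

lemma lattice_cell_eq_tiles:
  assumes "1 \<le> N" and a: "(a::real^'n) \<in> unit_corners"
  shows "lattice_cell N z = (\<Union>c\<in>tile_corners a. lattice_tile N z c)"
proof -
  obtain c0 where c0: "c0 \<in> unit_corners" "tile_corners a = {c0, 1 - c0}"
    using tile_corners_obtain[OF a] by metis
  show ?thesis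
    using opposite_tiles_cover[OF c0(1)] c0(2) by (auto simp: mem_lattice_cell[OF assms(1)] lattice_tile_def)
qed

lemma lattice_tiles_cover:
  assumes N: "1 \<le> N" and a: "(a::real^'n) \<in> unit_corners"
  shows "cbox (-1) 1 = (\<Union>(z, c)\<in>cells N \<times> tile_corners a. lattice_tile N z c)"
proof
  show "cbox (-1) 1 \<subseteq> (\<Union>(z, c)\<in>cells N \<times> tile_corners a. lattice_tile N z c)"
  proof
    fix x :: "real^'n" assume "x \<in> cbox (-1) 1"
    then obtain z where z: "z \<in> cells N" "x \<in> lattice_cell N z" by (rule nearest_cell[OF N])
    then obtain c where "c \<in> tile_corners a" "x \<in> lattice_tile N z c"
      unfolding lattice_cell_eq_tiles[OF N a] by blast
    with z show "x \<in> (\<Union>(z, c)\<in>cells N \<times> tile_corners a. lattice_tile N z c)"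
      by (intro UN_I[of "(z, c)"]) auto
  qed
  show "(\<Union>(z, c)\<in>cells N \<times> tile_corners a. lattice_tile N z c) \<subseteq> cbox (-1) 1"
  proof (clarify)
    fix x z c :: "real^'n" assume z: "z \<in> cells N" and x: "x \<in> lattice_tile N z c"
    have "x \<in> lattice_cell N z" using x lattice_tile_subset_cell[OF N] by blast
    moreover have "lattice_cell N z \<subseteq> cbox (-1) 1"
      using z lattice_cell_subset_iff[OF N, of z] by (auto simp: cells_def)
    ultimately show "x \<in> cbox (-1) 1" by blast
  qed
qed

lemma cell_subdivision_eq:
  assumes "cell_subdivision (K :: (real^'n) set set)"
  obtains a where "a \<in> unit_corners" "K = corner_tile ` tile_corners a"
proof -
  have "CARD('n) = 2" using ij unfolding all_ij by simp
  then obtain a where a: "a \<in> unit_corners" "K = {convex hull {a, 1 - a, c} |c. c \<in> unit_corners - {a, 1 - a}}"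
    using assms by (auto simp: cell_subdivision_def)
  have "K = corner_tile ` tile_corners a"
    unfolding a(2) using convex_hull_corner_tile[OF a(1)] by (auto simp: tile_corners_def image_iff)
  then show thesis using that a(1) by blast
qed

lemma per_fine_mesh_eq:
  assumes "1 \<le> N"
  shows "per_fine_mesh N (corner_tile ` C) = {lattice_tile N z c |z c. z \<in> Zd \<and> c \<in> (C :: (real^'n) set)}"
proof -
  have "(\<lambda>x. eps N *\<^sub>R z + eps N *\<^sub>R x) ` corner_tile c = lattice_tile N z c" for z c :: "real^'n"
    unfolding lattice_tile_eq_image[OF assms] by (simp add: add.commute)
  then show ?thesis unfolding per_fine_mesh_def per_lattice_def by blast
qed

lemma fine_mesh_eq:
  assumes N: "1 \<le> N" and a: "(a::real^'n) \<in> unit_corners"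
  shows "fine_mesh N (corner_tile ` tile_corners a) = (\<lambda>(z, c). lattice_tile N z c) ` (cells N \<times> tile_corners a)"
proof -
  have "lattice_tile N z c \<subseteq> cbox (-1) 1 \<longleftrightarrow> z \<in> cells N" if "z \<in> Zd" "c \<in> tile_corners a" for z c
  proof
    assume s: "lattice_tile N z c \<subseteq> cbox (-1) 1"
    have c: "c \<in> unit_corners" using that tile_corners_subset by blast
    have "- real N \<le> z $ l \<and> z $ l \<le> real N - 1" for l
    proof -
      have "eps N *\<^sub>R (z + upd c l b) \<in> cbox (-1) 1" if "b = 0 \<or> b = 1" for b
        using s edge_in_lattice_tile[OF N c, of b z l] that by auto
      from this[of 0] this[of 1] have "-1 \<le> eps N * z $ l" "eps N * (z $ l + 1) \<le> 1"
        by (auto simp: mem_box_cart dest!: spec[of _ l])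
      then show ?thesis using N by (simp add: field_simps)
    qed
    then show "z \<in> cells N" using that by (simp add: cells_def)
  next
    assume "z \<in> cells N"
    then show "lattice_tile N z c \<subseteq> cbox (-1) 1"
      using lattice_cell_subset_iff[OF N that(1)] lattice_tile_subset_cell[OF N] by blast
  qed
  then show ?thesis
    unfolding fine_mesh_def per_fine_mesh_eq[OF N] closure_Omega by (auto simp: cells_def image_iff)
qed

end

section \<open>The interpolant on the fine mesh\<close>

context plane
begin

text \<open>The nodal basis function of the origin: its support is the hexagon of the six tiles around
  the origin. The sign selects the direction of the diagonal, according to the right angles \<open>c\<close> and
  \<open>1 - c\<close> of the tiles.\<close>

definition hat :: "real^'n \<Rightarrow> real^'n \<Rightarrow> real" where
  "hat c u = max 0 (1 - max (max \<bar>u $ i\<bar> \<bar>u $ j\<bar>) \<bar>if c $ i = c $ j then u $ i + u $ j else u $ i - u $ j\<bar>)"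

lemma hat_eq_0: "1 \<le> \<bar>u $ l\<bar> \<Longrightarrow> hat c u = 0"
proof -
  assume u: "1 \<le> \<bar>u $ l\<bar>"
  have "l = i \<or> l = j" using all_ij by blast
  then have "1 \<le> max (max \<bar>u $ i\<bar> \<bar>u $ j\<bar>) q" for q using u by (elim disjE) (simp_all add: le_max_iff_disj)
  then show ?thesis unfolding hat_def by (intro max_absorb1) simp
qed

lemma hat_0 [simp]: "hat c 0 = 1"
  by (simp add: hat_def)

lemma continuous_on_hat [continuous_intros]: "continuous_on S f \<Longrightarrow> continuous_on S (\<lambda>x. hat c (f x))"
  unfolding hat_def by (cases "c $ i = c $ j") (auto intro!: continuous_intros)

lemma hat_opposite: "c \<in> unit_corners \<Longrightarrow> hat (1 - c) = hat c"
  by (rule ext) (simp add: hat_def)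

text \<open>On a corner tile the hat function of a corner is the barycentric coordinate of this corner, and
  that of the fourth corner of the square vanishes.\<close>

lemma hat_real:
  fixes X Y s t s' t' :: real
  assumes "0 \<le> X" "X \<le> 1" "0 \<le> Y" "Y \<le> 1" and le: "\<bar>Y - t\<bar> + \<bar>X - s\<bar> \<le> 1"
    and "s = 0 \<or> s = 1" "t = 0 \<or> t = 1" "s' = 0 \<or> s' = 1" "t' = 0 \<or> t' = 1"
  shows "max 0 (1 - max (max \<bar>Y - t'\<bar> \<bar>X - s'\<bar>) \<bar>if t = s then (Y - t') + (X - s') else (Y - t') - (X - s')\<bar>) =
     (if s' = s \<and> t' = t then 1 - \<bar>Y - t\<bar> - \<bar>X - s\<bar>
      else if s' = s then \<bar>Y - t\<bar> else if t' = t then \<bar>X - s\<bar> else 0)"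
proof -
  have a: "\<bar>Y - 0\<bar> = Y" "\<bar>Y - 1\<bar> = 1 - Y" "\<bar>X - 0\<bar> = X" "\<bar>X - 1\<bar> = 1 - X" using assms(1-4) by auto
  show ?thesis
    using assms(6-9) le assms(1-4)
    by (elim disjE; simp only: a if_True if_False zero_neq_one one_neq_zero simp_thms; linarith)
qed

lemma hat_affine_corner:
  fixes c w :: "real^'n"
  assumes c: "c \<in> unit_corners" and w: "w \<in> unit_corners"
  shows "\<exists>b d. \<forall>x\<in>corner_tile c. hat c (x - w) = b \<bullet> x + d"
proof -
  obtain s t where st: "c = pt j s t" "s = 0 \<or> s = 1" "t = 0 \<or> t = 1"
    using c unfolding unit_corners_pt by auto
  obtain s' t' where st': "w = pt j s' t'" "s' = 0 \<or> s' = 1" "t' = 0 \<or> t' = 1"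
    using w unfolding unit_corners_pt by auto
  have x: "0 \<le> x $ j \<and> x $ j \<le> 1 \<and> 0 \<le> x $ i \<and> x $ i \<le> 1 \<and> \<bar>x $ i - t\<bar> + \<bar>x $ j - s\<bar> \<le> 1"
    if "x \<in> corner_tile c" for x
    using that unfolding corner_tile_def mem_unit_box by (simp add: sum_ij st)
  have abs: "\<bar>x $ j - s\<bar> = s + (1 - 2 * s) * x $ j" "\<bar>x $ i - t\<bar> = t + (1 - 2 * t) * x $ i"
    if "x \<in> corner_tile c" for x
    using x[OF that] st by auto
  have in_pt: "b \<bullet> x = b $ i * x $ i + b $ j * x $ j" for b x :: "real^'n"
    by (simp add: inner_vec_def sum_ij)
  have key: "hat c (x - w) = (if s' = s \<and> t' = t then 1 - \<bar>x $ i - t\<bar> - \<bar>x $ j - s\<bar>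
      else if s' = s then \<bar>x $ i - t\<bar> else if t' = t then \<bar>x $ j - s\<bar> else 0)"
    if xT: "x \<in> corner_tile c" for x
  proof -
    have "hat c (x - w) = max 0 (1 - max (max \<bar>x $ i - t'\<bar> \<bar>x $ j - s'\<bar>)
        \<bar>if t = s then (x $ i - t') + (x $ j - s') else (x $ i - t') - (x $ j - s')\<bar>)"
      by (simp only: hat_def st(1) st'(1) pt_nth vector_minus_component)
    also note hat_real
    finally show ?thesis using x[OF xT] st(2,3) st'(2,3) by blast
  qed
  show ?thesis
  proof (cases "s' = s"; cases "t' = t")
    assume "s' = s" "t' = t"
    then have "\<forall>x\<in>corner_tile c. hat c (x - w) = pt j (2 * s - 1) (2 * t - 1) \<bullet> x + (1 - s - t)"
      by (simp add: key abs in_pt algebra_simps)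
    then show ?thesis by blast
  next
    assume "s' = s" "t' \<noteq> t"
    then have "\<forall>x\<in>corner_tile c. hat c (x - w) = pt j 0 (1 - 2 * t) \<bullet> x + t"
      by (simp add: key abs in_pt algebra_simps)
    then show ?thesis by blast
  next
    assume "s' \<noteq> s" "t' = t"
    then have "\<forall>x\<in>corner_tile c. hat c (x - w) = pt j (1 - 2 * s) 0 \<bullet> x + s"
      by (simp add: key abs in_pt algebra_simps)
    then show ?thesis by blast
  next
    assume "s' \<noteq> s" "t' \<noteq> t"
    then have "\<forall>x\<in>corner_tile c. hat c (x - w) = 0 \<bullet> x + 0" by (simp add: key)
    then show ?thesis by blast
  qed
qed

lemma hat_affine:
  fixes c z :: "real^'n"
  assumes c: "c \<in> unit_corners" and z: "z \<in> Zd"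
  shows "\<exists>b d. \<forall>x\<in>corner_tile c. hat c (x - z) = b \<bullet> x + d"
proof (cases "z \<in> unit_corners")
  case False
  then obtain l where l: "z $ l \<noteq> 0" "z $ l \<noteq> 1" by (auto simp: unit_corners_def)
  obtain m :: int where m: "z $ l = of_int m" using z by (auto simp: Zd_def Ints_def)
  have "m \<noteq> 0" "m \<noteq> 1" using l m by auto
  then have "m \<le> -1 \<or> m \<ge> 2" by linarith
  then have "z $ l \<le> -1 \<or> z $ l \<ge> 2" unfolding m by linarith
  then have "hat c (x - z) = 0" if "x \<in> corner_tile c" for x
  proof (intro hat_eq_0[of _ l])
    have "0 \<le> x $ l \<and> x $ l \<le> 1" using that by (simp add: corner_tile_def mem_unit_box)
    then show "1 \<le> \<bar>(x - z) $ l\<bar>" using \<open>z $ l \<le> -1 \<or> z $ l \<ge> 2\<close> by auto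
  qed
  then show ?thesis by (intro exI[of _ 0]) simp
qed (rule hat_affine_corner[OF c])

text \<open>At every point only finitely many hat functions are nonzero.\<close>

definition hat_interpolant :: "nat \<Rightarrow> real^'n \<Rightarrow> (real^'n \<Rightarrow> real^'n) \<Rightarrow> real^'n \<Rightarrow> real^'n" where
  "hat_interpolant N c v x = (\<Sum>z\<in>{z \<in> Zd. hat c (real N *\<^sub>R x - z) \<noteq> 0}. hat c (real N *\<^sub>R x - z) *\<^sub>R v (eps N *\<^sub>R z))"

lemma hat_interpolant_near:
  assumes "\<And>l. \<bar>real N * x $ l - y $ l\<bar> \<le> r"
  shows "hat_interpolant N c v x =
    (\<Sum>z\<in>{z \<in> Zd. \<forall>l. \<bar>z $ l - y $ l\<bar> \<le> r + 1}. hat c (real N *\<^sub>R x - z) *\<^sub>R v (eps N *\<^sub>R z))"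
  unfolding hat_interpolant_def
proof (rule sum.mono_neutral_left)
  show "{z \<in> Zd. hat c (real N *\<^sub>R x - z) \<noteq> 0} \<subseteq> {z \<in> Zd. \<forall>l. \<bar>z $ l - y $ l\<bar> \<le> r + 1}"
  proof clarify
    fix z l assume "hat c (real N *\<^sub>R x - z) \<noteq> 0"
    then have "\<bar>(real N *\<^sub>R x - z) $ l\<bar> < 1" using hat_eq_0[of "real N *\<^sub>R x - z" l] by force
    then show "\<bar>z $ l - y $ l\<bar> \<le> r + 1" using assms[of l] by simp
  qed
qed (auto intro: finite_near_Zd)

lemma hat_interpolant_node:
  assumes "1 \<le> N" "z \<in> Zd"
  shows "hat_interpolant N c v (eps N *\<^sub>R z) = v (eps N *\<^sub>R z)"
proof -
  have "hat_interpolant N c v (eps N *\<^sub>R z) =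
    (\<Sum>z'\<in>{z' \<in> Zd. \<forall>l. \<bar>z' $ l - z $ l\<bar> \<le> 0 + 1}. hat c (real N *\<^sub>R eps N *\<^sub>R z - z') *\<^sub>R v (eps N *\<^sub>R z'))"
    by (rule hat_interpolant_near) (use assms in simp)
  also have "\<dots> = (\<Sum>z'\<in>{z' \<in> Zd. \<forall>l. \<bar>z' $ l - z $ l\<bar> \<le> 0 + 1}. if z' = z then v (eps N *\<^sub>R z) else 0)"
  proof (intro sum.cong refl)
    fix z' assume z': "z' \<in> {z' \<in> Zd. \<forall>l. \<bar>z' $ l - z $ l\<bar> \<le> 0 + 1}"
    show "hat c (real N *\<^sub>R eps N *\<^sub>R z - z') *\<^sub>R v (eps N *\<^sub>R z') = (if z' = z then v (eps N *\<^sub>R z) else 0)"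
    proof (cases "z' = z")
      case False
      then obtain l where l: "z' $ l \<noteq> z $ l" by (auto simp: vec_eq_iff)
      have "z $ l - z' $ l \<in> \<int>" using z' assms(2) by (auto simp: Zd_def)
      then have "1 \<le> \<bar>z $ l - z' $ l\<bar>" using l by (intro Ints_nonzero_abs_ge1) auto
      then show ?thesis using hat_eq_0[of "z - z'" l] assms(1) False by simp
    qed (use assms(1) in simp)
  qed
  also have "\<dots> = v (eps N *\<^sub>R z)"
    using assms(2) finite_near_Zd[of z "0 + 1"] by (subst sum.delta) auto
  finally show ?thesis .
qed

lemma continuous_hat_interpolant:
  assumes "1 \<le> N"
  shows "continuous_on UNIV (hat_interpolant N c v)"
  unfolding continuous_on_eq_continuous_at[OF open_UNIV]
proof
  fix x0 :: "real^'n"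
  let ?G = "{z \<in> Zd. \<forall>l. \<bar>z $ l - (real N *\<^sub>R x0) $ l\<bar> \<le> 1 + 1}"
  let ?f = "\<lambda>x. \<Sum>z\<in>?G. hat c (real N *\<^sub>R x - z) *\<^sub>R v (eps N *\<^sub>R z)"
  have "continuous_on UNIV ?f" by (intro continuous_intros)
  then have "continuous_on (ball x0 (1 / N)) ?f" by (rule continuous_on_subset) simp
  moreover have "hat_interpolant N c v x = ?f x" if "x \<in> ball x0 (1 / N)" for x
  proof (rule hat_interpolant_near)
    fix l
    have "\<bar>(x - x0) $ l\<bar> \<le> norm (x - x0)" by (rule component_le_norm_cart)
    also have "\<dots> \<le> 1 / N" using that by (simp add: dist_norm norm_minus_commute)
    finally have "real N * \<bar>x $ l - x0 $ l\<bar> \<le> real N * (1 / N)" by (intro mult_left_mono) auto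
    then have "\<bar>real N * (x $ l - x0 $ l)\<bar> \<le> 1" using assms by (simp add: abs_mult)
    then show "\<bar>real N * x $ l - (real N *\<^sub>R x0) $ l\<bar> \<le> 1" by (simp add: right_diff_distrib)
  qed
  ultimately have "continuous_on (ball x0 (1 / N)) (hat_interpolant N c v)"
    by (subst continuous_on_cong[OF refl]) auto
  then show "continuous (at x0) (hat_interpolant N c v)"
    using assms by (simp add: continuous_on_eq_continuous_at)
qed

lemma hat_interpolant_affine:
  assumes N: "1 \<le> N" and z0: "z0 \<in> Zd" and c: "c \<in> unit_corners"
  shows "\<exists>(A :: real^'n^'n) b. \<forall>x\<in>lattice_tile N z0 c. hat_interpolant N c v x = A *v x + b"
proof -
  let ?G = "{z \<in> Zd. \<forall>l. \<bar>z $ l - z0 $ l\<bar> \<le> 1 + 1}"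
  have "\<exists>b d. \<forall>x\<in>corner_tile c. hat c (x - (z - z0)) = b \<bullet> x + d" if "z \<in> ?G" for z
    by (rule hat_affine[OF c Zd_diff[OF _ z0]]) (use that in blast)
  then have "\<forall>z\<in>?G. \<exists>p. \<forall>x\<in>corner_tile c. hat c (x - (z - z0)) = fst p \<bullet> x + snd p"
    by (simp only: split_paired_Ex fst_conv snd_conv) blast
  then obtain p where p: "\<forall>z\<in>?G. \<forall>x\<in>corner_tile c. hat c (x - (z - z0)) = fst (p z) \<bullet> x + snd (p z)"
    by (rule bchoice[THEN exE])
  define b where "b z = fst (p z)" for z
  define d where "d z = snd (p z)" for z
  have bd: "hat c (x - (z - z0)) = b z \<bullet> x + d z" if "z \<in> ?G" "x \<in> corner_tile c" for z x
    unfolding b_def d_def using p that by blast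
  define L where "L h = (\<Sum>z\<in>?G. (b z \<bullet> (real N *\<^sub>R h)) *\<^sub>R v (eps N *\<^sub>R z))" for h
  have "linear L"
    unfolding L_def
    by (intro linearI) (simp_all add: inner_add_right scaleR_add_left sum.distrib scaleR_sum_right
        distrib_left mult_ac)
  define e where "e = (\<Sum>z\<in>?G. (d z - b z \<bullet> z0) *\<^sub>R v (eps N *\<^sub>R z))"
  have "hat_interpolant N c v x = matrix L *v x + e" if x: "x \<in> lattice_tile N z0 c" for x
  proof -
    have xT: "real N *\<^sub>R x - z0 \<in> corner_tile c" using x by (simp add: lattice_tile_def)
    then have "\<bar>(real N *\<^sub>R x - z0) $ l\<bar> \<le> 1" for l by (auto simp: corner_tile_def mem_unit_box)
    then have "hat_interpolant N c v x = (\<Sum>z\<in>?G. hat c (real N *\<^sub>R x - z) *\<^sub>R v (eps N *\<^sub>R z))"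
      by (intro hat_interpolant_near) simp
    also have "\<dots> = (\<Sum>z\<in>?G. (b z \<bullet> (real N *\<^sub>R x - z0) + d z) *\<^sub>R v (eps N *\<^sub>R z))"
    proof (rule sum.cong)
      fix z assume "z \<in> ?G"
      from bd[OF this xT] show "hat c (real N *\<^sub>R x - z) *\<^sub>R v (eps N *\<^sub>R z) =
          (b z \<bullet> (real N *\<^sub>R x - z0) + d z) *\<^sub>R v (eps N *\<^sub>R z)" by simp
    qed simp
    also have "\<dots> = L x + e"
      unfolding L_def e_def sum.distrib[symmetric]
      by (intro sum.cong) (simp_all add: inner_diff_right scaleR_add_left scaleR_diff_left)
    finally show ?thesis using matrix_works[OF \<open>linear L\<close>[unfolded linear_def scalar_mult_eq_scaleR[abs_def, symmetric]]] by simp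
  qed
  then show ?thesis by blast
qed

lemma P1_hat_interpolant:
  assumes N: "1 \<le> N" and a: "a \<in> unit_corners" and c: "c \<in> tile_corners a"
  shows "P1 (per_fine_mesh N (corner_tile ` tile_corners a)) (hat_interpolant N c v)"
proof -
  obtain c0 where c0: "c0 \<in> unit_corners" "tile_corners a = {c0, 1 - c0}"
    using tile_corners_obtain[OF a] by metis
  have hats: "hat_interpolant N c' v = hat_interpolant N c v" if "c' \<in> tile_corners a" for c'
  proof -
    have "hat c' = hat c" using that c c0 hat_opposite[OF c0(1)] by auto
    then show ?thesis by (simp add: fun_eq_iff hat_interpolant_def)
  qed
  have "\<exists>(A :: real^'n^'n) b. \<forall>x\<in>lattice_tile N z c'. hat_interpolant N c v x = A *v x + b"
    if "z \<in> Zd" "c' \<in> tile_corners a" for z c'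
    using hat_interpolant_affine[OF N that(1), of c' v] that(2) tile_corners_subset hats[OF that(2)] by auto
  then show ?thesis
    unfolding P1_def per_fine_mesh_eq[OF N] using continuous_hat_interpolant[OF N] by blast
qed

lemma P1_fine_unique:
  assumes N: "1 \<le> N" and a: "(a :: real^'n) \<in> unit_corners"
    and P1: "P1 (per_fine_mesh N (corner_tile ` tile_corners a)) w"
      "P1 (per_fine_mesh N (corner_tile ` tile_corners a)) w'"
    and eq: "\<And>x. x \<in> per_lattice N \<Longrightarrow> w x = w' x"
  shows "w = w'"
proof
  fix x :: "real^'n"
  let ?z = "\<chi> l. (of_int \<lfloor>real N * x $ l\<rfloor> :: real)"
  have zZ: "?z \<in> Zd" by (simp add: Zd_def)
  have "x \<in> lattice_cell N ?z" by (rule floor_cell[OF N])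
  then obtain c where c: "c \<in> tile_corners a" "x \<in> lattice_tile N ?z c"
    unfolding lattice_cell_eq_tiles[OF N a] by blast
  then have corner: "c \<in> unit_corners" using tile_corners_subset by blast
  have T: "lattice_tile N ?z c \<in> per_fine_mesh N (corner_tile ` tile_corners a)"
    unfolding per_fine_mesh_eq[OF N] using c(1) zZ by blast
  obtain A b where A: "\<And>x. x \<in> lattice_tile N ?z c \<Longrightarrow> w x = A *v x + b"
    using P1(1) T unfolding P1_def by metis
  obtain A' b' where A': "\<And>x. x \<in> lattice_tile N ?z c \<Longrightarrow> w' x = A' *v x + b'"
    using P1(2) T unfolding P1_def by metis
  have lat: "eps N *\<^sub>R (?z + upd c k b) \<in> per_lattice N" if "b \<in> {0, 1}" for k b
    unfolding per_lattice_def
    using Zd_add[OF zZ] upd_unit_corners[OF corner that] unit_corners_Zd by blast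
  have "tile_grad N w ?z c = tile_grad N w' ?z c"
    unfolding tile_grad_def by (simp add: eq lat)
  then have "A = A'" using affine_on_lattice_tile[OF N corner A] affine_on_lattice_tile[OF N corner A'] by metis
  moreover have "w (eps N *\<^sub>R (?z + upd c j 0)) = w' (eps N *\<^sub>R (?z + upd c j 0))" by (rule eq[OF lat]) simp
  then have "b = b'"
    using A[OF edge_in_lattice_tile[OF N corner, of 0]] A'[OF edge_in_lattice_tile[OF N corner, of 0]] \<open>A = A'\<close> by simp
  ultimately show "w x = w' x" using A[OF c(2)] A'[OF c(2)] by simp
qed

lemma interpolant_fine:
  assumes N: "1 \<le> N" and a: "(a :: real^'n) \<in> unit_corners"
  defines "T \<equiv> per_fine_mesh N (corner_tile ` tile_corners a)"
  shows "P1 T (interpolant N T v) \<and> (\<forall>x\<in>per_lattice N. interpolant N T v x = v x)"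
proof -
  obtain c where c: "c \<in> tile_corners a" using tile_corners_obtain[OF a] by blast
  have ex: "P1 T (hat_interpolant N c v) \<and> (\<forall>x\<in>per_lattice N. hat_interpolant N c v x = v x)"
    using P1_hat_interpolant[OF N a c] hat_interpolant_node[OF N] by (auto simp: per_lattice_def T_def)
  show ?thesis
    unfolding interpolant_def
  proof (rule theI[where P = "\<lambda>w. P1 T w \<and> (\<forall>x\<in>per_lattice N. w x = v x)" and a = "hat_interpolant N c v"])
    show "P1 T (hat_interpolant N c v) \<and> (\<forall>x\<in>per_lattice N. hat_interpolant N c v x = v x)" by (rule ex)
    fix w assume "P1 T w \<and> (\<forall>x\<in>per_lattice N. w x = v x)"
    then show "w = hat_interpolant N c v"
      using ex unfolding T_def by (intro P1_fine_unique[OF N a]) auto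
  qed
qed

lemma interpolant_fine_eqI:
  assumes N: "1 \<le> N" and a: "(a :: real^'n) \<in> unit_corners"
  defines "T \<equiv> per_fine_mesh N (corner_tile ` tile_corners a)"
  assumes "P1 T w" "\<And>x. x \<in> per_lattice N \<Longrightarrow> w x = v x"
  shows "interpolant N T v = w"
  using interpolant_fine[OF N a, of v] assms(4,5)
  unfolding T_def by (intro P1_fine_unique[OF N a]) auto

end

section \<open>Triangulations with lattice vertices\<close>

lemma simplex_hull_lattice:
  assumes "n simplex T" "\<And>x. x extreme_point_of T \<Longrightarrow> x \<in> L"
  obtains C where "finite C" "C \<subseteq> L" "T = convex hull C"
proof -
  obtain C where C: "finite C" "\<not> affine_dependent C" "T = convex hull C"
    using assms(1) by (auto simp: simplex)
  then have "C \<subseteq> L" using assms(2) extreme_point_of_convex_hull_affine_independent[OF C(2)] by auto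
  with C that show thesis by blast
qed

lemma convex_hull_coordinate_bounds:
  fixes x :: "real^'n"
  assumes "x \<in> convex hull C"
  obtains p q where "p \<in> C" "p $ i \<le> x $ i" "q \<in> C" "x $ i \<le> q $ i"
proof -
  have "\<exists>p\<in>C. p $ i \<le> x $ i"
  proof (rule ccontr)
    assume "\<not> ?thesis"
    then have "C \<subseteq> {y. axis i 1 \<bullet> y > x $ i}" by (auto simp: inner_axis')
    then have "convex hull C \<subseteq> {y. axis i 1 \<bullet> y > x $ i}"
      by (rule hull_minimal) (simp add: convex_halfspace_gt)
    then show False using assms by (auto simp: inner_axis')
  qed
  moreover have "\<exists>q\<in>C. x $ i \<le> q $ i"
  proof (rule ccontr)
    assume "\<not> ?thesis"
    then have "C \<subseteq> {y. axis i 1 \<bullet> y < x $ i}" by (auto simp: inner_axis')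
    then have "convex hull C \<subseteq> {y. axis i 1 \<bullet> y < x $ i}"
      by (rule hull_minimal) (simp add: convex_halfspace_lt)
    then show False using assms by (auto simp: inner_axis')
  qed
  ultimately show thesis using that by blast
qed

lemma triangulation_overlap:
  fixes T T' :: "(real^'n) set"
  assumes tri: "regular_triangulation \<T> S" and T: "T \<in> \<T>" "T' \<in> \<T>" "T \<noteq> T'"
  shows "negligible (T \<inter> T')"
proof -
  have s: "int CARD('n) simplex T" "int CARD('n) simplex T'"
    and f: "(T \<inter> T') face_of T" "(T \<inter> T') face_of T'"
    using tri T by (auto simp: regular_triangulation_def)
  have cv: "convex T" "convex T'" using s by (auto dest: convex_simplex)
  have "aff_dim (T \<inter> T') < int CARD('n)"
  proof (cases "T \<inter> T' = T")
    case False
    from face_of_aff_dim_lt[OF cv(1) f(1) this] show ?thesis using aff_dim_simplex[OF s(1)] by simp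
  next
    case True
    then have "T \<inter> T' \<noteq> T'" using T(3) by auto
    from face_of_aff_dim_lt[OF cv(2) f(2) this] show ?thesis using aff_dim_simplex[OF s(2)] by simp
  qed
  then have "interior (T \<inter> T') = {}"
    using aff_dim_open[OF open_interior, of "T \<inter> T'"] aff_dim_subset[OF interior_subset, of "T \<inter> T'"] by force
  then show ?thesis using negligible_convex_interior[OF convex_Int[OF cv]] by simp
qed

lemma per_lattice_translate: "1 \<le> N \<Longrightarrow> (x::real^'n) \<in> per_lattice N \<Longrightarrow> \<xi> \<in> twoZd \<Longrightarrow> \<xi> + x \<in> per_lattice N"
proof -
  assume "1 \<le> N" "x \<in> per_lattice N" "\<xi> \<in> twoZd"
  then obtain z z' :: "real^'n" where z: "x = eps N *\<^sub>R z" "z \<in> Zd" "\<xi> = 2 *\<^sub>R z'" "z' \<in> Zd"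
    by (auto simp: per_lattice_def twoZd_def)
  then have "\<xi> + x = eps N *\<^sub>R (z + (2 * real N) *\<^sub>R z')" using \<open>1 \<le> N\<close> by (simp add: algebra_simps)
  moreover have "z + (2 * real N) *\<^sub>R z' \<in> Zd" using z by (auto simp: Zd_def)
  ultimately show ?thesis by (auto simp: per_lattice_def)
qed

text \<open>Every element is the convex hull of lattice points, at which both functions agree.\<close>

lemma P1_coarse_unique:
  fixes \<T> :: "(real^'n) set set"
  assumes N: "1 \<le> N" and tri: "regular_triangulation \<T> S" and per: "regular_triangulation (periodize_mesh \<T>) UNIV"
    and vert: "\<And>T x. T \<in> \<T> \<Longrightarrow> x extreme_point_of T \<Longrightarrow> x \<in> per_lattice N"
    and P1: "P1 (periodize_mesh \<T>) w" "P1 (periodize_mesh \<T>) w'"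
    and eq: "\<And>x. x \<in> per_lattice N \<Longrightarrow> w x = w' x"
  shows "w = w'"
proof
  fix x :: "real^'n"
  have "x \<in> \<Union>(periodize_mesh \<T>)" using per by (simp add: regular_triangulation_def)
  then obtain T' where T': "T' \<in> periodize_mesh \<T>" "x \<in> T'" by blast
  then obtain T \<xi> where T: "T \<in> \<T>" "\<xi> \<in> twoZd" "T' = (\<lambda>x. \<xi> + x) ` T" by (auto simp: periodize_mesh_def)
  obtain C where C: "finite C" "C \<subseteq> per_lattice N" "T = convex hull C"
    by (rule simplex_hull_lattice[where T = T and L = "per_lattice N"])
      (use tri T vert in \<open>auto simp: regular_triangulation_def\<close>)
  have hull: "T' = convex hull ((\<lambda>x. \<xi> + x) ` C)"
    unfolding T(3) C(3) by (rule convex_hull_translation[symmetric])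
  obtain A b where A: "\<And>x. x \<in> T' \<Longrightarrow> w x = A *v x + b" using P1(1) T'(1) unfolding P1_def by metis
  obtain A' b' where A': "\<And>x. x \<in> T' \<Longrightarrow> w' x = A' *v x + b'" using P1(2) T'(1) unfolding P1_def by metis
  have "T' \<subseteq> {x. A *v x + b = A' *v x + b'}"
    unfolding hull
  proof (rule hull_minimal)
    show "(\<lambda>x. \<xi> + x) ` C \<subseteq> {x. A *v x + b = A' *v x + b'}"
    proof clarify
      fix c assume "c \<in> C"
      then have "\<xi> + c \<in> T'" "\<xi> + c \<in> per_lattice N"
        using hull C(2) T(2) per_lattice_translate[OF N] by (auto intro: hull_inc)
      then show "A *v (\<xi> + c) + b = A' *v (\<xi> + c) + b'" using A A' eq by metis
    qed
    show "convex {x. A *v x + b = A' *v x + b'}"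
      unfolding convex_def
    proof (intro ballI allI impI, clarify)
      fix x y and u v :: real assume e: "A *v x + b = A' *v x + b'" "A *v y + b = A' *v y + b'" "u + v = 1"
      have comb: "B *v (u *\<^sub>R x + v *\<^sub>R y) + d = u *\<^sub>R (B *v x + d) + v *\<^sub>R (B *v y + d)"
        for B :: "real^'n^'n" and d
        using e(3) by (simp add: matrix_vector_right_distrib matrix_vector_mult_scaleR scaleR_add_right
            flip: scaleR_add_left)
      show "A *v (u *\<^sub>R x + v *\<^sub>R y) + b = A' *v (u *\<^sub>R x + v *\<^sub>R y) + b'"
        unfolding comb e(1,2) ..
    qed
  qed
  then show "w x = w' x" using A A' T'(2) by auto
qed

section \<open>Piecewise constant functions\<close>

lemma jacobian_affine_interior:
  fixes w :: "real^'n \<Rightarrow> real^'m" and A :: "real^'n^'m"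
  assumes "\<And>x. x \<in> T \<Longrightarrow> w x = A *v x + b" "x \<in> interior T"
  shows "jacobian w (at x) = A"
proof -
  have "((\<lambda>x. A *v x + b) has_derivative (\<lambda>h. A *v h)) (at x)"
    by (intro has_derivative_add_const bounded_linear_imp_has_derivative matrix_vector_mul_bounded_linear)
  then have "(w has_derivative (\<lambda>h. A *v h)) (at x)"
    by (rule has_derivative_transform_within_open[OF _ open_interior assms(2)])
      (use assms(1) interior_subset in force)
  from frechet_derivative_at[OF this] show ?thesis
    unfolding jacobian_def by (metis matrix_of_matrix_vector_mul)
qed

definition skeleton :: "'p set \<Rightarrow> ('p \<Rightarrow> 'a::euclidean_space set) \<Rightarrow> 'a set" where
  "skeleton P T = (\<Union>p\<in>P. frontier (T p)) \<union> (\<Union>p\<in>P. \<Union>q\<in>P - {p}. T p \<inter> T q)"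

lemma negligible_skeleton:
  assumes "tiling P T" shows "negligible (skeleton P T)"
  unfolding skeleton_def
proof (intro negligible_Un)
  note t = tilingD[OF assms]
  show "negligible (\<Union>p\<in>P. frontier (T p))"
    using t by (intro negligible_Union) (auto intro: negligible_convex_frontier)
  have "negligible (\<Union>q\<in>P - {p}. T p \<inter> T q)" if "p \<in> P" for p
  proof (rule negligible_Union)
    show "finite ((\<lambda>q. T p \<inter> T q) ` (P - {p}))" using t by simp
    show "negligible S" if "S \<in> (\<lambda>q. T p \<inter> T q) ` (P - {p})" for S
      using that t(4)[OF \<open>p \<in> P\<close>] by blast
  qed
  then show "negligible (\<Union>p\<in>P. \<Union>q\<in>P - {p}. T p \<inter> T q)"
    by (intro negligible_Union finite_imageI t) blast
qed

lemma off_skeleton: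
  assumes "tiling P T" "x \<in> (\<Union>p\<in>P. T p)" "x \<notin> skeleton P T"
  obtains p where "p \<in> P" "x \<in> interior (T p)" "\<And>q. q \<in> P \<Longrightarrow> x \<in> T q \<Longrightarrow> q = p"
proof -
  obtain p where p: "p \<in> P" "x \<in> T p" using assms by auto
  have "x \<in> interior (T p)"
    using p assms(3) closure_subset[of "T p"] by (auto simp: skeleton_def frontier_def)
  moreover have "q = p" if "q \<in> P" "x \<in> T q" for q
    using p that assms(3) by (auto simp: skeleton_def)
  ultimately show thesis using p that by blast
qed

lemma measurable_tiling:
  fixes g :: "'a::euclidean_space \<Rightarrow> 'b::topological_space"
  assumes tl: "tiling P T" and S: "S \<in> sets lebesgue" "S \<subseteq> (\<Union>p\<in>P. T p)"
    and g: "\<And>p x. p \<in> P \<Longrightarrow> x \<in> interior (T p) \<Longrightarrow> g x = val p"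
  shows "g \<in> borel_measurable (lebesgue_on S)"
proof (rule measurableI)
  fix B :: "'b set" assume "B \<in> sets borel"
  let ?N = "skeleton P T"
  have N: "negligible ?N" by (rule negligible_skeleton[OF tl])
  have eq: "g -` B \<inter> S = (g -` B \<inter> S \<inter> ?N) \<union> (\<Union>p\<in>{p \<in> P. val p \<in> B}. T p \<inter> S - ?N)"
  proof (intro equalityI subsetI)
    fix x assume x: "x \<in> g -` B \<inter> S"
    show "x \<in> (g -` B \<inter> S \<inter> ?N) \<union> (\<Union>p\<in>{p \<in> P. val p \<in> B}. T p \<inter> S - ?N)"
    proof (cases "x \<in> ?N")
      case False
      then obtain p where "p \<in> P" "x \<in> interior (T p)" using off_skeleton[OF tl] x S(2) by blast
      then show ?thesis using g x False interior_subset by force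
    qed (use x in auto)
  next
    fix x assume x: "x \<in> (g -` B \<inter> S \<inter> ?N) \<union> (\<Union>p\<in>{p \<in> P. val p \<in> B}. T p \<inter> S - ?N)"
    show "x \<in> g -` B \<inter> S"
    proof (cases "x \<in> ?N")
      case False
      then obtain p where p: "p \<in> P" "val p \<in> B" "x \<in> T p" "x \<in> S" using x by auto
      then obtain q where q: "q \<in> P" "x \<in> interior (T q)" "p = q"
        using off_skeleton[OF tl _ False] by (metis UN_I)
      then show ?thesis using g p by auto
    qed (use x in auto)
  qed
  have 1: "g -` B \<inter> S \<inter> ?N \<in> sets lebesgue"
    using N by (intro negligible_imp_sets negligible_subset[OF N]) auto
  have Tm: "T p \<in> sets lebesgue" if "p \<in> P" for p
    using tilingD(2)[OF tl that] by (intro fmeasurableD lmeasurable_compact)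
  have Nm: "?N \<in> sets lebesgue" using N by (rule negligible_imp_sets)
  have 2: "(\<Union>p\<in>{p \<in> P. val p \<in> B}. T p \<inter> S - ?N) \<in> sets lebesgue"
    using tilingD(1)[OF tl] S(1) Tm Nm by (intro sets.finite_UN sets.Diff sets.Int) simp_all
  have "g -` B \<inter> S \<in> sets lebesgue" by (subst eq) (rule sets.Un[OF 1 2])
  then show "g -` B \<inter> space (lebesgue_on S) \<in> sets (lebesgue_on S)"
    using S(1) by (auto simp: sets_restrict_space_iff)
qed simp

lemma integral_tiling:
  fixes g :: "'a::euclidean_space \<Rightarrow> real"
  assumes tl: "tiling P T" and S: "S \<in> sets lebesgue" "S \<subseteq> (\<Union>p\<in>P. T p)"
    and g: "\<And>p x. p \<in> P \<Longrightarrow> x \<in> interior (T p) \<Longrightarrow> g x = val p"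
  shows "(LINT x : S | lebesgue. g x) = (\<Sum>p\<in>P. measure lebesgue (T p \<inter> S) * val p)"
proof -
  let ?N = "skeleton P T"
  have N: "?N \<in> null_sets lebesgue" using negligible_skeleton[OF tl] by (simp add: negligible_iff_null_sets)
  have Tm: "T p \<inter> S \<in> lmeasurable" if "p \<in> P" for p
    using tilingD(2)[OF tl that] S(1) by (intro fmeasurable_Int_fmeasurable lmeasurable_compact)
  have gm: "g \<in> borel_measurable (lebesgue_on S)"
    by (rule measurable_tiling[OF tl S, where val = val]) (use g in auto)
  then have "(\<lambda>x. indicator S x *\<^sub>R g x) \<in> borel_measurable lebesgue"
    using S(1) by (simp add: borel_measurable_restrict_space_iff)
  moreover have "(\<lambda>x. \<Sum>p\<in>P. val p * indicator (T p \<inter> S) x) \<in> borel_measurable lebesgue"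
    using Tm by (intro borel_measurable_sum borel_measurable_times borel_measurable_indicator) auto
  moreover have "AE x in lebesgue. indicator S x *\<^sub>R g x = (\<Sum>p\<in>P. val p * indicator (T p \<inter> S) x)"
  proof (rule AE_I'[OF N], intro subsetI, rule ccontr)
    fix x assume x: "x \<in> {x \<in> space lebesgue. indicator S x *\<^sub>R g x \<noteq> (\<Sum>p\<in>P. val p * indicator (T p \<inter> S) x)}" "x \<notin> ?N"
    have "indicator S x *\<^sub>R g x = (\<Sum>p\<in>P. val p * indicator (T p \<inter> S) x)"
    proof (cases "x \<in> S")
      case True
      then obtain p where p: "p \<in> P" "x \<in> interior (T p)" "\<And>q. q \<in> P \<Longrightarrow> x \<in> T q \<Longrightarrow> q = p"
        using off_skeleton[OF tl] x(2) S(2) by blast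
      have "(\<Sum>q\<in>P. val q * indicator (T q \<inter> S) x) = (\<Sum>q\<in>P. if q = p then val p else 0)"
      proof (intro sum.cong refl)
        fix q assume "q \<in> P"
        then have "x \<in> T q \<longleftrightarrow> q = p" using p(3) subsetD[OF interior_subset p(2)] by metis
        then show "val q * indicator (T q \<inter> S) x = (if q = p then val p else 0)"
          using True by (simp add: indicator_def)
      qed
      then show ?thesis using p g True tilingD(1)[OF tl] by simp
    qed simp
    with x show False by simp
  qed
  ultimately have "(LINT x : S | lebesgue. g x) = (LINT x|lebesgue. (\<Sum>p\<in>P. val p * indicator (T p \<inter> S) x))"
    unfolding set_lebesgue_integral_def by (rule integral_cong_AE)
  also have "\<dots> = (\<Sum>p\<in>P. LINT x|lebesgue. val p * indicator (T p \<inter> S) x)"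
    using Tm by (intro Bochner_Integration.integral_sum integrable_mult_right)
      (simp add: lmeasurable_iff_integrable)
  also have "\<dots> = (\<Sum>p\<in>P. measure lebesgue (T p \<inter> S) * val p)"
    using Tm by (intro sum.cong) (auto simp: fmeasurable_def)
  finally show ?thesis .
qed

context plane
begin

text \<open>Finiteness: an element is the hull of a subset of the finitely many lattice points in the cube.\<close>

lemma triangulation_tiling:
  assumes N: "1 \<le> N" and tri: "regular_triangulation \<T> (closure Omega :: (real^'n) set)"
    and vert: "\<And>T x. T \<in> \<T> \<Longrightarrow> x extreme_point_of T \<Longrightarrow> x \<in> per_lattice N"
  shows "tiling \<T> (\<lambda>T. T)"
proof -
  define L where "L = per_lattice N \<inter> cbox (-1) (1 :: real^'n)"
  have "L \<subseteq> (\<lambda>z. eps N *\<^sub>R z) ` {z \<in> Zd. \<forall>l. \<bar>z $ l - 0 $ l\<bar> \<le> real N}"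
  proof
    fix x assume "x \<in> L"
    then have x: "x \<in> per_lattice N" and z3: "\<And>l. -1 \<le> x $ l \<and> x $ l \<le> 1"
      by (simp_all add: L_def mem_box_cart)
    from x obtain z where z: "x = eps N *\<^sub>R z" "z \<in> Zd" unfolding per_lattice_def by blast
    have "\<bar>z $ l\<bar> \<le> real N" for l
    proof -
      have "- 1 \<le> eps N * z $ l" "eps N * z $ l \<le> 1" using z(1) z3[of l] by simp_all
      then show ?thesis using N by (simp add: field_simps abs_le_iff)
    qed
    then show "x \<in> (\<lambda>z. eps N *\<^sub>R z) ` {z \<in> Zd. \<forall>l. \<bar>z $ l - 0 $ l\<bar> \<le> real N}" using z by auto
  qed
  then have finL: "finite L" using finite_near_Zd finite_surj by blast
  have "\<exists>C\<subseteq>L. T = convex hull C" if T: "T \<in> \<T>" for T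
  proof -
    have s: "int CARD('n) simplex T" and sub: "T \<subseteq> cbox (-1) 1"
      using tri T by (auto simp: regular_triangulation_def closure_Omega)
    have "x \<in> L" if "x extreme_point_of T" for x
      using vert[OF T that] sub that by (auto simp: L_def extreme_point_of_def)
    then show ?thesis using simplex_hull_lattice[OF s, of L] by metis
  qed
  then have "\<T> \<subseteq> (\<lambda>C. convex hull C) ` Pow L" by blast
  then have "finite \<T>" using finL by (meson finite_Pow_iff finite_surj)
  moreover have "compact T \<and> convex T" if "T \<in> \<T>" for T
    using tri that by (auto simp: regular_triangulation_def dest!: bspec simplex_imp_polytope
      intro: polytope_imp_compact polytope_imp_convex)
  ultimately show ?thesis
    unfolding tiling_def using triangulation_overlap[OF tri] by blast
qed

text \<open>Since no vertex lies strictly between two consecutive lattice rows, a polygon that reaches into a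
  strip has vertices on both sides of it.\<close>

lemma lattice_polygon_rows:
  assumes N: "1 \<le> N" and T: "T = convex hull (C :: (real^'n) set)" "C \<subseteq> per_lattice N"
    and t: "t \<in> {real k / N - 1<..<real (Suc k) / N - 1}" "t' \<in> {real k / N - 1<..<real (Suc k) / N - 1}"
    and ne: "slice j T t \<noteq> {}"
  shows "slice j T t' \<noteq> {}"
proof -
  obtain s where s: "pt j s t \<in> T" using ne by (auto simp: slice_def)
  have row: "v $ i \<le> real k / N - 1 \<or> real (Suc k) / N - 1 \<le> v $ i" if v: "v \<in> C" for v
  proof -
    obtain m :: int where m: "v $ i = eps N * of_int m"
    proof -
      have "v \<in> per_lattice N" using v T(2) by blast
      then obtain z where z: "v = eps N *\<^sub>R z" "z \<in> Zd" unfolding per_lattice_def by blast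
      then have "z $ i \<in> \<int>" by (simp add: Zd_def)
      then obtain m where "z $ i = of_int m" by (rule Ints_cases)
      then show thesis using z(1) by (intro that[of m]) simp
    qed
    have "m \<le> int k - int N \<or> int (Suc k) - int N \<le> m" by linarith
    then have "real_of_int m \<le> real k - real N \<or> real (Suc k) - real N \<le> real_of_int m" by linarith
    moreover have "real l / N - 1 = eps N * (real l - real N)" for l using N by (simp add: field_simps)
    ultimately show ?thesis unfolding m by (metis mult_left_mono zero_le_divide_1_iff of_nat_0_le_iff)
  qed
  have "pt j s t \<in> convex hull C" using s T(1) by simp
  then obtain v u where "v \<in> C" "v $ i \<le> pt j s t $ i" "u \<in> C" "pt j s t $ i \<le> u $ i"
    by (rule convex_hull_coordinate_bounds[where i = i])
  then have v: "v \<in> C" "v $ i \<le> t" and u: "u \<in> C" "t \<le> u $ i" by simp_all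
  have v1: "v $ i \<le> t'" using row[OF v(1)] v t by auto
  have u1: "t' \<le> u $ i" using row[OF u(1)] u t by auto
  have lt: "v $ i < u $ i" using row[OF v(1)] row[OF u(1)] v u t by auto
  define \<mu> where "\<mu> = (t' - v $ i) / (u $ i - v $ i)"
  have \<mu>: "0 \<le> \<mu>" "\<mu> \<le> 1" "\<mu> * (u $ i - v $ i) = t' - v $ i"
    using v1 u1 lt by (auto simp: \<mu>_def)
  have "(1 - \<mu>) *\<^sub>R v + \<mu> *\<^sub>R u \<in> T"
    unfolding T(1) using v u \<mu> by (intro convexD_alt[OF convex_convex_hull]) (auto intro: hull_inc)
  moreover have "((1 - \<mu>) *\<^sub>R v + \<mu> *\<^sub>R u) $ i = t'" using \<mu>(3) by (simp add: algebra_simps)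
  ultimately have "pt j (((1 - \<mu>) *\<^sub>R v + \<mu> *\<^sub>R u) $ j) t' \<in> T" by (metis pt_eta)
  then show ?thesis by (auto simp: slice_def)
qed

end

section \<open>Norms of piecewise constant gradients\<close>

text \<open>The condition \<open>\<Sum>\<^sub>p \<mu>\<^sub>p growth q (b\<^sub>p) \<le> unit_level q\<close> says that the weighted \<open>q\<close>-norm of \<open>b\<close> is
  at most one. In this form the exponent \<open>q = \<infinity>\<close> is accessible to Jensen's inequality as well.\<close>

definition growth :: "ennreal \<Rightarrow> real \<Rightarrow> real" where
  "growth q x = (if q = \<infinity> then max 0 (\<bar>x\<bar> - 1) else \<bar>x\<bar> powr enn2real q)"

definition unit_level :: "ennreal \<Rightarrow> real" where
  "unit_level q = (if q = \<infinity> then 0 else 1)"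

lemma powr_convex_nonneg:
  fixes a b r :: real
  assumes "1 \<le> r" "0 \<le> a" "0 \<le> b" "0 \<le> u" "0 \<le> v" "u + v = 1"
  shows "(u * a + v * b) powr r \<le> u * a powr r + v * b powr r"
proof -
  have pw: "u powr r \<le> u" if "0 \<le> u" "u \<le> 1" for u :: real
    using powr_mono'[of 1 r u] that assms(1) by (cases "u = 0") auto
  consider "a = 0" | "b = 0" | "a > 0" "b > 0" using assms by linarith
  then show ?thesis
  proof cases
    case 1
    then show ?thesis using pw[of v] assms by (simp add: powr_mult mult_right_mono)
  next
    case 2
    then show ?thesis using pw[of u] assms by (simp add: powr_mult mult_right_mono)
  next
    case 3
    then show ?thesis
      using powr_convex[OF assms(1)] assms unfolding convex_on_def by auto
  qed
qed

lemma even_convex_growth: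
  assumes "1 \<le> q" shows "even_convex (growth q)"
proof (cases "q = \<infinity>")
  case True
  show ?thesis
  proof
    show "convex_on UNIV (growth q)"
      unfolding convex_on_def
    proof (intro conjI ballI allI impI)
      fix x y u v :: real assume uv: "0 \<le> u" "0 \<le> v" "u + v = 1"
      have "\<bar>u * x + v * y\<bar> - 1 \<le> u * (\<bar>x\<bar> - 1) + v * (\<bar>y\<bar> - 1)"
        using abs_triangle_ineq[of "u * x" "v * y"] uv by (simp add: abs_mult algebra_simps)
      also have "\<dots> \<le> u * max 0 (\<bar>x\<bar> - 1) + v * max 0 (\<bar>y\<bar> - 1)"
        using uv by (intro add_mono mult_left_mono) auto
      finally have "\<bar>u * x + v * y\<bar> - 1 \<le> u * max 0 (\<bar>x\<bar> - 1) + v * max 0 (\<bar>y\<bar> - 1)" .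
      moreover have "0 \<le> u * max 0 (\<bar>x\<bar> - 1) + v * max 0 (\<bar>y\<bar> - 1)" using uv by simp
      ultimately show "growth q (u *\<^sub>R x + v *\<^sub>R y) \<le> u * growth q x + v * growth q y"
        by (simp add: growth_def True)
    qed simp
  qed (auto simp: growth_def True)
next
  case False
  define r where "r = enn2real q"
  have r: "1 \<le> r"
    using assms False by (cases q) (auto simp: r_def ennreal_1[symmetric] simp del: ennreal_1)
  show ?thesis
  proof
    show "convex_on UNIV (growth q)"
      unfolding convex_on_def
    proof (intro conjI ballI allI impI)
      fix x y u v :: real assume uv: "0 \<le> u" "0 \<le> v" "u + v = 1"
      have "\<bar>u * x + v * y\<bar> powr r \<le> (u * \<bar>x\<bar> + v * \<bar>y\<bar>) powr r"
        using r uv abs_triangle_ineq[of "u * x" "v * y"] by (intro powr_mono2) (auto simp: abs_mult)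
      also have "\<dots> \<le> u * \<bar>x\<bar> powr r + v * \<bar>y\<bar> powr r"
        by (rule powr_convex_nonneg) (use r uv in auto)
      finally show "growth q (u *\<^sub>R x + v *\<^sub>R y) \<le> u * growth q x + v * growth q y"
        using False by (simp add: growth_def r_def)
    qed simp
  qed (use False in \<open>auto simp: growth_def\<close>)
qed

lemma conj_exponent_cases:
  assumes "1 \<le> p"
  obtains "p = 1" "conj_exponent p = \<infinity>" | "p = \<infinity>" "conj_exponent p = 1"
  | r s where "p = ennreal r" "conj_exponent p = ennreal s" "1 < r" "1 < s" "1 / r + 1 / s = 1"
proof (cases p)
  case top
  then show thesis using that(2) by (simp add: conj_exponent_def)
next
  case (real r)
  then have r1: "1 \<le> r" using assms by (simp add: ennreal_1[symmetric] del: ennreal_1)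
  show thesis
  proof (cases "r = 1")
    case True
    then show thesis using that(1) real by (simp add: conj_exponent_def)
  next
    case False
    then have r: "1 < r" using r1 by simp
    have "inverse p = ennreal (inverse r)" using real r by (simp add: inverse_ennreal)
    then have "1 - inverse p = ennreal (1 - inverse r)"
      using r by (simp add: ennreal_minus ennreal_1[symmetric] del: ennreal_1)
    moreover have "0 < 1 - inverse r" using r by (simp add: field_simps)
    ultimately have "conj_exponent p = ennreal (inverse (1 - inverse r))"
      by (simp add: conj_exponent_def inverse_ennreal)
    moreover have "1 < inverse (1 - inverse r)" "1 / r + 1 / inverse (1 - inverse r) = 1"
      using r by (simp_all add: field_simps)
    ultimately show thesis using that(3) real r by blast
  qed
qed

lemma conj_exponent_ge_1: "1 \<le> p \<Longrightarrow> 1 \<le> conj_exponent p"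
  by (rule conj_exponent_cases[of p]) (auto simp: ennreal_1[symmetric] simp del: ennreal_1)

definition weighted_norm :: "ennreal \<Rightarrow> 'i set \<Rightarrow> ('i \<Rightarrow> real) \<Rightarrow> ('i \<Rightarrow> real) \<Rightarrow> real" where
  "weighted_norm p I \<mu> a = (if p = \<infinity> then Max (insert 0 (a ` I))
     else (\<Sum>i\<in>I. \<mu> i * a i powr enn2real p) powr (1 / enn2real p))"

text \<open>Hoelder's inequality against a function of norm at most one.\<close>

lemma weighted_hoelder:
  assumes p: "1 \<le> p" and I: "finite I" and \<mu>: "\<And>i. i \<in> I \<Longrightarrow> 0 \<le> \<mu> i"
    and a: "\<And>i. i \<in> I \<Longrightarrow> 0 \<le> a i" and b: "\<And>i. i \<in> I \<Longrightarrow> 0 \<le> b i"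
    and unit: "(\<Sum>i\<in>I. \<mu> i * growth (conj_exponent p) (b i)) \<le> unit_level (conj_exponent p)"
  shows "(\<Sum>i\<in>I. \<mu> i * (a i * b i)) \<le> weighted_norm p I \<mu> a"
  using p
proof (cases rule: conj_exponent_cases)
  case 1
  have g: "0 \<le> \<mu> i * growth (conj_exponent p) (b i)" if "i \<in> I" for i
    using \<mu>[OF that] by (simp add: growth_def)
  have z: "\<mu> i * growth (conj_exponent p) (b i) = 0" if "i \<in> I" for i
    using sum_nonneg_0[OF I g] unit 1 that sum_nonneg[OF g, of I] by (force simp: unit_level_def)
  have "\<mu> i * (a i * b i) \<le> \<mu> i * a i" if i: "i \<in> I" for i
  proof (cases "\<mu> i = 0")
    case False
    then have "b i \<le> 1" using z[OF i] b[OF i] 1 by (auto simp: growth_def max_def split: if_splits)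
    then have "a i * b i \<le> a i" using mult_left_mono[OF _ a[OF i], of "b i" 1] by simp
    then show ?thesis using \<mu>[OF i] by (rule mult_left_mono)
  qed simp
  then have "(\<Sum>i\<in>I. \<mu> i * (a i * b i)) \<le> (\<Sum>i\<in>I. \<mu> i * a i)" by (rule sum_mono)
  also have "\<dots> = (\<Sum>i\<in>I. \<mu> i * a i powr 1)" using a by (intro sum.cong) auto
  also have "\<dots> = weighted_norm p I \<mu> a"
    using 1 \<mu> by (simp add: weighted_norm_def sum_nonneg)
  finally show ?thesis .
next
  case 2
  let ?m = "Max (insert 0 (a ` I))"
  have m: "a i \<le> ?m" if "i \<in> I" for i using that I by (intro Max_ge) auto
  have m0: "0 \<le> ?m" using I by (intro Max_ge) auto
  have "(\<Sum>i\<in>I. \<mu> i * (a i * b i)) \<le> (\<Sum>i\<in>I. ?m * (\<mu> i * growth (conj_exponent p) (b i)))"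
  proof (rule sum_mono)
    fix i assume i: "i \<in> I"
    have "\<mu> i * b i * a i \<le> \<mu> i * b i * ?m" by (intro mult_left_mono m i mult_nonneg_nonneg \<mu> b)
    then show "\<mu> i * (a i * b i) \<le> ?m * (\<mu> i * growth (conj_exponent p) (b i))"
      using b[OF i] 2 by (simp add: growth_def mult_ac)
  qed
  also have "\<dots> = ?m * (\<Sum>i\<in>I. \<mu> i * growth (conj_exponent p) (b i))" by (simp add: sum_distrib_left)
  also have "\<dots> \<le> ?m * 1" by (rule mult_left_mono[OF _ m0]) (use unit 2 in \<open>simp add: unit_level_def\<close>)
  finally show ?thesis using 2 by (simp add: weighted_norm_def)
next
  case (3 r s)
  define A where "A = (\<Sum>i\<in>I. \<mu> i * a i powr r)"
  have A0: "0 \<le> A" unfolding A_def using \<mu> by (intro sum_nonneg) auto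
  have W: "weighted_norm p I \<mu> a = A powr (1 / r)" using 3 by (simp add: weighted_norm_def A_def)
  have B: "(\<Sum>i\<in>I. \<mu> i * b i powr s) \<le> 1"
    using unit 3 b by (simp add: growth_def unit_level_def)
  show ?thesis
  proof (cases "A = 0")
    case True
    have "\<mu> i * a i powr r = 0" if "i \<in> I" for i
      using sum_nonneg_0[OF I, of "\<lambda>i. \<mu> i * a i powr r"] \<mu> True that unfolding A_def by auto
    then have "\<mu> i * (a i * b i) = 0" if "i \<in> I" for i using that by fastforce
    then have "(\<Sum>i\<in>I. \<mu> i * (a i * b i)) = 0" by (intro sum.neutral) blast
    then show ?thesis unfolding W by simp
  next
    case False
    define \<sigma> where "\<sigma> = A powr (1 / r)"
    have \<sigma>: "\<sigma> > 0" "\<sigma> powr r = A" using False A0 3 by (simp_all add: \<sigma>_def powr_powr)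
    have "(\<Sum>i\<in>I. \<mu> i * (a i * b i)) = \<sigma> * (\<Sum>i\<in>I. \<mu> i * (a i / \<sigma> * b i))"
      using \<sigma> by (simp add: sum_distrib_left mult_ac)
    also have "(\<Sum>i\<in>I. \<mu> i * (a i / \<sigma> * b i)) \<le> (\<Sum>i\<in>I. \<mu> i * ((a i / \<sigma>) powr r / r + b i powr s / s))"
      by (intro sum_mono mult_left_mono Youngs_inequality \<mu>) (use 3 a b \<sigma> in auto)
    also have "\<dots> = (\<Sum>i\<in>I. \<mu> i * a i powr r) / (A * r) + (\<Sum>i\<in>I. \<mu> i * b i powr s) / s"
      using a \<sigma> by (simp add: powr_divide distrib_left sum.distrib sum_divide_distrib)
    also have "\<dots> \<le> 1 / r + 1 / s"
      using B False 3 by (intro add_mono) (simp_all add: A_def[symmetric] divide_right_mono)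
    finally show ?thesis unfolding W using \<sigma> 3 by (simp add: \<sigma>_def)
  qed
qed


lemma weighted_norm_reindex:
  assumes p: "1 \<le> p" and J: "finite J" and f: "inj_on f I" "f ` I \<subseteq> J"
    and \<mu>: "\<And>i. i \<in> I \<Longrightarrow> \<mu> i = \<nu> (f i)" and \<alpha>: "\<And>i. i \<in> I \<Longrightarrow> \<alpha> i = \<beta> (f i)" and \<nu>: "\<And>j. 0 \<le> \<nu> j"
  shows "weighted_norm p I \<mu> \<alpha> \<le> weighted_norm p J \<nu> \<beta>"
proof (cases "p = \<infinity>")
  case True
  have "\<alpha> ` I \<subseteq> \<beta> ` J" using f(2) \<alpha> by force
  then have "Max (insert 0 (\<alpha> ` I)) \<le> Max (insert 0 (\<beta> ` J))" using J by (intro Max_mono) auto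
  then show ?thesis using True by (simp add: weighted_norm_def)
next
  case False
  have "(\<Sum>i\<in>I. \<mu> i * \<alpha> i powr enn2real p) = (\<Sum>i\<in>I. \<nu> (f i) * \<beta> (f i) powr enn2real p)"
    using \<mu> \<alpha> by (intro sum.cong) auto
  also have "\<dots> = (\<Sum>j\<in>f ` I. \<nu> j * \<beta> j powr enn2real p)"
    by (simp add: sum.reindex[OF f(1)])
  also have "\<dots> \<le> (\<Sum>j\<in>J. \<nu> j * \<beta> j powr enn2real p)"
    using J f(2) \<nu> by (intro sum_mono2) auto
  finally have "(\<Sum>i\<in>I. \<mu> i * \<alpha> i powr enn2real p) \<le> (\<Sum>j\<in>J. \<nu> j * \<beta> j powr enn2real p)" .
  moreover have "0 \<le> (\<Sum>i\<in>I. \<mu> i * \<alpha> i powr enn2real p)" using \<mu> \<nu> by (intro sum_nonneg) simp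
  ultimately show ?thesis using False by (simp add: weighted_norm_def powr_mono2)
qed

text \<open>The gradient on the frontiers of the tiles, a null set, is left open.\<close>

definition has_gradients ::
    "'p set \<Rightarrow> ('p \<Rightarrow> (real^'n) set) \<Rightarrow> ('p \<Rightarrow> real^'n^'n) \<Rightarrow> (real^'n \<Rightarrow> real^'n) \<Rightarrow> bool" where
  "has_gradients P T A v \<longleftrightarrow> tiling P T \<and> (\<Union>p\<in>P. T p) = cbox (-1) 1 \<and>
     (\<forall>p\<in>P. interior (T p) \<noteq> {}) \<and> (\<forall>p\<in>P. \<forall>x\<in>interior (T p). grad v x = A p)"

lemma has_gradientsD:
  assumes "has_gradients P T A v"
  shows "tiling P T" "(\<Union>p\<in>P. T p) = cbox (-1) 1" "p \<in> P \<Longrightarrow> interior (T p) \<noteq> {}"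
    "p \<in> P \<Longrightarrow> x \<in> interior (T p) \<Longrightarrow> grad v x = A p"
  using assms by (auto simp: has_gradients_def)

lemma measure_tile_pos:
  assumes "compact T" "convex T" "interior T \<noteq> {}"
  shows "0 < measure lebesgue T"
  using assms negligible_convex_interior[of T] lmeasurable_compact[of T]
  by (metis negligible_iff_measure measure_nonneg order_le_less)

lemma Omega_subset_cbox: "Omega \<subseteq> cbox (-1) (1 :: real^'n)"
  using closure_subset closure_Omega by blast

lemma Omega_in_sets_lebesgue: "(Omega :: (real^'n) set) \<in> sets lebesgue"
proof -
  have "convex (Omega :: (real^'n) set)"
    unfolding convex_alt Omega_def
  proof (intro ballI allI impI CollectI)
    fix x y :: "real^'n" and u :: real and i
    assume x: "x \<in> {x. \<forall>i. - 1 < x $ i \<and> x $ i \<le> 1}" and y: "y \<in> {x. \<forall>i. - 1 < x $ i \<and> x $ i \<le> 1}" and u: "0 \<le> u \<and> u \<le> 1"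
    have c: "convex {-1<..(1::real)}" by simp
    have "(1 - u) *\<^sub>R (x $ i) + u *\<^sub>R (y $ i) \<in> {-1<..1}"
      using c x y u unfolding convex_alt by (metis (mono_tags, lifting) greaterThanAtMost_iff mem_Collect_eq)
    then show "- 1 < ((1 - u) *\<^sub>R x + u *\<^sub>R y) $ i \<and> ((1 - u) *\<^sub>R x + u *\<^sub>R y) $ i \<le> 1" by simp
  qed
  then have "(Omega :: (real^'n) set) \<in> lmeasurable"
    by (rule measurable_convex) (rule bounded_subset[OF bounded_cbox Omega_subset_cbox])
  then show ?thesis by (rule fmeasurableD)
qed

lemma box_subset_Omega: "box (-1) 1 \<subseteq> (Omega :: (real^'n) set)"
  by (auto simp: Omega_def mem_box_cart less_imp_le)

lemma measure_Int_Omega: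
  assumes "compact (T :: (real^'n) set)" "convex T" "T \<subseteq> cbox (-1) 1"
  shows "measure lebesgue (T \<inter> Omega) = measure lebesgue T"
proof (rule antisym)
  have T: "T \<in> lmeasurable" by (rule lmeasurable_compact[OF assms(1)])
  have TO: "T \<inter> Omega \<in> lmeasurable" by (rule fmeasurable_Int_fmeasurable[OF T Omega_in_sets_lebesgue])
  show "measure lebesgue (T \<inter> Omega) \<le> measure lebesgue T"
    by (rule measure_mono_fmeasurable) (use T TO in auto)
  have "interior T \<subseteq> T \<inter> Omega"
    using interior_mono[OF assms(3)] box_subset_Omega interior_subset[of T] by (auto simp: interior_cbox)
  then have "measure lebesgue (interior T) \<le> measure lebesgue (T \<inter> Omega)"
    using TO by (intro measure_mono_fmeasurable) (auto intro: lmeasurable_open bounded_interior compact_imp_bounded assms)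
  then show "measure lebesgue T \<le> measure lebesgue (T \<inter> Omega)"
    using measure_interior[of T] assms by (simp add: compact_imp_bounded negligible_convex_frontier)
qed

lemma entry_norm_infty:
  shows "\<bar>A $ i $ j\<bar> \<le> entry_norm \<infinity> A" "entry_norm \<infinity> A \<in> range (\<lambda>(i, j). \<bar>A $ i $ j\<bar>)"
proof -
  have eq: "{\<bar>A $ i $ j\<bar> |i j. True} = range (\<lambda>(i, j). \<bar>A $ i $ j\<bar>)" by auto
  show "\<bar>A $ i $ j\<bar> \<le> entry_norm \<infinity> A" unfolding entry_norm_def eq by (auto intro!: Max_ge)
  have "Max (range (\<lambda>(i, j). \<bar>A $ i $ j\<bar>)) \<in> range (\<lambda>(i, j). \<bar>A $ i $ j\<bar>)" by (rule Max_in) auto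
  then show "entry_norm \<infinity> A \<in> range (\<lambda>(i, j). \<bar>A $ i $ j\<bar>)" by (simp only: entry_norm_def eq if_True refl)
qed

lemma entry_norm_infty_scale: "entry_norm \<infinity> (s *\<^sub>R A) = \<bar>s\<bar> * entry_norm \<infinity> A"
proof (rule antisym)
  obtain i j where "entry_norm \<infinity> (s *\<^sub>R A) = \<bar>(s *\<^sub>R A) $ i $ j\<bar>" using entry_norm_infty(2)[of "s *\<^sub>R A"] by auto
  then show "entry_norm \<infinity> (s *\<^sub>R A) \<le> \<bar>s\<bar> * entry_norm \<infinity> A"
    using entry_norm_infty(1)[of A i j] by (simp add: abs_mult mult_left_mono)
  obtain i j where "entry_norm \<infinity> A = \<bar>A $ i $ j\<bar>" using entry_norm_infty(2)[of A] by auto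
  then show "\<bar>s\<bar> * entry_norm \<infinity> A \<le> entry_norm \<infinity> (s *\<^sub>R A)"
    using entry_norm_infty(1)[of "s *\<^sub>R A" i j] by (simp add: abs_mult)
qed

lemma grad_norm_finite:
  assumes v: "has_gradients P T A v" and r: "1 \<le> r"
  shows "grad_norm (ennreal r) v =
    (\<Sum>p\<in>P. measure lebesgue (T p) * (\<Sum>i\<in>UNIV. \<Sum>j\<in>UNIV. \<bar>A p $ i $ j\<bar> powr r)) powr (1 / r)"
proof -
  note g = has_gradientsD[OF v]
  have e: "entry_norm (ennreal r) B powr r = (\<Sum>i\<in>UNIV. \<Sum>j\<in>UNIV. \<bar>B $ i $ j\<bar> powr r)" for B :: "real^'n^'n"
    using r by (simp add: entry_norm_def powr_powr sum_nonneg)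
  have "(LINT x : Omega | lebesgue. entry_norm (ennreal r) (grad v x) powr r) =
      (\<Sum>p\<in>P. measure lebesgue (T p \<inter> Omega) * (\<Sum>i\<in>UNIV. \<Sum>j\<in>UNIV. \<bar>A p $ i $ j\<bar> powr r))"
    by (rule integral_tiling[OF g(1) Omega_in_sets_lebesgue]) (use g Omega_subset_cbox e in auto)
  also have "\<dots> = (\<Sum>p\<in>P. measure lebesgue (T p) * (\<Sum>i\<in>UNIV. \<Sum>j\<in>UNIV. \<bar>A p $ i $ j\<bar> powr r))"
  proof (rule sum.cong)
    fix p assume p: "p \<in> P"
    have "measure lebesgue (T p \<inter> Omega) = measure lebesgue (T p)"
      by (rule measure_Int_Omega) (use tilingD[OF g(1)] g(2) p in auto)
    then show "measure lebesgue (T p \<inter> Omega) * (\<Sum>i\<in>UNIV. \<Sum>j\<in>UNIV. \<bar>A p $ i $ j\<bar> powr r) =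
      measure lebesgue (T p) * (\<Sum>i\<in>UNIV. \<Sum>j\<in>UNIV. \<bar>A p $ i $ j\<bar> powr r)" by simp
  qed simp
  finally show ?thesis using r by (simp add: grad_norm_def)
qed

lemma has_gradients_nonempty:
  assumes "has_gradients P T A (v :: real^'n \<Rightarrow> real^'n)" shows "P \<noteq> {}"
proof -
  have "(0 :: real^'n) \<in> cbox (-1) 1" by (simp add: mem_box_cart)
  then show ?thesis using has_gradientsD(2)[OF assms] by auto
qed

lemma grad_norm_infty:
  assumes v: "has_gradients P T A v"
  shows "grad_norm \<infinity> v = Max ((\<lambda>p. entry_norm \<infinity> (A p)) ` P)"
proof -
  note g = has_gradientsD[OF v]
  note t = tilingD[OF g(1)]
  let ?M = "lebesgue_on (Omega :: (real^'n) set)" and ?f = "\<lambda>x. ereal (entry_norm \<infinity> (grad v x))"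
  let ?m = "Max ((\<lambda>p. entry_norm \<infinity> (A p)) ` P)"
  have ne: "P \<noteq> {}" by (rule has_gradients_nonempty[OF v])
  have meas: "?f \<in> borel_measurable ?M"
    by (rule measurable_tiling[OF g(1) Omega_in_sets_lebesgue, where val = "\<lambda>p. ereal (entry_norm \<infinity> (A p))"])
      (use g Omega_subset_cbox in auto)
  have "AE x in ?M. ?f x \<le> ereal ?m"
  proof (rule AE_I')
    show "skeleton P T \<inter> Omega \<in> null_sets ?M"
      unfolding null_sets_restrict_space[OF Omega_in_sets_lebesgue] negligible_iff_null_sets[symmetric]
      using negligible_subset[OF negligible_skeleton[OF g(1)]] by blast
    show "{x \<in> space ?M. \<not> ?f x \<le> ereal ?m} \<subseteq> skeleton P T \<inter> Omega"
    proof clarify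
      fix x assume x: "x \<in> space ?M" "\<not> ?f x \<le> ereal ?m"
      then have xO: "x \<in> Omega" by simp
      have "x \<in> skeleton P T"
      proof (rule ccontr)
        assume "x \<notin> skeleton P T"
        then obtain p where "p \<in> P" "x \<in> interior (T p)"
          using off_skeleton[OF g(1)] g(2) xO Omega_subset_cbox by blast
        then have "entry_norm \<infinity> (grad v x) \<le> ?m" using g(4) t(1) by (auto intro: Max_ge)
        with x show False by simp
      qed
      with xO show "x \<in> skeleton P T \<inter> Omega" by simp
    qed
  qed
  then have le: "esssup ?M ?f \<le> ereal ?m" by (rule esssup_I[OF meas])
  have "?m \<in> (\<lambda>p. entry_norm \<infinity> (A p)) ` P" using ne t(1) by (intro Max_in) auto
  then obtain p where p: "p \<in> P" "?m = entry_norm \<infinity> (A p)" by auto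
  have "ereal ?m \<le> esssup ?M ?f"
  proof (rule ccontr)
    assume lt: "\<not> ?thesis"
    have "AE x in ?M. ?f x \<le> esssup ?M ?f" by (rule esssup_AE)
    then obtain Z where Z0: "Z \<in> null_sets ?M" "{x \<in> space ?M. \<not> ?f x \<le> esssup ?M ?f} \<subseteq> Z"
      by (auto elim!: AE_E simp: null_sets_def)
    have Z: "negligible Z" "{x. \<not> (x \<in> Omega \<longrightarrow> ?f x \<le> esssup ?M ?f)} \<subseteq> Z"
      using Z0 unfolding null_sets_restrict_space[OF Omega_in_sets_lebesgue] negligible_iff_null_sets by auto
    have "interior (T p) \<subseteq> Z"
    proof
      fix x assume x: "x \<in> interior (T p)"
      have "interior (T p) \<subseteq> interior (cbox (-1) 1)" using g(2) p(1) by (intro interior_mono) auto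
      then have "x \<in> Omega" using x box_subset_Omega by (auto simp: interior_cbox)
      moreover have "?f x = ereal ?m" using g(4)[OF p(1) x] p(2) by simp
      ultimately show "x \<in> Z" using lt Z(2) by auto
    qed
    then have "negligible (interior (T p))" using Z(1) negligible_subset by blast
    then show False using open_not_negligible[OF open_interior g(3)[OF p(1)]] by blast
  qed
  with le have "esssup ?M ?f = ereal ?m" by (rule antisym)
  then show ?thesis by (simp add: grad_norm_def)
qed

lemma grad_norm_nonneg:
  assumes "has_gradients P T A v" "1 \<le> q" shows "0 \<le> grad_norm q v"
proof (cases q)
  case (real r)
  then have "1 \<le> r" using assms(2) by (simp add: ennreal_1[symmetric] del: ennreal_1)
  then show ?thesis using grad_norm_finite[OF assms(1)] real by simp
next
  case top
  obtain p where "p \<in> P" using has_gradients_nonempty[OF assms(1)] by auto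
  then have "entry_norm \<infinity> (A p) \<le> grad_norm \<infinity> v"
    unfolding grad_norm_infty[OF assms(1)] using tilingD(1)[OF has_gradientsD(1)[OF assms(1)]] by (intro Max_ge) auto
  moreover have "0 \<le> entry_norm \<infinity> (A p)" using entry_norm_infty(1)[of "A p"] abs_ge_zero order_trans by blast
  ultimately show ?thesis using top by simp
qed

lemma grad_norm_scale:
  assumes v: "has_gradients P T A v" and v': "has_gradients P T (\<lambda>p. s *\<^sub>R A p) v'" and "1 \<le> q"
  shows "grad_norm q v' = \<bar>s\<bar> * grad_norm q v"
proof (cases q)
  case (real r)
  then have r: "1 \<le> r" using assms(3) by (simp add: ennreal_1[symmetric] del: ennreal_1)
  let ?S = "\<Sum>p\<in>P. measure lebesgue (T p) * (\<Sum>i\<in>UNIV. \<Sum>j\<in>UNIV. \<bar>A p $ i $ j\<bar> powr r)"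
  have "0 \<le> ?S" by (intro sum_nonneg mult_nonneg_nonneg) auto
  have "grad_norm q v' = (\<bar>s\<bar> powr r * ?S) powr (1 / r)"
    unfolding real grad_norm_finite[OF v' r] 
    by (simp add: abs_mult powr_mult sum_distrib_left mult_ac)
  also have "\<dots> = \<bar>s\<bar> * ?S powr (1 / r)"
    using r \<open>0 \<le> ?S\<close> by (simp add: powr_mult powr_powr)
  finally show ?thesis unfolding real grad_norm_finite[OF v r] .
next
  case top
  have P: "finite P" "P \<noteq> {}" using tilingD(1)[OF has_gradientsD(1)[OF v]] has_gradients_nonempty[OF v] by auto
  have "Max ((\<lambda>p. \<bar>s\<bar> * entry_norm \<infinity> (A p)) ` P) = \<bar>s\<bar> * Max ((\<lambda>p. entry_norm \<infinity> (A p)) ` P)"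
    using mono_Max_commute[of "\<lambda>x. \<bar>s\<bar> * x" "(\<lambda>p. entry_norm \<infinity> (A p)) ` P"] P
    by (simp add: image_image mono_def mult_left_mono)
  then have "grad_norm \<infinity> v' = \<bar>s\<bar> * grad_norm \<infinity> v"
    unfolding grad_norm_infty[OF v] grad_norm_infty[OF v'] entry_norm_infty_scale .
  then show ?thesis using top by simp
qed

lemma grad_norm_le_1_iff:
  assumes v: "has_gradients P T A v" and q: "1 \<le> q"
  shows "grad_norm q v \<le> 1 \<longleftrightarrow>
    (\<Sum>p\<in>P. measure lebesgue (T p) * (\<Sum>i\<in>UNIV. \<Sum>j\<in>UNIV. growth q (A p $ i $ j))) \<le> unit_level q"
proof (cases q)
  case (real r)
  then have r: "1 \<le> r" using q by (simp add: ennreal_1[symmetric] del: ennreal_1)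
  let ?S = "\<Sum>p\<in>P. measure lebesgue (T p) * (\<Sum>i\<in>UNIV. \<Sum>j\<in>UNIV. \<bar>A p $ i $ j\<bar> powr r)"
  have S: "0 \<le> ?S" by (intro sum_nonneg mult_nonneg_nonneg) auto
  have "?S powr (1 / r) \<le> 1 \<longleftrightarrow> ?S \<le> 1"
  proof
    show "?S powr (1 / r) \<le> 1" if "?S \<le> 1"
      using powr_mono2[OF _ S that, of "1 / r"] r by simp
    show "?S \<le> 1" if "?S powr (1 / r) \<le> 1"
    proof (rule ccontr)
      assume "\<not> ?S \<le> 1"
      then have "1 powr (1 / r) < ?S powr (1 / r)" using r by (intro powr_less_mono2) auto
      then show False using that by simp
    qed
  qed
  then show ?thesis
    unfolding real grad_norm_finite[OF v r] using r by (simp add: growth_def unit_level_def)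
next
  case top
  note g = has_gradientsD[OF v]
  note t = tilingD[OF g(1)]
  have pos: "0 < measure lebesgue (T p)" if "p \<in> P" for p
    using that t g(3) by (intro measure_tile_pos) auto
  have nn: "0 \<le> measure lebesgue (T p) * (\<Sum>i\<in>UNIV. \<Sum>j\<in>UNIV. growth \<infinity> (A p $ i $ j))" for p
    by (intro mult_nonneg_nonneg sum_nonneg) (auto simp: growth_def)
  have "(\<Sum>p\<in>P. measure lebesgue (T p) * (\<Sum>i\<in>UNIV. \<Sum>j\<in>UNIV. growth \<infinity> (A p $ i $ j))) \<le> 0 \<longleftrightarrow>
      (\<forall>p\<in>P. (\<Sum>i\<in>UNIV. \<Sum>j\<in>UNIV. growth \<infinity> (A p $ i $ j)) = 0)"
  proof -
    have "(\<Sum>p\<in>P. measure lebesgue (T p) * (\<Sum>i\<in>UNIV. \<Sum>j\<in>UNIV. growth \<infinity> (A p $ i $ j))) \<le> 0 \<longleftrightarrow>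
      (\<Sum>p\<in>P. measure lebesgue (T p) * (\<Sum>i\<in>UNIV. \<Sum>j\<in>UNIV. growth \<infinity> (A p $ i $ j))) = 0"
      using sum_nonneg[of P "\<lambda>p. measure lebesgue (T p) * (\<Sum>i\<in>UNIV. \<Sum>j\<in>UNIV. growth \<infinity> (A p $ i $ j))"] nn by auto
    also have "\<dots> \<longleftrightarrow> (\<forall>p\<in>P. measure lebesgue (T p) * (\<Sum>i\<in>UNIV. \<Sum>j\<in>UNIV. growth \<infinity> (A p $ i $ j)) = 0)"
      by (rule sum_nonneg_eq_0_iff[OF t(1) nn])
    finally show ?thesis using pos by fastforce
  qed
  also have "\<dots> \<longleftrightarrow> (\<forall>p\<in>P. \<forall>i j. growth \<infinity> (A p $ i $ j) = 0)"
    by (simp add: sum_nonneg_eq_0_iff sum_nonneg growth_def)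
  also have "\<dots> \<longleftrightarrow> (\<forall>p\<in>P. \<forall>i j. \<bar>A p $ i $ j\<bar> \<le> 1)"
  proof -
    have "growth \<infinity> x = 0 \<longleftrightarrow> \<bar>x\<bar> \<le> 1" for x by (auto simp: growth_def max_def)
    then show ?thesis by simp
  qed
  also have "\<dots> \<longleftrightarrow> (\<forall>p\<in>P. entry_norm \<infinity> (A p) \<le> 1)"
  proof (intro ball_cong refl iffI allI)
    fix p assume "\<forall>i j. \<bar>A p $ i $ j\<bar> \<le> 1"
    then show "entry_norm \<infinity> (A p) \<le> 1" using entry_norm_infty(2)[of "A p"] by auto
  next
    fix p i j assume "entry_norm \<infinity> (A p) \<le> 1"
    then show "\<bar>A p $ i $ j\<bar> \<le> 1" using entry_norm_infty(1)[of "A p" i j] by linarith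
  qed
  also have "\<dots> \<longleftrightarrow> grad_norm \<infinity> v \<le> 1"
    unfolding grad_norm_infty[OF v] using t(1) has_gradients_nonempty[OF v] by simp
  finally show ?thesis using top by (simp add: unit_level_def)
qed

lemma grad_norm_eq_0:
  assumes v: "has_gradients P T A v" and q: "1 \<le> q" and 0: "grad_norm q v = 0" and p: "p \<in> P"
  shows "A p = 0"
proof (rule ccontr)
  assume "A p \<noteq> 0"
  then obtain i j where ij: "A p $ i $ j \<noteq> 0" by (auto simp: vec_eq_iff)
  note g = has_gradientsD[OF v]
  note t = tilingD[OF g(1)]
  have pos: "0 < measure lebesgue (T p)" using p t g(3) by (intro measure_tile_pos) auto
  show False
  proof (cases q)
    case (real r)
    then have r: "1 \<le> r" using q by (simp add: ennreal_1[symmetric] del: ennreal_1)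
    have "0 < (\<Sum>i\<in>UNIV. \<Sum>j\<in>UNIV. \<bar>A p $ i $ j\<bar> powr r)"
      using ij by (intro sum_pos2[of _ i] sum_pos2[of _ j] sum_nonneg) auto
    then have "0 < (\<Sum>p\<in>P. measure lebesgue (T p) * (\<Sum>i\<in>UNIV. \<Sum>j\<in>UNIV. \<bar>A p $ i $ j\<bar> powr r))"
      using pos p t(1) by (intro sum_pos2[of _ p] mult_nonneg_nonneg sum_nonneg) auto
    then show False using 0 unfolding real grad_norm_finite[OF v r] by simp
  next
    case top
    have "entry_norm \<infinity> (A p) \<le> grad_norm \<infinity> v" unfolding grad_norm_infty[OF v] using t(1) p by (intro Max_ge) auto
    then show False using entry_norm_infty(1)[of "A p" i j] ij 0 top by auto
  qed
qed

section \<open>The oscillation\<close>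

text \<open>The essential supremum sees the values on any two tiles, as their interiors have positive measure.
  Since the gradient takes finitely many values, this supremum is finite, so that it survives the
  conversion to a real number.\<close>

lemma osc_ge:
  fixes Y :: "real^'n \<Rightarrow> real^'n"
  assumes N: "1 \<le> N" and tl: "tiling P T" and \<omega>: "\<omega> \<in> lmeasurable" "\<omega> \<subseteq> (\<Union>p\<in>P. T p)"
    and B: "\<And>p x. p \<in> P \<Longrightarrow> x \<in> interior (T p) \<Longrightarrow> grad Y x = B p"
    and p: "p \<in> P" "T p \<subseteq> \<omega>" "interior (T p) \<noteq> {}" and q: "q \<in> P" "T q \<subseteq> \<omega>" "interior (T q) \<noteq> {}"
  shows "norm (B p - B q) \<le> eps N * osc N Y \<omega>"
proof -
  let ?M = "lebesgue_on \<omega>"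
  let ?f = "\<lambda>(x, x'). ereal (norm (grad Y x - grad Y x'))"
  interpret M: finite_measure ?M by (rule finite_measure_lebesgue_on[OF \<omega>(1)])
  have \<omega>s: "\<omega> \<in> sets lebesgue" using \<omega>(1) by auto
  have gm: "(\<lambda>x. grad Y x) \<in> borel_measurable ?M"
    by (rule measurable_tiling[OF tl \<omega>s \<omega>(2), where val = B]) (use B in auto)
  have meas: "?f \<in> borel_measurable (?M \<Otimes>\<^sub>M ?M)"
    unfolding case_prod_unfold using gm by measurable
  let ?N = "skeleton P T \<inter> \<omega>"
  have N0: "?N \<in> null_sets ?M"
    unfolding null_sets_restrict_space[OF \<omega>s] negligible_iff_null_sets[symmetric]
    using negligible_subset[OF negligible_skeleton[OF tl]] by blast
  define C where "C = Max ((\<lambda>(p, q). norm (B p - B q)) ` (P \<times> P))"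
  have C: "norm (B p - B q) \<le> C" if "p \<in> P" "q \<in> P" for p q
    unfolding C_def using that tilingD(1)[OF tl] by (intro Max_ge) auto
  have "AE z in ?M \<Otimes>\<^sub>M ?M. ?f z \<le> ereal C"
  proof (rule AE_I')
    show "?N \<times> \<omega> \<union> \<omega> \<times> ?N \<in> null_sets (?M \<Otimes>\<^sub>M ?M)"
      using N0 \<omega>s by (intro null_sets.Un M.times_in_null_sets1 M.times_in_null_sets2)
        (auto simp: sets_restrict_space_iff)
    show "{z \<in> space (?M \<Otimes>\<^sub>M ?M). \<not> ?f z \<le> ereal C} \<subseteq> ?N \<times> \<omega> \<union> \<omega> \<times> ?N"
    proof (intro subsetI)
      fix z assume z: "z \<in> {z \<in> space (?M \<Otimes>\<^sub>M ?M). \<not> ?f z \<le> ereal C}"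
      obtain x x' where xx: "z = (x, x')" by (cases z)
      have mem: "x \<in> \<omega>" "x' \<in> \<omega>" using z xx by (auto simp: space_pair_measure)
      have "x \<in> skeleton P T \<or> x' \<in> skeleton P T"
      proof (rule ccontr)
        assume no: "\<not> ?thesis"
        obtain p where p: "p \<in> P" "x \<in> interior (T p)"
          by (rule off_skeleton[OF tl, of x]) (use no mem \<omega>(2) in blast)+
        obtain q where q: "q \<in> P" "x' \<in> interior (T q)"
          by (rule off_skeleton[OF tl, of x']) (use no mem \<omega>(2) in blast)+
        have "norm (grad Y x - grad Y x') \<le> C" using B[OF p] B[OF q] C[OF p(1) q(1)] by simp
        then show False using z xx by simp
      qed
      then show "z \<in> ?N \<times> \<omega> \<union> \<omega> \<times> ?N" using mem xx by auto
    qed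
  qed
  then have le: "esssup (?M \<Otimes>\<^sub>M ?M) ?f \<le> ereal C" by (rule esssup_I[OF meas])
  have ge: "ereal (norm (B p - B q)) \<le> esssup (?M \<Otimes>\<^sub>M ?M) ?f"
  proof (rule ccontr)
    assume lt: "\<not> ?thesis"
    have "AE z in ?M \<Otimes>\<^sub>M ?M. ?f z \<le> esssup (?M \<Otimes>\<^sub>M ?M) ?f" by (rule esssup_AE)
    then obtain Z where Z: "Z \<in> null_sets (?M \<Otimes>\<^sub>M ?M)"
      "{z \<in> space (?M \<Otimes>\<^sub>M ?M). \<not> ?f z \<le> esssup (?M \<Otimes>\<^sub>M ?M) ?f} \<subseteq> Z"
      by (auto elim!: AE_E simp: null_sets_def)
    let ?I = "interior (T p) \<times> interior (T q)"
    have sets: "interior (T p) \<in> sets ?M" "interior (T q) \<in> sets ?M"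
      using p(2) q(2) interior_subset \<omega>s by (auto simp: sets_restrict_space_iff)
    have "?I \<subseteq> Z"
    proof clarify
      fix x x' assume x: "x \<in> interior (T p)" "x' \<in> interior (T q)"
      have "?f (x, x') = ereal (norm (B p - B q))" using B[OF p(1) x(1)] B[OF q(1) x(2)] by simp
      moreover have "(x, x') \<in> space (?M \<Otimes>\<^sub>M ?M)"
        using x p(2) q(2) interior_subset by (force simp: space_pair_measure)
      ultimately show "(x, x') \<in> Z" using lt Z(2) by auto
    qed
    from emeasure_eq_0[OF null_setsD2[OF Z(1)] null_setsD1[OF Z(1)] this] have "emeasure ?M (interior (T p)) * emeasure ?M (interior (T q)) = 0"
      using sets by (simp add: M.emeasure_pair_measure_Times)
    moreover have "emeasure ?M (interior S) \<noteq> 0" if "S \<subseteq> \<omega>" "interior S \<noteq> {}" for S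
    proof -
      have "emeasure ?M (interior S) = emeasure lebesgue (interior S)"
        using that(1) interior_subset[of S] \<omega>s by (intro emeasure_restrict_space) auto
      then show ?thesis
        using open_not_negligible[OF open_interior that(2)] by (simp add: negligible_iff_emeasure0)
    qed
    ultimately show False using p(2,3) q(2,3) by auto
  qed
  have "norm (B p - B q) \<le> real_of_ereal (esssup (?M \<Otimes>\<^sub>M ?M) ?f)"
    using le ge by (cases "esssup (?M \<Otimes>\<^sub>M ?M) ?f") auto
  then show ?thesis using N by (simp add: osc_def)
qed

section \<open>Coarse and fine interpolants of the same lattice function\<close>

lemma (in plane) sum_cells_shift:
  fixes f :: "real^'n \<Rightarrow> real"
  assumes per: "\<And>z. z \<in> Zd \<Longrightarrow> f (z + (2 * real N) *\<^sub>R axis i 1) = f z"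
  shows "(\<Sum>z\<in>cells N. f (z + axis i 1)) = (\<Sum>z\<in>cells N. f z)"
proof -
  have "(\<Sum>k<2*N. f (pt j s (real k - real N) + axis i 1)) = (\<Sum>k<2*N. f (pt j s (real k - real N)))"
    if s: "s \<in> \<int>" for s
  proof -
    define g where "g k = f (pt j s (real k - real N))" for k :: nat
    have "f (pt j s (real k - real N) + axis i 1) = g (Suc k)" for k
    proof -
      have "pt j s (real k - real N) + axis i 1 = pt j s (real (Suc k) - real N)"
        using ij by (simp add: vec_eq_ij axis_def)
      then show ?thesis by (simp add: g_def)
    qed
    moreover have "(\<Sum>k<n. g (Suc k)) = (\<Sum>k<n. g k) + g n - g 0" for n by (induction n) auto
    moreover have "g (2 * N) = g 0"
    proof -
      have "pt j s (real (2 * N) - real N) = pt j s (real 0 - real N) + (2 * real N) *\<^sub>R axis i 1"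
        using ij by (simp add: vec_eq_ij axis_def)
      moreover have "(\<forall>l. pt j s (real 0 - real N) $ l \<in> \<int>)" using s by (subst ex_ij) simp
      then have "pt j s (real 0 - real N) \<in> Zd" by (simp add: Zd_def)
      ultimately show ?thesis using per by (simp add: g_def)
    qed
    ultimately show ?thesis by (simp add: g_def)
  qed
  then show ?thesis unfolding sum_cells by simp
qed

lemma twoZd_axis: "2 *\<^sub>R axis k 1 \<in> twoZd" "- (2 *\<^sub>R axis k 1) \<in> twoZd"
proof -
  have "axis k 1 \<in> Zd" "- axis k 1 \<in> Zd" by (auto simp: Zd_def axis_def)
  then show "2 *\<^sub>R axis k 1 \<in> twoZd" "- (2 *\<^sub>R axis k 1) \<in> twoZd"
    unfolding twoZd_def by (auto intro: exI[of _ "- axis k 1"])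
qed

text \<open>\<open>w\<close> is piecewise affine on the coarse mesh \<open>Th\<close>, with gradients \<open>A\<close>, and \<open>v\<close> is the interpolant on
  the fine mesh that has the same lattice values.\<close>

locale coarse_fine = plane i j for i j :: "'n::finite" +
  fixes N :: nat and a :: "real^'n" and Th :: "(real^'n) set set"
    and w v :: "real^'n \<Rightarrow> real^'n" and A :: "(real^'n) set \<Rightarrow> real^'n^'n" and d :: "(real^'n) set \<Rightarrow> real^'n"
  assumes N: "1 \<le> N" and a: "a \<in> unit_corners"
    and Th: "tiling Th (\<lambda>T. T)" "\<Union>Th = cbox (-1) 1"
    and polygons: "\<And>T. T \<in> Th \<Longrightarrow> \<exists>C\<subseteq>per_lattice N. T = convex hull C"
    and w_cont: "continuous_on UNIV w" and w_affine: "\<And>T x. T \<in> Th \<Longrightarrow> x \<in> T \<Longrightarrow> w x = A T *v x + d T"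
    and w_per: "\<And>x \<xi>. \<xi> \<in> twoZd \<Longrightarrow> w (x + \<xi>) = w x"
    and v_P1: "P1 (per_fine_mesh N (corner_tile ` tile_corners a)) v"
    and v_per: "\<And>x \<xi>. \<xi> \<in> twoZd \<Longrightarrow> v (x + \<xi>) = v x"
    and v_eq_w: "\<And>x. x \<in> per_lattice N \<Longrightarrow> v x = w x"
begin

lemma v_affine:
  assumes "z \<in> Zd" "c \<in> tile_corners a"
  obtains b where "\<And>x. x \<in> lattice_tile N z c \<Longrightarrow> v x = tile_grad N v z c *v x + b"
proof -
  have "lattice_tile N z c \<in> per_fine_mesh N (corner_tile ` tile_corners a)"
    unfolding per_fine_mesh_eq[OF N] using assms by blast
  then obtain B b where B: "\<And>x. x \<in> lattice_tile N z c \<Longrightarrow> v x = B *v x + b"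
    using v_P1 unfolding P1_def by metis
  have "c \<in> unit_corners" using assms(2) tile_corners_subset by blast
  from affine_on_lattice_tile[OF N this B] B that show thesis by metis
qed

lemma edge_sum_bound:
  assumes \<phi>: "even_convex \<phi>"
    and cont: "\<And>s. continuous_on UNIV (\<Lambda> s)"
    and bound: "\<And>s t V. (\<And>x y. x \<in> {s..s + 1 / N} \<Longrightarrow> y \<in> {s..s + 1 / N} \<Longrightarrow>
        \<bar>w (pt j x t) $ l - w (pt j y t) $ l\<bar> \<le> V) \<Longrightarrow> \<bar>\<Lambda> s t\<bar> \<le> V"
    and per: "\<And>s. \<Lambda> s 1 = \<Lambda> s (-1)"
  shows "(\<Sum>z\<in>cells N. (1 / N)\<^sup>2 * \<phi> (real N * \<Lambda> (eps N * z $ j) (eps N * z $ i)))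
    \<le> (\<Sum>T\<in>Th. measure lebesgue T * \<phi> (A T $ l $ j))"
proof -
  have "(\<Sum>m<2*N. \<Sum>k<2*N. (1 / N)\<^sup>2 * \<phi> (real N * \<Lambda> (real m / N - 1) (real k / N - 1)))
    \<le> (\<Sum>T\<in>Th. measure lebesgue T * \<phi> (A T $ l $ j))"
  proof (rule mesh_edge_bound[OF \<phi> N Th(1), where f = "\<lambda>x. w x $ l" and d = "\<lambda>T. d T $ l"])
    show "continuous_on UNIV (\<lambda>x. w x $ l)" using w_cont by (rule continuous_on_component)
    show "w x $ l = A T $ l \<bullet> x + d T $ l" if "T \<in> Th" "x \<in> T" for T x
      using w_affine[OF that] by (simp add: matrix_vector_mult_def inner_vec_def)
    show "slice j T t' \<noteq> {}" if "T \<in> Th" "t \<in> {real k / N - 1<..<real (Suc k) / N - 1}"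
      "t' \<in> {real k / N - 1<..<real (Suc k) / N - 1}" "slice j T t \<noteq> {}" for T k t t'
      using polygons[OF that(1)] lattice_polygon_rows[OF N _ _ that(2-4)] by blast
  qed (use Th cont bound per in auto)
  moreover have "eps N * (real m - real N) = real m / N - 1" for m using N by (simp add: field_simps)
  ultimately show ?thesis unfolding sum_cells by simp
qed

lemma pt_per: "pt j s 1 = pt j s (-1) + 2 *\<^sub>R axis i 1"
  using ij by (simp add: vec_eq_ij axis_def)

lemma w_row_per: "w (pt j s 1) = w (pt j s (-1))"
  unfolding pt_per by (rule w_per[OF twoZd_axis(1)])

lemma continuous_on_w_pt: "continuous_on S (\<lambda>t. w (pt j s t) $ l)"
  by (intro continuous_on_component continuous_on_compose2[OF w_cont] continuous_intros) auto

lemma increment_sum_bound: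
  assumes \<phi>: "even_convex \<phi>"
  shows "(\<Sum>z\<in>cells N. (1 / N)\<^sup>2 * \<phi> (real N * (w (eps N *\<^sub>R (z + axis j 1)) $ l - w (eps N *\<^sub>R z) $ l)))
    \<le> (\<Sum>T\<in>Th. measure lebesgue T * \<phi> (A T $ l $ j))"
proof -
  have "(\<Sum>z\<in>cells N. (1 / N)\<^sup>2 * \<phi> (real N *
      (\<lambda>s t. w (pt j (s + 1 / N) t) $ l - w (pt j s t) $ l) (eps N * z $ j) (eps N * z $ i)))
    \<le> (\<Sum>T\<in>Th. measure lebesgue T * \<phi> (A T $ l $ j))"
  proof (rule edge_sum_bound[OF \<phi>])
    show "continuous_on UNIV (\<lambda>t. w (pt j (s + 1 / N) t) $ l - w (pt j s t) $ l)" for s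
      by (intro continuous_on_diff continuous_on_w_pt)
  qed (auto simp: w_row_per)
  moreover have "pt j (eps N * z $ j) (eps N * z $ i) = eps N *\<^sub>R z"
    "pt j (eps N * z $ j + 1 / N) (eps N * z $ i) = eps N *\<^sub>R (z + axis j 1)" for z :: "real^'n"
    using ij by (simp_all add: vec_eq_ij axis_def add_divide_distrib)
  ultimately show ?thesis by simp
qed

text \<open>Every lattice edge in direction \<open>j\<close> is a leg of one tile on either side of it. Together these two
  tiles have the area of a cell, so the sum over the tiles is the sum over the edges that
  \<open>increment_sum_bound\<close> estimates.\<close>

lemma tile_grad_sum_bound:
  assumes \<phi>: "even_convex \<phi>"
  shows "(\<Sum>(z, c)\<in>cells N \<times> tile_corners a. measure lebesgue (lattice_tile N z c) * \<phi> (tile_grad N v z c $ l $ j))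
    \<le> (\<Sum>T\<in>Th. measure lebesgue T * \<phi> (A T $ l $ j))"
proof -
  define g where "g z = \<phi> (real N * (w (eps N *\<^sub>R (z + axis j 1)) $ l - w (eps N *\<^sub>R z) $ l))" for z
  obtain c0 where c0: "c0 \<in> unit_corners" "tile_corners a = {c0, 1 - c0}" "c0 $ i = 0"
    using tile_corners_obtain[OF a] by metis
  have ne: "c0 \<noteq> 1 - c0" by (rule corner_ne_opposite[OF c0(1)])
  have corner: "c \<in> unit_corners" if "c \<in> tile_corners a" for c using that tile_corners_subset by blast
  have tg: "\<phi> (tile_grad N v z c $ l $ j) = g (z + (c $ i) *\<^sub>R axis i 1)"
    if z: "z \<in> Zd" and c: "c \<in> tile_corners a" for z c
  proof -
    have vw: "v (eps N *\<^sub>R (z + upd c j b)) = w (eps N *\<^sub>R (z + upd c j b))" if "b \<in> {0, 1}" for b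
      using Zd_add[OF z] upd_unit_corners[OF corner[OF c] that] unit_corners_Zd
      by (intro v_eq_w) (auto simp: per_lattice_def)
    have e: "z + (c $ i) *\<^sub>R axis i 1 + axis j 1 = z + upd c j 1" "z + (c $ i) *\<^sub>R axis i 1 = z + upd c j 0"
      using ij by (simp_all add: vec_eq_ij axis_def)
    show ?thesis unfolding g_def e(1) unfolding e(2) using vw[of 0] vw[of 1] by (simp add: tile_grad_def)
  qed
  have gper: "g (z + (2 * real N) *\<^sub>R axis i 1) = g z" for z
  proof -
    have "eps N *\<^sub>R (z + (2 * real N) *\<^sub>R axis i 1 + u) = eps N *\<^sub>R (z + u) + 2 *\<^sub>R axis i 1" for u
      using N by (simp add: algebra_simps)
    from this[of 0] this[of "axis j 1"] show ?thesis unfolding g_def by (simp add: w_per[OF twoZd_axis(1)])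
  qed
  have "(\<Sum>(z, c)\<in>cells N \<times> tile_corners a. measure lebesgue (lattice_tile N z c) * \<phi> (tile_grad N v z c $ l $ j))
      = (\<Sum>z\<in>cells N. \<Sum>c\<in>tile_corners a. measure lebesgue (lattice_tile N z c) * \<phi> (tile_grad N v z c $ l $ j))"
    by (rule sum.cartesian_product[symmetric])
  also have "\<dots> = (\<Sum>z\<in>cells N. (1 / N)\<^sup>2 / 2 * (g z + g (z + axis i 1)))"
  proof (rule sum.cong)
    fix z :: "real^'n" assume "z \<in> cells N"
    then have z: "z \<in> Zd" by (simp add: cells_def)
    have "(\<Sum>c\<in>tile_corners a. measure lebesgue (lattice_tile N z c) * \<phi> (tile_grad N v z c $ l $ j)) =
        (\<Sum>c\<in>tile_corners a. (1 / N)\<^sup>2 / 2 * g (z + (c $ i) *\<^sub>R axis i 1))"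
      by (intro sum.cong) (simp_all add: tg[OF z] measure_lattice_tile[OF N corner])
    then show "(\<Sum>c\<in>tile_corners a. measure lebesgue (lattice_tile N z c) * \<phi> (tile_grad N v z c $ l $ j)) =
        (1 / N)\<^sup>2 / 2 * (g z + g (z + axis i 1))"
      using ne by (simp add: c0(2,3) distrib_left)
  qed simp
  also have "\<dots> = (1 / N)\<^sup>2 / 2 * ((\<Sum>z\<in>cells N. g z) + (\<Sum>z\<in>cells N. g (z + axis i 1)))"
    by (simp add: sum_distrib_left sum.distrib distrib_left)
  also have "(\<Sum>z\<in>cells N. g (z + axis i 1)) = (\<Sum>z\<in>cells N. g z)"
    by (rule sum_cells_shift) (rule gper)
  also have "(1 / N)\<^sup>2 / 2 * ((\<Sum>z\<in>cells N. g z) + (\<Sum>z\<in>cells N. g z)) = (\<Sum>z\<in>cells N. (1 / N)\<^sup>2 * g z)"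
    by (simp add: sum_distrib_left)
  also have "\<dots> \<le> (\<Sum>T\<in>Th. measure lebesgue T * \<phi> (A T $ l $ j))"
    unfolding g_def by (rule increment_sum_bound[OF \<phi>])
  finally show ?thesis .
qed

text \<open>The integral of \<open>w - v\<close> over the face of the cell \<open>z\<close> on which coordinate \<open>i\<close> is smallest.\<close>

definition face_defect :: "real^'n \<Rightarrow> 'n \<Rightarrow> real" where
  "face_defect z l = integral {eps N * z $ j..eps N * z $ j + 1 / N}
     (\<lambda>s. w (pt j s (eps N * z $ i)) $ l - v (pt j s (eps N * z $ i)) $ l)"

lemma face_in_tile:
  assumes s: "s \<in> {eps N * z $ j..eps N * z $ j + 1 / N}" and c: "c \<in> unit_corners"
  shows "c $ i = 0 \<Longrightarrow> pt j s (eps N * z $ i) \<in> lattice_tile N z c"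
    and "c $ i = 1 \<Longrightarrow> pt j s (eps N * z $ i) \<in> lattice_tile N (z - axis i 1) c"
proof -
  have b: "0 \<le> real N * s - z $ j" "real N * s - z $ j \<le> 1" using s N by (auto simp: field_simps)
  show "pt j s (eps N * z $ i) \<in> lattice_tile N z c" if "c $ i = 0"
  proof -
    have "real N *\<^sub>R pt j s (eps N * z $ i) - z = upd c j (real N * s - z $ j)"
      using N ij that by (simp add: vec_eq_ij)
    then show ?thesis unfolding lattice_tile_def using edge_in_corner_tile[OF c b] by simp
  qed
  show "pt j s (eps N * z $ i) \<in> lattice_tile N (z - axis i 1) c" if "c $ i = 1"
  proof -
    have "real N *\<^sub>R pt j s (eps N * z $ i) - (z - axis i 1) = upd c j (real N * s - z $ j)"
      using N ij that by (simp add: vec_eq_ij axis_def)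
    then show ?thesis unfolding lattice_tile_def using edge_in_corner_tile[OF c b] by simp
  qed
qed

lemma face_defect_eq_0:
  assumes "c \<in> unit_corners" and
    "c $ i = 0 \<and> (\<forall>x\<in>lattice_tile N z c. w x = v x) \<or> c $ i = 1 \<and> (\<forall>x\<in>lattice_tile N (z - axis i 1) c. w x = v x)"
  shows "face_defect z l = 0"
proof -
  have "integral {eps N * z $ j..eps N * z $ j + 1 / N}
     (\<lambda>s. w (pt j s (eps N * z $ i)) $ l - v (pt j s (eps N * z $ i)) $ l) =
     integral {eps N * z $ j..eps N * z $ j + 1 / N} (\<lambda>s. 0)"
    by (rule integral_cong) (use assms face_in_tile[OF _ assms(1)] in fastforce)
  then show ?thesis by (simp add: face_defect_def)
qed

lemma face_defect_per: "face_defect (z + (2 * real N) *\<^sub>R axis i 1) l = face_defect z l"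
proof -
  have "pt j s (eps N * (z + (2 * real N) *\<^sub>R axis i 1) $ i) = pt j s (eps N * z $ i) + 2 *\<^sub>R axis i 1" for s
    using N ij by (simp add: vec_eq_ij axis_def field_simps)
  moreover have "(z + (2 * real N) *\<^sub>R axis i 1) $ j = z $ j" using ij by (simp add: axis_def)
  ultimately show ?thesis
    unfolding face_defect_def by (simp only: w_per[OF twoZd_axis(1)] v_per[OF twoZd_axis(1)])
qed

lemma continuous_on_v: "continuous_on UNIV v"
  using v_P1 by (simp add: P1_def)

text \<open>On a face \<open>v\<close> interpolates \<open>w\<close> between the endpoints, so the defect is the error of the
  trapezoidal rule for \<open>w\<close>.\<close>

lemma face_defect_trapezoidal:
  assumes z: "z \<in> Zd"
  defines "s \<equiv> eps N * z $ j" and "t \<equiv> eps N * z $ i"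
  shows "face_defect z l = integral {s..s + 1 / N} (\<lambda>x. w (pt j x t) $ l) -
    (w (pt j s t) $ l + w (pt j (s + 1 / N) t) $ l) / (2 * real N)"
proof -
  obtain c where c: "c \<in> unit_corners" "c \<in> tile_corners a" "c $ i = 0"
    using tile_corners_obtain[OF a] by (metis insertI1)
  obtain b where b: "\<And>x. x \<in> lattice_tile N z c \<Longrightarrow> v x = tile_grad N v z c *v x + b"
    using v_affine[OF z c(2)] by blast
  define \<alpha> where "\<alpha> = tile_grad N v z c $ l $ j"
  define \<beta> where "\<beta> = tile_grad N v z c $ l $ i * t + b $ l"
  have v: "v (pt j x t) $ l = \<alpha> * x + \<beta>" if "x \<in> {s..s + 1 / N}" for x
    using b[OF face_in_tile(1)[OF that[unfolded s_def] c(1,3)]]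
    by (simp add: t_def \<alpha>_def \<beta>_def matrix_vector_mult_def sum_ij)
  have F: "((\<lambda>x. \<alpha> * x\<^sup>2 / 2 + \<beta> * x) has_vector_derivative \<alpha> * x + \<beta>) (at x within S)" for x S
    unfolding has_real_derivative_iff_has_vector_derivative[symmetric]
    by (auto intro!: derivative_eq_intros)
  have "((\<lambda>x. \<alpha> * x + \<beta>) has_integral (\<alpha> * (s + 1 / N)\<^sup>2 / 2 + \<beta> * (s + 1 / N)) - (\<alpha> * s\<^sup>2 / 2 + \<beta> * s)) {s..s + 1 / N}"
    by (rule fundamental_theorem_of_calculus) (use F in auto)
  moreover have "(\<alpha> * (s + 1 / N)\<^sup>2 / 2 + \<beta> * (s + 1 / N)) - (\<alpha> * s\<^sup>2 / 2 + \<beta> * s) =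
      ((\<alpha> * s + \<beta>) + (\<alpha> * (s + 1 / N) + \<beta>)) / (2 * real N)"
    using N by (simp add: power2_eq_square field_simps)
  ultimately have "((\<lambda>x. \<alpha> * x + \<beta>) has_integral ((\<alpha> * s + \<beta>) + (\<alpha> * (s + 1 / N) + \<beta>)) / (2 * real N)) {s..s + 1 / N}"
    by simp
  then have iv: "((\<lambda>x. v (pt j x t) $ l) has_integral (v (pt j s t) $ l + v (pt j (s + 1 / N) t) $ l) / (2 * real N)) {s..s + 1 / N}"
    using v[of s] v[of "s + 1 / N"] by (subst has_integral_cong[OF v]) auto
  have p1: "pt j s t = eps N *\<^sub>R z" "pt j (s + 1 / N) t = eps N *\<^sub>R (z + axis j 1)"
    using ij by (simp_all add: vec_eq_ij axis_def add_divide_distrib s_def t_def)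
  have "axis j 1 \<in> (Zd :: (real^'n) set)" by (auto simp: Zd_def axis_def)
  then have ends: "v (pt j s t) = w (pt j s t)" "v (pt j (s + 1 / N) t) = w (pt j (s + 1 / N) t)"
    unfolding p1 using z Zd_add[OF z] by (intro v_eq_w; unfold per_lattice_def; blast)+
  have wi: "(\<lambda>x. w (pt j x t) $ l) integrable_on {s..s + 1 / N}"
    by (intro integrable_continuous_interval continuous_on_component continuous_on_compose2[OF w_cont]
      continuous_intros) auto
  have "face_defect z l = integral {s..s + 1 / N} (\<lambda>x. w (pt j x t) $ l) - integral {s..s + 1 / N} (\<lambda>x. v (pt j x t) $ l)"
    unfolding face_defect_def s_def[symmetric] t_def[symmetric]
    using iv by (intro Henstock_Kurzweil_Integration.integral_diff wi) auto
  then show ?thesis using iv ends by (simp add: integral_unique)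
qed

text \<open>By the trapezoidal rule, \<open>N\<close> times the defect is the mean of \<open>w\<close> on the edge minus its mean at the two
  endpoints. This is at most the oscillation of \<open>w\<close> on the edge.\<close>

lemma face_defect_sum_bound:
  assumes \<phi>: "even_convex \<phi>"
  shows "(\<Sum>z\<in>cells N. (1 / N)\<^sup>2 * \<phi> ((real N)\<^sup>2 * face_defect z l)) \<le> (\<Sum>T\<in>Th. measure lebesgue T * \<phi> (A T $ l $ j))"
proof -
  define \<Lambda> where "\<Lambda> s t = real N * integral {s..s + 1 / N} (\<lambda>x. w (pt j x t) $ l) -
    (w (pt j s t) $ l + w (pt j (s + 1 / N) t) $ l) / 2" for s t
  have "(\<Sum>z\<in>cells N. (1 / N)\<^sup>2 * \<phi> (real N * \<Lambda> (eps N * z $ j) (eps N * z $ i)))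
    \<le> (\<Sum>T\<in>Th. measure lebesgue T * \<phi> (A T $ l $ j))"
  proof (rule edge_sum_bound[OF \<phi>])
    fix s
    have "continuous_on (UNIV \<times> cbox s (s + 1 / N)) (\<lambda>(t, x). w (pt j x t) $ l)"
      unfolding case_prod_unfold
      by (intro continuous_on_component continuous_on_compose2[OF w_cont] continuous_intros) auto
    then have "continuous_on UNIV (\<lambda>t. integral (cbox s (s + 1 / N)) (\<lambda>x. w (pt j x t) $ l))"
      by (rule integral_continuous_on_param)
    then show "continuous_on UNIV (\<Lambda> s)"
      unfolding \<Lambda>_def[abs_def] by (auto intro!: continuous_intros continuous_on_w_pt)
  next
    fix s t V
    assume V: "\<And>x y. x \<in> {s..s + 1 / N} \<Longrightarrow> y \<in> {s..s + 1 / N} \<Longrightarrow> \<bar>w (pt j x t) $ l - w (pt j y t) $ l\<bar> \<le> V"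
    define m where "m = (w (pt j s t) $ l + w (pt j (s + 1 / N) t) $ l) / 2"
    have wi: "(\<lambda>x. w (pt j x t) $ l) integrable_on {s..s + 1 / N}"
      by (intro integrable_continuous_interval continuous_on_component continuous_on_compose2[OF w_cont]
        continuous_intros) auto
    have hi: "((\<lambda>x. w (pt j x t) $ l - m) has_integral integral {s..s + 1 / N} (\<lambda>x. w (pt j x t) $ l) - (1 / N) * m) {s..s + 1 / N}"
      using has_integral_diff[OF integrable_integral[OF wi] has_integral_const_real[of m s "s + 1 / N"]] by simp
    have "norm (integral {s..s + 1 / N} (\<lambda>x. w (pt j x t) $ l) - (1 / N) * m) \<le> V * measure lborel {s..s + 1 / N}"
    proof (rule has_integral_bound_real[OF _ finite.emptyI hi])
      show "norm (w (pt j x t) $ l - m) \<le> V" if "x \<in> {s..s + 1 / N} - {}" for x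
        using V[of x s] V[of x "s + 1 / N"] that by (simp add: m_def abs_le_iff field_simps)
      show "0 \<le> V" using V[of s s] by simp
    qed
    then have "\<bar>integral {s..s + 1 / N} (\<lambda>x. w (pt j x t) $ l) - (1 / N) * m\<bar> * real N \<le> V * (1 / N) * real N"
      by (intro mult_right_mono) auto
    moreover have "\<bar>integral {s..s + 1 / N} (\<lambda>x. w (pt j x t) $ l) - (1 / N) * m\<bar> * real N = \<bar>\<Lambda> s t\<bar>"
    proof -
      have "(integral {s..s + 1 / N} (\<lambda>x. w (pt j x t) $ l) - (1 / N) * m) * real N = \<Lambda> s t"
        unfolding \<Lambda>_def m_def using N by (simp add: field_simps)
      then show ?thesis by (metis abs_mult abs_of_nat)
    qed
    ultimately show "\<bar>\<Lambda> s t\<bar> \<le> V" using N by simp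
  qed (simp add: \<Lambda>_def w_row_per)
  moreover have "real N * \<Lambda> (eps N * z $ j) (eps N * z $ i) = (real N)\<^sup>2 * face_defect z l" if "z \<in> cells N" for z
  proof -
    have "z \<in> Zd" using that by (simp add: cells_def)
    then show ?thesis unfolding face_defect_trapezoidal[OF \<open>z \<in> Zd\<close>] \<Lambda>_def
      using N by (simp add: power2_eq_square right_diff_distrib)
  qed
  ultimately show ?thesis by (simp cong: sum.cong)
qed

text \<open>The integral of a partial derivative over a cell depends only on the values on two opposite faces.\<close>

lemma cell_gradient_defect:
  assumes z: "z \<in> cells N"
  shows "(\<Sum>T\<in>Th. A T $ l $ i * measure lebesgue (T \<inter> lattice_cell N z)) -
      (\<Sum>c\<in>tile_corners a. tile_grad N v z c $ l $ i * measure lebesgue (lattice_tile N z c))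
    = face_defect (z + axis i 1) l - face_defect z l"
proof -
  interpret sw: plane j i using ij all_ij by unfold_locales auto
  have zZ: "z \<in> Zd" using z by (simp add: cells_def)
  have swap: "pt i s t = pt j t s" for s t :: real by (simp add: vec_eq_ij)
  let ?l = "eps N *\<^sub>R z" and ?u = "eps N *\<^sub>R (z + 1)"
  let ?I = "{eps N * z $ j..eps N * z $ j + 1 / N}"
  have Q: "lattice_cell N z = cbox ?l ?u" by (simp add: lattice_cell_def)
  have lu: "?l $ k \<le> ?u $ k" for k using N by (simp add: divide_right_mono)
  have I: "{?l $ j..?u $ j} = ?I" by (simp add: add_divide_distrib)
  have w: "(\<Sum>T\<in>Th. A T $ l $ i * measure lebesgue (T \<inter> lattice_cell N z)) =
     integral ?I (\<lambda>t. w (pt j t (?u $ i)) $ l - w (pt j t (?l $ i)) $ l)"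
    unfolding Q I[symmetric] swap[symmetric]
  proof (rule sw.integral_partial_over_box[OF Th(1), where d = "\<lambda>T. d T $ l"])
    show "continuous_on UNIV (\<lambda>x. w x $ l)" using w_cont by (rule continuous_on_component)
    show "w x $ l = A T $ l \<bullet> x + d T $ l" if "T \<in> Th" "x \<in> T" for T x
      using w_affine[OF that] by (simp add: matrix_vector_mult_def inner_vec_def)
    show "cbox ?l ?u \<subseteq> (\<Union>T\<in>Th. T)"
      using z lattice_cell_subset_iff[OF N zZ] Th(2) by (simp add: lattice_cell_def)
  qed (rule lu)
  have "\<exists>b. \<forall>x. x \<in> lattice_tile N z c \<longrightarrow> v x = tile_grad N v z c *v x + b" if "c \<in> tile_corners a" for c
    using v_affine[OF zZ that] by metis
  then obtain b where b: "\<And>c x. c \<in> tile_corners a \<Longrightarrow> x \<in> lattice_tile N z c \<Longrightarrow> v x = tile_grad N v z c *v x + b c"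
    by metis
  have "tiling ({z} \<times> tile_corners a) (\<lambda>(z, c). lattice_tile N z c)"
    by (rule tiling_lattice_tiles[OF N a]) (use zZ in auto)
  then have tl: "tiling (tile_corners a) (lattice_tile N z)"
    unfolding tiling_def by (auto simp: finite_cartesian_product_iff)
  have "(\<Sum>c\<in>tile_corners a. tile_grad N v z c $ l $ i * measure lebesgue (lattice_tile N z c \<inter> cbox ?l ?u)) =
     integral ?I (\<lambda>t. v (pt j t (?u $ i)) $ l - v (pt j t (?l $ i)) $ l)"
    unfolding I[symmetric] swap[symmetric]
  proof (rule sw.integral_partial_over_box[OF tl, where d = "\<lambda>c. b c $ l"])
    show "continuous_on UNIV (\<lambda>x. v x $ l)" using continuous_on_v by (rule continuous_on_component)
    show "v x $ l = tile_grad N v z c $ l \<bullet> x + b c $ l" if "c \<in> tile_corners a" "x \<in> lattice_tile N z c" for c x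
      using b[OF that] by (simp add: matrix_vector_mult_def inner_vec_def)
    show "cbox ?l ?u \<subseteq> (\<Union>c\<in>tile_corners a. lattice_tile N z c)"
      using lattice_cell_eq_tiles[OF N a] by (simp add: lattice_cell_def)
  qed (rule lu)
  moreover have "lattice_tile N z c \<inter> cbox ?l ?u = lattice_tile N z c" for c
    using lattice_tile_subset_cell[OF N, of z c] unfolding Q by blast
  ultimately have vv: "(\<Sum>c\<in>tile_corners a. tile_grad N v z c $ l $ i * measure lebesgue (lattice_tile N z c)) =
     integral ?I (\<lambda>t. v (pt j t (?u $ i)) $ l - v (pt j t (?l $ i)) $ l)" by simp
  have int: "(\<lambda>t. f (pt j t r) $ l) integrable_on ?I" if "continuous_on UNIV f" for f :: "real^'n \<Rightarrow> real^'n" and r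
    by (intro integrable_continuous_interval continuous_on_component continuous_on_compose2[OF that]
      continuous_intros) auto
  note ints = int[OF w_cont] int[OF continuous_on_v]
  have zj: "(z + axis i 1) $ j = z $ j" "eps N * (z + axis i 1) $ i = ?u $ i" "eps N * z $ i = ?l $ i"
    using ij by (simp_all add: axis_def)
  show ?thesis
    unfolding w vv face_defect_def zj
    by (simp only: Henstock_Kurzweil_Integration.integral_diff integrable_diff ints)
qed

end

lemma (in coarse_fine) tile_grad_entry_sum_bound:
  assumes \<phi>: "even_convex \<phi>"
  shows "(\<Sum>(z, c)\<in>cells N \<times> tile_corners a. measure lebesgue (lattice_tile N z c) * \<phi> (tile_grad N v z c $ l $ k))
    \<le> (\<Sum>T\<in>Th. measure lebesgue T * \<phi> (A T $ l $ k))"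
proof -
  interpret sw: plane j i using ij all_ij by unfold_locales auto
  interpret sw: coarse_fine j i N a Th w v A d
    by unfold_locales (use N a Th polygons w_cont w_affine w_per v_P1 v_per v_eq_w in auto)
  have "k = i \<or> k = j" using all_ij by blast
  then show ?thesis using tile_grad_sum_bound[OF \<phi>, of l] sw.tile_grad_sum_bound[OF \<phi>, of l] by blast
qed

section \<open>The consistency error of the coarse interpolant\<close>

lemma norm_matrix_le_entries:
  fixes G :: "real^'n^'m" shows "norm G \<le> (\<Sum>l\<in>UNIV. \<Sum>k\<in>UNIV. \<bar>G $ l $ k\<bar>)"
proof -
  have "norm G \<le> (\<Sum>l\<in>UNIV. norm (G $ l))" by (simp add: norm_vec_def[of G] L2_set_le_sum)
  also have "\<dots> \<le> (\<Sum>l\<in>UNIV. \<Sum>k\<in>UNIV. \<bar>G $ l $ k\<bar>)" by (intro sum_mono norm_le_l1_cart)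
  finally show ?thesis .
qed

lemma matrix_eq_sum_units:
  fixes G :: "real^'n^'m" shows "G = (\<Sum>l\<in>UNIV. \<Sum>k\<in>UNIV. G $ l $ k *\<^sub>R axis l (axis k 1))"
proof -
  have u: "(axis l (axis k 1) :: real^'n^'m) $ r $ s = (if k = s then if l = r then 1 else 0 else 0)" for l k r s
    by (simp add: axis_def)
  have "(\<Sum>l\<in>UNIV. \<Sum>k\<in>UNIV. G $ l $ k * (if k = s then if l = r then 1 else 0 else 0)) = G $ r $ s" for r s
    by (simp add: if_distrib[of "\<lambda>x. _ * x"] cong: if_cong)
  then show ?thesis by (simp add: vec_eq_iff sum_component u)
qed

lemma norm_axis_vec: "norm (axis l x :: 'a::real_normed_vector^'m) = norm x"
proof -
  have "(norm ((axis l x :: 'a^'m) $ i))\<^sup>2 = (if i = l then (norm x)\<^sup>2 else 0)" for i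
    by (simp add: axis_def)
  then show ?thesis by (simp add: norm_vec_def[of "axis l x"] L2_set_def)
qed

lemma norm_matrix_unit: "norm (axis l (axis k 1) :: real^'n^'m) = 1"
  by (simp add: norm_axis_vec)

text \<open>\<open>S F\<close> is the stress at \<open>F\<close> as a functional of the gradient of the test function, \<open>B\<close> the gradient
  of the deformation on the tiles, and \<open>os\<close> its oscillation on the patch of a tile. The oscillation
  controls only those tiles that touch the given one and on which \<open>w\<close> and \<open>v\<close> differ: only these are
  known to belong to the continuum region.\<close>

locale coarse_fine_stress = coarse_fine i j N a Th w v A d
  for i j :: "'n::finite" and N a Th w v A d +
  fixes S :: "real^'n^'n \<Rightarrow> real^'n^'n \<Rightarrow> real" and L :: real
    and B :: "real^'n \<Rightarrow> real^'n \<Rightarrow> real^'n^'n" and os :: "real^'n \<Rightarrow> real^'n \<Rightarrow> real"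
  assumes S_linear: "linear (S F)" and L: "0 \<le> L"
    and S_lipschitz: "\<bar>S F G - S F' G\<bar> \<le> L * norm (F - F') * norm G"
    and B_per: "B (z + (2 * real N) *\<^sub>R axis k 1) c = B z c"
    and osc_nonneg: "\<lbrakk>z \<in> cells N; c \<in> tile_corners a; \<exists>x\<in>lattice_tile N z c. w x \<noteq> v x\<rbrakk> \<Longrightarrow> 0 \<le> os z c"
    and osc_bound: "\<lbrakk>z \<in> cells N; c \<in> tile_corners a; \<exists>x\<in>lattice_tile N z c. w x \<noteq> v x;
        z1 \<in> Zd; c1 \<in> tile_corners a; \<exists>x\<in>lattice_tile N z1 c1. w x \<noteq> v x; lattice_tile N z c \<inter> lattice_tile N z1 c1 \<noteq> {};
        z2 \<in> Zd; c2 \<in> tile_corners a; \<exists>x\<in>lattice_tile N z2 c2. w x \<noteq> v x; lattice_tile N z c \<inter> lattice_tile N z2 c2 \<noteq> {}\<rbrakk>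
        \<Longrightarrow> norm (B z1 c1 - B z2 c2) \<le> eps N * os z c"
begin

definition differs :: "real^'n \<Rightarrow> real^'n \<Rightarrow> bool" where
  "differs z c \<longleftrightarrow> (\<exists>x\<in>lattice_tile N z c. w x \<noteq> v x)"

text \<open>The tile whose stress represents the cell: one on which \<open>w\<close> and \<open>v\<close> differ, if the cell has such a
  tile. Otherwise \<open>w = v\<close> on the cell and any choice will do.\<close>

definition pick :: "real^'n \<Rightarrow> real^'n" where
  "pick z = (SOME c. c \<in> tile_corners a \<and> ((\<exists>c'\<in>tile_corners a. differs z c') \<longrightarrow> differs z c))"

lemma pick: "pick z \<in> tile_corners a" "c \<in> tile_corners a \<Longrightarrow> differs z c \<Longrightarrow> differs z (pick z)"
proof -
  have "tile_corners a \<noteq> {}" using tile_corners_obtain[OF a] by (metis insert_not_empty)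
  then have "\<exists>c. c \<in> tile_corners a \<and> ((\<exists>c'\<in>tile_corners a. differs z c') \<longrightarrow> differs z c)" by blast
  from someI_ex[OF this] show "pick z \<in> tile_corners a" "c \<in> tile_corners a \<Longrightarrow> differs z c \<Longrightarrow> differs z (pick z)"
    unfolding pick_def[symmetric] by blast+
qed

lemma differs_per: "differs (z + (2 * real N) *\<^sub>R axis k 1) = differs z"
proof (rule ext)
  fix c
  have sh: "x - 2 *\<^sub>R axis k 1 \<in> lattice_tile N z c \<longleftrightarrow> x \<in> lattice_tile N (z + (2 * real N) *\<^sub>R axis k 1) c" for x
    by (simp add: lattice_tile_def algebra_simps)
  have "w (x - 2 *\<^sub>R axis k 1) = w x" "v (x - 2 *\<^sub>R axis k 1) = v x" for x
    using w_per[OF twoZd_axis(2), of x k] v_per[OF twoZd_axis(2), of x k] by simp_all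
  then have "(\<exists>x\<in>lattice_tile N (z + (2 * real N) *\<^sub>R axis k 1) c. w x \<noteq> v x) \<longleftrightarrow> (\<exists>x\<in>lattice_tile N z c. w x \<noteq> v x)"
    using sh by (metis add_diff_cancel)
  then show "differs (z + (2 * real N) *\<^sub>R axis k 1) c = differs z c" unfolding differs_def .
qed

lemma pick_per: "pick (z + (2 * real N) *\<^sub>R axis k 1) = pick z"
  by (simp add: pick_def differs_per)

lemma corner: "c \<in> tile_corners a \<Longrightarrow> c \<in> unit_corners"
  using tile_corners_subset by blast

lemma tiles_of_cell_touch:
  assumes "c \<in> tile_corners a" "c' \<in> tile_corners a"
  shows "lattice_tile N z c \<inter> lattice_tile N z c' \<noteq> {}"
proof -
  obtain c0 where c0: "c0 \<in> unit_corners" "tile_corners a = {c0, 1 - c0}"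
    using tile_corners_obtain[OF a] by metis
  define x where "x = eps N *\<^sub>R (z + upd c0 i (1 - c0 $ i))"
  have c1: "1 - c0 \<in> unit_corners" using c0 corner by blast
  have b: "0 \<le> 1 - c0 $ k" "1 - c0 $ k \<le> 1" "0 \<le> c0 $ k" "c0 $ k \<le> 1" for k using unit_corners_nth[OF c0(1), of k] by auto
  have e: "upd c0 i (1 - c0 $ i) = upd (1 - c0) j (c0 $ j)" using ij by (simp add: vec_eq_ij)
  have "x \<in> lattice_tile N z c0" unfolding x_def by (rule edge_in_lattice_tile[OF N c0(1)]) (use b in auto)
  moreover have "x \<in> lattice_tile N z (1 - c0)" unfolding x_def e by (rule edge_in_lattice_tile[OF N c1]) (use b in auto)
  ultimately show ?thesis using assms c0(2) by auto
qed

text \<open>All tiles of the cell below a face meet the tile that lies above the face and contains it.\<close>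

lemma tiles_across_face_touch:
  assumes "c \<in> tile_corners a" "c $ i = 0" "c' \<in> tile_corners a"
  shows "lattice_tile N z c \<inter> lattice_tile N (z - axis i 1) c' \<noteq> {}"
proof -
  define x where "x = eps N *\<^sub>R (z + upd c j (c' $ j))"
  have "x \<in> lattice_tile N z c" unfolding x_def
    by (rule edge_in_lattice_tile[OF N corner[OF assms(1)]]) (use unit_corners_nth[OF corner[OF assms(3)], of j] in auto)
  moreover have e: "z + upd c j (c' $ j) = (z - axis i 1) + upd c' i 1"
    using ij assms(2) by (simp add: vec_eq_ij axis_def)
  have "x \<in> lattice_tile N (z - axis i 1) c'"
    unfolding x_def e by (rule edge_in_lattice_tile[OF N corner[OF assms(3)]]) auto
  ultimately show ?thesis by blast
qed

definition differing :: "((real^'n) \<times> (real^'n)) set" where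
  "differing = {(z, c). z \<in> cells N \<and> c \<in> tile_corners a \<and> differs z c}"

definition tile_area :: "(real^'n) \<times> (real^'n) \<Rightarrow> real" where
  "tile_area = (\<lambda>(z, c). measure lebesgue (lattice_tile N z c))"

lemma tile_area: "c \<in> tile_corners a \<Longrightarrow> tile_area (z, c) = (1 / N)\<^sup>2 / 2"
  using measure_lattice_tile[OF N corner] by (simp add: tile_area_def)

lemma finite_tile_corners: "finite (tile_corners a)"
  using tile_corners_obtain[OF a] by (metis finite.emptyI finite_insert)

lemma differing_subset: "differing \<subseteq> cells N \<times> tile_corners a"
  by (auto simp: differing_def)

lemma finite_differing: "finite differing"
  using differing_subset finite_cells finite_tile_corners by (meson finite_SigmaI finite_subset)

lemma differing_nonneg: "\<tau> \<in> differing \<Longrightarrow> 0 \<le> (\<lambda>(z, c). os z c) \<tau>"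
  by (auto simp: differing_def differs_def intro: osc_nonneg)

lemma tile_area_nonneg: "0 \<le> tile_area \<tau>"
  by (simp add: tile_area_def split: prod.split)

text \<open>After summation by parts the defect of a face is multiplied by the difference of the stresses of the
  two cells that share it. If the defect is nonzero, then \<open>w\<close> and \<open>v\<close> differ on the two tiles at the
  face, so the stresses of both cells are those of tiles in the patch of the tile on one side. The
  factor 2 arises since this tile has half the area of a cell.\<close>

lemma face_part_bound:
  assumes p: "1 \<le> p" and unit: "(\<Sum>T\<in>Th. measure lebesgue T * growth (conj_exponent p) (A T $ l $ j)) \<le> unit_level (conj_exponent p)"
  shows "\<bar>\<Sum>z\<in>cells N. S (B z (pick z)) (axis l (axis i 1)) * (face_defect (z + axis i 1) l - face_defect z l)\<bar>
    \<le> 2 * L * eps N * weighted_norm p differing tile_area (\<lambda>(z, c). os z c)"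
proof -
  define s where "s z = S (B z (pick z)) (axis l (axis i 1))" for z
  let ?e = "axis i 1 :: real^'n"
  let ?q = "conj_exponent p"
  interpret \<phi>: even_convex "growth ?q" by (rule even_convex_growth[OF conj_exponent_ge_1[OF p]])
  obtain c0 where c0: "c0 \<in> unit_corners" "tile_corners a = {c0, 1 - c0}" "c0 $ i = 0"
    using tile_corners_obtain[OF a] by metis
  have ne: "c0 \<noteq> 1 - c0" by (rule corner_ne_opposite[OF c0(1)])
  have c0m: "c0 \<in> tile_corners a" "1 - c0 \<in> tile_corners a" using c0(2) by auto
  have s_per: "s (z + (2 * real N) *\<^sub>R ?e) = s z" for z by (simp add: s_def B_per pick_per)
  have "(\<Sum>z\<in>cells N. s ((z + ?e) - ?e) * face_defect (z + ?e) l) = (\<Sum>z\<in>cells N. s (z - ?e) * face_defect z l)"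
  proof (rule sum_cells_shift)
    fix z :: "real^'n"
    have "z + (2 * real N) *\<^sub>R ?e - ?e = (z - ?e) + (2 * real N) *\<^sub>R ?e" by simp
    then show "s (z + (2 * real N) *\<^sub>R ?e - ?e) * face_defect (z + (2 * real N) *\<^sub>R ?e) l = s (z - ?e) * face_defect z l"
      using s_per face_defect_per by metis
  qed
  \<comment> \<open>Summation by parts: there are no boundary terms, by periodicity.\<close>
  then have abel: "(\<Sum>z\<in>cells N. s z * (face_defect (z + ?e) l - face_defect z l)) =
      (\<Sum>z\<in>cells N. (s (z - ?e) - s z) * face_defect z l)"
    by (simp add: right_diff_distrib left_diff_distrib sum_subtractf)
  define b where "b = (\<lambda>(z, c). if c = c0 then (real N)\<^sup>2 * \<bar>face_defect z l\<bar> else 0)"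
  define Z where "Z = {z \<in> cells N. face_defect z l \<noteq> 0}"
  have Z: "differs z c0" "differs (z - ?e) (1 - c0)" if "z \<in> Z" for z
  proof -
    have "1 - c0 \<in> unit_corners" "(1 - c0) $ i = 1" using corner[OF c0m(2)] c0(3) by auto
    then show "differs z c0" "differs (z - ?e) (1 - c0)"
      using face_defect_eq_0[OF c0(1), of z l] face_defect_eq_0[of "1 - c0" z l] that c0(3)
      by (auto simp: differs_def Z_def)
  qed
  have ax: "?e \<in> Zd" by (auto simp: Zd_def axis_def)
  have term_le: "\<bar>(s (z - ?e) - s z) * face_defect z l\<bar> \<le> (2 * L * eps N) * (tile_area (z, c0) * (os z c0 * b (z, c0)))"
    if z: "z \<in> Z" for z
  proof -
    have zc: "z \<in> cells N" and zZ: "z \<in> Zd" using z by (auto simp: Z_def cells_def)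
    have d1: "differs z (pick z)" "differs (z - ?e) (pick (z - ?e))"
      using pick(2) c0m Z[OF z] by blast+
    have "norm (B (z - ?e) (pick (z - ?e)) - B z (pick z)) \<le> eps N * os z c0"
      using zc c0m(1) Z(1)[OF z] d1 Zd_diff[OF zZ ax] zZ pick(1)
        tiles_across_face_touch[OF c0m(1) c0(3) pick(1)] tiles_of_cell_touch[OF c0m(1) pick(1)]
      unfolding differs_def by (intro osc_bound) auto
    then have "L * norm (B (z - ?e) (pick (z - ?e)) - B z (pick z)) \<le> L * (eps N * os z c0)"
      using L by (rule mult_left_mono)
    then have "\<bar>s (z - ?e) - s z\<bar> \<le> L * (eps N * os z c0) * 1"
      unfolding s_def by (intro order_trans[OF S_lipschitz]) (simp add: norm_matrix_unit)
    then have "\<bar>(s (z - ?e) - s z) * face_defect z l\<bar> \<le> (L * (eps N * os z c0) * 1) * \<bar>face_defect z l\<bar>"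
      unfolding abs_mult by (rule mult_right_mono) simp
    also have "\<dots> = (2 * L * eps N) * (tile_area (z, c0) * (os z c0 * b (z, c0)))"
      using N by (simp add: tile_area[OF c0m(1)] b_def power2_eq_square)
    finally show ?thesis .
  qed
  have "(\<Sum>z\<in>Z. tile_area (z, c0) * (os z c0 * b (z, c0))) =
      (\<Sum>\<tau>\<in>(\<lambda>z. (z, c0)) ` Z. tile_area \<tau> * ((\<lambda>(z, c). os z c) \<tau> * b \<tau>))"
    by (subst sum.reindex) (auto simp: inj_on_def)
  also have "\<dots> \<le> (\<Sum>\<tau>\<in>differing. tile_area \<tau> * ((\<lambda>(z, c). os z c) \<tau> * b \<tau>))"
  proof (rule sum_mono2[OF finite_differing])
    show "(\<lambda>z. (z, c0)) ` Z \<subseteq> differing" using Z(1) c0m(1) by (auto simp: differing_def Z_def)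
    show "0 \<le> tile_area \<tau> * ((\<lambda>(z, c). os z c) \<tau> * b \<tau>)" if "\<tau> \<in> differing - (\<lambda>z. (z, c0)) ` Z" for \<tau>
      using that by (auto simp: differing_def differs_def tile_area_def b_def intro!: mult_nonneg_nonneg intro: osc_nonneg)
  qed
  also have "\<dots> \<le> weighted_norm p differing tile_area (\<lambda>(z, c). os z c)"
  proof (rule weighted_hoelder[OF p finite_differing])
    have "(\<Sum>\<tau>\<in>differing. tile_area \<tau> * growth ?q (b \<tau>)) \<le> (\<Sum>\<tau>\<in>cells N \<times> tile_corners a. tile_area \<tau> * growth ?q (b \<tau>))"
      using differing_subset finite_cells finite_tile_corners \<phi>.\<phi>_nonneg
      by (intro sum_mono2) (auto simp: tile_area_def)
    also have "\<dots> = (\<Sum>z\<in>cells N. \<Sum>c\<in>tile_corners a. tile_area (z, c) * growth ?q (b (z, c)))"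
      by (simp add: sum.cartesian_product)
    also have "\<dots> = (\<Sum>z\<in>cells N. (1 / N)\<^sup>2 / 2 * growth ?q ((real N)\<^sup>2 * face_defect z l))"
      using ne c0m \<phi>.\<phi>_0 \<phi>.\<phi>_abs[of "(real N)\<^sup>2 * face_defect z l" for z]
      by (simp add: c0(2) tile_area b_def abs_mult del: \<phi>.\<phi>_abs)
    also have "\<dots> \<le> (\<Sum>z\<in>cells N. (1 / N)\<^sup>2 * growth ?q ((real N)\<^sup>2 * face_defect z l))"
      using \<phi>.\<phi>_nonneg by (intro sum_mono mult_right_mono) auto
    also have "\<dots> \<le> (\<Sum>T\<in>Th. measure lebesgue T * growth ?q (A T $ l $ j))"
      by (rule face_defect_sum_bound) (rule \<phi>.even_convex_axioms)
    finally show "(\<Sum>\<tau>\<in>differing. tile_area \<tau> * growth ?q (b \<tau>)) \<le> unit_level ?q" using unit by simp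
  qed (use tile_area_nonneg differing_nonneg in \<open>auto simp: b_def\<close>)
  finally have X: "(\<Sum>z\<in>Z. tile_area (z, c0) * (os z c0 * b (z, c0))) \<le> weighted_norm p differing tile_area (\<lambda>(z, c). os z c)" .
  have "\<bar>\<Sum>z\<in>cells N. (s (z - ?e) - s z) * face_defect z l\<bar> \<le> (\<Sum>z\<in>cells N. \<bar>(s (z - ?e) - s z) * face_defect z l\<bar>)"
    by (rule sum_abs)
  also have "\<dots> = (\<Sum>z\<in>Z. \<bar>(s (z - ?e) - s z) * face_defect z l\<bar>)"
    by (rule sum.mono_neutral_right) (auto simp: Z_def finite_cells)
  also have "\<dots> \<le> (\<Sum>z\<in>Z. (2 * L * eps N) * (tile_area (z, c0) * (os z c0 * b (z, c0))))"
    by (rule sum_mono) (rule term_le)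
  also have "\<dots> = (2 * L * eps N) * (\<Sum>z\<in>Z. tile_area (z, c0) * (os z c0 * b (z, c0)))"
    by (simp add: sum_distrib_left)
  also have "\<dots> \<le> (2 * L * eps N) * weighted_norm p differing tile_area (\<lambda>(z, c). os z c)"
    using L by (intro mult_left_mono X) simp
  finally have "\<bar>\<Sum>z\<in>cells N. (s (z - ?e) - s z) * face_defect z l\<bar>
      \<le> (2 * L * eps N) * weighted_norm p differing tile_area (\<lambda>(z, c). os z c)" .
  then show ?thesis using abel by (simp add: s_def)
qed

lemma overlap_gradient:
  assumes T: "T \<in> Th" and z: "z \<in> Zd" and c: "c \<in> tile_corners a"
    and eq: "\<And>x. x \<in> T \<inter> lattice_tile N z c \<Longrightarrow> w x = v x"
  shows "measure lebesgue (T \<inter> lattice_tile N z c) *\<^sub>R (A T - tile_grad N v z c) = 0"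
proof (cases "interior (T \<inter> lattice_tile N z c) = {}")
  case True
  have "convex (T \<inter> lattice_tile N z c)"
    using tilingD(3)[OF Th(1) T] convex_lattice_tile[OF N corner[OF c]] by (rule convex_Int)
  then have "negligible (T \<inter> lattice_tile N z c)" using True negligible_convex_interior by blast
  then show ?thesis by (simp add: negligible_imp_measure0)
next
  case False
  then obtain x where x: "x \<in> interior (T \<inter> lattice_tile N z c)" by blast
  obtain b where b: "\<And>x. x \<in> lattice_tile N z c \<Longrightarrow> v x = tile_grad N v z c *v x + b"
    using v_affine[OF z c] by blast
  have "jacobian w (at x) = A T" by (rule jacobian_affine_interior[OF _ x]) (use w_affine[OF T] in blast)
  moreover have "jacobian w (at x) = tile_grad N v z c"
    by (rule jacobian_affine_interior[OF _ x]) (use eq b in auto)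
  ultimately show ?thesis by simp
qed

definition tile_defect :: "real^'n \<Rightarrow> real^'n \<Rightarrow> real^'n^'n" where
  "tile_defect z c = (\<Sum>T\<in>Th. measure lebesgue (T \<inter> lattice_tile N z c) *\<^sub>R (A T - tile_grad N v z c))"

lemma measure_tile_split:
  assumes z: "z \<in> cells N" and c: "c \<in> tile_corners a"
  shows "measure lebesgue (lattice_tile N z c) = (\<Sum>T\<in>Th. measure lebesgue (T \<inter> lattice_tile N z c))"
proof (rule measure_tiling[OF Th(1)])
  have "(z, c) \<in> cells N \<times> tile_corners a" using assms by simp
  then have "lattice_tile N z c \<subseteq> cbox (-1) 1" unfolding lattice_tiles_cover[OF N a] by blast
  then show "lattice_tile N z c \<subseteq> (\<Union>T\<in>Th. T)" using Th(2) by simp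
qed (use compact_lattice_tile[OF N corner[OF c]] convex_lattice_tile[OF N corner[OF c]] in auto)

lemma tile_defect_alt:
  assumes z: "z \<in> cells N" and c: "c \<in> tile_corners a"
  shows "tile_defect z c = (\<Sum>T\<in>Th. measure lebesgue (T \<inter> lattice_tile N z c) *\<^sub>R A T) -
    measure lebesgue (lattice_tile N z c) *\<^sub>R tile_grad N v z c"
  unfolding tile_defect_def measure_tile_split[OF assms]
  by (simp add: scaleR_diff_right sum_subtractf scaleR_sum_left)

lemma tile_defect_eq_0:
  assumes "z \<in> cells N" "c \<in> tile_corners a" "\<not> differs z c" shows "tile_defect z c = 0"
  unfolding tile_defect_def
  by (intro sum.neutral ballI overlap_gradient) (use assms in \<open>auto simp: differs_def cells_def\<close>)

text \<open>The mean of \<open>\<nabla>w\<close> over a tile is estimated by Jensen's inequality, \<open>\<nabla>v\<close> is constant there. The factor 8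
  counts the four entries of each of the two gradients.\<close>

lemma tile_part_bound:
  assumes p: "1 \<le> p"
    and unit: "\<And>l k. (\<Sum>T\<in>Th. measure lebesgue T * growth (conj_exponent p) (A T $ l $ k)) \<le> unit_level (conj_exponent p)"
    and grad_unit: "\<And>l k. (\<Sum>(z, c)\<in>cells N \<times> tile_corners a. measure lebesgue (lattice_tile N z c) *
        growth (conj_exponent p) (tile_grad N v z c $ l $ k)) \<le> unit_level (conj_exponent p)"
  shows "\<bar>\<Sum>(z, c)\<in>cells N \<times> tile_corners a. S (B z c) (tile_defect z c) - S (B z (pick z)) (tile_defect z c)\<bar>
    \<le> 8 * L * eps N * weighted_norm p differing tile_area (\<lambda>(z, c). os z c)"
proof -
  let ?q = "conj_exponent p"
  let ?X = "weighted_norm p differing tile_area (\<lambda>(z, c). os z c)"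
  interpret \<phi>: even_convex "growth ?q" by (rule even_convex_growth[OF conj_exponent_ge_1[OF p]])
  define m :: "(real^'n) set \<Rightarrow> (real^'n) \<times> (real^'n) \<Rightarrow> real" where "m T \<tau> = measure lebesgue (T \<inter> (case \<tau> of (z, c) \<Rightarrow> lattice_tile N z c))" for T \<tau>
  have m0: "0 \<le> m T \<tau>" for T \<tau> by (simp add: m_def)
  have area0: "0 < tile_area \<tau>" if "\<tau> \<in> cells N \<times> tile_corners a" for \<tau>
    using that N by (cases \<tau>) (simp add: tile_area)
  have m_sum: "(\<Sum>T\<in>Th. m T \<tau>) = tile_area \<tau>" if "\<tau> \<in> cells N \<times> tile_corners a" for \<tau>
    using that measure_tile_split by (cases \<tau>) (auto simp: m_def tile_area_def)
  define b1 where "b1 l k \<tau> = (\<Sum>T\<in>Th. m T \<tau> / tile_area \<tau> * \<bar>A T $ l $ k\<bar>)" for l k \<tau>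
  define b2 where "b2 l k = (\<lambda>(z, c). \<bar>tile_grad N v z c $ l $ k\<bar>)" for l k
  have b10: "0 \<le> b1 l k \<tau>" for l k \<tau>
    unfolding b1_def by (intro sum_nonneg mult_nonneg_nonneg divide_nonneg_nonneg m0) (auto simp: tile_area_def split: prod.splits)
  have finTh: "finite Th" by (rule tilingD[OF Th(1)])
  have finF: "finite ((cells N :: (real^'n) set) \<times> tile_corners a)" using finite_cells finite_tile_corners by simp
  have entry: "\<bar>tile_defect z c $ l $ k\<bar> \<le> tile_area (z, c) * (b1 l k (z, c) + b2 l k (z, c))"
    if zc: "(z, c) \<in> cells N \<times> tile_corners a" for z c l k
  proof -
    have "tile_defect z c $ l $ k = (\<Sum>T\<in>Th. m T (z, c) * A T $ l $ k) - tile_area (z, c) * tile_grad N v z c $ l $ k"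
      using zc by (simp add: tile_defect_alt m_def tile_area_def sum_component)
    also have "\<bar>\<dots>\<bar> \<le> (\<Sum>T\<in>Th. \<bar>m T (z, c) * A T $ l $ k\<bar>) + \<bar>tile_area (z, c) * tile_grad N v z c $ l $ k\<bar>"
      by (intro order_trans[OF abs_triangle_ineq4] add_mono sum_abs order_refl)
    also have "\<dots> = tile_area (z, c) * (b1 l k (z, c) + b2 l k (z, c))"
      using area0[OF zc] m0 by (simp add: b1_def b2_def abs_mult sum_distrib_left distrib_left mult.commute)
    finally show ?thesis .
  qed
  have unit1: "(\<Sum>\<tau>\<in>differing. tile_area \<tau> * growth ?q (b1 l k \<tau>)) \<le> unit_level ?q" for l k
  proof -
    have "(\<Sum>\<tau>\<in>differing. tile_area \<tau> * growth ?q (b1 l k \<tau>)) \<le> (\<Sum>\<tau>\<in>cells N \<times> tile_corners a. tile_area \<tau> * growth ?q (b1 l k \<tau>))"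
      using differing_subset finF \<phi>.\<phi>_nonneg less_imp_le[OF area0] by (intro sum_mono2) auto
    also have "\<dots> \<le> (\<Sum>\<tau>\<in>cells N \<times> tile_corners a. \<Sum>T\<in>Th. m T \<tau> * growth ?q (A T $ l $ k))"
    proof (rule sum_mono)
      fix \<tau> :: "(real^'n) \<times> (real^'n)" assume \<tau>: "\<tau> \<in> cells N \<times> tile_corners a"
      have "growth ?q (b1 l k \<tau>) \<le> (\<Sum>T\<in>Th. m T \<tau> / tile_area \<tau> * growth ?q \<bar>A T $ l $ k\<bar>)"
        unfolding b1_def using m0 area0[OF \<tau>] m_sum[OF \<tau>]
        by (intro \<phi>.\<phi>_jensen finTh) (auto simp: sum_divide_distrib[symmetric])
      then have "tile_area \<tau> * growth ?q (b1 l k \<tau>) \<le> tile_area \<tau> * (\<Sum>T\<in>Th. m T \<tau> / tile_area \<tau> * growth ?q \<bar>A T $ l $ k\<bar>)"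
        using area0[OF \<tau>] by (intro mult_left_mono) auto
      also have "\<dots> = (\<Sum>T\<in>Th. m T \<tau> * growth ?q (A T $ l $ k))"
        using area0[OF \<tau>] by (simp add: sum_distrib_left \<phi>.\<phi>_abs)
      finally show "tile_area \<tau> * growth ?q (b1 l k \<tau>) \<le> (\<Sum>T\<in>Th. m T \<tau> * growth ?q (A T $ l $ k))" .
    qed
    also have "\<dots> = (\<Sum>T\<in>Th. (\<Sum>\<tau>\<in>cells N \<times> tile_corners a. m T \<tau>) * growth ?q (A T $ l $ k))"
      by (subst sum.swap) (simp add: sum_distrib_right)
    also have "\<dots> = (\<Sum>T\<in>Th. measure lebesgue T * growth ?q (A T $ l $ k))"
    proof (rule sum.cong)
      fix T assume T: "T \<in> Th"
      have "measure lebesgue T = (\<Sum>\<tau>\<in>cells N \<times> tile_corners a. measure lebesgue ((case \<tau> of (z, c) \<Rightarrow> lattice_tile N z c) \<inter> T))"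
        by (rule measure_tiling[OF tiling_cells[OF N a]])
          (use tilingD[OF Th(1) ] T Th(2) in \<open>auto simp flip: lattice_tiles_cover[OF N a]\<close>)
      then show "(\<Sum>\<tau>\<in>cells N \<times> tile_corners a. m T \<tau>) * growth ?q (A T $ l $ k) = measure lebesgue T * growth ?q (A T $ l $ k)"
        by (simp add: m_def Int_commute)
    qed simp
    finally show ?thesis using unit[of l k] by linarith
  qed
  have unit2: "(\<Sum>\<tau>\<in>differing. tile_area \<tau> * growth ?q (b2 l k \<tau>)) \<le> unit_level ?q" for l k
  proof -
    have "(\<Sum>\<tau>\<in>differing. tile_area \<tau> * growth ?q (b2 l k \<tau>)) \<le> (\<Sum>\<tau>\<in>cells N \<times> tile_corners a. tile_area \<tau> * growth ?q (b2 l k \<tau>))"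
      using differing_subset finF \<phi>.\<phi>_nonneg less_imp_le[OF area0] by (intro sum_mono2) auto
    also have "\<dots> = (\<Sum>(z, c)\<in>cells N \<times> tile_corners a. measure lebesgue (lattice_tile N z c) * growth ?q (tile_grad N v z c $ l $ k))"
      by (intro sum.cong) (auto simp: b2_def tile_area_def \<phi>.\<phi>_abs)
    finally show ?thesis using grad_unit[of l k] by linarith
  qed
  have hb: "(\<Sum>\<tau>\<in>differing. tile_area \<tau> * ((\<lambda>(z, c). os z c) \<tau> * b \<tau>)) \<le> ?X"
    if "\<And>\<tau>. \<tau> \<in> differing \<Longrightarrow> 0 \<le> b \<tau>" "(\<Sum>\<tau>\<in>differing. tile_area \<tau> * growth ?q (b \<tau>)) \<le> unit_level ?q" for b
    by (rule weighted_hoelder[OF p finite_differing tile_area_nonneg differing_nonneg that])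
  have "\<bar>\<Sum>(z, c)\<in>cells N \<times> tile_corners a. S (B z c) (tile_defect z c) - S (B z (pick z)) (tile_defect z c)\<bar>
      = \<bar>\<Sum>(z, c)\<in>differing. S (B z c) (tile_defect z c) - S (B z (pick z)) (tile_defect z c)\<bar>"
  proof (rule arg_cong[where f = abs], rule sum.mono_neutral_right[OF finF differing_subset], clarify)
    fix z c assume "(z, c) \<notin> differing" "z \<in> cells N" "c \<in> tile_corners a"
    then have "tile_defect z c = 0" by (intro tile_defect_eq_0) (auto simp: differing_def)
    then show "S (B z c) (tile_defect z c) - S (B z (pick z)) (tile_defect z c) = 0"
      by (simp add: linear_0[OF S_linear])
  qed
  also have "\<dots> \<le> (\<Sum>(z, c)\<in>differing. \<bar>S (B z c) (tile_defect z c) - S (B z (pick z)) (tile_defect z c)\<bar>)"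
    by (rule order_trans[OF sum_abs]) (simp add: case_prod_unfold)
  also have "\<dots> \<le> (\<Sum>\<tau>\<in>differing. L * eps N * (\<Sum>l\<in>UNIV. \<Sum>k\<in>UNIV. tile_area \<tau> * ((\<lambda>(z, c). os z c) \<tau> * (b1 l k \<tau> + b2 l k \<tau>))))"
  proof (rule sum_mono)
    fix \<tau> assume \<tau>: "\<tau> \<in> differing"
    obtain z c where zc: "\<tau> = (z, c)" by (cases \<tau>)
    with \<tau> have z: "z \<in> cells N" "z \<in> Zd" and c: "c \<in> tile_corners a" and df: "differs z c" by (auto simp: differing_def cells_def)
    have "norm (B z c - B z (pick z)) \<le> eps N * os z c"
      using z c df pick(2)[OF c df] pick(1)[of z] tiles_of_cell_touch[OF c c] tiles_of_cell_touch[OF c pick(1)]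
      unfolding differs_def by (intro osc_bound) auto
    then have "\<bar>S (B z c) (tile_defect z c) - S (B z (pick z)) (tile_defect z c)\<bar> \<le> L * (eps N * os z c) * norm (tile_defect z c)"
      using L by (intro order_trans[OF S_lipschitz] mult_right_mono mult_left_mono) auto
    also have "\<dots> \<le> L * (eps N * os z c) * (\<Sum>l\<in>UNIV. \<Sum>k\<in>UNIV. tile_area (z, c) * (b1 l k (z, c) + b2 l k (z, c)))"
    proof (rule mult_left_mono)
      show "norm (tile_defect z c) \<le> (\<Sum>l\<in>UNIV. \<Sum>k\<in>UNIV. tile_area (z, c) * (b1 l k (z, c) + b2 l k (z, c)))"
        using z(1) c by (intro order_trans[OF norm_matrix_le_entries] sum_mono entry) simp
      show "0 \<le> L * (eps N * os z c)" using L osc_nonneg[OF z(1) c] df by (simp add: differs_def)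
    qed
    also have "\<dots> = L * eps N * (\<Sum>l\<in>UNIV. \<Sum>k\<in>UNIV. tile_area (z, c) * (os z c * (b1 l k (z, c) + b2 l k (z, c))))"
      by (simp add: sum_distrib_left mult_ac)
    finally show "(case \<tau> of (z, c) \<Rightarrow> \<bar>S (B z c) (tile_defect z c) - S (B z (pick z)) (tile_defect z c)\<bar>) \<le>
        L * eps N * (\<Sum>l\<in>UNIV. \<Sum>k\<in>UNIV. tile_area \<tau> * ((\<lambda>(z, c). os z c) \<tau> * (b1 l k \<tau> + b2 l k \<tau>)))"
      unfolding zc by simp
  qed
  also have "\<dots> = L * eps N * (\<Sum>l\<in>UNIV. \<Sum>k\<in>UNIV. \<Sum>\<tau>\<in>differing. tile_area \<tau> * ((\<lambda>(z, c). os z c) \<tau> * (b1 l k \<tau> + b2 l k \<tau>)))"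
    by (simp only: sum_distrib_left[symmetric] sum.swap[of _ differing UNIV])
  also have "\<dots> \<le> L * eps N * (\<Sum>l\<in>(UNIV::'n set). \<Sum>k\<in>(UNIV::'n set). 2 * ?X)"
  proof (intro mult_left_mono sum_mono)
    fix l k :: 'n
    have "(\<Sum>\<tau>\<in>differing. tile_area \<tau> * ((\<lambda>(z, c). os z c) \<tau> * (b1 l k \<tau> + b2 l k \<tau>))) =
      (\<Sum>\<tau>\<in>differing. tile_area \<tau> * ((\<lambda>(z, c). os z c) \<tau> * b1 l k \<tau>)) +
      (\<Sum>\<tau>\<in>differing. tile_area \<tau> * ((\<lambda>(z, c). os z c) \<tau> * b2 l k \<tau>))"
      by (simp add: distrib_left sum.distrib)
    also have "\<dots> \<le> ?X + ?X"
      by (intro add_mono hb unit1 unit2 b10) (auto simp: b2_def)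
    finally show "(\<Sum>\<tau>\<in>differing. tile_area \<tau> * ((\<lambda>(z, c). os z c) \<tau> * (b1 l k \<tau> + b2 l k \<tau>))) \<le> 2 * ?X" by simp
  qed (use L in auto)
  also have "\<dots> = 8 * L * eps N * ?X" unfolding sum_ij by simp
  finally show ?thesis .
qed

end

text \<open>With one stress per cell the defects of its two tiles add up to face defects, entry by entry; each
  of the four entries contributes 2 by \<open>face_part_bound\<close>, in the direction \<open>i\<close> or, with the roles of
  \<open>i\<close> and \<open>j\<close> exchanged, in the direction \<open>j\<close>. Together with the 8 from \<open>tile_part_bound\<close> this gives 16.\<close>

lemma (in coarse_fine_stress) consistency_error_bound:
  assumes p: "1 \<le> p"
    and unit: "\<And>l k. (\<Sum>T\<in>Th. measure lebesgue T * growth (conj_exponent p) (A T $ l $ k)) \<le> unit_level (conj_exponent p)"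
  shows "\<bar>\<Sum>(z, c)\<in>cells N \<times> tile_corners a. S (B z c) (tile_defect z c)\<bar>
    \<le> 16 * L * eps N * weighted_norm p differing tile_area (\<lambda>(z, c). os z c)"
proof -
  let ?q = "conj_exponent p"
  let ?X = "weighted_norm p differing tile_area (\<lambda>(z, c). os z c)"
  interpret sw: plane j i using ij all_ij by unfold_locales auto
  interpret sw: coarse_fine j i N a Th w v A d
    by unfold_locales (use N a Th polygons w_cont w_affine w_per v_P1 v_per v_eq_w in auto)
  interpret sw: coarse_fine_stress j i N a Th w v A d S L B os
    by unfold_locales
      (rule linear_add[OF S_linear], rule linear_scale[OF S_linear], rule L, rule S_lipschitz, rule B_per,
        rule osc_nonneg, assumption+, rule osc_bound, assumption+)
  have \<phi>: "even_convex (growth ?q)" by (rule even_convex_growth[OF conj_exponent_ge_1[OF p]])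
  have all: "k = i \<or> k = j" for k using all_ij by blast
  have gu: "(\<Sum>(z, c)\<in>cells N \<times> tile_corners a. measure lebesgue (lattice_tile N z c) *
        growth ?q (tile_grad N v z c $ l $ k)) \<le> unit_level ?q" for l k
    using tile_grad_entry_sum_bound[OF \<phi>, of l k] unit[of l k] by linarith
  define fd where "fd k = (if k = i then face_defect else sw.face_defect)" for k
  define H where "H z = (\<Sum>c\<in>tile_corners a. tile_defect z c)" for z
  have cell: "(\<Sum>T\<in>Th. A T $ l $ k * measure lebesgue (T \<inter> lattice_cell N z)) -
      (\<Sum>c\<in>tile_corners a. tile_grad N v z c $ l $ k * measure lebesgue (lattice_tile N z c)) = H z $ l $ k"
    if z: "z \<in> cells N" for z l k
  proof -
    have zZ: "z \<in> Zd" using z by (simp add: cells_def)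
    have tl: "tiling (tile_corners a) (lattice_tile N z)"
    proof -
      have "tiling ({z} \<times> tile_corners a) (\<lambda>(z, c). lattice_tile N z c)"
        by (rule tiling_lattice_tiles[OF N a]) (use zZ in auto)
      then show ?thesis unfolding tiling_def by (auto simp: finite_cartesian_product_iff)
    qed
    have "measure lebesgue (T \<inter> lattice_cell N z) = (\<Sum>c\<in>tile_corners a. measure lebesgue (T \<inter> lattice_tile N z c))"
      if "T \<in> Th" for T
    proof -
      have "measure lebesgue (T \<inter> lattice_cell N z) =
          (\<Sum>c\<in>tile_corners a. measure lebesgue (lattice_tile N z c \<inter> (T \<inter> lattice_cell N z)))"
      proof (rule measure_tiling[OF tl])
        show "compact (T \<inter> lattice_cell N z)" "convex (T \<inter> lattice_cell N z)"
          using tilingD(2,3)[OF Th(1) that] by (auto simp: lattice_cell_def intro: compact_Int convex_Int)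
      qed (use lattice_cell_eq_tiles[OF N a, of z] in blast)
      moreover have "lattice_tile N z c \<inter> (T \<inter> lattice_cell N z) = T \<inter> lattice_tile N z c" for c
        using lattice_tile_subset_cell[OF N, of z c] by blast
      ultimately show ?thesis by simp
    qed
    then have "(\<Sum>T\<in>Th. A T $ l $ k * measure lebesgue (T \<inter> lattice_cell N z)) =
        (\<Sum>T\<in>Th. \<Sum>c\<in>tile_corners a. A T $ l $ k * measure lebesgue (T \<inter> lattice_tile N z c))"
      by (simp add: sum_distrib_left)
    also have "\<dots> = (\<Sum>c\<in>tile_corners a. \<Sum>T\<in>Th. A T $ l $ k * measure lebesgue (T \<inter> lattice_tile N z c))"
      by (rule sum.swap)
    finally show ?thesis
      unfolding H_def using z by (simp add: tile_defect_alt sum_component sum_subtractf mult.commute)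
  qed
  have Hfd: "H z $ l $ k = fd k (z + axis k 1) l - fd k z l" if z: "z \<in> cells N" for z l k
    using all[of k] cell[OF z, of l k] cell_gradient_defect[OF z, of l] sw.cell_gradient_defect[OF z, of l] ij
    by (auto simp: fd_def)
  have part: "\<bar>\<Sum>z\<in>cells N. S (B z (pick z)) (axis l (axis k 1)) * (fd k (z + axis k 1) l - fd k z l)\<bar> \<le> 2 * L * eps N * ?X" for l k
    using all[of k] face_part_bound[OF p unit, of l] sw.face_part_bound[OF p unit, of l] ij by (auto simp: fd_def)
  have S_expand: "S F G = (\<Sum>l\<in>UNIV. \<Sum>k\<in>UNIV. S F (axis l (axis k 1)) * G $ l $ k)" for F G
  proof -
    interpret S: linear "S F" by (rule S_linear)
    have "S F G = S F (\<Sum>l\<in>UNIV. \<Sum>k\<in>UNIV. G $ l $ k *\<^sub>R axis l (axis k 1))" using matrix_eq_sum_units[of G] by simp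
    then show ?thesis by (simp add: S.sum S.scale mult.commute)
  qed
  have "(\<Sum>(z, c)\<in>cells N \<times> tile_corners a. S (B z (pick z)) (tile_defect z c)) =
      (\<Sum>z\<in>cells N. \<Sum>c\<in>tile_corners a. S (B z (pick z)) (tile_defect z c))"
    by (rule sum.cartesian_product[symmetric])
  also have "\<dots> = (\<Sum>z\<in>cells N. S (B z (pick z)) (H z))"
    by (simp add: H_def linear_sum[OF S_linear])
  also have "\<dots> = (\<Sum>z\<in>cells N. \<Sum>l\<in>UNIV. \<Sum>k\<in>UNIV. S (B z (pick z)) (axis l (axis k 1)) * (fd k (z + axis k 1) l - fd k z l))"
    by (intro sum.cong refl) (subst S_expand, simp add: Hfd)
  also have "\<dots> = (\<Sum>l\<in>UNIV. \<Sum>k\<in>UNIV. \<Sum>z\<in>cells N. S (B z (pick z)) (axis l (axis k 1)) * (fd k (z + axis k 1) l - fd k z l))"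
    by (simp only: sum.swap[of _ "cells N" UNIV])
  also have "\<bar>\<dots>\<bar> \<le> (\<Sum>l\<in>(UNIV::'n set). \<Sum>k\<in>(UNIV::'n set). 2 * L * eps N * ?X)"
    by (rule order_trans[OF sum_abs], rule sum_mono, rule order_trans[OF sum_abs], rule sum_mono, rule part)
  also have "\<dots> = 8 * L * eps N * ?X" unfolding sum_ij by simp
  finally have faces: "\<bar>\<Sum>(z, c)\<in>cells N \<times> tile_corners a. S (B z (pick z)) (tile_defect z c)\<bar> \<le> 8 * L * eps N * ?X" .
  have "(\<Sum>(z, c)\<in>cells N \<times> tile_corners a. S (B z c) (tile_defect z c)) =
      (\<Sum>(z, c)\<in>cells N \<times> tile_corners a. S (B z (pick z)) (tile_defect z c)) +
      (\<Sum>(z, c)\<in>cells N \<times> tile_corners a. S (B z c) (tile_defect z c) - S (B z (pick z)) (tile_defect z c))"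
    by (simp add: sum.distrib[symmetric] case_prod_unfold)
  then show ?thesis using faces tile_part_bound[OF p unit gu] by linarith
qed

section \<open>First variations of the energies\<close>

lemma Dq_add_scaleR: "Dq N r (\<lambda>x. y x + t *\<^sub>R z x) x = Dq N r y x + t *\<^sub>R Dq N r z x"
  by (simp add: Dq_def algebra_simps)

lemma Dq_scaleR: "Dq N r (\<lambda>x. s *\<^sub>R z x) x = s *\<^sub>R Dq N r z x"
  by (simp add: Dq_def algebra_simps)

definition site_variation where
  "site_variation N X R V y z = eps N ^ CARD('n::finite) *
     (\<Sum>x\<in>X. \<Sum>r\<in>R. pgrad V r (\<lambda>r\<in>R. Dq N r y x) \<bullet> (Dq N r z x :: real^'n))"

definition bond_variation where
  "bond_variation N R Ti Ei y z = eps N ^ CARD('n::finite) *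
     (\<Sum>b\<in>interface_bonds N R Ti. pgrad Ei b
        (restrict (\<lambda>(x, x'). Dq N ((1 / eps N) *\<^sub>R (x' - x)) y x) (interface_bonds N R Ti)) \<bullet>
        (\<lambda>(x, x'). Dq N ((1 / eps N) *\<^sub>R (x' - x)) z x :: real^'n) b)"

lemma site_energy_derivative:
  fixes y z :: "real^'n \<Rightarrow> real^'n"
  assumes "C2_family R V" "finite R"
  shows "((\<lambda>t. eps N ^ CARD('n) * (\<Sum>x\<in>X. V (\<lambda>r\<in>R. Dq N r (\<lambda>x. y x + t *\<^sub>R z x) x)))
    has_real_derivative site_variation N X R V y z) (at 0)"
  unfolding site_variation_def Dq_add_scaleR
  by (intro DERIV_cmult DERIV_sum)
    (use C2_family_derivative_line[OF assms, of "\<lambda>r. Dq N r y x" "\<lambda>r. Dq N r z x" 0 for x] in simp)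

lemma bond_energy_derivative:
  fixes y z :: "real^'n \<Rightarrow> real^'n"
  assumes "C2_family (interface_bonds N R Ti) Ei" "finite (interface_bonds N R Ti)"
  shows "((\<lambda>t. E_int N R Ti Ei (\<lambda>x. y x + t *\<^sub>R z x))
    has_real_derivative bond_variation N R Ti Ei y z) (at 0)"
proof -
  let ?b = "interface_bonds N R Ti"
  let ?g = "\<lambda>y. \<lambda>(x, x'). Dq N ((1 / eps N) *\<^sub>R (x' - x)) y x :: real^'n"
  have "restrict (?g (\<lambda>x. y x + t *\<^sub>R z x)) ?b = (\<lambda>b\<in>?b. ?g y b + t *\<^sub>R ?g z b)" for t
    by (auto simp: fun_eq_iff restrict_def Dq_add_scaleR)
  then show ?thesis
    using C2_family_derivative_line[OF assms, of "?g y" "?g z" 0]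
    unfolding E_int_def bond_variation_def by (intro DERIV_cmult) simp
qed

lemma E_ac_derivative:
  fixes y z :: "real^'n \<Rightarrow> real^'n"
  assumes V: "C2_family R V" "finite R" and Ei: "C2_family (interface_bonds N R Ti) Ei" "finite (interface_bonds N R Ti)"
    and cont: "\<And>t. (LINT x : \<Union>Tc | lebesgue. Wcb R V (grad (\<lambda>x. y x + t *\<^sub>R z x) x)) =
      (\<Sum>p\<in>P. \<mu> p * Wcb R V (F p + t *\<^sub>R G p))"
  shows "((\<lambda>t. E_ac N R V Ta Ti Tc Ei (\<lambda>x. y x + t *\<^sub>R z x)) has_real_derivative
    (\<Sum>p\<in>P. \<mu> p * stress R V (F p) (G p)) + site_variation N (atomistic_sites N R Ta) R V y z +
      bond_variation N R Ti Ei y z) (at 0)"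
  unfolding E_ac_def cont
  by (intro DERIV_add DERIV_sum DERIV_cmult Wcb_derivative[OF V] site_energy_derivative[OF V] bond_energy_derivative[OF Ei])

lemma E_a_derivative:
  fixes y z :: "real^'n \<Rightarrow> real^'n"
  assumes "C2_family R V" "finite R"
  shows "((\<lambda>t. E_a N R V (\<lambda>x. y x + t *\<^sub>R z x)) has_real_derivative site_variation N (lattice N) R V y z) (at 0)"
  unfolding E_a_def by (rule site_energy_derivative[OF assms])

lemma per_lattice_bond:
  assumes "x \<in> lattice N" "r \<in> Zd" shows "x \<in> per_lattice N" "x + eps N *\<^sub>R r \<in> per_lattice N"
proof -
  obtain z where z: "x = eps N *\<^sub>R z" "z \<in> Zd" using assms(1) by (auto simp: lattice_def)
  then show "x \<in> per_lattice N" by (auto simp: per_lattice_def)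
  have "x + eps N *\<^sub>R r = eps N *\<^sub>R (z + r)" using z by (simp add: algebra_simps)
  then show "x + eps N *\<^sub>R r \<in> per_lattice N" using Zd_add[OF z(2) assms(2)] by (auto simp: per_lattice_def)
qed

lemma site_variation_cong:
  assumes "X \<subseteq> lattice N" "R \<subseteq> Zd" "\<And>x. x \<in> per_lattice N \<Longrightarrow> z x = z' x"
  shows "site_variation N X R V y z = site_variation N X R V y z'"
proof -
  have "Dq N r z x = Dq N r z' x" if "x \<in> X" "r \<in> R" for x r
  proof -
    have "x \<in> lattice N" "r \<in> Zd" using that assms(1,2) by blast+
    from per_lattice_bond[OF this] show ?thesis using assms(3) by (simp add: Dq_def)
  qed
  then show ?thesis
    unfolding site_variation_def by (intro arg_cong2[where f = "(*)"] sum.cong refl) simp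
qed

lemma bond_variation_cong:
  assumes N: "1 \<le> N" and "R \<subseteq> Zd" "\<And>x. x \<in> per_lattice N \<Longrightarrow> z x = z' x"
  shows "bond_variation N R Ti Ei y z = bond_variation N R Ti Ei y z'"
proof -
  have "Dq N ((1 / eps N) *\<^sub>R (x' - x)) z x = Dq N ((1 / eps N) *\<^sub>R (x' - x)) z' x"
    if b: "(x, x') \<in> interface_bonds N R Ti" for x x'
  proof -
    obtain r where r: "x \<in> lattice N" "r \<in> R" "x' = x + eps N *\<^sub>R r"
      using b unfolding interface_bonds_def by blast
    then have "x \<in> per_lattice N" "x + eps N *\<^sub>R r \<in> per_lattice N" using per_lattice_bond assms(2) by blast+
    then show ?thesis using r(3) assms(3) N by (simp add: Dq_def)
  qed
  then show ?thesis
    unfolding bond_variation_def by (intro arg_cong2[where f = "(*)"] sum.cong refl) auto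
qed

lemma site_variation_scaleR: "site_variation N X R V y (\<lambda>x. s *\<^sub>R z x) = s * site_variation N X R V y z"
  by (simp add: site_variation_def Dq_scaleR sum_distrib_left mult_ac)

lemma bond_variation_scaleR: "bond_variation N R Ti Ei y (\<lambda>x. s *\<^sub>R z x) = s * bond_variation N R Ti Ei y z"
  by (simp add: bond_variation_def Dq_scaleR sum_distrib_left case_prod_unfold mult_ac)

lemma tiling_product:
  assumes "tiling P T" "tiling Q U"
  shows "tiling (P \<times> Q) (\<lambda>(p, q). T p \<inter> U q)"
proof -
  have "negligible ((T p \<inter> U q) \<inter> (T p' \<inter> U q'))" if "p \<in> P" "p' \<in> P" "q \<in> Q" "q' \<in> Q" "(p, q) \<noteq> (p', q')" for p p' q q'
  proof (cases "p = p'")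
    case True
    then have "negligible (U q \<inter> U q')" using that tilingD(4)[OF assms(2)] by auto
    then show ?thesis by (rule negligible_subset) auto
  next
    case False
    then have "negligible (T p \<inter> T p')" using that tilingD(4)[OF assms(1)] by auto
    then show ?thesis by (rule negligible_subset) auto
  qed
  then show ?thesis
    using assms unfolding tiling_def by (auto intro: compact_Int convex_Int)
qed

section \<open>Periodicity of the interpolants\<close>

lemma P1_translate:
  fixes w :: "real^'n \<Rightarrow> real^'n"
  assumes w: "P1 \<T> w" and inv: "\<And>T. T \<in> \<T> \<Longrightarrow> (\<lambda>x. \<xi> + x) ` T \<in> \<T>"
  shows "P1 \<T> (\<lambda>x. w (x + \<xi>) + k)"
  unfolding P1_def
proof (intro conjI ballI)
  have "continuous_on UNIV w" using w by (simp add: P1_def)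
  then show "continuous_on UNIV (\<lambda>x. w (x + \<xi>) + k)"
  proof (intro continuous_on_add continuous_on_const)
    assume "continuous_on UNIV w"
    then show "continuous_on UNIV (\<lambda>x. w (x + \<xi>))"
      by (rule continuous_on_compose2[where g = w and s = UNIV and f = "\<lambda>x. x + \<xi>"]) (simp_all add: continuous_on_add)
  qed
  fix T assume T: "T \<in> \<T>"
  have "\<forall>T\<in>\<T>. \<exists>(A :: real^'n^'n) b. \<forall>x\<in>T. w x = A *v x + b" using w by (simp add: P1_def)
  from bspec[OF this inv[OF T]] obtain A :: "real^'n^'n" and b
    where A: "\<forall>x\<in>(\<lambda>x. \<xi> + x) ` T. w x = A *v x + b" by (elim exE)
  have "w (x + \<xi>) + k = A *v x + (A *v \<xi> + b + k)" if "x \<in> T" for x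
  proof -
    have "w (\<xi> + x) = A *v (\<xi> + x) + b" by (rule bspec[OF A imageI[OF that]])
    then show ?thesis by (simp add: add.commute[of x \<xi>] matrix_vector_right_distrib)
  qed
  then show "\<exists>(A :: real^'n^'n) b. \<forall>x\<in>T. w (x + \<xi>) + k = A *v x + b" by blast
qed

lemma twoZd_add: "x \<in> twoZd \<Longrightarrow> y \<in> twoZd \<Longrightarrow> x + y \<in> twoZd"
proof -
  assume "x \<in> twoZd" "y \<in> twoZd"
  then obtain z z' where "x = 2 *\<^sub>R z" "z \<in> Zd" "y = 2 *\<^sub>R z'" "z' \<in> Zd" by (auto simp: twoZd_def)
  then have "x + y = 2 *\<^sub>R (z + z')" "z + z' \<in> Zd" by (auto simp: scaleR_add_right Zd_add)
  then show ?thesis by (auto simp: twoZd_def)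
qed

lemma zero_in_twoZd: "0 \<in> twoZd"
  by (auto simp: twoZd_def Zd_def intro: exI[of _ 0])

lemma periodize_mesh_translate:
  assumes "\<xi> \<in> twoZd" "T \<in> periodize_mesh \<T>" shows "(\<lambda>x. \<xi> + x) ` T \<in> periodize_mesh \<T>"
proof -
  obtain \<xi>' T' where T: "T = (\<lambda>x. \<xi>' + x) ` T'" "\<xi>' \<in> twoZd" "T' \<in> \<T>" using assms(2) by (auto simp: periodize_mesh_def)
  have "(\<lambda>x. \<xi> + x) ` T = (\<lambda>x. (\<xi> + \<xi>') + x) ` T'" unfolding T(1) image_image by (simp add: add.assoc)
  then show ?thesis using twoZd_add[OF assms(1) T(2)] T(3) by (auto simp: periodize_mesh_def)
qed

lemma periodize_mesh_subset: "\<T> \<subseteq> periodize_mesh \<T>"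
  using zero_in_twoZd by (force simp: periodize_mesh_def)

lemma per_fine_mesh_translate:
  assumes N: "1 \<le> N" and "\<xi> \<in> twoZd" "T \<in> per_fine_mesh N K" shows "(\<lambda>x. \<xi> + x) ` T \<in> per_fine_mesh N K"
proof -
  obtain \<xi>' T' where T: "T = (\<lambda>x. \<xi>' + eps N *\<^sub>R x) ` T'" "\<xi>' \<in> per_lattice N" "T' \<in> K" using assms(3) by (auto simp: per_fine_mesh_def)
  have "(\<lambda>x. \<xi> + x) ` T = (\<lambda>x. (\<xi> + \<xi>') + eps N *\<^sub>R x) ` T'" unfolding T(1) image_image by (simp add: add.assoc)
  then show ?thesis using per_lattice_translate[OF N T(2) assms(2)] T(3) by (auto simp: per_fine_mesh_def)
qed

context plane
begin

lemma cells_representative: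
  fixes z :: "real^'n"
  assumes N: "1 \<le> N" and z: "z \<in> Zd"
  obtains z0 k where "z0 \<in> cells N" "k \<in> Zd" "z = z0 + (2 * real N) *\<^sub>R k"
proof -
  have "\<exists>m q :: int. z $ l = of_int m + 2 * real N * of_int q \<and> - int N \<le> m \<and> m \<le> int N - 1" for l
  proof -
    have "z $ l \<in> \<int>" using z by (simp add: Zd_def)
    then obtain n where n: "z $ l = of_int n" by (rule Ints_cases)
    define q where "q = (n + int N) div (2 * int N)"
    define m where "m = (n + int N) mod (2 * int N) - int N"
    have "n + int N = 2 * int N * q + (m + int N)" unfolding q_def m_def by simp
    then have "n = m + 2 * int N * q" by simp
    then have "real_of_int n = real_of_int (m + 2 * int N * q)" by (simp only:)
    then have "z $ l = of_int m + 2 * real N * of_int q" using n by simp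
    moreover have "- int N \<le> m" "m \<le> int N - 1" using N pos_mod_bound[of "2 * int N" "n + int N"] by (simp_all add: m_def)
    ultimately show ?thesis by blast
  qed
  then obtain m q where mq: "\<And>l. z $ l = of_int (m l) + 2 * real N * of_int (q l)" "\<And>l. - int N \<le> m l" "\<And>l. m l \<le> int N - 1"
    by metis
  show thesis
  proof (rule that[of "\<chi> l. of_int (m l)" "\<chi> l. of_int (q l)"])
    have "real_of_int (- int N) \<le> of_int (m l)" "real_of_int (m l) \<le> of_int (int N - 1)" for l
      using mq(2,3)[of l] by (simp_all only: of_int_le_iff)
    then show "(\<chi> l. of_int (m l)) \<in> cells N" by (simp add: cells_def Zd_def)
    show "(\<chi> l. of_int (q l)) \<in> Zd" by (simp add: Zd_def)
    show "z = (\<chi> l. of_int (m l)) + (2 * real N) *\<^sub>R (\<chi> l. of_int (q l))" using mq(1) by (simp add: vec_eq_iff)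
  qed
qed

lemma lattice_tile_translate:
  assumes "1 \<le> N"
  shows "lattice_tile N (z + (2 * real N) *\<^sub>R k) c = (\<lambda>x. 2 *\<^sub>R k + x) ` lattice_tile N z c"
proof (intro equalityI subsetI)
  fix x assume "x \<in> lattice_tile N (z + (2 * real N) *\<^sub>R k) c"
  then have "x - 2 *\<^sub>R k \<in> lattice_tile N z c" by (simp add: lattice_tile_def algebra_simps)
  then show "x \<in> (\<lambda>x. 2 *\<^sub>R k + x) ` lattice_tile N z c" by (intro image_eqI[of _ _ "x - 2 *\<^sub>R k"]) auto
qed (auto simp: lattice_tile_def algebra_simps)

lemma finite_lattice: "finite (lattice N :: (real^'n) set)"
proof -
  have "lattice N \<subseteq> (\<lambda>z. eps N *\<^sub>R z) ` {z \<in> Zd. \<forall>l. \<bar>z $ l - (0::real^'n) $ l\<bar> \<le> real N}"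
  proof
    fix x :: "real^'n" assume "x \<in> lattice N"
    then obtain z where z: "x = eps N *\<^sub>R z" "z \<in> Zd" "\<And>l. - real N + 1 \<le> z $ l \<and> z $ l \<le> real N"
      unfolding lattice_def by blast
    have "\<bar>z $ l\<bar> \<le> real N" for l using z(3)[of l] by linarith
    then show "x \<in> (\<lambda>z. eps N *\<^sub>R z) ` {z \<in> Zd. \<forall>l. \<bar>z $ l - (0::real^'n) $ l\<bar> \<le> real N}" using z by auto
  qed
  then show ?thesis using finite_near_Zd finite_surj by blast
qed

lemma countable_Zd: "countable (Zd :: (real^'n) set)"
proof -
  have "Zd \<subseteq> (\<Union>M. cells M :: (real^'n) set)"
  proof
    fix z :: "real^'n" assume z: "z \<in> Zd"
    obtain M :: nat where M: "\<bar>z $ i\<bar> + 1 \<le> real M" "\<bar>z $ j\<bar> + 1 \<le> real M"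
      by (metis max.bounded_iff real_arch_simple)
    have "\<bar>z $ l\<bar> + 1 \<le> real M" for l using M ex_ij[of "\<lambda>l. \<bar>z $ l\<bar> + 1 \<le> real M"] by blast
    then have "- real M \<le> z $ l \<and> z $ l \<le> real M - 1" for l by (smt (verit))
    then show "z \<in> (\<Union>M. cells M)" using z by (auto simp: cells_def)
  qed
  then show ?thesis using countable_subset finite_cells by (metis countable_UN countable_finite countableI_type)
qed

end

section \<open>The coupled model in the plane\<close>

context ac_setting
begin

lemma M_nonneg: "r \<in> R \<Longrightarrow> s \<in> R \<Longrightarrow> 0 \<le> M r s"
proof -
  assume rs: "r \<in> R" "s \<in> R"
  have "onorm (\<lambda>h. phess V r s (\<lambda>r\<in>R. 0) *v h) \<le> M r s" using rs by (intro V_bound) auto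
  then show ?thesis using onorm_pos_le[OF matrix_vector_mul_bounded_linear, of "phess V r s (\<lambda>r\<in>R. 0)"] by linarith
qed

lemma M_total_nonneg: "0 \<le> M_total R M"
  unfolding M_total_def by (intro sum_nonneg mult_nonneg_nonneg M_nonneg) auto

end

locale ac_plane = plane i j + ac_setting N K R V M Ta Ti Tc Ei
  for i j :: "'n::finite" and N and K :: "(real^'n) set set" and R V M Ta Ti Tc Ei +
  fixes a :: "real^'n" and y :: "real^'n \<Rightarrow> real^'n"
  assumes a: "a \<in> unit_corners" and K_eq: "K = corner_tile ` tile_corners a"
    and interface_fine: "Ta \<union> Ti \<subseteq> fine_mesh N K" and y: "y \<in> deformations N"
begin

abbreviation fineM :: "(real^'n) set set" where "fineM \<equiv> per_fine_mesh N K"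
abbreviation coarseM :: "(real^'n) set set" where "coarseM \<equiv> Ta \<union> Ti \<union> Tc"
abbreviation tiles :: "((real^'n) \<times> (real^'n)) set" where "tiles \<equiv> cells N \<times> tile_corners a"
abbreviation tile :: "(real^'n) \<times> (real^'n) \<Rightarrow> (real^'n) set" where "tile \<equiv> (\<lambda>(z, c). lattice_tile N z c)"

lemmas N = N_pos

lemma corner: "c \<in> tile_corners a \<Longrightarrow> c \<in> unit_corners"
  using tile_corners_subset by blast

lemma finite_tile_corners: "finite (tile_corners a)"
  using tile_corners_obtain[OF a] by (metis finite.emptyI finite_insert)

lemma coarse_tiling: "tiling coarseM (\<lambda>T. T)"
  by (rule triangulation_tiling[OF N Th_triangulation Th_vertices])

lemma coarse_cover: "\<Union>coarseM = cbox (-1) 1"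
  using Th_triangulation by (simp add: regular_triangulation_def closure_Omega)

lemma coarse_polygons: "T \<in> coarseM \<Longrightarrow> \<exists>C\<subseteq>per_lattice N. T = convex hull C"
proof -
  assume T: "T \<in> coarseM"
  then have "int CARD('n) simplex T" using Th_triangulation by (simp add: regular_triangulation_def)
  then show ?thesis using simplex_hull_lattice[of _ T "per_lattice N"] Th_vertices[OF T] by metis
qed

lemma coarse_interior: "T \<in> coarseM \<Longrightarrow> interior T \<noteq> {}"
proof -
  assume T: "T \<in> coarseM"
  then have s: "int CARD('n) simplex T" using Th_triangulation by (simp add: regular_triangulation_def)
  have "aff_dim T = int (DIM(real^'n))" using aff_dim_simplex[OF s] by simp
  then have "interior T = rel_interior T" by (simp add: interior_rel_interior_gen)
  moreover have "T \<noteq> {}" using aff_dim_simplex[OF s] by auto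
  ultimately show ?thesis using rel_interior_eq_empty[OF convex_simplex[OF s]] by simp
qed

lemma fine_tiling: "tiling tiles tile"
  by (rule tiling_cells[OF N a])

lemma fine_cover: "(\<Union>\<tau>\<in>tiles. tile \<tau>) = cbox (-1) 1"
  using lattice_tiles_cover[OF N a] by simp

lemma lattice_tile_interior: "c \<in> tile_corners a \<Longrightarrow> interior (lattice_tile N z c) \<noteq> {}"
proof
  assume c: "c \<in> tile_corners a" and "interior (lattice_tile N z c) = {}"
  then have "negligible (lattice_tile N z c)"
    using negligible_convex_interior[OF convex_lattice_tile[OF N corner[OF c]]] by simp
  then show False using measure_lattice_tile[OF N corner[OF c], of z] N by (simp add: negligible_imp_measure0)
qed

lemma lattice_tile_fine: "z \<in> Zd \<Longrightarrow> c \<in> tile_corners a \<Longrightarrow> lattice_tile N z c \<in> fineM"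
  unfolding K_eq per_fine_mesh_eq[OF N] by blast

lemma tile_grad_cong:
  assumes "z \<in> Zd" "c \<in> tile_corners a" "\<And>x. x \<in> per_lattice N \<Longrightarrow> u x = u' x"
  shows "tile_grad N u z c = tile_grad N u' z c"
proof -
  have "eps N *\<^sub>R (z + upd c k b) \<in> per_lattice N" if "b \<in> {0, 1}" for k b
    unfolding per_lattice_def
    using Zd_add[OF assms(1)] upd_unit_corners[OF corner[OF assms(2)] that] unit_corners_Zd by blast
  then show ?thesis unfolding tile_grad_def by (simp add: assms(3))
qed

lemma fine_interpolant:
  shows "P1 fineM (interpolant N fineM u)" "x \<in> per_lattice N \<Longrightarrow> interpolant N fineM u x = u x"
  using interpolant_fine[OF N a, of u] unfolding K_eq by auto

lemma fine_interpolant_eqI: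
  "P1 fineM w \<Longrightarrow> (\<And>x. x \<in> per_lattice N \<Longrightarrow> w x = u x) \<Longrightarrow> interpolant N fineM u = w"
  using interpolant_fine_eqI[OF N a, of w u] unfolding K_eq by blast

lemma fine_affine:
  assumes "P1 fineM u" "z \<in> Zd" "c \<in> tile_corners a"
  obtains b where "\<And>x. x \<in> lattice_tile N z c \<Longrightarrow> u x = tile_grad N u z c *v x + b"
proof -
  have "\<forall>T\<in>fineM. \<exists>(A :: real^'n^'n) b. \<forall>x\<in>T. u x = A *v x + b" using assms(1) by (simp add: P1_def)
  from bspec[OF this lattice_tile_fine[OF assms(2,3)]] obtain A :: "real^'n^'n" and b
    where A: "\<forall>x\<in>lattice_tile N z c. u x = A *v x + b" by (elim exE)
  then have "A = tile_grad N u z c" by (intro affine_on_lattice_tile[OF N corner[OF assms(3)]]) blast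
  with A that show thesis by blast
qed

lemma fine_has_gradients:
  assumes "P1 fineM u"
  shows "has_gradients tiles tile (\<lambda>(z, c). tile_grad N u z c) u"
proof -
  have "grad u x = tile_grad N u z c" if zc: "z \<in> cells N" "c \<in> tile_corners a" and x: "x \<in> interior (lattice_tile N z c)" for z c x
  proof -
    obtain b where "\<And>x. x \<in> lattice_tile N z c \<Longrightarrow> u x = tile_grad N u z c *v x + b"
      using fine_affine[OF assms, of z c] zc by (auto simp: cells_def)
    then show ?thesis using jacobian_affine_interior[OF _ x] by blast
  qed
  then show ?thesis
    unfolding has_gradients_def using fine_tiling fine_cover lattice_tile_interior by auto
qed

abbreviation Y where "Y \<equiv> interpolant N fineM y"

text \<open>A translate of the deformation by a period, corrected by a constant, has the same lattice values.\<close>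

lemma Y_translate: "\<exists>k. \<forall>x. Y (x + \<xi>) = Y x + k" if \<xi>: "\<xi> \<in> twoZd" for \<xi>
proof -
  obtain A :: "real^'n^'n" where A: "(\<lambda>x. y x - A *v x) \<in> periodic_displacements N"
    using y by (auto simp: deformations_def)
  have "P1 fineM (\<lambda>x. Y (x + \<xi>) + (- (A *v \<xi>)))"
    by (rule P1_translate[OF fine_interpolant(1)]) (rule per_fine_mesh_translate[OF N \<xi>])
  moreover have "Y (x + \<xi>) + (- (A *v \<xi>)) = y x" if x: "x \<in> per_lattice N" for x
  proof -
    have "x + \<xi> \<in> per_lattice N" using per_lattice_translate[OF N x \<xi>] by (simp add: add.commute)
    moreover have "y (x + \<xi>) - A *v (x + \<xi>) = y x - A *v x"
      using A x \<xi> by (auto simp: periodic_displacements_def)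
    ultimately show ?thesis by (simp add: fine_interpolant(2) matrix_vector_right_distrib algebra_simps)
  qed
  ultimately have "Y = (\<lambda>x. Y (x + \<xi>) + (- (A *v \<xi>)))" by (rule fine_interpolant_eqI)
  then have e: "Y x = Y (x + \<xi>) + (- (A *v \<xi>))" for x by (rule fun_cong)
  have "Y (x + \<xi>) = Y x + A *v \<xi>" for x by (subst e[of x]) simp
  then show ?thesis by blast
qed

lemma Y_grad_periodic: "tile_grad N Y (z + (2 * real N) *\<^sub>R axis k 1) c = tile_grad N Y z c"
proof -
  obtain e where e: "\<And>x. Y (x + 2 *\<^sub>R axis k 1) = Y x + e" using Y_translate[OF twoZd_axis(1)] by blast
  have "eps N *\<^sub>R (z + (2 * real N) *\<^sub>R axis k 1 + u) = eps N *\<^sub>R (z + u) + 2 *\<^sub>R axis k 1" for u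
    using N by (simp add: algebra_simps)
  then show ?thesis unfolding tile_grad_def by (simp only: e) simp
qed

lemma fine_interpolant_periodic:
  assumes u: "u \<in> periodic_displacements N" and \<xi>: "\<xi> \<in> twoZd"
  shows "interpolant N fineM u (x + \<xi>) = interpolant N fineM u x"
proof -
  have "P1 fineM (\<lambda>x. interpolant N fineM u (x + \<xi>) + 0)"
    by (rule P1_translate[OF fine_interpolant(1)]) (rule per_fine_mesh_translate[OF N \<xi>])
  moreover have "interpolant N fineM u (x + \<xi>) + 0 = u x" if x: "x \<in> per_lattice N" for x
    using per_lattice_translate[OF N x \<xi>] u x \<xi>
    by (simp add: fine_interpolant(2) add.commute[of \<xi>] periodic_displacements_def)
  ultimately have "interpolant N fineM u = (\<lambda>x. interpolant N fineM u (x + \<xi>) + 0)" by (rule fine_interpolant_eqI)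
  then have "interpolant N fineM u x = interpolant N fineM u (x + \<xi>) + 0" by (rule fun_cong)
  then show ?thesis by simp
qed

lemma coarse_unique:
  "P1 (periodize_mesh coarseM) w \<Longrightarrow> P1 (periodize_mesh coarseM) w' \<Longrightarrow> (\<And>x. x \<in> per_lattice N \<Longrightarrow> w x = w' x) \<Longrightarrow> w = w'"
  by (rule P1_coarse_unique[OF N Th_triangulation Th_periodic Th_vertices])

lemma coarse_interpolant:
  assumes "u \<in> coarse_displacements N coarseM"
  shows "P1 (periodize_mesh coarseM) (interpolant N (periodize_mesh coarseM) u)"
    "x \<in> per_lattice N \<Longrightarrow> interpolant N (periodize_mesh coarseM) u x = u x"
proof -
  obtain w where w: "P1 (periodize_mesh coarseM) w \<and> (\<forall>x\<in>per_lattice N. w x = u x)"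
    using assms by (auto simp: coarse_displacements_def)
  have "P1 (periodize_mesh coarseM) (interpolant N (periodize_mesh coarseM) u) \<and>
      (\<forall>x\<in>per_lattice N. interpolant N (periodize_mesh coarseM) u x = u x)"
    unfolding interpolant_def
  proof (rule theI[where P = "\<lambda>w. P1 (periodize_mesh coarseM) w \<and> (\<forall>x\<in>per_lattice N. w x = u x)" and a = w])
    fix w' assume "P1 (periodize_mesh coarseM) w' \<and> (\<forall>x\<in>per_lattice N. w' x = u x)"
    then show "w' = w" using w by (intro coarse_unique) auto
  qed (rule w)
  then show "P1 (periodize_mesh coarseM) (interpolant N (periodize_mesh coarseM) u)"
    "x \<in> per_lattice N \<Longrightarrow> interpolant N (periodize_mesh coarseM) u x = u x" by auto
qed

lemma coarse_interpolant_periodic: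
  assumes u: "u \<in> coarse_displacements N coarseM" and \<xi>: "\<xi> \<in> twoZd"
  shows "interpolant N (periodize_mesh coarseM) u (x + \<xi>) = interpolant N (periodize_mesh coarseM) u x"
proof -
  let ?w = "interpolant N (periodize_mesh coarseM) u"
  have "(\<lambda>x. ?w (x + \<xi>) + 0) = ?w"
  proof (rule coarse_unique)
    show "P1 (periodize_mesh coarseM) (\<lambda>x. ?w (x + \<xi>) + 0)"
      by (rule P1_translate[OF coarse_interpolant(1)[OF u]]) (rule periodize_mesh_translate[OF \<xi>])
    fix x :: "real^'n" assume x: "x \<in> per_lattice N"
    then show "?w (x + \<xi>) + 0 = ?w x"
      using per_lattice_translate[OF N x \<xi>] u \<xi>
      by (simp add: coarse_interpolant(2)[OF u] add.commute[of \<xi>] coarse_displacements_def periodic_displacements_def)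
  qed (rule coarse_interpolant(1)[OF u])
  then have "?w (x + \<xi>) + 0 = ?w x" by (rule fun_cong)
  then show ?thesis by simp
qed

text \<open>The interior of a fine tile that belongs to neither fine part of the coarse mesh meets the
  elements of these parts in null sets only. Since the continuum region is closed, it contains the tile.\<close>

lemma tile_dichotomy:
  assumes z: "z \<in> cells N" and c: "c \<in> tile_corners a" and not: "lattice_tile N z c \<notin> Ta \<union> Ti"
  shows "lattice_tile N z c \<subseteq> \<Union>Tc"
proof -
  let ?T = "lattice_tile N z c"
  have fin: "finite coarseM" by (rule tilingD[OF coarse_tiling])
  have "compact (\<Union>Tc)" using tilingD(2)[OF coarse_tiling] fin by (intro compact_Union) auto
  then have cl: "closed (\<Union>Tc)" by (rule compact_imp_closed)
  have zc: "(z, c) \<in> tiles" using z c by simp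
  have "interior ?T - \<Union>Tc \<subseteq> (\<Union>T\<in>Ta \<union> Ti. ?T \<inter> T)"
  proof
    fix x assume x: "x \<in> interior ?T - \<Union>Tc"
    have "x \<in> tile (z, c)" using x interior_subset by auto
    then have "x \<in> cbox (-1) 1" using fine_cover zc by blast
    then show "x \<in> (\<Union>T\<in>Ta \<union> Ti. ?T \<inter> T)" using x interior_subset coarse_cover by auto
  qed
  moreover have "negligible (\<Union>T\<in>Ta \<union> Ti. ?T \<inter> T)"
  proof (intro negligible_Union finite_imageI)
    show "finite (Ta \<union> Ti)" using fin by simp
    fix S assume "S \<in> (\<lambda>T. ?T \<inter> T) ` (Ta \<union> Ti)"
    then obtain T where T: "T \<in> Ta \<union> Ti" "S = ?T \<inter> T" by blast
    then obtain \<tau> where \<tau>: "\<tau> \<in> tiles" "T = tile \<tau>"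
      using interface_fine unfolding K_eq fine_mesh_eq[OF N a] by blast
    have "\<tau> \<noteq> (z, c)" using T(1) \<tau>(2) not by auto
    then have "negligible (tile (z, c) \<inter> tile \<tau>)" using tilingD(4)[OF fine_tiling zc \<tau>(1)] by simp
    then show "negligible S" using T(2) \<tau>(2) by simp
  qed
  ultimately have "negligible (interior ?T - \<Union>Tc)" using negligible_subset by blast
  moreover have "open (interior ?T - \<Union>Tc)" using cl by (intro open_Diff) auto
  ultimately have "interior ?T - \<Union>Tc = {}" using open_not_negligible by blast
  then have "closure (interior ?T) \<subseteq> \<Union>Tc" using cl by (intro closure_minimal) auto
  moreover have "closure (interior ?T) = closure ?T"
    by (rule convex_closure_interior[OF convex_lattice_tile[OF N corner[OF c]] lattice_tile_interior[OF c]])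
  ultimately show ?thesis using closure_subset by blast
qed

lemma
  assumes z: "z \<in> Zd" and c: "c \<in> tile_corners a"
  shows measurable_patch: "patch N K Tc (lattice_tile N z c) \<in> lmeasurable"
    and patch_cover: "patch N K Tc (lattice_tile N z c) \<subseteq>
      (\<Union>\<tau>\<in>{z' \<in> Zd. \<forall>l. \<bar>z' $ l - z $ l\<bar> \<le> 1} \<times> tile_corners a. tile \<tau>)"
proof -
  let ?T = "lattice_tile N z c" and ?P = "{z' \<in> Zd. \<forall>l. \<bar>z' $ l - z $ l\<bar> \<le> 1} \<times> tile_corners a"
  have near: "{T' \<in> fineM. ?T \<inter> T' \<noteq> {}} \<subseteq> tile ` ?P"
  proof
    fix T' assume "T' \<in> {T' \<in> fineM. ?T \<inter> T' \<noteq> {}}"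
    then obtain x where T': "T' \<in> fineM" and x: "x \<in> ?T" "x \<in> T'" by blast
    obtain z' c' where zc: "z' \<in> Zd" "c' \<in> tile_corners a" "T' = lattice_tile N z' c'"
      using T' unfolding K_eq per_fine_mesh_eq[OF N] by blast
    have "real N *\<^sub>R x - z \<in> cbox 0 1" "real N *\<^sub>R x - z' \<in> cbox 0 1"
      using x zc(3) by (auto simp: lattice_tile_def corner_tile_def)
    then have b: "0 \<le> real N * x $ l - z $ l" "real N * x $ l - z $ l \<le> 1" "0 \<le> real N * x $ l - z' $ l" "real N * x $ l - z' $ l \<le> 1" for l
      by (auto simp: mem_unit_box)
    have "\<bar>z' $ l - z $ l\<bar> \<le> 1" for l using b[of l] by linarith
    then show "T' \<in> tile ` ?P" using zc by (intro image_eqI[of _ _ "(z', c')"]) auto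
  qed
  then show "patch N K Tc ?T \<subseteq> (\<Union>\<tau>\<in>?P. tile \<tau>)" unfolding patch_def by blast
  have finP: "finite ?P" using finite_near_Zd finite_tile_corners by simp
  have "compact T'" if "T' \<in> tile ` ?P" for T' using that compact_lattice_tile[OF N corner] by auto
  then have cpt: "compact (\<Union>{T' \<in> fineM. ?T \<inter> T' \<noteq> {}})"
    by (intro compact_Union finite_subset[OF near finite_imageI[OF finP]]) (use near in blast)
  have "compact (\<Union>Tc)" using tilingD(1,2)[OF coarse_tiling] by (intro compact_Union) auto
  then have "(\<lambda>x. \<xi> + x) ` \<Union>Tc \<in> sets borel" for \<xi> :: "real^'n"
    by (intro borel_compact compact_translation)
  moreover have "countable (twoZd :: (real^'n) set)"
  proof -
    have "twoZd = (\<lambda>z. 2 *\<^sub>R z) ` (Zd :: (real^'n) set)" by (auto simp: twoZd_def)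
    then show ?thesis using countable_image[OF countable_Zd, of "\<lambda>z. 2 *\<^sub>R z"] by metis
  qed
  ultimately have "periodize (\<Union>Tc) \<in> sets borel" unfolding periodize_def by (intro sets.countable_UN') auto
  then have "periodize (\<Union>Tc) \<in> sets lebesgue" by auto
  then show "patch N K Tc ?T \<in> lmeasurable"
    unfolding patch_def Int_commute[of "periodize (\<Union>Tc)"]
    by (intro fmeasurable_Int_fmeasurable lmeasurable_compact cpt)
qed

text \<open>Touching tiles belong to cells whose coordinates differ by at most one, so finitely many tiles cover
  the patch and \<open>osc_ge\<close> applies to them.\<close>

lemma osc_bound_patch:
  assumes z: "z \<in> Zd" and c: "c \<in> tile_corners a"
    and 1: "z1 \<in> Zd" "c1 \<in> tile_corners a" "lattice_tile N z1 c1 \<subseteq> periodize (\<Union>Tc)" "lattice_tile N z c \<inter> lattice_tile N z1 c1 \<noteq> {}"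
    and 2: "z2 \<in> Zd" "c2 \<in> tile_corners a" "lattice_tile N z2 c2 \<subseteq> periodize (\<Union>Tc)" "lattice_tile N z c \<inter> lattice_tile N z2 c2 \<noteq> {}"
  shows "norm (tile_grad N Y z1 c1 - tile_grad N Y z2 c2) \<le> eps N * osc N Y (patch N K Tc (lattice_tile N z c))"
proof -
  let ?P = "{z' \<in> Zd. \<forall>l. \<bar>z' $ l - z $ l\<bar> \<le> 1} \<times> tile_corners a"
  let ?\<omega> = "patch N K Tc (lattice_tile N z c)"
  have near: "(z', c') \<in> ?P" if zc': "z' \<in> Zd" "c' \<in> tile_corners a" "lattice_tile N z c \<inter> lattice_tile N z' c' \<noteq> {}" for z' c'
  proof -
    obtain x where x: "x \<in> lattice_tile N z c" "x \<in> lattice_tile N z' c'" using zc'(3) by blast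
    have "real N *\<^sub>R x - z \<in> cbox 0 1" "real N *\<^sub>R x - z' \<in> cbox 0 1"
      using x by (auto simp: lattice_tile_def corner_tile_def)
    then have b: "0 \<le> real N * x $ l - z $ l" "real N * x $ l - z $ l \<le> 1" "0 \<le> real N * x $ l - z' $ l" "real N * x $ l - z' $ l \<le> 1" for l
      by (auto simp: mem_unit_box)
    have "\<bar>z' $ l - z $ l\<bar> \<le> 1" for l using b[of l] by linarith
    then show ?thesis using zc' by auto
  qed
  have sub: "tile (z', c') \<subseteq> ?\<omega>"
    if "z' \<in> Zd" "c' \<in> tile_corners a" "lattice_tile N z' c' \<subseteq> periodize (\<Union>Tc)" "lattice_tile N z c \<inter> lattice_tile N z' c' \<noteq> {}" for z' c'
    using that lattice_tile_fine[OF that(1,2)] unfolding patch_def by auto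
  have "norm ((\<lambda>(z, c). tile_grad N Y z c) (z1, c1) - (\<lambda>(z, c). tile_grad N Y z c) (z2, c2)) \<le> eps N * osc N Y ?\<omega>"
  proof (rule osc_ge[OF N, where P = ?P and T = tile])
    show "tiling ?P tile" by (rule tiling_lattice_tiles[OF N a finite_near_Zd]) auto
    show "?\<omega> \<in> lmeasurable" by (rule measurable_patch[OF z c])
    show "?\<omega> \<subseteq> (\<Union>\<tau>\<in>?P. tile \<tau>)" by (rule patch_cover[OF z c])
    fix \<tau> x assume \<tau>: "\<tau> \<in> ?P" and x: "x \<in> interior (tile \<tau>)"
    obtain z' c' where zc: "\<tau> = (z', c')" "z' \<in> Zd" "c' \<in> tile_corners a" using \<tau> by auto
    obtain b where b: "\<And>x. x \<in> lattice_tile N z' c' \<Longrightarrow> Y x = tile_grad N Y z' c' *v x + b"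
      using fine_affine[OF fine_interpolant(1) zc(2,3)] by blast
    have "x \<in> interior (lattice_tile N z' c')" using x zc(1) by simp
    from jacobian_affine_interior[OF b this] show "grad Y x = (\<lambda>(z, c). tile_grad N Y z c) \<tau>"
      using zc(1) by simp
  qed (use near 1 2 sub lattice_tile_interior in auto)
  then show ?thesis by simp
qed

definition error_functional where
  "error_functional z = first_variation (E_ac N R V Ta Ti Tc Ei) Y z - first_variation (E_a N R V) Y z"

text \<open>The part of the error functional that depends on the test function through its lattice values only,
  and therefore takes the same value at both interpolants.\<close>

definition lattice_variation where
  "lattice_variation z = site_variation N (atomistic_sites N R Ta) R V Y z + bond_variation N R Ti Ei Y z
     - site_variation N (lattice N) R V Y z"

lemma finite_interface_bonds: "finite (interface_bonds N R Ti)"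
proof -
  have "interface_bonds N R Ti \<subseteq> (\<lambda>(x, r). (x, x + eps N *\<^sub>R r)) ` (lattice N \<times> R)"
    by (auto simp: interface_bonds_def)
  then show ?thesis using finite_lattice R_finite by (meson finite_SigmaI finite_surj)
qed

lemma R_Zd: "R \<subseteq> Zd"
  using R_lattice by blast

lemma continuum_integral:
  assumes z: "\<And>T \<tau>. T \<in> Tc \<Longrightarrow> \<tau> \<in> tiles \<Longrightarrow> \<exists>b. \<forall>x\<in>T \<inter> tile \<tau>. z x = G T \<tau> *v x + b"
  shows "(LINT x : \<Union>Tc | lebesgue. Wcb R V (grad (\<lambda>x. Y x + t *\<^sub>R z x) x)) =
    (\<Sum>p\<in>Tc \<times> tiles. (\<lambda>(T, \<tau>). measure lebesgue (T \<inter> tile \<tau>)) p *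
       Wcb R V ((\<lambda>(T, (z, c)). tile_grad N Y z c) p + t *\<^sub>R (\<lambda>(T, \<tau>). G T \<tau>) p))"
proof -
  have tlc: "tiling Tc (\<lambda>T. T)" using coarse_tiling by (auto simp: tiling_def)
  have "compact (\<Union>Tc)" using tilingD(1,2)[OF tlc] by (intro compact_Union) auto
  then have Tcs: "\<Union>Tc \<in> sets lebesgue" by (intro fmeasurableD lmeasurable_compact)
  have cov: "\<Union>Tc \<subseteq> (\<Union>p\<in>Tc \<times> tiles. (\<lambda>(T, \<tau>). T \<inter> tile \<tau>) p)"
  proof
    fix x assume x: "x \<in> \<Union>Tc"
    then obtain T where T: "T \<in> Tc" "x \<in> T" by blast
    have "x \<in> (\<Union>\<tau>\<in>tiles. tile \<tau>)" unfolding fine_cover using x coarse_cover by blast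
    then obtain \<tau> where \<tau>: "\<tau> \<in> tiles" "x \<in> tile \<tau>" by blast
    show "x \<in> (\<Union>p\<in>Tc \<times> tiles. (\<lambda>(T, \<tau>). T \<inter> tile \<tau>) p)"
      by (rule UN_I[of "(T, \<tau>)"]) (use T \<tau> in auto)
  qed
  have "(LINT x : \<Union>Tc | lebesgue. Wcb R V (grad (\<lambda>x. Y x + t *\<^sub>R z x) x)) =
    (\<Sum>p\<in>Tc \<times> tiles. measure lebesgue ((\<lambda>(T, \<tau>). T \<inter> tile \<tau>) p \<inter> \<Union>Tc) *
       Wcb R V ((\<lambda>(T, (z, c)). tile_grad N Y z c) p + t *\<^sub>R (\<lambda>(T, \<tau>). G T \<tau>) p))"
  proof (rule integral_tiling[OF tiling_product[OF tlc fine_tiling] Tcs cov])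
    fix p x assume p: "p \<in> Tc \<times> tiles" and x: "x \<in> interior ((\<lambda>(T, \<tau>). T \<inter> tile \<tau>) p)"
    obtain T zz c where pe: "p = (T, (zz, c))" "T \<in> Tc" "zz \<in> cells N" "c \<in> tile_corners a" using p by auto
    have zz: "zz \<in> Zd" using pe(3) by (simp add: cells_def)
    obtain b where b: "\<And>x. x \<in> lattice_tile N zz c \<Longrightarrow> Y x = tile_grad N Y zz c *v x + b"
      using fine_affine[OF fine_interpolant(1) zz pe(4)] by blast
    obtain b' where b': "\<forall>x\<in>T \<inter> tile (zz, c). z x = G T (zz, c) *v x + b'"
      using z[of T "(zz, c)"] pe by auto
    have "grad (\<lambda>x. Y x + t *\<^sub>R z x) x = tile_grad N Y zz c + t *\<^sub>R G T (zz, c)"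
    proof (rule jacobian_affine_interior[where T = "T \<inter> tile (zz, c)" and b = "b + t *\<^sub>R b'"])
      show "x \<in> interior (T \<inter> tile (zz, c))" using x pe(1) by simp
      show "Y x + t *\<^sub>R z x = (tile_grad N Y zz c + t *\<^sub>R G T (zz, c)) *v x + (b + t *\<^sub>R b')" if "x \<in> T \<inter> tile (zz, c)" for x
        using that b[of x] b' by (simp add: matrix_vector_mult_add_rdistrib scaleR_matrix_vector_assoc[symmetric] scaleR_add_right)
    qed
    then show "Wcb R V (grad (\<lambda>x. Y x + t *\<^sub>R z x) x) =
        Wcb R V ((\<lambda>(T, (z, c)). tile_grad N Y z c) p + t *\<^sub>R (\<lambda>(T, \<tau>). G T \<tau>) p)" using pe(1) by simp
  qed
  moreover have "(\<lambda>(T, \<tau>). T \<inter> tile \<tau>) p \<inter> \<Union>Tc = (\<lambda>(T, \<tau>). T \<inter> tile \<tau>) p" if "p \<in> Tc \<times> tiles" for p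
    using that by auto
  ultimately show ?thesis by (simp add: case_prod_unfold cong: sum.cong)
qed

lemma error_functional_eq:
  assumes z: "\<And>T \<tau>. T \<in> Tc \<Longrightarrow> \<tau> \<in> tiles \<Longrightarrow> \<exists>b. \<forall>x\<in>T \<inter> tile \<tau>. z x = G T \<tau> *v x + b"
  shows "error_functional z = (\<Sum>T\<in>Tc. \<Sum>(zz, c)\<in>tiles. measure lebesgue (T \<inter> lattice_tile N zz c) *
      stress R V (tile_grad N Y zz c) (G T (zz, c))) + lattice_variation z"
proof -
  have "first_variation (E_ac N R V Ta Ti Tc Ei) Y z =
     (\<Sum>p\<in>Tc \<times> tiles. (\<lambda>(T, \<tau>). measure lebesgue (T \<inter> tile \<tau>)) p *
       stress R V ((\<lambda>(T, (z, c)). tile_grad N Y z c) p) ((\<lambda>(T, \<tau>). G T \<tau>) p)) +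
     site_variation N (atomistic_sites N R Ta) R V Y z + bond_variation N R Ti Ei Y z"
    unfolding first_variation_def
    by (rule DERIV_imp_deriv, rule E_ac_derivative[OF V_C2 R_finite Ei_C2 finite_interface_bonds])
      (rule continuum_integral[OF z])
  moreover have "first_variation (E_a N R V) Y z = site_variation N (lattice N) R V Y z"
    unfolding first_variation_def by (rule DERIV_imp_deriv[OF E_a_derivative[OF V_C2 R_finite]])
  ultimately show ?thesis
    by (simp add: error_functional_def lattice_variation_def sum.cartesian_product case_prod_unfold)
qed

lemma lattice_variation_cong:
  assumes "\<And>x. x \<in> per_lattice N \<Longrightarrow> z x = z' x" shows "lattice_variation z = lattice_variation z'"
proof -
  have "atomistic_sites N R Ta \<subseteq> lattice N" by (auto simp: atomistic_sites_def)
  from site_variation_cong[where z = z and z' = z', OF this R_Zd assms] site_variation_cong[where z = z and z' = z', OF subset_refl R_Zd assms]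
    bond_variation_cong[where z = z and z' = z', OF N R_Zd assms]
  show ?thesis unfolding lattice_variation_def by simp
qed

lemma error_functional_fine:
  assumes "P1 fineM v"
  shows "error_functional v = (\<Sum>T\<in>Tc. \<Sum>(zz, c)\<in>tiles. measure lebesgue (T \<inter> lattice_tile N zz c) *
      stress R V (tile_grad N Y zz c) (tile_grad N v zz c)) + lattice_variation v"
proof -
  have "error_functional v = (\<Sum>T\<in>Tc. \<Sum>(zz, c)\<in>tiles. measure lebesgue (T \<inter> lattice_tile N zz c) *
      stress R V (tile_grad N Y zz c) ((\<lambda>T (z, c). tile_grad N v z c) T (zz, c))) + lattice_variation v"
  proof (rule error_functional_eq)
    fix T \<tau> assume "\<tau> \<in> tiles"
    then obtain zz c where t: "\<tau> = (zz, c)" "zz \<in> Zd" "c \<in> tile_corners a" by (auto simp: cells_def)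
    obtain b where "\<And>x. x \<in> lattice_tile N zz c \<Longrightarrow> v x = tile_grad N v zz c *v x + b"
      using fine_affine[OF assms t(2,3)] by blast
    then show "\<exists>b. \<forall>x\<in>T \<inter> tile \<tau>. v x = (\<lambda>T (z, c). tile_grad N v z c) T \<tau> *v x + b"
      unfolding t(1) by auto
  qed
  then show ?thesis by simp
qed

lemma P1_fine_scaleR:
  assumes "P1 fineM v" shows "P1 fineM (\<lambda>x. s *\<^sub>R v x)"
  unfolding P1_def
proof (intro conjI ballI)
  show "continuous_on UNIV (\<lambda>x. s *\<^sub>R v x)" using assms by (auto simp: P1_def intro!: continuous_intros)
  fix T assume "T \<in> fineM"
  then obtain A :: "real^'n^'n" and b where A: "\<forall>x\<in>T. v x = A *v x + b" using assms unfolding P1_def by meson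
  then have "\<forall>x\<in>T. s *\<^sub>R v x = (s *\<^sub>R A) *v x + s *\<^sub>R b"
    by (simp add: scaleR_matrix_vector_assoc[symmetric] scaleR_add_right)
  then show "\<exists>(A :: real^'n^'n) b. \<forall>x\<in>T. s *\<^sub>R v x = A *v x + b" by blast
qed

lemma tile_grad_scaleR: "tile_grad N (\<lambda>x. s *\<^sub>R v x) z c = s *\<^sub>R tile_grad N v z c"
  by (simp add: tile_grad_def vec_eq_iff right_diff_distrib mult_ac)

lemma error_functional_fine_scaleR:
  assumes "P1 fineM v" shows "error_functional (\<lambda>x. s *\<^sub>R v x) = s * error_functional v"
  unfolding error_functional_fine[OF assms] error_functional_fine[OF P1_fine_scaleR[OF assms]]
  by (simp add: tile_grad_scaleR lattice_variation_def site_variation_scaleR bond_variation_scaleR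
      linear_scale[OF linear_stress] sum_distrib_left case_prod_unfold algebra_simps)

text \<open>All difference quotients in one period vanish, hence by periodicity those on the whole lattice.\<close>

lemma fine_constant:
  assumes v: "P1 fineM v" and u: "u \<in> periodic_displacements N" "v = interpolant N fineM u" and q: "1 \<le> q" and 0: "grad_norm q v = 0"
    and x: "x \<in> per_lattice N"
  shows "v x = v 0"
proof -
  note hg = fine_has_gradients[OF v]
  have t0: "tile_grad N v z c = 0" if "z \<in> cells N" "c \<in> tile_corners a" for z c
    using grad_norm_eq_0[OF hg q 0, of "(z, c)"] that by simp
  have t: "tile_grad N v z c = 0" if z: "z \<in> Zd" and c: "c \<in> tile_corners a" for z c
  proof -
    obtain z0 k where k: "z0 \<in> cells N" "k \<in> Zd" "z = z0 + (2 * real N) *\<^sub>R k" by (rule cells_representative[OF N z])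
    have "eps N *\<^sub>R (z + e) = eps N *\<^sub>R (z0 + e) + 2 *\<^sub>R k" for e unfolding k(3) using N by (simp add: algebra_simps)
    moreover have "2 *\<^sub>R k \<in> twoZd" using k(2) by (auto simp: twoZd_def)
    ultimately have "tile_grad N v z c = tile_grad N v z0 c"
      unfolding tile_grad_def u(2) by (simp add: fine_interpolant_periodic[OF u(1)])
    then show ?thesis using t0[OF k(1) c] by simp
  qed
  define h where "h z = v (eps N *\<^sub>R z)" for z
  obtain c where c: "c \<in> tile_corners a" using tile_corners_obtain[OF a] by blast
  have step: "h (z + axis k 1) = h z" if z: "z \<in> Zd" for z k
  proof -
    define z' where "z' = z - upd c k 0"
    have z': "z' \<in> Zd" unfolding z'_def using Zd_diff[OF z] upd_unit_corners[OF corner[OF c]] unit_corners_Zd by blast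
    have "v (eps N *\<^sub>R (z' + upd c k 1)) $ l = v (eps N *\<^sub>R (z' + upd c k 0)) $ l" for l
    proof -
      have "tile_grad N v z' c $ l $ k = 0" using t[OF z' c] by simp
      then show ?thesis using N by (simp add: tile_grad_def)
    qed
    moreover have "z' + upd c k 1 = z + axis k 1" "z' + upd c k 0 = z" by (simp_all add: z'_def vec_eq_iff axis_def)
    ultimately show ?thesis by (simp add: h_def vec_eq_iff)
  qed
  have ptZ: "pt j (of_int m) (of_int n) \<in> Zd" for m n
  proof -
    have "\<forall>l. pt j (of_int m) (of_int n) $ l \<in> \<int>" by (subst ex_ij) simp
    then show ?thesis by (simp add: Zd_def)
  qed
  have s1: "h (pt j (of_int (m + 1)) (of_int n)) = h (pt j (of_int m) (of_int n))" for m n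
    using step[OF ptZ[of m n], of j] ij by (simp add: pt_def axis_def vec_eq_iff plus_vec_def if_distrib cong: if_cong)
  have s2: "h (pt j (of_int m) (of_int (n + 1))) = h (pt j (of_int m) (of_int n))" for m n
  proof -
    have "pt j (of_int m) (of_int n) + axis i 1 = pt j (of_int m) (of_int (n + 1))"
      using ij by (simp add: vec_eq_ij axis_def)
    then show ?thesis using step[OF ptZ[of m n], of i] by simp
  qed
  have h1: "h (pt j (of_int m) (of_int n)) = h (pt j 0 (of_int n))" for m n
  proof (induction m rule: int_induct[where k = 0])
    case (step2 m) then show ?case using s1[of "m - 1" n] by simp
  qed (use s1 in simp_all)
  have h2: "h (pt j 0 (of_int n)) = h (pt j 0 0)" for n
  proof (induction n rule: int_induct[where k = 0])
    case (step2 n) then show ?case using s2[of 0 "n - 1"] by simp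
  qed (use s2[of 0] in simp_all)
  obtain z where z: "x = eps N *\<^sub>R z" "z \<in> Zd" using x unfolding per_lattice_def by blast
  have "z $ j \<in> \<int>" "z $ i \<in> \<int>" using z(2) by (auto simp: Zd_def)
  then obtain m n where "z $ j = of_int m" "z $ i = of_int n" by (auto elim!: Ints_cases)
  then have "z = pt j (of_int m) (of_int n)" by (simp add: vec_eq_ij)
  then have "v x = h (pt j 0 0)" using h1 h2 z(1) by (simp add: h_def)
  moreover have "pt j 0 0 = 0" by (simp add: vec_eq_ij)
  ultimately show ?thesis by (simp add: h_def)
qed

abbreviation Ih where "Ih \<equiv> interpolant N (periodize_mesh coarseM)"
abbreviation Ieps where "Ieps \<equiv> interpolant N fineM"

definition patch_osc :: "(real^'n) set \<Rightarrow> real" where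
  "patch_osc T = osc N Y (patch N K Tc T)"

text \<open>The lattice variations cancel, and tiles outside the continuum region contribute nothing, since the
  interpolants agree there. So the difference is the sum of the tile defects, weighted with the
  stress, that \<open>consistency_error_bound\<close> estimates.\<close>

lemma coarse_vs_fine:
  assumes u: "u \<in> coarse_displacements N coarseM" and p: "1 \<le> p" and le: "grad_norm (conj_exponent p) (Ih u) \<le> 1"
  shows "error_functional (Ih u) \<le> error_functional (Ieps u) +
      M_total R M * 16 * eps N * weighted_norm p (continuum_fine_mesh N K Tc) (measure lebesgue) patch_osc"
    and "grad_norm (conj_exponent p) (Ieps u) \<le> 1"
proof -
  define w where "w = Ih u"
  define v where "v = Ieps u"
  let ?q = "conj_exponent p"
  have q: "1 \<le> ?q" by (rule conj_exponent_ge_1[OF p])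
  interpret \<phi>: even_convex "growth ?q" by (rule even_convex_growth[OF q])
  have up: "u \<in> periodic_displacements N" using u by (simp add: coarse_displacements_def)
  have wP1: "P1 (periodize_mesh coarseM) w" unfolding w_def by (rule coarse_interpolant(1)[OF u])
  have ex: "\<forall>T\<in>coarseM. \<exists>p. \<forall>x\<in>T. w x = fst p *v x + snd p"
  proof
    fix T assume "T \<in> coarseM"
    then have T: "T \<in> periodize_mesh coarseM" by (rule subsetD[OF periodize_mesh_subset])
    have "\<forall>T\<in>periodize_mesh coarseM. \<exists>(A :: real^'n^'n) b. \<forall>x\<in>T. w x = A *v x + b" using wP1 by (simp add: P1_def)
    from bspec[OF this T] obtain A :: "real^'n^'n" and b where "\<forall>x\<in>T. w x = A *v x + b" by (elim exE)
    then have "\<forall>x\<in>T. w x = fst (A, b) *v x + snd (A, b)" by (simp only: fst_conv snd_conv)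
    then show "\<exists>p. \<forall>x\<in>T. w x = fst p *v x + snd p" by (rule exI)
  qed
  obtain pp where pp: "\<forall>T\<in>coarseM. \<forall>x\<in>T. w x = fst (pp T) *v x + snd (pp T)" using bchoice[OF ex] by (elim exE)
  define A where "A T = fst (pp T)" for T
  define d where "d T = snd (pp T)" for T
  have w_aff: "w x = A T *v x + d T" if "T \<in> coarseM" "x \<in> T" for T x
    unfolding A_def d_def by (rule bspec[OF bspec[OF pp that(1)] that(2)])
  have vw: "v x = w x" if "x \<in> per_lattice N" for x
    using that by (simp add: v_def w_def fine_interpolant(2) coarse_interpolant(2)[OF u])
  have v_P1: "P1 fineM v" unfolding v_def by (rule fine_interpolant(1))
  have w_per: "w (x + \<xi>) = w x" if "\<xi> \<in> twoZd" for x \<xi> unfolding w_def by (rule coarse_interpolant_periodic[OF u that])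
  have v_per: "v (x + \<xi>) = v x" if "\<xi> \<in> twoZd" for x \<xi> unfolding v_def by (rule fine_interpolant_periodic[OF up that])
  have w_grad: "has_gradients coarseM (\<lambda>T. T) A w"
    unfolding has_gradients_def
  proof (intro conjI ballI)
    show "grad w x = A T" if "T \<in> coarseM" "x \<in> interior T" for T x
      by (rule jacobian_affine_interior[OF w_aff[OF that(1)] that(2)])
  qed (use coarse_tiling coarse_cover coarse_interior in auto)
  have agree: "w x = v x" if z: "z \<in> cells N" and c: "c \<in> tile_corners a" and T: "lattice_tile N z c \<in> Ta \<union> Ti" and x: "x \<in> lattice_tile N z c" for z c x
  proof -
    let ?T = "lattice_tile N z c"
    have zZ: "z \<in> Zd" using z by (simp add: cells_def)
    have TC: "?T \<in> coarseM" using T by blast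
    obtain b where b: "\<And>x. x \<in> ?T \<Longrightarrow> v x = tile_grad N v z c *v x + b" using fine_affine[OF v_P1 zZ c] by blast
    have "A ?T = tile_grad N w z c" by (rule affine_on_lattice_tile[OF N corner[OF c] w_aff[OF TC]])
    also have "\<dots> = tile_grad N v z c" by (rule tile_grad_cong[OF zZ c]) (simp add: vw)
    finally have A: "A ?T = tile_grad N v z c" .
    define x0 where "x0 = eps N *\<^sub>R (z + upd c j 0)"
    have x0: "x0 \<in> ?T" unfolding x0_def by (rule edge_in_lattice_tile[OF N corner[OF c]]) auto
    have "z + upd c j 0 \<in> Zd" using Zd_add[OF zZ] upd_unit_corners[OF corner[OF c]] unit_corners_Zd by blast
    then have "x0 \<in> per_lattice N" by (auto simp: x0_def per_lattice_def)
    from vw[OF this] have "b = d ?T" using b[OF x0] w_aff[OF TC x0] A by simp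
    then show ?thesis using b[OF x] w_aff[OF TC x] A by simp
  qed
  have in_continuum: "lattice_tile N z c \<subseteq> periodize (\<Union>Tc)"
    if z: "z \<in> Zd" and c: "c \<in> tile_corners a" and df: "\<exists>x\<in>lattice_tile N z c. w x \<noteq> v x" for z c
  proof -
    obtain z0 k where k: "z0 \<in> cells N" "k \<in> Zd" "z = z0 + (2 * real N) *\<^sub>R k" by (rule cells_representative[OF N z])
    have k2: "2 *\<^sub>R k \<in> twoZd" using k(2) by (auto simp: twoZd_def)
    have tr: "lattice_tile N z c = (\<lambda>x. 2 *\<^sub>R k + x) ` lattice_tile N z0 c" unfolding k(3) by (rule lattice_tile_translate[OF N])
    obtain x where x: "x \<in> lattice_tile N z0 c" "w (2 *\<^sub>R k + x) \<noteq> v (2 *\<^sub>R k + x)" using df unfolding tr by blast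
    then have "w x \<noteq> v x" using w_per[OF k2, of x] v_per[OF k2, of x] by (simp add: add.commute)
    then have "lattice_tile N z0 c \<notin> Ta \<union> Ti" using agree[OF k(1) c _ x(1)] by blast
    then have "lattice_tile N z0 c \<subseteq> \<Union>Tc" by (rule tile_dichotomy[OF k(1) c])
    then show ?thesis unfolding tr periodize_def using k2 by blast
  qed
  define os where "os z c = patch_osc (lattice_tile N z c)" for z c
  have v_P1': "P1 (per_fine_mesh N (corner_tile ` tile_corners a)) v" using v_P1 unfolding K_eq .
  interpret cf: coarse_fine i j N a coarseM w v A d
  proof
    show "continuous_on UNIV w" using wP1 by (simp add: P1_def)
  qed (use N a coarse_tiling coarse_cover coarse_polygons w_aff w_per v_P1' v_per vw in auto)
  have bound: "norm (tile_grad N Y z1 c1 - tile_grad N Y z2 c2) \<le> eps N * os z c"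
    if "z \<in> cells N" "c \<in> tile_corners a"
      "z1 \<in> Zd" "c1 \<in> tile_corners a" "\<exists>x\<in>lattice_tile N z1 c1. w x \<noteq> v x" "lattice_tile N z c \<inter> lattice_tile N z1 c1 \<noteq> {}"
      "z2 \<in> Zd" "c2 \<in> tile_corners a" "\<exists>x\<in>lattice_tile N z2 c2. w x \<noteq> v x" "lattice_tile N z c \<inter> lattice_tile N z2 c2 \<noteq> {}"
    for z c z1 c1 z2 c2
  proof -
    have "z \<in> Zd" using that(1) by (simp add: cells_def)
    then show ?thesis
      unfolding os_def patch_osc_def
      using that in_continuum[OF that(3-5)] in_continuum[OF that(7-9)] by (intro osc_bound_patch)
  qed
  interpret cfs: coarse_fine_stress i j N a coarseM w v A d "stress R V" "M_total R M" "tile_grad N Y" os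
  proof
    show "stress R V F (G + G') = stress R V F G + stress R V F G'" for F G G' by (rule linear_add[OF linear_stress])
    show "stress R V F (r *\<^sub>R G) = r *\<^sub>R stress R V F G" for F r G by (rule linear_scale[OF linear_stress])
    show "0 \<le> M_total R M" by (rule M_total_nonneg)
    show "\<bar>stress R V F G - stress R V F' G\<bar> \<le> M_total R M * norm (F - F') * norm G" for F G F'
    proof (rule stress_lipschitz[OF V_C2 R_finite V_bound])
      show "norm (G *v r) \<le> norm r * norm G" for r using norm_matrix_vector_mult_le[of G r] by (simp add: mult.commute)
    qed
    show "tile_grad N Y (z + (2 * real N) *\<^sub>R axis k 1) c = tile_grad N Y z c" for z k c by (rule Y_grad_periodic)
    show "0 \<le> os z c" if zc: "z \<in> cells N" "c \<in> tile_corners a" "\<exists>x\<in>lattice_tile N z c. w x \<noteq> v x" for z c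
    proof -
      have zZ: "z \<in> Zd" using zc by (simp add: cells_def)
      have "lattice_tile N z c \<inter> lattice_tile N z c \<noteq> {}" using zc(3) by blast
      from bound[OF zc(1,2) zZ zc(2,3) this zZ zc(2,3) this] show ?thesis using N by (simp add: zero_le_divide_iff)
    qed
  qed (rule bound)
  have levels: "(\<Sum>T\<in>coarseM. measure lebesgue T * (\<Sum>l\<in>UNIV. \<Sum>k\<in>UNIV. growth ?q (A T $ l $ k))) \<le> unit_level ?q"
    using le unfolding w_def[symmetric] grad_norm_le_1_iff[OF w_grad q] .
  have swap: "(\<Sum>i\<in>I. \<mu> i * (\<Sum>l\<in>UNIV. \<Sum>k\<in>UNIV. f i l k)) = (\<Sum>l\<in>(UNIV::'n set). \<Sum>k\<in>(UNIV::'n set). \<Sum>i\<in>I. \<mu> i * f i l k)"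
    for I :: "'i set" and \<mu> :: "'i \<Rightarrow> real" and f
    by (simp only: sum_distrib_left sum.swap[of _ I UNIV])
  have "(\<Sum>\<tau>\<in>tiles. measure lebesgue (tile \<tau>) * (\<Sum>l\<in>UNIV. \<Sum>k\<in>UNIV. growth ?q ((\<lambda>(z, c). tile_grad N v z c) \<tau> $ l $ k)))
      \<le> (\<Sum>T\<in>coarseM. measure lebesgue T * (\<Sum>l\<in>UNIV. \<Sum>k\<in>UNIV. growth ?q (A T $ l $ k)))"
    unfolding swap
  proof (intro sum_mono)
    fix l k
    show "(\<Sum>\<tau>\<in>tiles. measure lebesgue (tile \<tau>) * growth ?q ((\<lambda>(z, c). tile_grad N v z c) \<tau> $ l $ k))
        \<le> (\<Sum>T\<in>coarseM. measure lebesgue T * growth ?q (A T $ l $ k))"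
      using cf.tile_grad_entry_sum_bound[OF \<phi>.even_convex_axioms, of l k] by (simp add: case_prod_unfold)
  qed
  then show "grad_norm (conj_exponent p) (Ieps u) \<le> 1"
    using levels unfolding v_def[symmetric] grad_norm_le_1_iff[OF fine_has_gradients[OF v_P1] q] by linarith
  have unit: "(\<Sum>T\<in>coarseM. measure lebesgue T * growth ?q (A T $ l $ k)) \<le> unit_level ?q" for l k
  proof -
    have "growth ?q (A T $ l $ k) \<le> (\<Sum>l\<in>UNIV. \<Sum>k\<in>UNIV. growth ?q (A T $ l $ k))" for T
    proof -
      have "growth ?q (A T $ l $ k) \<le> (\<Sum>k\<in>UNIV. growth ?q (A T $ l $ k))"
        by (rule member_le_sum) (auto simp: \<phi>.\<phi>_nonneg)
      also have "\<dots> \<le> (\<Sum>l\<in>UNIV. \<Sum>k\<in>UNIV. growth ?q (A T $ l $ k))"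
        by (rule member_le_sum[where f = "\<lambda>l. \<Sum>k\<in>UNIV. growth ?q (A T $ l $ k)"]) (auto intro: sum_nonneg \<phi>.\<phi>_nonneg)
      finally show ?thesis .
    qed
    then have "(\<Sum>T\<in>coarseM. measure lebesgue T * growth ?q (A T $ l $ k)) \<le>
      (\<Sum>T\<in>coarseM. measure lebesgue T * (\<Sum>l\<in>UNIV. \<Sum>k\<in>UNIV. growth ?q (A T $ l $ k)))"
      by (intro sum_mono mult_left_mono) auto
    then show ?thesis using levels by linarith
  qed
  let ?m = "\<lambda>T z c. measure lebesgue (T \<inter> lattice_tile N z c)"
  have fw: "error_functional w = (\<Sum>T\<in>Tc. \<Sum>(z, c)\<in>tiles. ?m T z c * stress R V (tile_grad N Y z c) (A T)) + lattice_variation w"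
  proof (rule error_functional_eq)
    show "\<exists>b. \<forall>x\<in>T \<inter> tile \<tau>. w x = A T *v x + b" if "T \<in> Tc" for T \<tau>
      using w_aff[of T] that by auto
  qed
  have lv: "lattice_variation w = lattice_variation v" by (rule lattice_variation_cong) (simp add: vw)
  have "error_functional w - error_functional v =
      (\<Sum>T\<in>Tc. \<Sum>(z, c)\<in>tiles. stress R V (tile_grad N Y z c) (?m T z c *\<^sub>R (A T - tile_grad N v z c)))"
    unfolding fw error_functional_fine[OF v_P1] lv
    by (simp add: sum_subtractf[symmetric] linear_scale[OF linear_stress] linear_diff[OF linear_stress] right_diff_distrib case_prod_unfold)
  also have "\<dots> = (\<Sum>T\<in>coarseM. \<Sum>(z, c)\<in>tiles. stress R V (tile_grad N Y z c) (?m T z c *\<^sub>R (A T - tile_grad N v z c)))"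
  proof (rule sum.mono_neutral_left)
    show "finite coarseM" by (rule tilingD[OF coarse_tiling])
    show "\<forall>T\<in>coarseM - Tc. (\<Sum>(z, c)\<in>tiles. stress R V (tile_grad N Y z c) (?m T z c *\<^sub>R (A T - tile_grad N v z c))) = 0"
    proof
      fix T assume T: "T \<in> coarseM - Tc"
      then have "T \<in> Ta \<union> Ti" by auto
      then have "T \<in> tile ` tiles" using interface_fine unfolding K_eq fine_mesh_eq[OF N a] by (rule rev_subsetD)
      then obtain z' c' where T': "T = lattice_tile N z' c'" "z' \<in> cells N" "c' \<in> tile_corners a" by auto
      have "?m T z c *\<^sub>R (A T - tile_grad N v z c) = 0" if "z \<in> cells N" "c \<in> tile_corners a" for z c
      proof (rule cfs.overlap_gradient)
        show "w x = v x" if "x \<in> T \<inter> lattice_tile N z c" for x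
          using agree[OF T'(2,3), of x] T that unfolding T'(1) by blast
      qed (use T that in \<open>auto simp: cells_def\<close>)
      then show "(\<Sum>(z, c)\<in>tiles. stress R V (tile_grad N Y z c) (?m T z c *\<^sub>R (A T - tile_grad N v z c))) = 0"
        using linear_0[OF linear_stress] by (intro sum.neutral ballI) (clarsimp simp only: split_beta mem_Sigma_iff fst_conv snd_conv)
    qed
  qed auto
  also have "\<dots> = (\<Sum>(z, c)\<in>tiles. stress R V (tile_grad N Y z c) (cfs.tile_defect z c))"
    unfolding cfs.tile_defect_def linear_sum[OF linear_stress]
    by (subst sum.swap) (simp add: case_prod_unfold)
  finally have diff: "error_functional w - error_functional v =
      (\<Sum>(z, c)\<in>tiles. stress R V (tile_grad N Y z c) (cfs.tile_defect z c))" .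
  have "weighted_norm p cfs.differing cfs.tile_area (\<lambda>(z, c). os z c) \<le> weighted_norm p (continuum_fine_mesh N K Tc) (measure lebesgue) patch_osc"
  proof (rule weighted_norm_reindex[OF p, where f = tile])
    have "finite (fine_mesh N K)" unfolding K_eq fine_mesh_eq[OF N a] using finite_cells finite_tile_corners by simp
    then show "finite (continuum_fine_mesh N K Tc)" by (simp add: continuum_fine_mesh_def)
    show "inj_on tile cfs.differing"
    proof (rule inj_onI, rule ccontr)
      fix \<tau> \<tau>' assume t: "\<tau> \<in> cfs.differing" "\<tau>' \<in> cfs.differing" "tile \<tau> = tile \<tau>'" "\<tau> \<noteq> \<tau>'"
      have mem: "\<tau> \<in> tiles" "\<tau>' \<in> tiles" by (rule subsetD[OF cfs.differing_subset t(1)], rule subsetD[OF cfs.differing_subset t(2)])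
      have "negligible (tile \<tau>)" using tilingD(4)[OF fine_tiling mem t(4)] t(3) by simp
      then have "cfs.tile_area \<tau> = 0" unfolding cfs.tile_area_def by (cases \<tau>) (simp add: negligible_imp_measure0)
      then show False using cfs.tile_area[of "snd \<tau>" "fst \<tau>"] mem N by auto
    qed
    show "tile ` cfs.differing \<subseteq> continuum_fine_mesh N K Tc"
    proof clarify
      fix z c assume "(z, c) \<in> cfs.differing"
      then have zc: "z \<in> cells N" "c \<in> tile_corners a" "\<exists>x\<in>lattice_tile N z c. w x \<noteq> v x"
        by (auto simp: cfs.differing_def cfs.differs_def)
      then have "lattice_tile N z c \<notin> Ta \<union> Ti" using agree[OF zc(1,2)] by blast
      then have "lattice_tile N z c \<subseteq> \<Union>Tc" by (rule tile_dichotomy[OF zc(1,2)])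
      moreover have "lattice_tile N z c \<in> fine_mesh N K" unfolding K_eq fine_mesh_eq[OF N a] using zc by force
      ultimately show "lattice_tile N z c \<in> continuum_fine_mesh N K Tc" by (simp add: continuum_fine_mesh_def)
    qed
  qed (auto simp: cfs.tile_area_def os_def split: prod.splits)
  then have "16 * M_total R M * eps N * weighted_norm p cfs.differing cfs.tile_area (\<lambda>(z, c). os z c) \<le>
      16 * M_total R M * eps N * weighted_norm p (continuum_fine_mesh N K Tc) (measure lebesgue) patch_osc"
    using M_total_nonneg by (intro mult_left_mono) auto
  then show "error_functional (Ih u) \<le> error_functional (Ieps u) +
      M_total R M * 16 * eps N * weighted_norm p (continuum_fine_mesh N K Tc) (measure lebesgue) patch_osc"
    using cfs.consistency_error_bound[OF p unit] diff unfolding w_def[symmetric] v_def[symmetric]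
    by (simp add: mult_ac)
qed

text \<open>The fine interpolant has a gradient norm \<open>g \<le> 1\<close>. If \<open>g = 0\<close>, then the lattice function is constant,
  and so is the coarse interpolant, whose norm is one. Otherwise one of the two multiples by
  \<open>1 / g\<close> and \<open>- 1 / g\<close> is an admissible test function with an error at least as large.\<close>

lemma fine_error_le_dual_norm:
  assumes u: "u \<in> coarse_displacements N coarseM" and p: "1 \<le> p" and unit: "grad_norm (conj_exponent p) (Ih u) = 1"
  shows "ereal (error_functional (Ieps u)) \<le> dual_norm (Ieps ` periodic_displacements N) p error_functional"
proof -
  define q where q_eq: "q = conj_exponent p"
  have q: "1 \<le> q" unfolding q_eq by (rule conj_exponent_ge_1[OF p])
  define v where "v = Ieps u"
  have up: "u \<in> periodic_displacements N" using u by (simp add: coarse_displacements_def)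
  have v: "P1 fineM v" unfolding v_def by (rule fine_interpolant(1))
  note hg = fine_has_gradients[OF v]
  define g where "g = grad_norm q v"
  have g0: "0 \<le> g" unfolding g_def by (rule grad_norm_nonneg[OF hg q])
  have "g \<noteq> 0"
  proof
    assume "g = 0"
    then have const: "v x = v 0" if "x \<in> per_lattice N" for x
      using fine_constant[OF v up v_def q _ that] by (simp add: g_def)
    have w0: "Ih u = (\<lambda>x. v 0)"
    proof (rule coarse_unique[OF coarse_interpolant(1)[OF u]])
      show "P1 (periodize_mesh coarseM) (\<lambda>x. v 0)"
        unfolding P1_def
      proof (intro conjI ballI)
        show "\<exists>(A :: real^'n^'n) b. \<forall>x\<in>T. v 0 = A *v x + b" for T
          by (intro exI[of _ 0] exI[of _ "v 0"]) simp
      qed simp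
      show "Ih u x = v 0" if "x \<in> per_lattice N" for x
        using const[OF that] that by (simp add: v_def fine_interpolant(2) coarse_interpolant(2)[OF u])
    qed
    have "has_gradients tiles tile (\<lambda>p. 0 *\<^sub>R (0 :: real^'n^'n)) (Ih u)" "has_gradients tiles tile (\<lambda>p. 0 :: real^'n^'n) (Ih u)"
    proof -
      have "grad (Ih u) x = 0" for x
        unfolding w0 using jacobian_affine_interior[of UNIV "\<lambda>x. v 0" 0 "v 0" x] by simp
      then show "has_gradients tiles tile (\<lambda>p. 0 :: real^'n^'n) (Ih u)"
        unfolding has_gradients_def using fine_tiling fine_cover lattice_tile_interior by auto
      then show "has_gradients tiles tile (\<lambda>p. 0 *\<^sub>R (0 :: real^'n^'n)) (Ih u)" by simp
    qed
    from grad_norm_scale[OF this(2) this(1) q] have "grad_norm q (Ih u) = 0" by simp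
    with unit show False by (simp add: q_eq)
  qed
  then have g: "0 < g" using g0 by simp
  have test: "ereal (s * error_functional v) \<le> dual_norm (Ieps ` periodic_displacements N) p error_functional"
    if s: "\<bar>s\<bar> = 1 / g" for s
    unfolding dual_norm_def
  proof (rule SUP_upper2[of "\<lambda>x. s *\<^sub>R v x"])
    have P1s: "P1 fineM (\<lambda>x. s *\<^sub>R v x)" by (rule P1_fine_scaleR[OF v])
    have "Ieps (\<lambda>x. s *\<^sub>R u x) = (\<lambda>x. s *\<^sub>R v x)"
      by (rule fine_interpolant_eqI[OF P1s]) (simp add: v_def fine_interpolant(2))
    moreover have "(\<lambda>x. s *\<^sub>R u x) \<in> periodic_displacements N" using up by (simp add: periodic_displacements_def)
    ultimately have "(\<lambda>x. s *\<^sub>R v x) \<in> Ieps ` periodic_displacements N" by (metis image_eqI)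
    moreover have "grad_norm q (\<lambda>x. s *\<^sub>R v x) = \<bar>s\<bar> * grad_norm q v"
    proof (rule grad_norm_scale[OF hg _ q])
      show "has_gradients tiles tile (\<lambda>p. s *\<^sub>R (case p of (z, c) \<Rightarrow> tile_grad N v z c)) (\<lambda>x. s *\<^sub>R v x)"
        using fine_has_gradients[OF P1s] by (simp add: tile_grad_scaleR case_prod_unfold)
    qed
    ultimately show "(\<lambda>x. s *\<^sub>R v x) \<in> {w \<in> Ieps ` periodic_displacements N. grad_norm (conj_exponent p) w = 1}"
      using s g by (simp add: q_eq[symmetric] g_def[symmetric])
    show "ereal (s * error_functional v) \<le> ereal (error_functional (\<lambda>x. s *\<^sub>R v x))"
      by (simp add: error_functional_fine_scaleR[OF v])
  qed
  have "g \<le> 1" unfolding g_def q_eq v_def by (rule coarse_vs_fine(2)[OF u p]) (simp add: unit)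
  then have g1: "1 \<le> 1 / g" using g by simp
  show ?thesis
  proof (cases "0 \<le> error_functional v")
    case True
    then have "error_functional v \<le> (1 / g) * error_functional v" using mult_right_mono[OF g1 True] by simp
    then show ?thesis using test[of "1 / g"] g by (simp add: v_def[symmetric]) (metis ereal_less_eq(3) order_trans)
  next
    case False
    have "0 \<le> (- (1 / g)) * error_functional v" using False g by (intro mult_nonpos_nonpos) auto
    then have "error_functional v \<le> (- (1 / g)) * error_functional v" using False by linarith
    then show ?thesis using test[of "- (1 / g)"] g by (simp add: v_def[symmetric]) (metis ereal_less_eq(3) order_trans)
  qed
qed


lemma plane_estimate:
  assumes p: "1 \<le> p"
  shows "dual_norm (Ih ` coarse_displacements N coarseM) p error_functional \<le>
    ereal (M_total R M * 16 * eps N * weighted_norm p (continuum_fine_mesh N K Tc) (measure lebesgue) patch_osc) +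
    dual_norm (Ieps ` periodic_displacements N) p error_functional"
  unfolding dual_norm_def[of "Ih ` coarse_displacements N coarseM"]
proof (rule SUP_least)
  fix z assume "z \<in> {w \<in> Ih ` coarse_displacements N coarseM. grad_norm (conj_exponent p) w = 1}"
  then obtain u where u: "u \<in> coarse_displacements N coarseM" "z = Ih u" "grad_norm (conj_exponent p) (Ih u) = 1" by auto
  let ?E = "M_total R M * 16 * eps N * weighted_norm p (continuum_fine_mesh N K Tc) (measure lebesgue) patch_osc"
  have "ereal (error_functional z) \<le> ereal ?E + ereal (error_functional (Ieps u))"
    unfolding u(2) using coarse_vs_fine(1)[OF u(1) p] u(3) by simp
  also have "\<dots> \<le> ereal ?E + dual_norm (Ieps ` periodic_displacements N) p error_functional"
    by (intro add_left_mono fine_error_le_dual_norm[OF u(1) p u(3)])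
  finally show "ereal (error_functional z) \<le> ereal ?E + dual_norm (Ieps ` periodic_displacements N) p error_functional" .
qed

end

section \<open>The coupled model on the line\<close>

context ac_setting
begin

context
  fixes l :: 'n
  assumes line: "UNIV = {l}"
begin

lemma line_eqI: "x $ l = y $ l \<Longrightarrow> x = (y :: real^'n)"
  using line by (metis UNIV_I singletonD vec_eq_iff)

lemma line_convex_comb:
  fixes x p q :: "real^'n"
  assumes "p $ l \<le> x $ l" "x $ l \<le> q $ l"
  obtains \<mu> where "0 \<le> \<mu>" "\<mu> \<le> 1" "x = (1 - \<mu>) *\<^sub>R p + \<mu> *\<^sub>R q"
proof (cases "p $ l = q $ l")
  case True
  then show ?thesis using assms by (intro that[of 0] line_eqI) auto
next
  case False
  define \<mu> where "\<mu> = (x $ l - p $ l) / (q $ l - p $ l)"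
  have "0 \<le> \<mu>" "\<mu> \<le> 1" using False assms by (auto simp: \<mu>_def divide_simps)
  moreover have "\<mu> * (q $ l - p $ l) = x $ l - p $ l" using False by (simp add: \<mu>_def)
  then have "x = (1 - \<mu>) *\<^sub>R p + \<mu> *\<^sub>R q" by (intro line_eqI) (simp add: algebra_simps)
  ultimately show ?thesis by (rule that)
qed

lemma line_fine_mesh: "per_fine_mesh N K = {cbox (eps N *\<^sub>R z) (eps N *\<^sub>R (z + 1)) |z. z \<in> Zd}"
proof -
  have "CARD('n) = card {l}" by (simp only: line)
  then have "CARD('n) = 1" by simp
  then have K: "K = {cbox 0 1}" using cell by (simp add: cell_subdivision_def)
  have "(\<lambda>x. eps N *\<^sub>R z + eps N *\<^sub>R x) ` cbox 0 1 = cbox (eps N *\<^sub>R z) (eps N *\<^sub>R (z + 1))" for z :: "real^'n"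
  proof (intro equalityI subsetI)
    fix x assume "x \<in> (\<lambda>x. eps N *\<^sub>R z + eps N *\<^sub>R x) ` cbox 0 1"
    then show "x \<in> cbox (eps N *\<^sub>R z) (eps N *\<^sub>R (z + 1))"
      by (auto simp: mem_box_cart add_divide_distrib divide_right_mono)
  next
    fix x assume x: "x \<in> cbox (eps N *\<^sub>R z) (eps N *\<^sub>R (z + 1))"
    have "real N *\<^sub>R x - z \<in> cbox 0 1"
      using x mem_lattice_cell[OF N_pos, of x z] by (simp add: lattice_cell_def)
    moreover have "x = eps N *\<^sub>R z + eps N *\<^sub>R (real N *\<^sub>R x - z)" using N_pos by (simp add: algebra_simps)
    ultimately show "x \<in> (\<lambda>x. eps N *\<^sub>R z + eps N *\<^sub>R x) ` cbox 0 1" by blast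
  qed
  then show ?thesis unfolding per_fine_mesh_def per_lattice_def K by auto
qed

lemma line_finite_mesh: "finite (continuum_fine_mesh N K Tc)"
proof -
  let ?Z = "{z :: real^'n. z \<in> Zd \<and> - real N \<le> z $ l \<and> z $ l \<le> real N}"
  have "continuum_fine_mesh N K Tc \<subseteq> (\<lambda>z. cbox (eps N *\<^sub>R z) (eps N *\<^sub>R (z + 1))) ` ?Z"
  proof
    fix T assume "T \<in> continuum_fine_mesh N K Tc"
    then obtain z where z: "T = cbox (eps N *\<^sub>R z) (eps N *\<^sub>R (z + 1))" "z \<in> Zd" "T \<subseteq> cbox (-1) 1"
      unfolding continuum_fine_mesh_def fine_mesh_def line_fine_mesh closure_Omega by blast
    have "eps N *\<^sub>R z \<in> T" unfolding z(1) using N_pos by (simp add: mem_box_cart divide_right_mono)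
    then have "eps N *\<^sub>R z \<in> cbox (-1) 1" using z(3) by (rule rev_subsetD)
    then have "-1 \<le> z $ l / real N" "z $ l / real N \<le> 1" by (auto simp: mem_box_cart)
    then show "T \<in> (\<lambda>z. cbox (eps N *\<^sub>R z) (eps N *\<^sub>R (z + 1))) ` ?Z"
      using z(1,2) N_pos by (auto simp: divide_simps)
  qed
  moreover have "finite ?Z"
  proof (rule finite_imageD)
    show "inj_on (\<lambda>z. z $ l) ?Z" by (rule inj_onI) (rule line_eqI)
    have "(\<lambda>z. z $ l) ` ?Z \<subseteq> of_int ` {- int N..int N}"
    proof clarify
      fix z :: "real^'n" assume z: "z \<in> Zd" "- real N \<le> z $ l" "z $ l \<le> real N"
      then have "z $ l \<in> \<int>" by (simp add: Zd_def)
      then obtain k :: int where k: "z $ l = of_int k" by (rule Ints_cases)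
      with z have "k \<in> {- int N..int N}" by auto
      then show "z $ l \<in> of_int ` {- int N..int N}" using k by blast
    qed
    then show "finite ((\<lambda>z. z $ l) ` ?Z)" by (rule finite_subset) simp
  qed
  ultimately show ?thesis by (rule finite_subset[OF _ finite_imageI])
qed

text \<open>A coarse interval with lattice endpoints that contains the midpoint of a fine interval contains
  all of it.\<close>

lemma line_coarse_P1_fine:
  assumes w: "P1 (periodize_mesh (Ta \<union> Ti \<union> Tc)) w"
  shows "P1 (per_fine_mesh N K) w"
  unfolding P1_def
proof (intro conjI ballI)
  show "continuous_on UNIV w" using w by (simp add: P1_def)
  fix T' assume "T' \<in> per_fine_mesh N K"
  then obtain z where z: "T' = cbox (eps N *\<^sub>R z) (eps N *\<^sub>R (z + 1))" "z \<in> Zd" unfolding line_fine_mesh by blast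
  define m where "m = eps N *\<^sub>R (z + (1 / 2) *\<^sub>R 1)"
  have "m \<in> \<Union>(periodize_mesh (Ta \<union> Ti \<union> Tc))" using Th_periodic by (simp add: regular_triangulation_def)
  then obtain T where T: "T \<in> periodize_mesh (Ta \<union> Ti \<union> Tc)" "m \<in> T" by blast
  then obtain \<xi> T0 where T0: "T = (\<lambda>x. \<xi> + x) ` T0" "\<xi> \<in> twoZd" "T0 \<in> Ta \<union> Ti \<union> Tc" unfolding periodize_mesh_def by blast
  have "int CARD('n) simplex T0" using Th_triangulation T0(3) by (simp add: regular_triangulation_def)
  then obtain C where C: "C \<subseteq> per_lattice N" "T0 = convex hull C"
    using simplex_hull_lattice[of _ T0 "per_lattice N"] Th_vertices[OF T0(3)] by metis
  define C' where "C' = (\<lambda>x. \<xi> + x) ` C"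
  have C': "C' \<subseteq> per_lattice N" "T = convex hull C'"
    using C per_lattice_translate[OF N_pos _ T0(2)] unfolding C'_def T0(1) C(2) by (auto simp: convex_hull_translation)
  obtain p q where pq: "p \<in> C'" "p $ l \<le> m $ l" "q \<in> C'" "m $ l \<le> q $ l"
    using convex_hull_coordinate_bounds[of m C' l] T(2) C'(2) by metis
  have coord: "\<exists>k::int. x $ l = eps N * of_int k" if "x \<in> per_lattice N" for x :: "real^'n"
  proof -
    from that obtain u where u: "x = eps N *\<^sub>R u" "u \<in> Zd" unfolding per_lattice_def by blast
    then have "u $ l \<in> \<int>" by (simp add: Zd_def)
    then show ?thesis using u(1) by (auto elim!: Ints_cases)
  qed
  obtain kp kq :: int where k: "p $ l = eps N * of_int kp" "q $ l = eps N * of_int kq" using coord pq C'(1) by blast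
  have "z $ l \<in> \<int>" using z(2) by (simp add: Zd_def)
  then obtain kz :: int where kz: "z $ l = of_int kz" by (rule Ints_cases)
  have ml: "m $ l = eps N * (of_int kz + 1 / 2)" by (simp add: m_def kz)
  have "real_of_int kp \<le> of_int kz + 1 / 2" "of_int kz + 1 / 2 \<le> real_of_int kq"
    using pq(2,4) N_pos unfolding k ml by (simp_all add: divide_le_cancel)
  then have "kp \<le> kz" "kz + 1 \<le> kq" by linarith+
  then have "real_of_int kp \<le> of_int kz" "real_of_int (kz + 1) \<le> of_int kq" by (simp_all only: of_int_le_iff)
  then have ends: "p $ l \<le> eps N * z $ l" "eps N * (z $ l + 1) \<le> q $ l"
    unfolding k kz by (auto intro!: mult_left_mono divide_right_mono)
  have "T' \<subseteq> T"
  proof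
    fix x assume "x \<in> T'"
    then have "eps N * z $ l \<le> x $ l \<and> x $ l \<le> eps N * (z $ l + 1)" unfolding z(1) by (simp add: mem_box_cart)
    then have "p $ l \<le> x $ l" "x $ l \<le> q $ l" using ends by linarith+
    then obtain \<mu> where "0 \<le> \<mu>" "\<mu> \<le> 1" "x = (1 - \<mu>) *\<^sub>R p + \<mu> *\<^sub>R q" by (rule line_convex_comb)
    moreover have "(1 - \<mu>) *\<^sub>R p + \<mu> *\<^sub>R q \<in> convex hull C'" if "0 \<le> \<mu>" "\<mu> \<le> 1" for \<mu>
      using that by (intro convexD_alt[OF convex_convex_hull] hull_inc pq)
    ultimately show "x \<in> T" unfolding C'(2) by simp
  qed
  moreover have "\<forall>T\<in>periodize_mesh (Ta \<union> Ti \<union> Tc). \<exists>(A :: real^'n^'n) b. \<forall>x\<in>T. w x = A *v x + b" using w by (simp add: P1_def)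
  from bspec[OF this T(1)] have "\<exists>(A :: real^'n^'n) b. \<forall>x\<in>T. w x = A *v x + b" .
  ultimately show "\<exists>(A :: real^'n^'n) b. \<forall>x\<in>T'. w x = A *v x + b" by (meson subsetD)
qed

lemma line_fine_unique:
  assumes w: "P1 (per_fine_mesh N K) w" and w': "P1 (per_fine_mesh N K) w'"
    and eq: "\<And>x. x \<in> per_lattice N \<Longrightarrow> w x = w' x"
  shows "w = w'"
proof
  fix x :: "real^'n"
  let ?z = "\<chi> l. (of_int \<lfloor>real N * x $ l\<rfloor> :: real)"
  have z: "?z \<in> Zd" by (simp add: Zd_def)
  have z1: "?z + 1 \<in> Zd" by (simp add: Zd_def)
  let ?T = "cbox (eps N *\<^sub>R ?z) (eps N *\<^sub>R (?z + 1))"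
  have T: "?T \<in> per_fine_mesh N K" unfolding line_fine_mesh using z by blast
  have xT: "x \<in> ?T" using floor_cell[OF N_pos, of x] by (simp add: lattice_cell_def)
  have ends: "eps N *\<^sub>R ?z \<in> ?T" "eps N *\<^sub>R (?z + 1) \<in> ?T" using N_pos by (simp_all add: mem_box_cart divide_right_mono)
  have "eps N *\<^sub>R ?z \<in> per_lattice N" "eps N *\<^sub>R (?z + 1) \<in> per_lattice N" using z z1 unfolding per_lattice_def by blast+
  note e = eq[OF this(1)] eq[OF this(2)]
  have "(eps N *\<^sub>R ?z) $ l \<le> x $ l" "x $ l \<le> (eps N *\<^sub>R (?z + 1)) $ l" using xT unfolding mem_box_cart by blast+
  then obtain \<mu> where \<mu>: "x = (1 - \<mu>) *\<^sub>R (eps N *\<^sub>R ?z) + \<mu> *\<^sub>R (eps N *\<^sub>R (?z + 1))" by (rule line_convex_comb)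
  have comb: "f x = (1 - \<mu>) *\<^sub>R f (eps N *\<^sub>R ?z) + \<mu> *\<^sub>R f (eps N *\<^sub>R (?z + 1))" if "P1 (per_fine_mesh N K) f" for f
  proof -
    have "\<forall>T\<in>per_fine_mesh N K. \<exists>(A :: real^'n^'n) b. \<forall>x\<in>T. f x = A *v x + b" using that by (simp add: P1_def)
    from bspec[OF this T] obtain A :: "real^'n^'n" and b where A: "\<forall>x\<in>?T. f x = A *v x + b" by (elim exE)
    have "f x = A *v ((1 - \<mu>) *\<^sub>R (eps N *\<^sub>R ?z) + \<mu> *\<^sub>R (eps N *\<^sub>R (?z + 1))) + b"
      using bspec[OF A xT] \<mu> by metis
    also have "\<dots> = (1 - \<mu>) *\<^sub>R (A *v (eps N *\<^sub>R ?z) + b) + \<mu> *\<^sub>R (A *v (eps N *\<^sub>R (?z + 1)) + b)"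
      by (simp only: matrix_vector_right_distrib matrix_vector_mult_scaleR scaleR_add_right)
        (simp add: scaleR_left_diff_distrib)
    finally show ?thesis using bspec[OF A ends(1)] bspec[OF A ends(2)] by simp
  qed
  show "w x = w' x" unfolding comb[OF w] comb[OF w'] e ..
qed

text \<open>Both interpolants are the coarse function itself.\<close>

lemma line_interpolants:
  assumes u: "u \<in> coarse_displacements N (Ta \<union> Ti \<union> Tc)"
  shows "interpolant N (periodize_mesh (Ta \<union> Ti \<union> Tc)) u = interpolant N (per_fine_mesh N K) u"
proof -
  obtain w where w: "P1 (periodize_mesh (Ta \<union> Ti \<union> Tc)) w" "\<forall>x\<in>per_lattice N. w x = u x"
    using u by (auto simp: coarse_displacements_def)
  have "interpolant N (periodize_mesh (Ta \<union> Ti \<union> Tc)) u = w"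
    unfolding interpolant_def
    by (rule the_equality)
      (use w P1_coarse_unique[OF N_pos Th_triangulation Th_periodic Th_vertices] in \<open>auto simp: \<close>)
  moreover have "interpolant N (per_fine_mesh N K) u = w"
    unfolding interpolant_def
    by (rule the_equality) (use w line_coarse_P1_fine line_fine_unique in auto)
  ultimately show ?thesis by simp
qed

lemma line_dual_norm_le:
  "dual_norm (interpolant N (periodize_mesh (Ta \<union> Ti \<union> Tc)) ` coarse_displacements N (Ta \<union> Ti \<union> Tc)) p \<Phi>
    \<le> dual_norm (interpolant N (per_fine_mesh N K) ` periodic_displacements N) p \<Phi>"
  unfolding dual_norm_def
proof (rule SUP_subset_mono)
  have "coarse_displacements N (Ta \<union> Ti \<union> Tc) \<subseteq> periodic_displacements N" by (auto simp: coarse_displacements_def)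
  then show "{v \<in> interpolant N (periodize_mesh (Ta \<union> Ti \<union> Tc)) ` coarse_displacements N (Ta \<union> Ti \<union> Tc).
        grad_norm (conj_exponent p) v = 1}
    \<subseteq> {v \<in> interpolant N (per_fine_mesh N K) ` periodic_displacements N. grad_norm (conj_exponent p) v = 1}"
    using line_interpolants by auto
qed simp

end

end

theorem theorem3p5:
  assumes "CARD('n::finite) \<in> {1, 2}"
  shows "\<exists>C\<^sub>M::real. \<forall>N (K :: (real^'n) set set) R V M Ta Ti Tc Ei y.
    ac_setting N K R V M Ta Ti Tc Ei \<and> Ta \<union> Ti \<subseteq> fine_mesh N K \<and> y \<in> deformations N \<longrightarrow>
    (let I\<^sub>\<epsilon> = interpolant N (per_fine_mesh N K);
         I\<^sub>h = interpolant N (periodize_mesh (Ta \<union> Ti \<union> Tc));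
         U\<^sub>\<epsilon> = I\<^sub>\<epsilon> ` periodic_displacements N;
         U\<^sub>h = I\<^sub>h ` coarse_displacements N (Ta \<union> Ti \<union> Tc);
         \<Phi> = (\<lambda>z. first_variation (E_ac N R V Ta Ti Tc Ei) (I\<^sub>\<epsilon> y) z
                  - first_variation (E_a N R V) (I\<^sub>\<epsilon> y) z);
         T\<^sub>c = continuum_fine_mesh N K Tc;
         osc\<^sub>y = (\<lambda>T. osc N (I\<^sub>\<epsilon> y) (patch N K Tc T))
     in
       (\<forall>p::real. 1 \<le> p \<longrightarrow>
          dual_norm U\<^sub>h (ennreal p) \<Phi> \<le>
            ereal (M_total R M * C\<^sub>M * eps N *
              (\<Sum>T\<in>T\<^sub>c. measure lebesgue T * osc\<^sub>y T powr p) powr (1 / p))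
            + dual_norm U\<^sub>\<epsilon> (ennreal p) \<Phi>) \<and>
       dual_norm U\<^sub>h \<infinity> \<Phi> \<le>
         ereal (M_total R M * C\<^sub>M * eps N * Max (insert 0 (osc\<^sub>y ` T\<^sub>c)))
         + dual_norm U\<^sub>\<epsilon> \<infinity> \<Phi>)"
proof (intro exI[of _ 16] allI impI)
  fix N and K :: "(real^'n) set set" and R V M Ta Ti Tc Ei and y :: "real^'n \<Rightarrow> real^'n"
  assume asm: "ac_setting N K R V M Ta Ti Tc Ei \<and> Ta \<union> Ti \<subseteq> fine_mesh N K \<and> y \<in> deformations N"
  then interpret ac_setting N K R V M Ta Ti Tc Ei by blast
  define \<Phi> where "\<Phi> = (\<lambda>z. first_variation (E_ac N R V Ta Ti Tc Ei) (interpolant N (per_fine_mesh N K) y) z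
    - first_variation (E_a N R V) (interpolant N (per_fine_mesh N K) y) z)"
  define osc\<^sub>y where "osc\<^sub>y T = osc N (interpolant N (per_fine_mesh N K) y) (patch N K Tc T)" for T
  \<comment> \<open>The two cases of the statement are the two cases in the definition of \<open>weighted_norm\<close>.\<close>
  have est: "dual_norm (interpolant N (periodize_mesh (Ta \<union> Ti \<union> Tc)) ` coarse_displacements N (Ta \<union> Ti \<union> Tc)) p \<Phi> \<le>
      ereal (M_total R M * 16 * eps N * weighted_norm p (continuum_fine_mesh N K Tc) (measure lebesgue) osc\<^sub>y) +
      dual_norm (interpolant N (per_fine_mesh N K) ` periodic_displacements N) p \<Phi>" if p: "1 \<le> p" for p
  proof (cases "CARD('n) = 1")
    case True
    then obtain l :: 'n where l: "UNIV = {l}" by (rule card_1_singletonE)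
    have "finite (continuum_fine_mesh N K Tc)" by (rule line_finite_mesh[OF l])
    then have "0 \<le> weighted_norm p (continuum_fine_mesh N K Tc) (measure lebesgue) osc\<^sub>y"
      by (simp add: weighted_norm_def)
    then have "0 \<le> M_total R M * 16 * eps N * weighted_norm p (continuum_fine_mesh N K Tc) (measure lebesgue) osc\<^sub>y"
      using M_total_nonneg by (intro mult_nonneg_nonneg) auto
    then show ?thesis using line_dual_norm_le[OF l] by (intro add_increasing) auto
  next
    case False
    with assms have "CARD('n) = 2" by simp
    then obtain i j :: 'n where ij: "UNIV = {i, j}" "i \<noteq> j" unfolding card_2_iff by blast
    obtain a where a: "a \<in> unit_corners" "K = corner_tile ` tile_corners a"
      using plane.cell_subdivision_eq[OF plane.intro[OF ij(2,1)] cell] by blast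
    interpret ac_plane i j N K R V M Ta Ti Tc Ei a y
      by unfold_locales (use ij a asm in auto)
    have "\<Phi> = error_functional" by (rule ext) (simp add: \<Phi>_def error_functional_def)
    moreover have "osc\<^sub>y = patch_osc" by (rule ext) (simp add: osc\<^sub>y_def patch_osc_def)
    ultimately show ?thesis using plane_estimate[OF p] by simp
  qed
  have "dual_norm (interpolant N (periodize_mesh (Ta \<union> Ti \<union> Tc)) ` coarse_displacements N (Ta \<union> Ti \<union> Tc)) (ennreal p) \<Phi> \<le>
      ereal (M_total R M * 16 * eps N * (\<Sum>T\<in>continuum_fine_mesh N K Tc. measure lebesgue T * osc\<^sub>y T powr p) powr (1 / p)) +
      dual_norm (interpolant N (per_fine_mesh N K) ` periodic_displacements N) (ennreal p) \<Phi>" if "1 \<le> p" for p :: real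
  proof -
    have "1 \<le> ennreal p" using ennreal_leI[OF that] by simp
    from est[OF this] show ?thesis using that by (simp add: weighted_norm_def)
  qed
  moreover have "dual_norm (interpolant N (periodize_mesh (Ta \<union> Ti \<union> Tc)) ` coarse_displacements N (Ta \<union> Ti \<union> Tc)) \<infinity> \<Phi> \<le>
      ereal (M_total R M * 16 * eps N * Max (insert 0 (osc\<^sub>y ` continuum_fine_mesh N K Tc))) +
      dual_norm (interpolant N (per_fine_mesh N K) ` periodic_displacements N) \<infinity> \<Phi>"
    using est[of \<infinity>] by (simp add: weighted_norm_def)
  ultimately show "(let I\<^sub>\<epsilon> = interpolant N (per_fine_mesh N K);
         I\<^sub>h = interpolant N (periodize_mesh (Ta \<union> Ti \<union> Tc));
         U\<^sub>\<epsilon> = I\<^sub>\<epsilon> ` periodic_displacements N;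
         U\<^sub>h = I\<^sub>h ` coarse_displacements N (Ta \<union> Ti \<union> Tc);
         \<Phi> = (\<lambda>z. first_variation (E_ac N R V Ta Ti Tc Ei) (I\<^sub>\<epsilon> y) z
                  - first_variation (E_a N R V) (I\<^sub>\<epsilon> y) z);
         T\<^sub>c = continuum_fine_mesh N K Tc;
         osc\<^sub>y = (\<lambda>T. osc N (I\<^sub>\<epsilon> y) (patch N K Tc T))
     in
       (\<forall>p::real. 1 \<le> p \<longrightarrow>
          dual_norm U\<^sub>h (ennreal p) \<Phi> \<le>
            ereal (M_total R M * 16 * eps N *
              (\<Sum>T\<in>T\<^sub>c. measure lebesgue T * osc\<^sub>y T powr p) powr (1 / p))
            + dual_norm U\<^sub>\<epsilon> (ennreal p) \<Phi>) \<and>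
       dual_norm U\<^sub>h \<infinity> \<Phi> \<le>
         ereal (M_total R M * 16 * eps N * Max (insert 0 (osc\<^sub>y ` T\<^sub>c)))
         + dual_norm U\<^sub>\<epsilon> \<infinity> \<Phi>)"
    unfolding Let_def \<Phi>_def[symmetric] osc\<^sub>y_def[symmetric] by auto
qed

end
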